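(* Let $\mathcal C$ be a finite tensor category, let $\mathcal M$ and $\mathcal N$ be finite $\mathcal C$-modules, and let $F,G\in\mathrm{Rex}_{\mathcal C}(\mathcal M,\mathcal N)$. (i) The object $\underline{\mathrm{Nat}}(F,G)\in\mathcal Z(\mathcal C)$ of internal natural transformations is canonically isomorphic, as an object of $\mathcal Z(\mathcal C)$, to an end over internal Homs: $$\underline{\mathrm{Nat}}(F,G)\;\cong\;\int_{m\in\mathcal M}\underline{\mathrm{Hom}}_{\mathcal N}(F(m),G(m)).$$ (ii) The internal coHom $\underline{\mathrm{coNat}}(F,G)\in\mathcal Z(\mathcal C)$ is canonically isomorphic, as an object of $\mathcal Z(\mathcal C)$, to a coend over internal coHoms: $$\underline{\mathrm{coNat}}(F,G)\;\cong\;\int^{m\in\mathcal M}\underline{\mathrm{coHom}}_{\mathcal N}(F(m),G(m)).$$ Here the end and coend are endowed with the canonical half-braidings described in the context.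
   Context: Let $\Bbbk$ be an algebraically closed field. A finite $\Bbbk$-linear category is one equivalent to the category of finite-dimensional modules over a finite-dimensional $\Bbbk$-algebra. A finite tensor category is a finite $\Bbbk$-linear rigid monoidal category with bilinear tensor product and simple unit $\mathbf 1$ (associators suppressed). The right dual $c^\vee$ has evaluation $c^\vee\otimes c\to\mathbf 1$ and coevaluation $\mathbf 1\to c\otimes c^\vee$; the left dual ${}^\vee c$ has evaluation $c\otimes{}^\vee c\to\mathbf 1$ and coevaluation $\mathbf 1\to{}^\vee c\otimes c$. A finite $\mathcal C$-module is a finite $\Bbbk$-linear left module category with bilinear action $(c,m)\mapsto c.m$, exact in the first variable and right exact in both. $\mathrm{Rex}_{\mathcal C}(\mathcal M,\mathcal N)$ is the category of right exact $\mathcal C$-module functors (constraint $\phi^F_{c,m}\colon F(c.m)\xrightarrow{\cong}c.F(m)$) and module natural transformations. Objects of the Drinfeld center $\mathcal Z(\mathcal C)$ are pairs $(c_0,\sigma)$ with half-braiding $\sigma_c\colon c\otimes c_0\to c_0\otimes c$, natural and satisfying $\sigma_{c\otimes c'}=(\sigma_c\otimes\mathrm{id})\circ(\mathrm{id}\otimes\sigma_{c'})$, $\sigma_{\mathbf 1}=\mathrm{id}$. $\mathrm{Rex}_{\mathcal C}(\mathcal M,\mathcal N)$ is a finite $\mathcal Z(\mathcal C)$-module: $((c_0,\sigma).F)(m)=c_0.F(m)$, with $\mathcal C$-module constraint $c_0.F(c.m)\cong(c_0\otimes c).F(m)\xrightarrow{\sigma_c^{-1}.\mathrm{id}}(c\otimes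 c_0).F(m)\cong c.(c_0.F(m))$. For a module category $\mathcal X$ over a finite tensor category $\mathcal A$, the internal Hom $\underline{\mathrm{Hom}}_{\mathcal X}(x,y)\in\mathcal A$ and internal coHom $\underline{\mathrm{coHom}}_{\mathcal X}(x,y)\in\mathcal A$ are defined by natural isomorphisms $\mathrm{Hom}_{\mathcal A}(a,\underline{\mathrm{Hom}}_{\mathcal X}(x,y))\cong\mathrm{Hom}_{\mathcal X}(a.x,y)$ and $\mathrm{Hom}_{\mathcal A}(\underline{\mathrm{coHom}}_{\mathcal X}(x,y),a)\cong\mathrm{Hom}_{\mathcal X}(y,a.x)$. Both are contravariant in $x$ and covariant in $y$. Set $\underline{\mathrm{Nat}}(F,G):=\underline{\mathrm{Hom}}_{\mathrm{Rex}_{\mathcal C}(\mathcal M,\mathcal N)}(F,G)$ and $\underline{\mathrm{coNat}}(F,G):=\underline{\mathrm{coHom}}_{\mathrm{Rex}_{\mathcal C}(\mathcal M,\mathcal N)}(F,G)$, for $\mathcal A=\mathcal Z(\mathcal C)$. The internal (co)Hom of $\mathcal N$ comes with canonical isomorphisms $\underline{\mathrm{Hom}}_{\mathcal N}(c.n,c'.n')\cong c'\otimes\underline{\mathrm{Hom}}_{\mathcal N}(n,n')\otimes c^\vee$ and $\underline{\mathrm{coHom}}_{\mathcal N}(c.n,c'.n')\cong c'\otimes\underline{\mathrm{coHom}}_{\mathcal N}(n,n')\otimes{}^\vee c$, obtained from the defining adjunctions and the dualities. Combined with $\phi^F,\phi^G$ they give, for $T(m,m')=\underline{\mathrm{Hom}}_{\mathcal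 N}(F(m),G(m'))$ and $T'(m,m')=\underline{\mathrm{coHom}}_{\mathcal N}(F(m),G(m'))$, isomorphisms $T(c.m,c.m)\cong c\otimes T(m,m)\otimes c^\vee$ and $T'(c.m,c.m)\cong c\otimes T'(m,m)\otimes{}^\vee c$. Canonical half-braidings. For $g=\int_mT(m,m)$ with structure morphisms $j_m$, let $\hat\delta_c\colon g\to c\otimes g\otimes c^\vee$ be the unique morphism such that $(c\otimes j_m\otimes c^\vee)\circ\hat\delta_c$ is $g\xrightarrow{j_{c.m}}T(c.m,c.m)\cong c\otimes T(m,m)\otimes c^\vee$ for all $m$; then $\sigma_c^{-1}\colon g\otimes c\to c\otimes g$ is $\hat\delta_c\otimes c$ followed by evaluation of $c^\vee\otimes c$. For $h=\int^mT'(m,m)$ with structure morphisms $i_m$, let $\hat\rho_c\colon c\otimes h\otimes{}^\vee c\to h$ be the unique morphism such that $\hat\rho_c\circ(c\otimes i_m\otimes{}^\vee c)$ is $c\otimes T'(m,m)\otimes{}^\vee c\cong T'(c.m,c.m)\xrightarrow{i_{c.m}}h$ for all $m$; then $\sigma_c\colon c\otimes h\to h\otimes c$ is the coevaluation $\mathbf 1\to{}^\vee c\otimes c$ followed by $\hat\rho_c\otimes c$. *)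

theory Defs
  imports "Jordan_Normal_Form.Matrix" "HOL-Computational_Algebra.Polynomial"
    "HOL-Library.FuncSet"
begin

section \<open>Linear categories\<close>

text \<open>A category has a carrier of objects and a carrier of arrows; the fields of the record are
  only meaningful on these carriers.\<close>

record ('o, 'm) cat =
  Obj :: "'o set"
  Arr :: "'m set"
  Dom :: "'m \<Rightarrow> 'o"
  Cod :: "'m \<Rightarrow> 'o"
  Idn :: "'o \<Rightarrow> 'm"
  Comp :: "'m \<Rightarrow> 'm \<Rightarrow> 'm"  (infixr "\<cdot>\<index>" 75)

definition Hom :: "('o, 'm, 'z) cat_scheme \<Rightarrow> 'o \<Rightarrow> 'o \<Rightarrow> 'm set" where
  "Hom C x y = {f \<in> Arr C. Dom C f = x \<and> Cod C f = y}"

locale category =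
  fixes C :: "('o, 'm, 'z) cat_scheme"
  assumes Dom_in_Obj: "f \<in> Arr C \<Longrightarrow> Dom C f \<in> Obj C"
    and Cod_in_Obj: "f \<in> Arr C \<Longrightarrow> Cod C f \<in> Obj C"
    and Idn_in_Hom: "x \<in> Obj C \<Longrightarrow> Idn C x \<in> Hom C x x"
    and Comp_in_Hom: "\<lbrakk>f \<in> Hom C x y; g \<in> Hom C y w\<rbrakk> \<Longrightarrow> g \<cdot>\<^bsub>C\<^esub> f \<in> Hom C x w"
    and Comp_assoc: "\<lbrakk>f \<in> Hom C x y; g \<in> Hom C y w; h \<in> Hom C w v\<rbrakk>
      \<Longrightarrow> (h \<cdot>\<^bsub>C\<^esub> g) \<cdot>\<^bsub>C\<^esub> f = h \<cdot>\<^bsub>C\<^esub> (g \<cdot>\<^bsub>C\<^esub> f)"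
    and Comp_Idn_left: "f \<in> Hom C x y \<Longrightarrow> Idn C y \<cdot>\<^bsub>C\<^esub> f = f"
    and Comp_Idn_right: "f \<in> Hom C x y \<Longrightarrow> f \<cdot>\<^bsub>C\<^esub> Idn C x = f"

definition inverse_arrows :: "('o, 'm, 'z) cat_scheme \<Rightarrow> 'm \<Rightarrow> 'm \<Rightarrow> bool" where
  "inverse_arrows C f g \<longleftrightarrow>
     f \<in> Arr C \<and> g \<in> Hom C (Cod C f) (Dom C f) \<and>
     g \<cdot>\<^bsub>C\<^esub> f = Idn C (Dom C f) \<and> f \<cdot>\<^bsub>C\<^esub> g = Idn C (Cod C f)"

definition iso_arr :: "('o, 'm, 'z) cat_scheme \<Rightarrow> 'm \<Rightarrow> bool" where
  "iso_arr C f \<longleftrightarrow> (\<exists>g. inverse_arrows C f g)"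

definition inv_arr :: "('o, 'm, 'z) cat_scheme \<Rightarrow> 'm \<Rightarrow> 'm" where
  "inv_arr C f = (THE g. inverse_arrows C f g)"

definition mono_arr :: "('o, 'm, 'z) cat_scheme \<Rightarrow> 'm \<Rightarrow> bool" where
  "mono_arr C f \<longleftrightarrow> f \<in> Arr C \<and>
     (\<forall>x \<in> Obj C. \<forall>u \<in> Hom C x (Dom C f). \<forall>v \<in> Hom C x (Dom C f).
        f \<cdot>\<^bsub>C\<^esub> u = f \<cdot>\<^bsub>C\<^esub> v \<longrightarrow> u = v)"

record ('k, 'o, 'm) lin_cat = "('o, 'm) cat" +
  Zero :: "'o \<Rightarrow> 'o \<Rightarrow> 'm"
  Add :: "'m \<Rightarrow> 'm \<Rightarrow> 'm"
  Scale :: "'k \<Rightarrow> 'm \<Rightarrow> 'm"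

locale linear_category = category C
  for C :: "('k::field, 'o, 'm, 'z) lin_cat_scheme" +
  assumes Zero_in_Hom: "\<lbrakk>x \<in> Obj C; y \<in> Obj C\<rbrakk> \<Longrightarrow> Zero C x y \<in> Hom C x y"
    and Add_in_Hom: "\<lbrakk>f \<in> Hom C x y; g \<in> Hom C x y\<rbrakk> \<Longrightarrow> Add C f g \<in> Hom C x y"
    and Scale_in_Hom: "f \<in> Hom C x y \<Longrightarrow> Scale C a f \<in> Hom C x y"
    and Add_assoc: "\<lbrakk>f \<in> Hom C x y; g \<in> Hom C x y; h \<in> Hom C x y\<rbrakk>
      \<Longrightarrow> Add C (Add C f g) h = Add C f (Add C g h)"
    and Add_commute: "\<lbrakk>f \<in> Hom C x y; g \<in> Hom C x y\<rbrakk> \<Longrightarrow> Add C f g = Add C g f"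
    and Add_Zero: "f \<in> Hom C x y \<Longrightarrow> Add C (Zero C x y) f = f"
    and Add_inverse: "f \<in> Hom C x y \<Longrightarrow> \<exists>g \<in> Hom C x y. Add C f g = Zero C x y"
    and Scale_one: "f \<in> Hom C x y \<Longrightarrow> Scale C 1 f = f"
    and Scale_Scale: "f \<in> Hom C x y \<Longrightarrow> Scale C a (Scale C b f) = Scale C (a * b) f"
    and Scale_add_left: "f \<in> Hom C x y
      \<Longrightarrow> Scale C (a + b) f = Add C (Scale C a f) (Scale C b f)"
    and Scale_add_right: "\<lbrakk>f \<in> Hom C x y; g \<in> Hom C x y\<rbrakk>
      \<Longrightarrow> Scale C a (Add C f g) = Add C (Scale C a f) (Scale C a g)"
    and Comp_Add_left: "\<lbrakk>f \<in> Hom C x y; g \<in> Hom C y w; g' \<in> Hom C y w\<rbrakk>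
      \<Longrightarrow> Add C g g' \<cdot>\<^bsub>C\<^esub> f = Add C (g \<cdot>\<^bsub>C\<^esub> f) (g' \<cdot>\<^bsub>C\<^esub> f)"
    and Comp_Add_right: "\<lbrakk>f \<in> Hom C x y; f' \<in> Hom C x y; g \<in> Hom C y w\<rbrakk>
      \<Longrightarrow> g \<cdot>\<^bsub>C\<^esub> Add C f f' = Add C (g \<cdot>\<^bsub>C\<^esub> f) (g \<cdot>\<^bsub>C\<^esub> f')"
    and Comp_Scale_left: "\<lbrakk>f \<in> Hom C x y; g \<in> Hom C y w\<rbrakk>
      \<Longrightarrow> Scale C a g \<cdot>\<^bsub>C\<^esub> f = Scale C a (g \<cdot>\<^bsub>C\<^esub> f)"
    and Comp_Scale_right: "\<lbrakk>f \<in> Hom C x y; g \<in> Hom C y w\<rbrakk>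
      \<Longrightarrow> g \<cdot>\<^bsub>C\<^esub> Scale C a f = Scale C a (g \<cdot>\<^bsub>C\<^esub> f)"


section \<open>Functors and natural transformations\<close>

record ('o, 'm, 'p, 'q) funct =
  FObj :: "'o \<Rightarrow> 'p"
  FMor :: "'m \<Rightarrow> 'q"

definition is_functor ::
  "('o, 'm, 'z) cat_scheme \<Rightarrow> ('p, 'q, 'y) cat_scheme \<Rightarrow> ('o, 'm, 'p, 'q, 'w) funct_scheme \<Rightarrow> bool"
where
  "is_functor C D F \<longleftrightarrow>
     (\<forall>x \<in> Obj C. FObj F x \<in> Obj D) \<and>
     (\<forall>f \<in> Arr C. FMor F f \<in> Hom D (FObj F (Dom C f)) (FObj F (Cod C f))) \<and>
     (\<forall>x \<in> Obj C. FMor F (Idn C x) = Idn D (FObj F x)) \<and>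
     (\<forall>f \<in> Arr C. \<forall>g \<in> Arr C. Dom C g = Cod C f \<longrightarrow>
        FMor F (g \<cdot>\<^bsub>C\<^esub> f) = FMor F g \<cdot>\<^bsub>D\<^esub> FMor F f)"

definition is_linear_functor ::
  "('k, 'o, 'm, 'z) lin_cat_scheme \<Rightarrow> ('k, 'p, 'q, 'y) lin_cat_scheme
    \<Rightarrow> ('o, 'm, 'p, 'q, 'w) funct_scheme \<Rightarrow> bool"
where
  "is_linear_functor C D F \<longleftrightarrow> is_functor C D F \<and>
     (\<forall>x \<in> Obj C. \<forall>y \<in> Obj C. \<forall>f \<in> Hom C x y. \<forall>g \<in> Hom C x y.
        FMor F (Add C f g) = Add D (FMor F f) (FMor F g)) \<and>
     (\<forall>a. \<forall>f \<in> Arr C. FMor F (Scale C a f) = Scale D a (FMor F f))"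

definition id_functor :: "('o, 'm, 'o, 'm) funct" where
  "id_functor = \<lparr>FObj = (\<lambda>x. x), FMor = (\<lambda>f. f)\<rparr>"

definition comp_functor ::
  "('p, 'q, 'r, 's, 'z) funct_scheme \<Rightarrow> ('o, 'm, 'p, 'q, 'y) funct_scheme \<Rightarrow> ('o, 'm, 'r, 's) funct"
where
  "comp_functor G F = \<lparr>FObj = (\<lambda>x. FObj G (FObj F x)), FMor = (\<lambda>f. FMor G (FMor F f))\<rparr>"

definition is_nat_transf ::
  "('o, 'm, 'z) cat_scheme \<Rightarrow> ('p, 'q, 'y) cat_scheme \<Rightarrow> ('o, 'm, 'p, 'q, 'w) funct_scheme
    \<Rightarrow> ('o, 'm, 'p, 'q, 'v) funct_scheme \<Rightarrow> ('o \<Rightarrow> 'q) \<Rightarrow> bool"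
where
  "is_nat_transf C D F G \<eta> \<longleftrightarrow>
     (\<forall>x \<in> Obj C. \<eta> x \<in> Hom D (FObj F x) (FObj G x)) \<and>
     (\<forall>f \<in> Arr C. FMor G f \<cdot>\<^bsub>D\<^esub> \<eta> (Dom C f) = \<eta> (Cod C f) \<cdot>\<^bsub>D\<^esub> FMor F f)"

definition is_nat_iso ::
  "('o, 'm, 'z) cat_scheme \<Rightarrow> ('p, 'q, 'y) cat_scheme \<Rightarrow> ('o, 'm, 'p, 'q, 'w) funct_scheme
    \<Rightarrow> ('o, 'm, 'p, 'q, 'v) funct_scheme \<Rightarrow> ('o \<Rightarrow> 'q) \<Rightarrow> bool"
where
  "is_nat_iso C D F G \<eta> \<longleftrightarrow> is_nat_transf C D F G \<eta> \<and> (\<forall>x \<in> Obj C. iso_arr D (\<eta> x))"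

definition linearly_equivalent ::
  "('k, 'o, 'm, 'z) lin_cat_scheme \<Rightarrow> ('k, 'p, 'q, 'y) lin_cat_scheme \<Rightarrow> bool"
where
  "linearly_equivalent C D \<longleftrightarrow>
     (\<exists>(F :: ('o, 'm, 'p, 'q) funct) (G :: ('p, 'q, 'o, 'm) funct) \<eta> \<epsilon>.
        is_linear_functor C D F \<and> is_linear_functor D C G \<and>
        is_nat_iso C C id_functor (comp_functor G F) \<eta> \<and>
        is_nat_iso D D (comp_functor F G) id_functor \<epsilon>)"


subsection \<open>Exactness\<close>

definition is_kernel :: "('k, 'o, 'm, 'z) lin_cat_scheme \<Rightarrow> 'm \<Rightarrow> 'm \<Rightarrow> bool" where
  "is_kernel C f i \<longleftrightarrow> f \<in> Arr C \<and> i \<in> Arr C \<and> Cod C i = Dom C f \<and>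
     f \<cdot>\<^bsub>C\<^esub> i = Zero C (Dom C i) (Cod C f) \<and>
     (\<forall>h \<in> Arr C. Cod C h = Dom C f \<and> f \<cdot>\<^bsub>C\<^esub> h = Zero C (Dom C h) (Cod C f) \<longrightarrow>
        (\<exists>!u. u \<in> Hom C (Dom C h) (Dom C i) \<and> i \<cdot>\<^bsub>C\<^esub> u = h))"

definition is_cokernel :: "('k, 'o, 'm, 'z) lin_cat_scheme \<Rightarrow> 'm \<Rightarrow> 'm \<Rightarrow> bool" where
  "is_cokernel C f q \<longleftrightarrow> f \<in> Arr C \<and> q \<in> Arr C \<and> Dom C q = Cod C f \<and>
     q \<cdot>\<^bsub>C\<^esub> f = Zero C (Dom C f) (Cod C q) \<and>
     (\<forall>h \<in> Arr C. Dom C h = Cod C f \<and> h \<cdot>\<^bsub>C\<^esub> f = Zero C (Dom C f) (Cod C h) \<longrightarrow>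
        (\<exists>!u. u \<in> Hom C (Cod C q) (Cod C h) \<and> u \<cdot>\<^bsub>C\<^esub> q = h))"

text \<open>Between abelian categories, \<open>a \<rightarrow> b \<rightarrow> c \<rightarrow> 0\<close> is exact iff
  \<open>b \<rightarrow> c\<close> is a cokernel of \<open>a \<rightarrow> b\<close>, and dually for kernels.\<close>

definition right_exact ::
  "('k, 'o, 'm, 'z) lin_cat_scheme \<Rightarrow> ('k, 'p, 'q, 'y) lin_cat_scheme
    \<Rightarrow> ('o, 'm, 'p, 'q, 'w) funct_scheme \<Rightarrow> bool"
where
  "right_exact C D F \<longleftrightarrow> is_linear_functor C D F \<and>
     (\<forall>f q. is_cokernel C f q \<longrightarrow> is_cokernel D (FMor F f) (FMor F q))"

definition left_exact ::
  "('k, 'o, 'm, 'z) lin_cat_scheme \<Rightarrow> ('k, 'p, 'q, 'y) lin_cat_scheme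
    \<Rightarrow> ('o, 'm, 'p, 'q, 'w) funct_scheme \<Rightarrow> bool"
where
  "left_exact C D F \<longleftrightarrow> is_linear_functor C D F \<and>
     (\<forall>f i. is_kernel C f i \<longrightarrow> is_kernel D (FMor F f) (FMor F i))"

definition exact ::
  "('k, 'o, 'm, 'z) lin_cat_scheme \<Rightarrow> ('k, 'p, 'q, 'y) lin_cat_scheme
    \<Rightarrow> ('o, 'm, 'p, 'q, 'w) funct_scheme \<Rightarrow> bool"
where
  "exact C D F \<longleftrightarrow> left_exact C D F \<and> right_exact C D F"


section \<open>Finite linear categories\<close>

text \<open>Up to isomorphism, a \<open>d\<close>-dimensional algebra is a ring structure on the vector space of
  column vectors of length \<open>d\<close>, and an \<open>n\<close>-dimensional module is a representation by
  \<open>n \<times> n\<close> matrices. The dimensions may be \<open>0\<close>.\<close>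

definition fd_algebra :: "nat \<Rightarrow> 'k::field vec ring \<Rightarrow> bool" where
  "fd_algebra d A \<longleftrightarrow> ring A \<and> carrier A = carrier_vec d \<and>
     (\<forall>x \<in> carrier A. \<forall>y \<in> carrier A. x \<oplus>\<^bsub>A\<^esub> y = x + y) \<and>
     (\<forall>a. \<forall>x \<in> carrier A. \<forall>y \<in> carrier A.
        (a \<cdot>\<^sub>v x) \<otimes>\<^bsub>A\<^esub> y = a \<cdot>\<^sub>v (x \<otimes>\<^bsub>A\<^esub> y) \<and> x \<otimes>\<^bsub>A\<^esub> (a \<cdot>\<^sub>v y) = a \<cdot>\<^sub>v (x \<otimes>\<^bsub>A\<^esub> y))"

type_synonym 'k fdmod = "nat \<times> ('k vec \<Rightarrow> 'k mat)"

definition fd_module :: "'k::field vec ring \<Rightarrow> 'k fdmod \<Rightarrow> bool" where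
  "fd_module A V \<longleftrightarrow>
     (\<forall>x \<in> carrier A. snd V x \<in> carrier_mat (fst V) (fst V)) \<and>
     (\<forall>x \<in> carrier A. \<forall>y \<in> carrier A. snd V (x \<oplus>\<^bsub>A\<^esub> y) = snd V x + snd V y) \<and>
     (\<forall>a. \<forall>x \<in> carrier A. snd V (a \<cdot>\<^sub>v x) = a \<cdot>\<^sub>m snd V x) \<and>
     (\<forall>x \<in> carrier A. \<forall>y \<in> carrier A. snd V (x \<otimes>\<^bsub>A\<^esub> y) = snd V x * snd V y) \<and>
     snd V \<one>\<^bsub>A\<^esub> = 1\<^sub>m (fst V)"

definition fd_module_cat ::
  "'k::field vec ring \<Rightarrow> ('k, 'k fdmod, 'k fdmod \<times> 'k mat \<times> 'k fdmod) lin_cat"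
where
  "fd_module_cat A =
     \<lparr>Obj = {V. fd_module A V},
      Arr = {(V, X, W). fd_module A V \<and> fd_module A W \<and> X \<in> carrier_mat (fst W) (fst V) \<and>
               (\<forall>x \<in> carrier A. X * snd V x = snd W x * X)},
      Dom = (\<lambda>(V, X, W). V),
      Cod = (\<lambda>(V, X, W). W),
      Idn = (\<lambda>V. (V, 1\<^sub>m (fst V), V)),
      Comp = (\<lambda>(V', Y, W) (V, X, W'). (V, Y * X, W)),
      Zero = (\<lambda>V W. (V, 0\<^sub>m (fst W) (fst V), W)),
      Add = (\<lambda>(V, X, W) (V', Y, W'). (V, X + Y, W)),
      Scale = (\<lambda>a (V, X, W). (V, a \<cdot>\<^sub>m X, W))\<rparr>"

definition finite_linear_category :: "('k::field, 'o, 'm, 'z) lin_cat_scheme \<Rightarrow> bool" where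
  "finite_linear_category C \<longleftrightarrow> linear_category C \<and>
     (\<exists>d A. fd_algebra d A \<and> linearly_equivalent C (fd_module_cat A))"


section \<open>Finite tensor categories\<close>

text \<open>Associators \<open>(a \<otimes> b) \<otimes> c \<rightarrow> a \<otimes> (b \<otimes> c)\<close> and unitors
  \<open>1 \<otimes> a \<rightarrow> a\<close>, \<open>a \<otimes> 1 \<rightarrow> a\<close> are kept explicit throughout.
  \<open>RDual c\<close> is the right dual with evaluation \<open>REv c : RDual c \<otimes> c \<rightarrow> 1\<close> and coevaluation
  \<open>RCoev c : 1 \<rightarrow> c \<otimes> RDual c\<close>; \<open>LDual c\<close> is the left dual with
  \<open>LEv c : c \<otimes> LDual c \<rightarrow> 1\<close> and \<open>LCoev c : 1 \<rightarrow> LDual c \<otimes> c\<close>.\<close>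

record ('k, 'c, 'd) tensor_cat = "('k, 'c, 'd) lin_cat" +
  Unit :: "'c"
  TObj :: "'c \<Rightarrow> 'c \<Rightarrow> 'c"  (infixr "\<otimes>\<^sub>o\<index>" 80)
  TMor :: "'d \<Rightarrow> 'd \<Rightarrow> 'd"  (infixr "\<otimes>\<^sub>m\<index>" 80)
  Assoc :: "'c \<Rightarrow> 'c \<Rightarrow> 'c \<Rightarrow> 'd"
  LUnit :: "'c \<Rightarrow> 'd"
  RUnit :: "'c \<Rightarrow> 'd"
  RDual :: "'c \<Rightarrow> 'c"
  REv :: "'c \<Rightarrow> 'd"
  RCoev :: "'c \<Rightarrow> 'd"
  LDual :: "'c \<Rightarrow> 'c"
  LEv :: "'c \<Rightarrow> 'd"
  LCoev :: "'c \<Rightarrow> 'd"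

locale monoidal_linear_category = linear_category C
  for C :: "('k::field, 'c, 'd, 'z) tensor_cat_scheme" +
  assumes Unit_in_Obj: "Unit C \<in> Obj C"
    and TObj_in_Obj: "\<lbrakk>a \<in> Obj C; b \<in> Obj C\<rbrakk> \<Longrightarrow> a \<otimes>\<^sub>o\<^bsub>C\<^esub> b \<in> Obj C"
    and TMor_in_Hom: "\<lbrakk>f \<in> Hom C a a'; g \<in> Hom C b b'\<rbrakk>
      \<Longrightarrow> f \<otimes>\<^sub>m\<^bsub>C\<^esub> g \<in> Hom C (a \<otimes>\<^sub>o\<^bsub>C\<^esub> b) (a' \<otimes>\<^sub>o\<^bsub>C\<^esub> b')"
    and TMor_Idn: "\<lbrakk>a \<in> Obj C; b \<in> Obj C\<rbrakk>
      \<Longrightarrow> Idn C a \<otimes>\<^sub>m\<^bsub>C\<^esub> Idn C b = Idn C (a \<otimes>\<^sub>o\<^bsub>C\<^esub> b)"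
    and TMor_Comp: "\<lbrakk>f \<in> Hom C a a'; f' \<in> Hom C a' a''; g \<in> Hom C b b'; g' \<in> Hom C b' b''\<rbrakk>
      \<Longrightarrow> (f' \<cdot>\<^bsub>C\<^esub> f) \<otimes>\<^sub>m\<^bsub>C\<^esub> (g' \<cdot>\<^bsub>C\<^esub> g) = (f' \<otimes>\<^sub>m\<^bsub>C\<^esub> g') \<cdot>\<^bsub>C\<^esub> (f \<otimes>\<^sub>m\<^bsub>C\<^esub> g)"
    and TMor_Add_left: "\<lbrakk>f \<in> Hom C a a'; f' \<in> Hom C a a'; g \<in> Hom C b b'\<rbrakk>
      \<Longrightarrow> Add C f f' \<otimes>\<^sub>m\<^bsub>C\<^esub> g = Add C (f \<otimes>\<^sub>m\<^bsub>C\<^esub> g) (f' \<otimes>\<^sub>m\<^bsub>C\<^esub> g)"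
    and TMor_Add_right: "\<lbrakk>f \<in> Hom C a a'; g \<in> Hom C b b'; g' \<in> Hom C b b'\<rbrakk>
      \<Longrightarrow> f \<otimes>\<^sub>m\<^bsub>C\<^esub> Add C g g' = Add C (f \<otimes>\<^sub>m\<^bsub>C\<^esub> g) (f \<otimes>\<^sub>m\<^bsub>C\<^esub> g')"
    and TMor_Scale_left: "\<lbrakk>f \<in> Hom C a a'; g \<in> Hom C b b'\<rbrakk>
      \<Longrightarrow> Scale C k f \<otimes>\<^sub>m\<^bsub>C\<^esub> g = Scale C k (f \<otimes>\<^sub>m\<^bsub>C\<^esub> g)"
    and TMor_Scale_right: "\<lbrakk>f \<in> Hom C a a'; g \<in> Hom C b b'\<rbrakk>
      \<Longrightarrow> f \<otimes>\<^sub>m\<^bsub>C\<^esub> Scale C k g = Scale C k (f \<otimes>\<^sub>m\<^bsub>C\<^esub> g)"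
    and Assoc_in_Hom: "\<lbrakk>a \<in> Obj C; b \<in> Obj C; c \<in> Obj C\<rbrakk>
      \<Longrightarrow> Assoc C a b c \<in> Hom C ((a \<otimes>\<^sub>o\<^bsub>C\<^esub> b) \<otimes>\<^sub>o\<^bsub>C\<^esub> c) (a \<otimes>\<^sub>o\<^bsub>C\<^esub> (b \<otimes>\<^sub>o\<^bsub>C\<^esub> c))"
    and Assoc_iso: "\<lbrakk>a \<in> Obj C; b \<in> Obj C; c \<in> Obj C\<rbrakk> \<Longrightarrow> iso_arr C (Assoc C a b c)"
    and Assoc_natural: "\<lbrakk>f \<in> Hom C a a'; g \<in> Hom C b b'; h \<in> Hom C c c'\<rbrakk>
      \<Longrightarrow> Assoc C a' b' c' \<cdot>\<^bsub>C\<^esub> ((f \<otimes>\<^sub>m\<^bsub>C\<^esub> g) \<otimes>\<^sub>m\<^bsub>C\<^esub> h)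
          = (f \<otimes>\<^sub>m\<^bsub>C\<^esub> (g \<otimes>\<^sub>m\<^bsub>C\<^esub> h)) \<cdot>\<^bsub>C\<^esub> Assoc C a b c"
    and LUnit_in_Hom: "a \<in> Obj C \<Longrightarrow> LUnit C a \<in> Hom C (Unit C \<otimes>\<^sub>o\<^bsub>C\<^esub> a) a"
    and LUnit_iso: "a \<in> Obj C \<Longrightarrow> iso_arr C (LUnit C a)"
    and LUnit_natural: "f \<in> Hom C a a'
      \<Longrightarrow> LUnit C a' \<cdot>\<^bsub>C\<^esub> (Idn C (Unit C) \<otimes>\<^sub>m\<^bsub>C\<^esub> f) = f \<cdot>\<^bsub>C\<^esub> LUnit C a"
    and RUnit_in_Hom: "a \<in> Obj C \<Longrightarrow> RUnit C a \<in> Hom C (a \<otimes>\<^sub>o\<^bsub>C\<^esub> Unit C) a"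
    and RUnit_iso: "a \<in> Obj C \<Longrightarrow> iso_arr C (RUnit C a)"
    and RUnit_natural: "f \<in> Hom C a a'
      \<Longrightarrow> RUnit C a' \<cdot>\<^bsub>C\<^esub> (f \<otimes>\<^sub>m\<^bsub>C\<^esub> Idn C (Unit C)) = f \<cdot>\<^bsub>C\<^esub> RUnit C a"
    and pentagon: "\<lbrakk>a \<in> Obj C; b \<in> Obj C; c \<in> Obj C; d \<in> Obj C\<rbrakk>
      \<Longrightarrow> (Idn C a \<otimes>\<^sub>m\<^bsub>C\<^esub> Assoc C b c d) \<cdot>\<^bsub>C\<^esub> Assoc C a (b \<otimes>\<^sub>o\<^bsub>C\<^esub> c) d
            \<cdot>\<^bsub>C\<^esub> (Assoc C a b c \<otimes>\<^sub>m\<^bsub>C\<^esub> Idn C d)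
          = Assoc C a b (c \<otimes>\<^sub>o\<^bsub>C\<^esub> d) \<cdot>\<^bsub>C\<^esub> Assoc C (a \<otimes>\<^sub>o\<^bsub>C\<^esub> b) c d"
    and triangle: "\<lbrakk>a \<in> Obj C; b \<in> Obj C\<rbrakk>
      \<Longrightarrow> (Idn C a \<otimes>\<^sub>m\<^bsub>C\<^esub> LUnit C b) \<cdot>\<^bsub>C\<^esub> Assoc C a (Unit C) b
          = RUnit C a \<otimes>\<^sub>m\<^bsub>C\<^esub> Idn C b"

text \<open>\<open>duality C d c ev coev\<close>: \<open>d\<close> is a right dual of \<open>c\<close>, equivalently \<open>c\<close> is a left dual
  of \<open>d\<close>.\<close>

definition duality ::
  "('k, 'c, 'd, 'z) tensor_cat_scheme \<Rightarrow> 'c \<Rightarrow> 'c \<Rightarrow> 'd \<Rightarrow> 'd \<Rightarrow> bool"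
where
  "duality C d c ev coev \<longleftrightarrow>
     d \<in> Obj C \<and> c \<in> Obj C \<and>
     ev \<in> Hom C (d \<otimes>\<^sub>o\<^bsub>C\<^esub> c) (Unit C) \<and> coev \<in> Hom C (Unit C) (c \<otimes>\<^sub>o\<^bsub>C\<^esub> d) \<and>
     RUnit C c \<cdot>\<^bsub>C\<^esub> (Idn C c \<otimes>\<^sub>m\<^bsub>C\<^esub> ev) \<cdot>\<^bsub>C\<^esub> Assoc C c d c \<cdot>\<^bsub>C\<^esub> (coev \<otimes>\<^sub>m\<^bsub>C\<^esub> Idn C c)
       = LUnit C c \<and>
     LUnit C d \<cdot>\<^bsub>C\<^esub> (ev \<otimes>\<^sub>m\<^bsub>C\<^esub> Idn C d) \<cdot>\<^bsub>C\<^esub> inv_arr C (Assoc C d c d) \<cdot>\<^bsub>C\<^esub> (Idn C d \<otimes>\<^sub>m\<^bsub>C\<^esub> coev)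
       = RUnit C d"

locale finite_tensor_category = monoidal_linear_category C
  for C :: "('k::alg_closed_field, 'c, 'd, 'z) tensor_cat_scheme" +
  assumes finite_linear: "finite_linear_category C"
    and right_dual: "c \<in> Obj C \<Longrightarrow> duality C (RDual C c) c (REv C c) (RCoev C c)"
    and left_dual: "c \<in> Obj C \<Longrightarrow> duality C c (LDual C c) (LEv C c) (LCoev C c)"
    and Unit_nonzero: "Idn C (Unit C) \<noteq> Zero C (Unit C) (Unit C)"
    and Unit_simple: "\<lbrakk>mono_arr C i; Cod C i = Unit C\<rbrakk>
      \<Longrightarrow> iso_arr C i \<or> Idn C (Dom C i) = Zero C (Dom C i) (Dom C i)"


section \<open>Finite module categories\<close>

text \<open>\<open>MAssoc c d m : (c \<otimes> d).m \<rightarrow> c.(d.m)\<close> and \<open>MUnit m : 1.m \<rightarrow> m\<close>.\<close>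

record ('k, 'c, 'd, 'o, 'm) module_cat = "('k, 'o, 'm) lin_cat" +
  ActObj :: "'c \<Rightarrow> 'o \<Rightarrow> 'o"  (infixr "\<rhd>\<^sub>o\<index>" 80)
  ActMor :: "'d \<Rightarrow> 'm \<Rightarrow> 'm"  (infixr "\<rhd>\<^sub>m\<index>" 80)
  MAssoc :: "'c \<Rightarrow> 'c \<Rightarrow> 'o \<Rightarrow> 'm"
  MUnit :: "'o \<Rightarrow> 'm"

locale finite_module_category = C: finite_tensor_category C + M: linear_category M
  for C :: "('k::alg_closed_field, 'c, 'd, 'z) tensor_cat_scheme"
    and M :: "('k, 'c, 'd, 'o, 'm, 'y) module_cat_scheme" +
  assumes finite_linear_M: "finite_linear_category M"
    and ActObj_in_Obj: "\<lbrakk>c \<in> Obj C; x \<in> Obj M\<rbrakk> \<Longrightarrow> c \<rhd>\<^sub>o\<^bsub>M\<^esub> x \<in> Obj M"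
    and ActMor_in_Hom: "\<lbrakk>f \<in> Hom C c c'; g \<in> Hom M x x'\<rbrakk>
      \<Longrightarrow> f \<rhd>\<^sub>m\<^bsub>M\<^esub> g \<in> Hom M (c \<rhd>\<^sub>o\<^bsub>M\<^esub> x) (c' \<rhd>\<^sub>o\<^bsub>M\<^esub> x')"
    and ActMor_Idn: "\<lbrakk>c \<in> Obj C; x \<in> Obj M\<rbrakk>
      \<Longrightarrow> Idn C c \<rhd>\<^sub>m\<^bsub>M\<^esub> Idn M x = Idn M (c \<rhd>\<^sub>o\<^bsub>M\<^esub> x)"
    and ActMor_Comp: "\<lbrakk>f \<in> Hom C c c'; f' \<in> Hom C c' c''; g \<in> Hom M x x'; g' \<in> Hom M x' x''\<rbrakk>
      \<Longrightarrow> (f' \<cdot>\<^bsub>C\<^esub> f) \<rhd>\<^sub>m\<^bsub>M\<^esub> (g' \<cdot>\<^bsub>M\<^esub> g) = (f' \<rhd>\<^sub>m\<^bsub>M\<^esub> g') \<cdot>\<^bsub>M\<^esub> (f \<rhd>\<^sub>m\<^bsub>M\<^esub> g)"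
    and ActMor_Add_left: "\<lbrakk>f \<in> Hom C c c'; f' \<in> Hom C c c'; g \<in> Hom M x x'\<rbrakk>
      \<Longrightarrow> Add C f f' \<rhd>\<^sub>m\<^bsub>M\<^esub> g = Add M (f \<rhd>\<^sub>m\<^bsub>M\<^esub> g) (f' \<rhd>\<^sub>m\<^bsub>M\<^esub> g)"
    and ActMor_Add_right: "\<lbrakk>f \<in> Hom C c c'; g \<in> Hom M x x'; g' \<in> Hom M x x'\<rbrakk>
      \<Longrightarrow> f \<rhd>\<^sub>m\<^bsub>M\<^esub> Add M g g' = Add M (f \<rhd>\<^sub>m\<^bsub>M\<^esub> g) (f \<rhd>\<^sub>m\<^bsub>M\<^esub> g')"
    and ActMor_Scale_left: "\<lbrakk>f \<in> Hom C c c'; g \<in> Hom M x x'\<rbrakk>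
      \<Longrightarrow> Scale C k f \<rhd>\<^sub>m\<^bsub>M\<^esub> g = Scale M k (f \<rhd>\<^sub>m\<^bsub>M\<^esub> g)"
    and ActMor_Scale_right: "\<lbrakk>f \<in> Hom C c c'; g \<in> Hom M x x'\<rbrakk>
      \<Longrightarrow> f \<rhd>\<^sub>m\<^bsub>M\<^esub> Scale M k g = Scale M k (f \<rhd>\<^sub>m\<^bsub>M\<^esub> g)"
    and MAssoc_in_Hom: "\<lbrakk>c \<in> Obj C; d \<in> Obj C; x \<in> Obj M\<rbrakk>
      \<Longrightarrow> MAssoc M c d x \<in> Hom M ((c \<otimes>\<^sub>o\<^bsub>C\<^esub> d) \<rhd>\<^sub>o\<^bsub>M\<^esub> x) (c \<rhd>\<^sub>o\<^bsub>M\<^esub> (d \<rhd>\<^sub>o\<^bsub>M\<^esub> x))"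
    and MAssoc_iso: "\<lbrakk>c \<in> Obj C; d \<in> Obj C; x \<in> Obj M\<rbrakk> \<Longrightarrow> iso_arr M (MAssoc M c d x)"
    and MAssoc_natural: "\<lbrakk>f \<in> Hom C c c'; f' \<in> Hom C d d'; h \<in> Hom M x x'\<rbrakk>
      \<Longrightarrow> MAssoc M c' d' x' \<cdot>\<^bsub>M\<^esub> ((f \<otimes>\<^sub>m\<^bsub>C\<^esub> f') \<rhd>\<^sub>m\<^bsub>M\<^esub> h)
          = (f \<rhd>\<^sub>m\<^bsub>M\<^esub> (f' \<rhd>\<^sub>m\<^bsub>M\<^esub> h)) \<cdot>\<^bsub>M\<^esub> MAssoc M c d x"
    and MUnit_in_Hom: "x \<in> Obj M \<Longrightarrow> MUnit M x \<in> Hom M (Unit C \<rhd>\<^sub>o\<^bsub>M\<^esub> x) x"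
    and MUnit_iso: "x \<in> Obj M \<Longrightarrow> iso_arr M (MUnit M x)"
    and MUnit_natural: "h \<in> Hom M x x'
      \<Longrightarrow> MUnit M x' \<cdot>\<^bsub>M\<^esub> (Idn C (Unit C) \<rhd>\<^sub>m\<^bsub>M\<^esub> h) = h \<cdot>\<^bsub>M\<^esub> MUnit M x"
    and module_pentagon: "\<lbrakk>b \<in> Obj C; c \<in> Obj C; d \<in> Obj C; x \<in> Obj M\<rbrakk>
      \<Longrightarrow> (Idn C b \<rhd>\<^sub>m\<^bsub>M\<^esub> MAssoc M c d x) \<cdot>\<^bsub>M\<^esub> MAssoc M b (c \<otimes>\<^sub>o\<^bsub>C\<^esub> d) x
            \<cdot>\<^bsub>M\<^esub> (Assoc C b c d \<rhd>\<^sub>m\<^bsub>M\<^esub> Idn M x)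
          = MAssoc M b c (d \<rhd>\<^sub>o\<^bsub>M\<^esub> x) \<cdot>\<^bsub>M\<^esub> MAssoc M (b \<otimes>\<^sub>o\<^bsub>C\<^esub> c) d x"
    and module_triangle: "\<lbrakk>c \<in> Obj C; x \<in> Obj M\<rbrakk>
      \<Longrightarrow> (Idn C c \<rhd>\<^sub>m\<^bsub>M\<^esub> MUnit M x) \<cdot>\<^bsub>M\<^esub> MAssoc M c (Unit C) x
          = RUnit C c \<rhd>\<^sub>m\<^bsub>M\<^esub> Idn M x"
    and act_exact_left: "x \<in> Obj M
      \<Longrightarrow> exact C M \<lparr>FObj = (\<lambda>c. c \<rhd>\<^sub>o\<^bsub>M\<^esub> x), FMor = (\<lambda>f. f \<rhd>\<^sub>m\<^bsub>M\<^esub> Idn M x)\<rparr>"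
    and act_right_exact_right: "c \<in> Obj C
      \<Longrightarrow> right_exact M M \<lparr>FObj = (\<lambda>x. c \<rhd>\<^sub>o\<^bsub>M\<^esub> x), FMor = (\<lambda>g. Idn C c \<rhd>\<^sub>m\<^bsub>M\<^esub> g)\<rparr>"


section \<open>The category of right exact module functors\<close>

text \<open>\<open>FCon F c m : F (c.m) \<rightarrow> c.F m\<close> is the module constraint. The values of a functor and its
  constraint outside the carriers are not fixed, so a module functor may be represented by several
  (isomorphic) objects. Families underlying module natural transformations are extensional, so that
  the Hom-sets are the right ones.\<close>

record ('c, 'o, 'm, 'p, 'q) mfunct = "('o, 'm, 'p, 'q) funct" +
  FCon :: "'c \<Rightarrow> 'o \<Rightarrow> 'q"

definition is_module_functor ::
  "('k, 'c, 'd, 'z) tensor_cat_scheme \<Rightarrow> ('k, 'c, 'd, 'o, 'm, 'y) module_cat_scheme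
    \<Rightarrow> ('k, 'c, 'd, 'p, 'q, 'x) module_cat_scheme \<Rightarrow> ('c, 'o, 'm, 'p, 'q) mfunct \<Rightarrow> bool"
where
  "is_module_functor C M N F \<longleftrightarrow> is_linear_functor M N F \<and>
     (\<forall>c \<in> Obj C. \<forall>x \<in> Obj M.
        FCon F c x \<in> Hom N (FObj F (c \<rhd>\<^sub>o\<^bsub>M\<^esub> x)) (c \<rhd>\<^sub>o\<^bsub>N\<^esub> FObj F x) \<and> iso_arr N (FCon F c x)) \<and>
     (\<forall>f \<in> Arr C. \<forall>g \<in> Arr M.
        FCon F (Cod C f) (Cod M g) \<cdot>\<^bsub>N\<^esub> FMor F (f \<rhd>\<^sub>m\<^bsub>M\<^esub> g)
          = (f \<rhd>\<^sub>m\<^bsub>N\<^esub> FMor F g) \<cdot>\<^bsub>N\<^esub> FCon F (Dom C f) (Dom M g)) \<and>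
     (\<forall>c \<in> Obj C. \<forall>d \<in> Obj C. \<forall>x \<in> Obj M.
        MAssoc N c d (FObj F x) \<cdot>\<^bsub>N\<^esub> FCon F (c \<otimes>\<^sub>o\<^bsub>C\<^esub> d) x
          = (Idn C c \<rhd>\<^sub>m\<^bsub>N\<^esub> FCon F d x) \<cdot>\<^bsub>N\<^esub> FCon F c (d \<rhd>\<^sub>o\<^bsub>M\<^esub> x) \<cdot>\<^bsub>N\<^esub> FMor F (MAssoc M c d x)) \<and>
     (\<forall>x \<in> Obj M. MUnit N (FObj F x) \<cdot>\<^bsub>N\<^esub> FCon F (Unit C) x = FMor F (MUnit M x))"

definition is_module_nat_transf ::
  "('k, 'c, 'd, 'z) tensor_cat_scheme \<Rightarrow> ('k, 'c, 'd, 'o, 'm, 'y) module_cat_scheme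
    \<Rightarrow> ('k, 'c, 'd, 'p, 'q, 'x) module_cat_scheme
    \<Rightarrow> ('c, 'o, 'm, 'p, 'q) mfunct \<Rightarrow> ('c, 'o, 'm, 'p, 'q) mfunct \<Rightarrow> ('o \<Rightarrow> 'q) \<Rightarrow> bool"
where
  "is_module_nat_transf C M N F G \<eta> \<longleftrightarrow> is_nat_transf M N F G \<eta> \<and>
     (\<forall>c \<in> Obj C. \<forall>x \<in> Obj M.
        FCon G c x \<cdot>\<^bsub>N\<^esub> \<eta> (c \<rhd>\<^sub>o\<^bsub>M\<^esub> x) = (Idn C c \<rhd>\<^sub>m\<^bsub>N\<^esub> \<eta> x) \<cdot>\<^bsub>N\<^esub> FCon F c x)"

type_synonym ('c, 'o, 'm, 'p, 'q) mtransf =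
  "('c, 'o, 'm, 'p, 'q) mfunct \<times> ('o \<Rightarrow> 'q) \<times> ('c, 'o, 'm, 'p, 'q) mfunct"

definition Rex ::
  "('k, 'c, 'd, 'z) tensor_cat_scheme \<Rightarrow> ('k, 'c, 'd, 'o, 'm, 'y) module_cat_scheme
    \<Rightarrow> ('k, 'c, 'd, 'p, 'q, 'x) module_cat_scheme
    \<Rightarrow> (('c, 'o, 'm, 'p, 'q) mfunct, ('c, 'o, 'm, 'p, 'q) mtransf) cat"
where
  "Rex C M N =
     \<lparr>Obj = {F. is_module_functor C M N F \<and> right_exact M N F},
      Arr = {(F, \<eta>, G). is_module_functor C M N F \<and> right_exact M N F \<and>
               is_module_functor C M N G \<and> right_exact M N G \<and>
               is_module_nat_transf C M N F G \<eta> \<and> \<eta> \<in> extensional (Obj M)},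
      Dom = (\<lambda>(F, \<eta>, G). F),
      Cod = (\<lambda>(F, \<eta>, G). G),
      Idn = (\<lambda>F. (F, restrict (\<lambda>x. Idn N (FObj F x)) (Obj M), F)),
      Comp = (\<lambda>(F', \<theta>, G) (F, \<eta>, G'). (F, restrict (\<lambda>x. \<theta> x \<cdot>\<^bsub>N\<^esub> \<eta> x) (Obj M), G))\<rparr>"

definition component :: "('c, 'o, 'm, 'p, 'q) mtransf \<Rightarrow> 'o \<Rightarrow> 'q" where
  "component t = fst (snd t)"


section \<open>The Drinfeld center and its action on module functors\<close>

definition half_braiding ::
  "('k, 'c, 'd, 'z) tensor_cat_scheme \<Rightarrow> 'c \<Rightarrow> ('c \<Rightarrow> 'd) \<Rightarrow> bool"
where
  "half_braiding C c0 \<sigma> \<longleftrightarrow>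
     (\<forall>c \<in> Obj C. \<sigma> c \<in> Hom C (c \<otimes>\<^sub>o\<^bsub>C\<^esub> c0) (c0 \<otimes>\<^sub>o\<^bsub>C\<^esub> c) \<and> iso_arr C (\<sigma> c)) \<and>
     (\<forall>f \<in> Arr C. (Idn C c0 \<otimes>\<^sub>m\<^bsub>C\<^esub> f) \<cdot>\<^bsub>C\<^esub> \<sigma> (Dom C f) = \<sigma> (Cod C f) \<cdot>\<^bsub>C\<^esub> (f \<otimes>\<^sub>m\<^bsub>C\<^esub> Idn C c0)) \<and>
     (\<forall>c \<in> Obj C. \<forall>c' \<in> Obj C.
        \<sigma> (c \<otimes>\<^sub>o\<^bsub>C\<^esub> c') = Assoc C c0 c c' \<cdot>\<^bsub>C\<^esub> (\<sigma> c \<otimes>\<^sub>m\<^bsub>C\<^esub> Idn C c') \<cdot>\<^bsub>C\<^esub> inv_arr C (Assoc C c c0 c')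
                         \<cdot>\<^bsub>C\<^esub> (Idn C c \<otimes>\<^sub>m\<^bsub>C\<^esub> \<sigma> c') \<cdot>\<^bsub>C\<^esub> Assoc C c c' c0) \<and>
     RUnit C c0 \<cdot>\<^bsub>C\<^esub> \<sigma> (Unit C) = LUnit C c0"

type_synonym ('c, 'd) cobj = "'c \<times> ('c \<Rightarrow> 'd)"
type_synonym ('c, 'd) carr = "('c, 'd) cobj \<times> 'd \<times> ('c, 'd) cobj"

definition center ::
  "('k, 'c, 'd, 'z) tensor_cat_scheme \<Rightarrow> (('c, 'd) cobj, ('c, 'd) carr) cat"
where
  "center C =
     \<lparr>Obj = {(c0, \<sigma>). c0 \<in> Obj C \<and> half_braiding C c0 \<sigma>},
      Arr = {((c0, \<sigma>), f, (c1, \<tau>)).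
               c0 \<in> Obj C \<and> half_braiding C c0 \<sigma> \<and> c1 \<in> Obj C \<and> half_braiding C c1 \<tau> \<and>
               f \<in> Hom C c0 c1 \<and>
               (\<forall>c \<in> Obj C. \<tau> c \<cdot>\<^bsub>C\<^esub> (Idn C c \<otimes>\<^sub>m\<^bsub>C\<^esub> f) = (f \<otimes>\<^sub>m\<^bsub>C\<^esub> Idn C c) \<cdot>\<^bsub>C\<^esub> \<sigma> c)},
      Dom = (\<lambda>(z, f, w). z),
      Cod = (\<lambda>(z, f, w). w),
      Idn = (\<lambda>z. (z, Idn C (fst z), z)),
      Comp = (\<lambda>(w', g, v) (z, f, w). (z, g \<cdot>\<^bsub>C\<^esub> f, v))\<rparr>"

definition underlying :: "('c, 'd) carr \<Rightarrow> 'd" where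
  "underlying u = fst (snd u)"

definition center_act_obj ::
  "('k, 'c, 'd, 'z) tensor_cat_scheme \<Rightarrow> ('k, 'c, 'd, 'p, 'q, 'x) module_cat_scheme
    \<Rightarrow> ('c, 'd) cobj \<Rightarrow> ('c, 'o, 'm, 'p, 'q) mfunct \<Rightarrow> ('c, 'o, 'm, 'p, 'q) mfunct"
where
  "center_act_obj C N z F = (case z of (c0, \<sigma>) \<Rightarrow>
     \<lparr>FObj = (\<lambda>x. c0 \<rhd>\<^sub>o\<^bsub>N\<^esub> FObj F x),
      FMor = (\<lambda>f. Idn C c0 \<rhd>\<^sub>m\<^bsub>N\<^esub> FMor F f),
      FCon = (\<lambda>c x. MAssoc N c c0 (FObj F x)
                     \<cdot>\<^bsub>N\<^esub> (inv_arr C (\<sigma> c) \<rhd>\<^sub>m\<^bsub>N\<^esub> Idn N (FObj F x))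
                     \<cdot>\<^bsub>N\<^esub> inv_arr N (MAssoc N c0 c (FObj F x))
                     \<cdot>\<^bsub>N\<^esub> (Idn C c0 \<rhd>\<^sub>m\<^bsub>N\<^esub> FCon F c x))\<rparr>)"

definition center_act_mor ::
  "('k, 'c, 'd, 'z) tensor_cat_scheme \<Rightarrow> ('k, 'c, 'd, 'o, 'm, 'y) module_cat_scheme
    \<Rightarrow> ('k, 'c, 'd, 'p, 'q, 'x) module_cat_scheme
    \<Rightarrow> ('c, 'd) carr \<Rightarrow> ('c, 'o, 'm, 'p, 'q) mtransf \<Rightarrow> ('c, 'o, 'm, 'p, 'q) mtransf"
where
  "center_act_mor C M N u t = (case (u, t) of ((z, f, w), (F, \<eta>, G)) \<Rightarrow>
     (center_act_obj C N z F, restrict (\<lambda>x. f \<rhd>\<^sub>m\<^bsub>N\<^esub> \<eta> x) (Obj M), center_act_obj C N w G))"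


section \<open>Internal Homs and coHoms\<close>

text \<open>For a category \<open>A\<close> acting on a category \<open>X\<close> by a bifunctor with object part \<open>ao\<close> and arrow part
  \<open>am\<close>, a structure of internal Homs consists of the bifunctor \<open>(HObj, HMor)\<close>, contravariant in the
  first and covariant in the second argument, together with bijections
  \<open>HAdj x y a : Hom\<^sub>A(a, HObj x y) \<rightarrow> Hom\<^sub>X(a.x, y)\<close>, natural in all three arguments.
  Likewise for internal coHoms, with \<open>HAdj x y a : Hom\<^sub>A(HObj x y, a) \<rightarrow> Hom\<^sub>X(y, a.x)\<close>.
  Functoriality of \<open>(HObj, HMor)\<close> and, for a bilinear action, linearity of \<open>HAdj\<close> follow from
  naturality.\<close>

record ('a, 'b, 'x, 'y) internal_hom =
  HObj :: "'x \<Rightarrow> 'x \<Rightarrow> 'a"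
  HMor :: "'y \<Rightarrow> 'y \<Rightarrow> 'b"
  HAdj :: "'x \<Rightarrow> 'x \<Rightarrow> 'a \<Rightarrow> 'b \<Rightarrow> 'y"

definition is_internal_Hom ::
  "('a, 'b, 'z) cat_scheme \<Rightarrow> ('x, 'y, 'w) cat_scheme \<Rightarrow> ('a \<Rightarrow> 'x \<Rightarrow> 'x) \<Rightarrow> ('b \<Rightarrow> 'y \<Rightarrow> 'y)
    \<Rightarrow> ('a, 'b, 'x, 'y) internal_hom \<Rightarrow> bool"
where
  "is_internal_Hom A X ao am H \<longleftrightarrow>
     (\<forall>x \<in> Obj X. \<forall>y \<in> Obj X. HObj H x y \<in> Obj A) \<and>
     (\<forall>f \<in> Arr X. \<forall>g \<in> Arr X.
        HMor H f g \<in> Hom A (HObj H (Cod X f) (Dom X g)) (HObj H (Dom X f) (Cod X g))) \<and>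
     (\<forall>x \<in> Obj X. \<forall>y \<in> Obj X. \<forall>a \<in> Obj A.
        bij_betw (HAdj H x y a) (Hom A a (HObj H x y)) (Hom X (ao a x) y)) \<and>
     (\<forall>u \<in> Arr A. \<forall>f \<in> Arr X. \<forall>g \<in> Arr X. \<forall>k \<in> Hom A (Cod A u) (HObj H (Cod X f) (Dom X g)).
        HAdj H (Dom X f) (Cod X g) (Dom A u) (HMor H f g \<cdot>\<^bsub>A\<^esub> k \<cdot>\<^bsub>A\<^esub> u)
          = g \<cdot>\<^bsub>X\<^esub> HAdj H (Cod X f) (Dom X g) (Cod A u) k \<cdot>\<^bsub>X\<^esub> am u f)"

definition is_internal_coHom ::
  "('a, 'b, 'z) cat_scheme \<Rightarrow> ('x, 'y, 'w) cat_scheme \<Rightarrow> ('a \<Rightarrow> 'x \<Rightarrow> 'x) \<Rightarrow> ('b \<Rightarrow> 'y \<Rightarrow> 'y)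
    \<Rightarrow> ('a, 'b, 'x, 'y) internal_hom \<Rightarrow> bool"
where
  "is_internal_coHom A X ao am K \<longleftrightarrow>
     (\<forall>x \<in> Obj X. \<forall>y \<in> Obj X. HObj K x y \<in> Obj A) \<and>
     (\<forall>f \<in> Arr X. \<forall>g \<in> Arr X.
        HMor K f g \<in> Hom A (HObj K (Cod X f) (Dom X g)) (HObj K (Dom X f) (Cod X g))) \<and>
     (\<forall>x \<in> Obj X. \<forall>y \<in> Obj X. \<forall>a \<in> Obj A.
        bij_betw (HAdj K x y a) (Hom A (HObj K x y) a) (Hom X y (ao a x))) \<and>
     (\<forall>u \<in> Arr A. \<forall>f \<in> Arr X. \<forall>g \<in> Arr X. \<forall>k \<in> Hom A (HObj K (Dom X f) (Cod X g)) (Dom A u).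
        HAdj K (Cod X f) (Dom X g) (Cod A u) (u \<cdot>\<^bsub>A\<^esub> k \<cdot>\<^bsub>A\<^esub> HMor K f g)
          = am u f \<cdot>\<^bsub>X\<^esub> HAdj K (Dom X f) (Cod X g) (Dom A u) k \<cdot>\<^bsub>X\<^esub> g)"

abbreviation internal_Hom_of ::
  "('k, 'c, 'd, 'z) tensor_cat_scheme \<Rightarrow> ('k, 'c, 'd, 'p, 'q, 'x) module_cat_scheme
    \<Rightarrow> ('c, 'd, 'p, 'q) internal_hom \<Rightarrow> bool"
where
  "internal_Hom_of C N \<equiv> is_internal_Hom C N (ActObj N) (ActMor N)"

abbreviation internal_coHom_of ::
  "('k, 'c, 'd, 'z) tensor_cat_scheme \<Rightarrow> ('k, 'c, 'd, 'p, 'q, 'x) module_cat_scheme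
    \<Rightarrow> ('c, 'd, 'p, 'q) internal_hom \<Rightarrow> bool"
where
  "internal_coHom_of C N \<equiv> is_internal_coHom C N (ActObj N) (ActMor N)"

abbreviation internal_Nat ::
  "('k, 'c, 'd, 'z) tensor_cat_scheme \<Rightarrow> ('k, 'c, 'd, 'o, 'm, 'y) module_cat_scheme
    \<Rightarrow> ('k, 'c, 'd, 'p, 'q, 'x) module_cat_scheme
    \<Rightarrow> (('c, 'd) cobj, ('c, 'd) carr, ('c, 'o, 'm, 'p, 'q) mfunct, ('c, 'o, 'm, 'p, 'q) mtransf)
         internal_hom \<Rightarrow> bool"
where
  "internal_Nat C M N \<equiv>
     is_internal_Hom (center C) (Rex C M N) (center_act_obj C N) (center_act_mor C M N)"

abbreviation internal_coNat ::
  "('k, 'c, 'd, 'z) tensor_cat_scheme \<Rightarrow> ('k, 'c, 'd, 'o, 'm, 'y) module_cat_scheme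
    \<Rightarrow> ('k, 'c, 'd, 'p, 'q, 'x) module_cat_scheme
    \<Rightarrow> (('c, 'd) cobj, ('c, 'd) carr, ('c, 'o, 'm, 'p, 'q) mfunct, ('c, 'o, 'm, 'p, 'q) mtransf)
         internal_hom \<Rightarrow> bool"
where
  "internal_coNat C M N \<equiv>
     is_internal_coHom (center C) (Rex C M N) (center_act_obj C N) (center_act_mor C M N)"


subsection \<open>Compatibility with the action\<close>

text \<open>The canonical isomorphism \<open>HObj (c.n) (c'.n') \<rightarrow> (c' \<otimes> HObj n n') \<otimes> RDual c\<close>:
  the image of the identity under the chain of bijections, for \<open>a = HObj (c.n) (c'.n')\<close>,
  \<open>Hom(a, a) \<cong> Hom(a.(c.n), c'.n') \<cong> Hom(RDual c'.(a.(c.n)), n') \<cong> Hom((RDual c' \<otimes> (a \<otimes> c)).n, n')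
  \<cong> Hom(RDual c' \<otimes> (a \<otimes> c), HObj n n') \<cong> Hom(a \<otimes> c, c' \<otimes> HObj n n')
  \<cong> Hom(a, (c' \<otimes> HObj n n') \<otimes> RDual c)\<close>.\<close>

definition Hom_act_iso ::
  "('k, 'c, 'd, 'z) tensor_cat_scheme \<Rightarrow> ('k, 'c, 'd, 'p, 'q, 'x) module_cat_scheme
    \<Rightarrow> ('c, 'd, 'p, 'q) internal_hom \<Rightarrow> 'c \<Rightarrow> 'p \<Rightarrow> 'c \<Rightarrow> 'p \<Rightarrow> 'd"
where
  "Hom_act_iso C N H c n c' n' =
    (let a = HObj H (c \<rhd>\<^sub>o\<^bsub>N\<^esub> n) (c' \<rhd>\<^sub>o\<^bsub>N\<^esub> n');
         r = RDual C c';
         ac = a \<otimes>\<^sub>o\<^bsub>C\<^esub> c;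
         e0 = HAdj H (c \<rhd>\<^sub>o\<^bsub>N\<^esub> n) (c' \<rhd>\<^sub>o\<^bsub>N\<^esub> n') a (Idn C a);
         e1 = MUnit N n' \<cdot>\<^bsub>N\<^esub> (REv C c' \<rhd>\<^sub>m\<^bsub>N\<^esub> Idn N n') \<cdot>\<^bsub>N\<^esub> inv_arr N (MAssoc N r c' n')
                \<cdot>\<^bsub>N\<^esub> (Idn C r \<rhd>\<^sub>m\<^bsub>N\<^esub> e0);
         e2 = e1 \<cdot>\<^bsub>N\<^esub> (Idn C r \<rhd>\<^sub>m\<^bsub>N\<^esub> MAssoc N a c n) \<cdot>\<^bsub>N\<^esub> MAssoc N r ac n;
         e3 = inv_into (Hom C (r \<otimes>\<^sub>o\<^bsub>C\<^esub> ac) (HObj H n n')) (HAdj H n n' (r \<otimes>\<^sub>o\<^bsub>C\<^esub> ac)) e2;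
         e4 = (Idn C c' \<otimes>\<^sub>m\<^bsub>C\<^esub> e3) \<cdot>\<^bsub>C\<^esub> Assoc C c' r ac \<cdot>\<^bsub>C\<^esub> (RCoev C c' \<otimes>\<^sub>m\<^bsub>C\<^esub> Idn C ac)
                \<cdot>\<^bsub>C\<^esub> inv_arr C (LUnit C ac)
     in (e4 \<otimes>\<^sub>m\<^bsub>C\<^esub> Idn C (RDual C c)) \<cdot>\<^bsub>C\<^esub> inv_arr C (Assoc C a c (RDual C c))
          \<cdot>\<^bsub>C\<^esub> (Idn C a \<otimes>\<^sub>m\<^bsub>C\<^esub> RCoev C c) \<cdot>\<^bsub>C\<^esub> inv_arr C (RUnit C a))"

text \<open>The canonical isomorphism \<open>(c' \<otimes> HObj n n') \<otimes> LDual c \<rightarrow> HObj (c.n) (c'.n')\<close> for coHoms: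
  the image of the identity under the chain of bijections, for \<open>a = HObj (c.n) (c'.n')\<close>,
  \<open>Hom(a, a) \<cong> Hom(c'.n', a.(c.n)) \<cong> Hom(n', LDual c'.(a.(c.n))) \<cong> Hom(n', (LDual c' \<otimes> (a \<otimes> c)).n)
  \<cong> Hom(HObj n n', LDual c' \<otimes> (a \<otimes> c)) \<cong> Hom(c' \<otimes> HObj n n', a \<otimes> c)
  \<cong> Hom((c' \<otimes> HObj n n') \<otimes> LDual c, a)\<close>.\<close>

definition coHom_act_iso ::
  "('k, 'c, 'd, 'z) tensor_cat_scheme \<Rightarrow> ('k, 'c, 'd, 'p, 'q, 'x) module_cat_scheme
    \<Rightarrow> ('c, 'd, 'p, 'q) internal_hom \<Rightarrow> 'c \<Rightarrow> 'p \<Rightarrow> 'c \<Rightarrow> 'p \<Rightarrow> 'd"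
where
  "coHom_act_iso C N K c n c' n' =
    (let a = HObj K (c \<rhd>\<^sub>o\<^bsub>N\<^esub> n) (c' \<rhd>\<^sub>o\<^bsub>N\<^esub> n');
         l = LDual C c';
         ac = a \<otimes>\<^sub>o\<^bsub>C\<^esub> c;
         e0 = HAdj K (c \<rhd>\<^sub>o\<^bsub>N\<^esub> n) (c' \<rhd>\<^sub>o\<^bsub>N\<^esub> n') a (Idn C a);
         e1 = (Idn C l \<rhd>\<^sub>m\<^bsub>N\<^esub> e0) \<cdot>\<^bsub>N\<^esub> MAssoc N l c' n' \<cdot>\<^bsub>N\<^esub> (LCoev C c' \<rhd>\<^sub>m\<^bsub>N\<^esub> Idn N n')
                \<cdot>\<^bsub>N\<^esub> inv_arr N (MUnit N n');
         e2 = inv_arr N (MAssoc N l ac n) \<cdot>\<^bsub>N\<^esub> (Idn C l \<rhd>\<^sub>m\<^bsub>N\<^esub> inv_arr N (MAssoc N a c n)) \<cdot>\<^bsub>N\<^esub> e1;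
         e3 = inv_into (Hom C (HObj K n n') (l \<otimes>\<^sub>o\<^bsub>C\<^esub> ac)) (HAdj K n n' (l \<otimes>\<^sub>o\<^bsub>C\<^esub> ac)) e2;
         e4 = LUnit C ac \<cdot>\<^bsub>C\<^esub> (LEv C c' \<otimes>\<^sub>m\<^bsub>C\<^esub> Idn C ac) \<cdot>\<^bsub>C\<^esub> inv_arr C (Assoc C c' l ac)
                \<cdot>\<^bsub>C\<^esub> (Idn C c' \<otimes>\<^sub>m\<^bsub>C\<^esub> e3)
     in RUnit C a \<cdot>\<^bsub>C\<^esub> (Idn C a \<otimes>\<^sub>m\<^bsub>C\<^esub> LEv C c) \<cdot>\<^bsub>C\<^esub> Assoc C a c (LDual C c)
          \<cdot>\<^bsub>C\<^esub> (e4 \<otimes>\<^sub>m\<^bsub>C\<^esub> Idn C (LDual C c)))"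


section \<open>Ends and coends\<close>

text \<open>For a bifunctor \<open>(To, Tm)\<close> from \<open>M\<^sup>o\<^sup>p \<times> M\<close> to \<open>C\<close>, with
  \<open>Tm f g : To (Cod f) (Dom g) \<rightarrow> To (Dom f) (Cod g)\<close>.\<close>

definition is_wedge ::
  "('o, 'm, 'y) cat_scheme \<Rightarrow> ('c, 'd, 'z) cat_scheme \<Rightarrow> ('o \<Rightarrow> 'o \<Rightarrow> 'c) \<Rightarrow> ('m \<Rightarrow> 'm \<Rightarrow> 'd)
    \<Rightarrow> 'c \<Rightarrow> ('o \<Rightarrow> 'd) \<Rightarrow> bool"
where
  "is_wedge M C To Tm g j \<longleftrightarrow> g \<in> Obj C \<and>
     (\<forall>x \<in> Obj M. j x \<in> Hom C g (To x x)) \<and>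
     (\<forall>f \<in> Arr M. Tm (Idn M (Dom M f)) f \<cdot>\<^bsub>C\<^esub> j (Dom M f) = Tm f (Idn M (Cod M f)) \<cdot>\<^bsub>C\<^esub> j (Cod M f))"

definition is_end ::
  "('o, 'm, 'y) cat_scheme \<Rightarrow> ('c, 'd, 'z) cat_scheme \<Rightarrow> ('o \<Rightarrow> 'o \<Rightarrow> 'c) \<Rightarrow> ('m \<Rightarrow> 'm \<Rightarrow> 'd)
    \<Rightarrow> 'c \<Rightarrow> ('o \<Rightarrow> 'd) \<Rightarrow> bool"
where
  "is_end M C To Tm g j \<longleftrightarrow> is_wedge M C To Tm g j \<and>
     (\<forall>w l. is_wedge M C To Tm w l \<longrightarrow>
        (\<exists>!u. u \<in> Hom C w g \<and> (\<forall>x \<in> Obj M. j x \<cdot>\<^bsub>C\<^esub> u = l x)))"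

definition is_cowedge ::
  "('o, 'm, 'y) cat_scheme \<Rightarrow> ('c, 'd, 'z) cat_scheme \<Rightarrow> ('o \<Rightarrow> 'o \<Rightarrow> 'c) \<Rightarrow> ('m \<Rightarrow> 'm \<Rightarrow> 'd)
    \<Rightarrow> 'c \<Rightarrow> ('o \<Rightarrow> 'd) \<Rightarrow> bool"
where
  "is_cowedge M C To Tm h i \<longleftrightarrow> h \<in> Obj C \<and>
     (\<forall>x \<in> Obj M. i x \<in> Hom C (To x x) h) \<and>
     (\<forall>f \<in> Arr M. i (Dom M f) \<cdot>\<^bsub>C\<^esub> Tm f (Idn M (Dom M f)) = i (Cod M f) \<cdot>\<^bsub>C\<^esub> Tm (Idn M (Cod M f)) f)"

definition is_coend ::
  "('o, 'm, 'y) cat_scheme \<Rightarrow> ('c, 'd, 'z) cat_scheme \<Rightarrow> ('o \<Rightarrow> 'o \<Rightarrow> 'c) \<Rightarrow> ('m \<Rightarrow> 'm \<Rightarrow> 'd)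
    \<Rightarrow> 'c \<Rightarrow> ('o \<Rightarrow> 'd) \<Rightarrow> bool"
where
  "is_coend M C To Tm h i \<longleftrightarrow> is_cowedge M C To Tm h i \<and>
     (\<forall>w l. is_cowedge M C To Tm w l \<longrightarrow>
        (\<exists>!u. u \<in> Hom C h w \<and> (\<forall>x \<in> Obj M. u \<cdot>\<^bsub>C\<^esub> i x = l x)))"

text \<open>The bifunctor \<open>(m, m') \<mapsto> HObj (F m) (G m')\<close>, for \<open>H\<close> the internal Homs or coHoms.\<close>

definition hom_bifun_obj ::
  "('c, 'd, 'p, 'q) internal_hom \<Rightarrow> ('b, 'o, 'm, 'p, 'q) mfunct \<Rightarrow> ('b, 'o, 'm, 'p, 'q) mfunct
    \<Rightarrow> 'o \<Rightarrow> 'o \<Rightarrow> 'c"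
where
  "hom_bifun_obj H F G = (\<lambda>x y. HObj H (FObj F x) (FObj G y))"

definition hom_bifun_mor ::
  "('c, 'd, 'p, 'q) internal_hom \<Rightarrow> ('b, 'o, 'm, 'p, 'q) mfunct \<Rightarrow> ('b, 'o, 'm, 'p, 'q) mfunct
    \<Rightarrow> 'm \<Rightarrow> 'm \<Rightarrow> 'd"
where
  "hom_bifun_mor H F G = (\<lambda>f g. HMor H (FMor F f) (FMor G g))"


subsection \<open>Canonical half-braidings\<close>

definition end_coaction ::
  "('k, 'c, 'd, 'z) tensor_cat_scheme \<Rightarrow> ('k, 'c, 'd, 'o, 'm, 'y) module_cat_scheme
    \<Rightarrow> ('k, 'c, 'd, 'p, 'q, 'x) module_cat_scheme \<Rightarrow> ('c, 'd, 'p, 'q) internal_hom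
    \<Rightarrow> ('c, 'o, 'm, 'p, 'q) mfunct \<Rightarrow> ('c, 'o, 'm, 'p, 'q) mfunct
    \<Rightarrow> 'c \<Rightarrow> ('o \<Rightarrow> 'd) \<Rightarrow> 'c \<Rightarrow> 'd"
where
  "end_coaction C M N H F G g j c =
    (THE d. d \<in> Hom C g ((c \<otimes>\<^sub>o\<^bsub>C\<^esub> g) \<otimes>\<^sub>o\<^bsub>C\<^esub> RDual C c) \<and>
      (\<forall>x \<in> Obj M.
        ((Idn C c \<otimes>\<^sub>m\<^bsub>C\<^esub> j x) \<otimes>\<^sub>m\<^bsub>C\<^esub> Idn C (RDual C c)) \<cdot>\<^bsub>C\<^esub> d
          = Hom_act_iso C N H c (FObj F x) c (FObj G x)
              \<cdot>\<^bsub>C\<^esub> HMor H (inv_arr N (FCon F c x)) (FCon G c x) \<cdot>\<^bsub>C\<^esub> j (c \<rhd>\<^sub>o\<^bsub>M\<^esub> x)))"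

definition end_half_braiding ::
  "('k, 'c, 'd, 'z) tensor_cat_scheme \<Rightarrow> ('k, 'c, 'd, 'o, 'm, 'y) module_cat_scheme
    \<Rightarrow> ('k, 'c, 'd, 'p, 'q, 'x) module_cat_scheme \<Rightarrow> ('c, 'd, 'p, 'q) internal_hom
    \<Rightarrow> ('c, 'o, 'm, 'p, 'q) mfunct \<Rightarrow> ('c, 'o, 'm, 'p, 'q) mfunct
    \<Rightarrow> 'c \<Rightarrow> ('o \<Rightarrow> 'd) \<Rightarrow> 'c \<Rightarrow> 'd"
where
  "end_half_braiding C M N H F G g j c =
     inv_arr C (RUnit C (c \<otimes>\<^sub>o\<^bsub>C\<^esub> g)
       \<cdot>\<^bsub>C\<^esub> (Idn C (c \<otimes>\<^sub>o\<^bsub>C\<^esub> g) \<otimes>\<^sub>m\<^bsub>C\<^esub> REv C c)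
       \<cdot>\<^bsub>C\<^esub> Assoc C (c \<otimes>\<^sub>o\<^bsub>C\<^esub> g) (RDual C c) c
       \<cdot>\<^bsub>C\<^esub> (end_coaction C M N H F G g j c \<otimes>\<^sub>m\<^bsub>C\<^esub> Idn C c))"

definition coend_action ::
  "('k, 'c, 'd, 'z) tensor_cat_scheme \<Rightarrow> ('k, 'c, 'd, 'o, 'm, 'y) module_cat_scheme
    \<Rightarrow> ('k, 'c, 'd, 'p, 'q, 'x) module_cat_scheme \<Rightarrow> ('c, 'd, 'p, 'q) internal_hom
    \<Rightarrow> ('c, 'o, 'm, 'p, 'q) mfunct \<Rightarrow> ('c, 'o, 'm, 'p, 'q) mfunct
    \<Rightarrow> 'c \<Rightarrow> ('o \<Rightarrow> 'd) \<Rightarrow> 'c \<Rightarrow> 'd"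
where
  "coend_action C M N K F G h i c =
    (THE r. r \<in> Hom C ((c \<otimes>\<^sub>o\<^bsub>C\<^esub> h) \<otimes>\<^sub>o\<^bsub>C\<^esub> LDual C c) h \<and>
      (\<forall>x \<in> Obj M.
        r \<cdot>\<^bsub>C\<^esub> ((Idn C c \<otimes>\<^sub>m\<^bsub>C\<^esub> i x) \<otimes>\<^sub>m\<^bsub>C\<^esub> Idn C (LDual C c))
          = i (c \<rhd>\<^sub>o\<^bsub>M\<^esub> x) \<cdot>\<^bsub>C\<^esub> HMor K (FCon F c x) (inv_arr N (FCon G c x))
              \<cdot>\<^bsub>C\<^esub> coHom_act_iso C N K c (FObj F x) c (FObj G x)))"

definition coend_half_braiding ::
  "('k, 'c, 'd, 'z) tensor_cat_scheme \<Rightarrow> ('k, 'c, 'd, 'o, 'm, 'y) module_cat_scheme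
    \<Rightarrow> ('k, 'c, 'd, 'p, 'q, 'x) module_cat_scheme \<Rightarrow> ('c, 'd, 'p, 'q) internal_hom
    \<Rightarrow> ('c, 'o, 'm, 'p, 'q) mfunct \<Rightarrow> ('c, 'o, 'm, 'p, 'q) mfunct
    \<Rightarrow> 'c \<Rightarrow> ('o \<Rightarrow> 'd) \<Rightarrow> 'c \<Rightarrow> 'd"
where
  "coend_half_braiding C M N K F G h i c =
     (coend_action C M N K F G h i c \<otimes>\<^sub>m\<^bsub>C\<^esub> Idn C c)
       \<cdot>\<^bsub>C\<^esub> inv_arr C (Assoc C (c \<otimes>\<^sub>o\<^bsub>C\<^esub> h) (LDual C c) c)
       \<cdot>\<^bsub>C\<^esub> (Idn C (c \<otimes>\<^sub>o\<^bsub>C\<^esub> h) \<otimes>\<^sub>m\<^bsub>C\<^esub> LCoev C c)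
       \<cdot>\<^bsub>C\<^esub> inv_arr C (RUnit C (c \<otimes>\<^sub>o\<^bsub>C\<^esub> h))"

end

theory Submission
  imports Defs "Jordan_Normal_Form.Determinant"
begin

text \<open>The end and the internal natural transformations have the same universal property. A morphism
  \<open>a \<rightarrow> Hom (F m) (G m)\<close> amounts to a morphism \<open>a.F m \<rightarrow> G m\<close>, so an end of the internal Homs is an
  object \<open>g\<close> with a universal natural family \<open>\<epsilon>\<^sub>m : g.F m \<rightarrow> G m\<close>. Because \<open>c\<close> has duals, \<open>c.\<epsilon>\<close> is universal
  among the families with values in \<open>c.G\<close>; comparing it with \<open>\<epsilon>\<close> at \<open>c.m\<close> along the module constraints
  gives the canonical half-braiding \<open>\<sigma>\<close>, which is invertible by duality, and a morphism \<open>a \<rightarrow> g\<close> respects the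
  half-braidings iff the corresponding family \<open>a.F m \<rightarrow> G m\<close> respects the module constraints. Hence
  \<open>(g, \<sigma>)\<close> with \<open>\<epsilon>\<close> is a universal element for the action of the center on module functors, and
  universal elements are unique up to a unique isomorphism. Part (ii) is part (i) in the opposite
  categories.

  For the existence of all these objects, \<open>E a = Nat(a.F, G)\<close> takes cokernels to kernels. Its values
  are finite-dimensional, since \<open>F\<close> is right exact and so a natural transformation is determined by its
  component at the object that corresponds to the regular module. Such a functor on modules over a
  finite-dimensional algebra \<open>A\<close> is representable: every \<open>e \<in> E V\<close> descends to a quotient \<open>W\<close> of \<open>V\<close> on
  which no nonzero vector, viewed as a map \<open>A \<rightarrow> W\<close>, kills it. The dimension of such a \<open>W\<close> is at most that of \<open>E A\<close>,
  and a \<open>W\<close> of maximal dimension represents \<open>E\<close>, as one sees by descending a pair of elements from a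
  biproduct.\<close>

section \<open>Categories\<close>

text \<open>Two obstacles shape the development. Associators and unitors are explicit, so a
  construction is only ever given up to coherence. The remedy is to let \<open>C\<close> act on
  itself: coherence and adjunction statements are proved once for module categories and hold for
  tensor products as a special case, and arrows into \<open>c \<otimes> g\<close> are compared
  through the families that they classify. The second obstacle is that part (ii) is to follow by
  reversing arrows, although right exactness, the center and \<open>Rex\<close> are not self-dual.
  The algebra is therefore done in locales whose axioms are stable under reversal, and exactness
  enters later, for the existence of universal families and for the action on \<open>Rex\<close>.
  Exactness of the action in the first variable contributes both of its halves: preservation of
  cokernels gives the end, preservation of kernels the coend. The half-braiding first appears as an
  arrow \<open>g \<otimes> c -> c \<otimes> g\<close>, the direction in which universality produces
  it and in which it enters the constraints of the center action; its inverse is taken afterwards.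
  Over the opposite categories the same arrow already points in the direction of the half-braiding
  of the coend.\<close>

context category
begin

lemma Hom_iff: "f \<in> Hom C x y \<longleftrightarrow> f \<in> Arr C \<and> Dom C f = x \<and> Cod C f = y"
  by (simp add: Hom_def)

lemma Dom_Obj [simp]: "f \<in> Arr C \<Longrightarrow> Dom C f \<in> Obj C"
  and Cod_Obj [simp]: "f \<in> Arr C \<Longrightarrow> Cod C f \<in> Obj C"
  by (simp_all add: Dom_in_Obj Cod_in_Obj)

lemma Idn_simps [simp]:
  assumes "x \<in> Obj C"
  shows "Idn C x \<in> Arr C" "Dom C (Idn C x) = x" "Cod C (Idn C x) = x"
  using Idn_in_Hom[OF assms] by (simp_all add: Hom_def)

lemma Comp_simps [simp]:
  assumes "f \<in> Arr C" "g \<in> Arr C" "Dom C g = Cod C f"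
  shows "g \<cdot>\<^bsub>C\<^esub> f \<in> Arr C" "Dom C (g \<cdot>\<^bsub>C\<^esub> f) = Dom C f" "Cod C (g \<cdot>\<^bsub>C\<^esub> f) = Cod C g"
  using Comp_in_Hom[of f "Dom C f" "Cod C f" g "Cod C g"] assms by (simp_all add: Hom_def)

lemma assoc [simp]:
  assumes "f \<in> Arr C" "g \<in> Arr C" "h \<in> Arr C" "Dom C g = Cod C f" "Dom C h = Cod C g"
  shows "(h \<cdot>\<^bsub>C\<^esub> g) \<cdot>\<^bsub>C\<^esub> f = h \<cdot>\<^bsub>C\<^esub> g \<cdot>\<^bsub>C\<^esub> f"
  using Comp_assoc[of f "Dom C f" "Cod C f" g "Cod C g" h "Cod C h"] assms by (simp add: Hom_def)

lemma Idn_left [simp]: "f \<in> Arr C \<Longrightarrow> Cod C f = y \<Longrightarrow> Idn C y \<cdot>\<^bsub>C\<^esub> f = f"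
  and Idn_right [simp]: "f \<in> Arr C \<Longrightarrow> Dom C f = x \<Longrightarrow> f \<cdot>\<^bsub>C\<^esub> Idn C x = f"
  using Comp_Idn_left[of f "Dom C f" y] Comp_Idn_right[of f x "Cod C f"] by (simp_all add: Hom_def)

text \<open>Composites are kept right-nested, so an equation between composites is
  applied inside a longer composite through this rule.\<close>

lemma prefix:
  assumes "g \<cdot>\<^bsub>C\<^esub> f = w" "f \<in> Arr C" "g \<in> Arr C" "Dom C g = Cod C f" "t \<in> Arr C" "Cod C t = Dom C f"
  shows "g \<cdot>\<^bsub>C\<^esub> f \<cdot>\<^bsub>C\<^esub> t = w \<cdot>\<^bsub>C\<^esub> t"
  using assms assoc[of t f g] by simp

lemma inverse_arrows_unique:
  assumes "inverse_arrows C f g" "inverse_arrows C f h"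
  shows "g = h"
proof -
  have "g = (h \<cdot>\<^bsub>C\<^esub> f) \<cdot>\<^bsub>C\<^esub> g"
    using assms by (auto simp: inverse_arrows_def Hom_def)
  also have "\<dots> = h \<cdot>\<^bsub>C\<^esub> f \<cdot>\<^bsub>C\<^esub> g"
    using assms by (intro assoc) (auto simp: inverse_arrows_def Hom_def)
  also have "\<dots> = h"
    using assms by (auto simp: inverse_arrows_def Hom_def)
  finally show ?thesis .
qed

lemma inv_arrI:
  assumes "inverse_arrows C f g"
  shows "iso_arr C f" "inv_arr C f = g"
  using assms inverse_arrows_unique unfolding iso_arr_def inv_arr_def by blast+

lemma inverse_arrows_inv_arr: "iso_arr C f \<Longrightarrow> inverse_arrows C f (inv_arr C f)"
  using inv_arrI(2) unfolding iso_arr_def by metis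

lemma iso_Arr: "iso_arr C f \<Longrightarrow> f \<in> Arr C"
  by (auto simp: iso_arr_def inverse_arrows_def)

lemma inv_simps [simp]:
  assumes "iso_arr C f"
  shows "inv_arr C f \<in> Arr C" "Dom C (inv_arr C f) = Cod C f" "Cod C (inv_arr C f) = Dom C f"
    "inv_arr C f \<cdot>\<^bsub>C\<^esub> f = Idn C (Dom C f)" "f \<cdot>\<^bsub>C\<^esub> inv_arr C f = Idn C (Cod C f)"
  using inverse_arrows_inv_arr[OF assms] by (auto simp: inverse_arrows_def Hom_def)

lemma inverse_arrows_sym: "inverse_arrows C f g \<Longrightarrow> inverse_arrows C g f"
  by (auto simp: inverse_arrows_def Hom_def)

lemma iso_inv [simp]: "iso_arr C f \<Longrightarrow> iso_arr C (inv_arr C f)"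
  and inv_inv [simp]: "iso_arr C f \<Longrightarrow> inv_arr C (inv_arr C f) = f"
  using inv_arrI inverse_arrows_inv_arr inverse_arrows_sym by blast+

lemma inv_cancel [simp]:
  assumes "iso_arr C f" "t \<in> Arr C"
  shows "Cod C t = Dom C f \<Longrightarrow> inv_arr C f \<cdot>\<^bsub>C\<^esub> f \<cdot>\<^bsub>C\<^esub> t = t"
    "Cod C t = Cod C f \<Longrightarrow> f \<cdot>\<^bsub>C\<^esub> inv_arr C f \<cdot>\<^bsub>C\<^esub> t = t"
  using assms iso_Arr by (simp_all add: prefix[OF inv_simps(4)] prefix[OF inv_simps(5)])

lemma inverse_arrowsI:
  assumes "f \<in> Arr C" "g \<in> Arr C" "Dom C g = Cod C f" "Cod C g = Dom C f"
    "g \<cdot>\<^bsub>C\<^esub> f = Idn C (Dom C f)" "f \<cdot>\<^bsub>C\<^esub> g = Idn C (Cod C f)"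
  shows "inverse_arrows C f g"
  using assms by (simp add: inverse_arrows_def Hom_def)

lemma iso_Idn [simp]: "x \<in> Obj C \<Longrightarrow> iso_arr C (Idn C x)"
  using inv_arrI[of "Idn C x" "Idn C x"] by (simp add: inverse_arrowsI)

lemma iso_Comp:
  assumes "iso_arr C f" "iso_arr C g" "Dom C g = Cod C f"
  shows "iso_arr C (g \<cdot>\<^bsub>C\<^esub> f)" "inv_arr C (g \<cdot>\<^bsub>C\<^esub> f) = inv_arr C f \<cdot>\<^bsub>C\<^esub> inv_arr C g"
proof -
  have "inverse_arrows C (g \<cdot>\<^bsub>C\<^esub> f) (inv_arr C f \<cdot>\<^bsub>C\<^esub> inv_arr C g)"
    using assms iso_Arr[OF assms(1)] iso_Arr[OF assms(2)] by (intro inverse_arrowsI) simp_all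
  then show "iso_arr C (g \<cdot>\<^bsub>C\<^esub> f)" "inv_arr C (g \<cdot>\<^bsub>C\<^esub> f) = inv_arr C f \<cdot>\<^bsub>C\<^esub> inv_arr C g"
    by (simp_all add: inv_arrI)
qed

lemma iso_cancel_left:
  assumes "iso_arr C f" "f \<cdot>\<^bsub>C\<^esub> u = f \<cdot>\<^bsub>C\<^esub> v" "u \<in> Arr C" "v \<in> Arr C" "Cod C u = Dom C f" "Cod C v = Dom C f"
  shows "u = v"
proof -
  have "inv_arr C f \<cdot>\<^bsub>C\<^esub> f \<cdot>\<^bsub>C\<^esub> u = u" "inv_arr C f \<cdot>\<^bsub>C\<^esub> f \<cdot>\<^bsub>C\<^esub> v = v"
    using assms(1,3-6) by simp_all
  then show ?thesis
    by (metis assms(2))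
qed

lemma iso_cancel_right:
  assumes "iso_arr C f" "u \<cdot>\<^bsub>C\<^esub> f = v \<cdot>\<^bsub>C\<^esub> f" "u \<in> Arr C" "v \<in> Arr C" "Dom C u = Cod C f" "Dom C v = Cod C f"
  shows "u = v"
proof -
  have "(u \<cdot>\<^bsub>C\<^esub> f) \<cdot>\<^bsub>C\<^esub> inv_arr C f = u" "(v \<cdot>\<^bsub>C\<^esub> f) \<cdot>\<^bsub>C\<^esub> inv_arr C f = v"
    using assms(1,3-6) iso_Arr[OF assms(1)] by simp_all
  then show ?thesis
    by (metis assms(2))
qed

text \<open>A commuting square read with two of its sides inverted; naturality of the inverse of a
  natural isomorphism is obtained from it throughout.\<close>

lemma square_inv:
  assumes "m' \<cdot>\<^bsub>C\<^esub> f = g \<cdot>\<^bsub>C\<^esub> m" "iso_arr C m" "iso_arr C m'" "f \<in> Arr C" "g \<in> Arr C"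
    "Dom C f = Dom C m" "Cod C f = Dom C m'" "Dom C g = Cod C m" "Cod C g = Cod C m'"
  shows "f \<cdot>\<^bsub>C\<^esub> inv_arr C m = inv_arr C m' \<cdot>\<^bsub>C\<^esub> g"
proof -
  have "f \<cdot>\<^bsub>C\<^esub> inv_arr C m = inv_arr C m' \<cdot>\<^bsub>C\<^esub> (m' \<cdot>\<^bsub>C\<^esub> f) \<cdot>\<^bsub>C\<^esub> inv_arr C m"
    using assms(2-9) iso_Arr[OF assms(2)] iso_Arr[OF assms(3)] by simp
  also have "\<dots> = inv_arr C m' \<cdot>\<^bsub>C\<^esub> g"
    using assms(2-9) iso_Arr[OF assms(2)] iso_Arr[OF assms(3)] unfolding assms(1) by simp
  finally show ?thesis .
qed

lemma move_inv_left:
  assumes "iso_arr C f" "f \<cdot>\<^bsub>C\<^esub> u = v" "u \<in> Arr C" "Cod C u = Dom C f"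
  shows "u = inv_arr C f \<cdot>\<^bsub>C\<^esub> v"
  using assms by auto

end

section \<open>Module categories\<close>

text \<open>The purely algebraic part of a module category. These axioms hold for \<open>C\<close>
  acting on itself (\<open>module_category_regmod\<close>) and survive the reversal of arrows
  (\<open>module_op\<close>), so everything proved here is available in all these cases.\<close>

locale module_category = C: monoidal_linear_category C + N: linear_category N
  for C :: "('k::field, 'c, 'd, 'z) tensor_cat_scheme"
    and N :: "('k, 'c, 'd, 'p, 'q, 'x) module_cat_scheme" +
  assumes ActObj_in_Obj: "\<lbrakk>c \<in> Obj C; x \<in> Obj N\<rbrakk> \<Longrightarrow> c \<rhd>\<^sub>o\<^bsub>N\<^esub> x \<in> Obj N"
    and ActMor_in_Hom: "\<lbrakk>f \<in> Hom C c c'; g \<in> Hom N x x'\<rbrakk>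
      \<Longrightarrow> f \<rhd>\<^sub>m\<^bsub>N\<^esub> g \<in> Hom N (c \<rhd>\<^sub>o\<^bsub>N\<^esub> x) (c' \<rhd>\<^sub>o\<^bsub>N\<^esub> x')"
    and ActMor_Idn: "\<lbrakk>c \<in> Obj C; x \<in> Obj N\<rbrakk>
      \<Longrightarrow> Idn C c \<rhd>\<^sub>m\<^bsub>N\<^esub> Idn N x = Idn N (c \<rhd>\<^sub>o\<^bsub>N\<^esub> x)"
    and ActMor_Comp: "\<lbrakk>f \<in> Hom C c c'; f' \<in> Hom C c' c''; g \<in> Hom N x x'; g' \<in> Hom N x' x''\<rbrakk>
      \<Longrightarrow> (f' \<cdot>\<^bsub>C\<^esub> f) \<rhd>\<^sub>m\<^bsub>N\<^esub> (g' \<cdot>\<^bsub>N\<^esub> g) = (f' \<rhd>\<^sub>m\<^bsub>N\<^esub> g') \<cdot>\<^bsub>N\<^esub> (f \<rhd>\<^sub>m\<^bsub>N\<^esub> g)"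
    and ActMor_Add_left: "\<lbrakk>f \<in> Hom C c c'; f' \<in> Hom C c c'; g \<in> Hom N x x'\<rbrakk>
      \<Longrightarrow> Add C f f' \<rhd>\<^sub>m\<^bsub>N\<^esub> g = Add N (f \<rhd>\<^sub>m\<^bsub>N\<^esub> g) (f' \<rhd>\<^sub>m\<^bsub>N\<^esub> g)"
    and ActMor_Scale_left: "\<lbrakk>f \<in> Hom C c c'; g \<in> Hom N x x'\<rbrakk>
      \<Longrightarrow> Scale C k f \<rhd>\<^sub>m\<^bsub>N\<^esub> g = Scale N k (f \<rhd>\<^sub>m\<^bsub>N\<^esub> g)"
    and MAssoc_in_Hom: "\<lbrakk>c \<in> Obj C; d \<in> Obj C; x \<in> Obj N\<rbrakk>
      \<Longrightarrow> MAssoc N c d x \<in> Hom N ((c \<otimes>\<^sub>o\<^bsub>C\<^esub> d) \<rhd>\<^sub>o\<^bsub>N\<^esub> x) (c \<rhd>\<^sub>o\<^bsub>N\<^esub> (d \<rhd>\<^sub>o\<^bsub>N\<^esub> x))"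
    and MAssoc_iso: "\<lbrakk>c \<in> Obj C; d \<in> Obj C; x \<in> Obj N\<rbrakk> \<Longrightarrow> iso_arr N (MAssoc N c d x)"
    and MAssoc_natural: "\<lbrakk>f \<in> Hom C c c'; f' \<in> Hom C d d'; h \<in> Hom N x x'\<rbrakk>
      \<Longrightarrow> MAssoc N c' d' x' \<cdot>\<^bsub>N\<^esub> ((f \<otimes>\<^sub>m\<^bsub>C\<^esub> f') \<rhd>\<^sub>m\<^bsub>N\<^esub> h)
          = (f \<rhd>\<^sub>m\<^bsub>N\<^esub> (f' \<rhd>\<^sub>m\<^bsub>N\<^esub> h)) \<cdot>\<^bsub>N\<^esub> MAssoc N c d x"
    and MUnit_in_Hom: "x \<in> Obj N \<Longrightarrow> MUnit N x \<in> Hom N (Unit C \<rhd>\<^sub>o\<^bsub>N\<^esub> x) x"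
    and MUnit_iso: "x \<in> Obj N \<Longrightarrow> iso_arr N (MUnit N x)"
    and MUnit_natural: "h \<in> Hom N x x'
      \<Longrightarrow> MUnit N x' \<cdot>\<^bsub>N\<^esub> (Idn C (Unit C) \<rhd>\<^sub>m\<^bsub>N\<^esub> h) = h \<cdot>\<^bsub>N\<^esub> MUnit N x"
    and module_pentagon: "\<lbrakk>b \<in> Obj C; c \<in> Obj C; d \<in> Obj C; x \<in> Obj N\<rbrakk>
      \<Longrightarrow> (Idn C b \<rhd>\<^sub>m\<^bsub>N\<^esub> MAssoc N c d x) \<cdot>\<^bsub>N\<^esub> MAssoc N b (c \<otimes>\<^sub>o\<^bsub>C\<^esub> d) x
            \<cdot>\<^bsub>N\<^esub> (Assoc C b c d \<rhd>\<^sub>m\<^bsub>N\<^esub> Idn N x)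
          = MAssoc N b c (d \<rhd>\<^sub>o\<^bsub>N\<^esub> x) \<cdot>\<^bsub>N\<^esub> MAssoc N (b \<otimes>\<^sub>o\<^bsub>C\<^esub> c) d x"
    and module_triangle: "\<lbrakk>c \<in> Obj C; x \<in> Obj N\<rbrakk>
      \<Longrightarrow> (Idn C c \<rhd>\<^sub>m\<^bsub>N\<^esub> MUnit N x) \<cdot>\<^bsub>N\<^esub> MAssoc N c (Unit C) x
          = RUnit C c \<rhd>\<^sub>m\<^bsub>N\<^esub> Idn N x"
begin

abbreviation ncomp (infixr "\<diamondop>" 75) where "f \<diamondop> g \<equiv> f \<cdot>\<^bsub>N\<^esub> g"
abbreviation nact (infixr "\<star>" 80) where "c \<star> x \<equiv> c \<rhd>\<^sub>o\<^bsub>N\<^esub> x"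

text \<open>Whiskering on either side. The action in two variables is split into these functors of
  one variable, so that composites have a normal form under rewriting; \<open>ActMor_lw_rw\<close>
  and \<open>interchange\<close> put them together again.\<close>

definition lw (infixr "\<triangleright>" 80) where "c \<triangleright> f = Idn C c \<rhd>\<^sub>m\<^bsub>N\<^esub> f"
definition rw (infixr "\<triangleleft>" 80) where "u \<triangleleft> x = u \<rhd>\<^sub>m\<^bsub>N\<^esub> Idn N x"

lemma Act_Obj [simp]: "c \<in> Obj C \<Longrightarrow> x \<in> Obj N \<Longrightarrow> c \<star> x \<in> Obj N"
  by (rule ActObj_in_Obj)

lemma ActMor_simps [simp]:
  assumes "f \<in> Arr C" "g \<in> Arr N"
  shows "f \<rhd>\<^sub>m\<^bsub>N\<^esub> g \<in> Arr N" "Dom N (f \<rhd>\<^sub>m\<^bsub>N\<^esub> g) = Dom C f \<star> Dom N g"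
    "Cod N (f \<rhd>\<^sub>m\<^bsub>N\<^esub> g) = Cod C f \<star> Cod N g"
  using ActMor_in_Hom[of f "Dom C f" "Cod C f" g "Dom N g" "Cod N g"] assms by (simp_all add: Hom_def)

lemma ActMor_Comp':
  assumes "f \<in> Arr C" "f' \<in> Arr C" "g \<in> Arr N" "g' \<in> Arr N" "Dom C f' = Cod C f" "Dom N g' = Cod N g"
  shows "(f' \<cdot>\<^bsub>C\<^esub> f) \<rhd>\<^sub>m\<^bsub>N\<^esub> (g' \<diamondop> g) = (f' \<rhd>\<^sub>m\<^bsub>N\<^esub> g') \<diamondop> (f \<rhd>\<^sub>m\<^bsub>N\<^esub> g)"
  using ActMor_Comp[of f "Dom C f" "Cod C f" f' "Cod C f'" g "Dom N g" "Cod N g" g' "Cod N g'"] assms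
  by (simp add: Hom_def)

lemma lw_simps [simp]:
  assumes "c \<in> Obj C" "f \<in> Arr N"
  shows "c \<triangleright> f \<in> Arr N" "Dom N (c \<triangleright> f) = c \<star> Dom N f" "Cod N (c \<triangleright> f) = c \<star> Cod N f"
  using assms by (simp_all add: lw_def)

lemma rw_simps [simp]:
  assumes "u \<in> Arr C" "x \<in> Obj N"
  shows "u \<triangleleft> x \<in> Arr N" "Dom N (u \<triangleleft> x) = Dom C u \<star> x" "Cod N (u \<triangleleft> x) = Cod C u \<star> x"
  using assms by (simp_all add: rw_def)

lemma lw_Idn [simp]: "c \<in> Obj C \<Longrightarrow> x \<in> Obj N \<Longrightarrow> c \<triangleright> Idn N x = Idn N (c \<star> x)"
  and rw_Idn [simp]: "c \<in> Obj C \<Longrightarrow> x \<in> Obj N \<Longrightarrow> Idn C c \<triangleleft> x = Idn N (c \<star> x)"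
  by (simp_all add: lw_def rw_def ActMor_Idn)

lemma lw_Comp:
  assumes "c \<in> Obj C" "f \<in> Arr N" "g \<in> Arr N" "Dom N g = Cod N f"
  shows "c \<triangleright> (g \<diamondop> f) = (c \<triangleright> g) \<diamondop> (c \<triangleright> f)"
  using ActMor_Comp'[of "Idn C c" "Idn C c" f g] assms by (simp add: lw_def)

lemma rw_Comp:
  assumes "x \<in> Obj N" "u \<in> Arr C" "v \<in> Arr C" "Dom C v = Cod C u"
  shows "(v \<cdot>\<^bsub>C\<^esub> u) \<triangleleft> x = (v \<triangleleft> x) \<diamondop> (u \<triangleleft> x)"
  using ActMor_Comp'[of u v "Idn N x" "Idn N x"] assms by (simp add: rw_def)

lemma ActMor_lw_rw:
  assumes "u \<in> Arr C" "f \<in> Arr N"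
  shows "u \<rhd>\<^sub>m\<^bsub>N\<^esub> f = (Cod C u \<triangleright> f) \<diamondop> (u \<triangleleft> Dom N f)"
  using ActMor_Comp'[of u "Idn C (Cod C u)" "Idn N (Dom N f)" f] assms by (simp add: lw_def rw_def)

lemma interchange:
  assumes "u \<in> Arr C" "f \<in> Arr N" "Dom C u = a" "Cod C u = b" "Dom N f = x" "Cod N f = y"
  shows "(b \<triangleright> f) \<diamondop> (u \<triangleleft> x) = (u \<triangleleft> y) \<diamondop> (a \<triangleright> f)"
proof -
  have "(Cod C u \<triangleright> f) \<diamondop> (u \<triangleleft> Dom N f) = (u \<triangleleft> Cod N f) \<diamondop> (Dom C u \<triangleright> f)"
    using ActMor_Comp'[of u "Idn C (Cod C u)" "Idn N (Dom N f)" f]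
      ActMor_Comp'[of "Idn C (Dom C u)" u f "Idn N (Cod N f)"] assms(1,2) by (simp add: lw_def rw_def)
  then show ?thesis
    by (simp only: assms(3-6))
qed

lemma iso_lw [simp]: "iso_arr N (c \<triangleright> f)" "inv_arr N (c \<triangleright> f) = c \<triangleright> inv_arr N f"
  if "c \<in> Obj C" "iso_arr N f"
proof -
  have "inverse_arrows N (c \<triangleright> f) (c \<triangleright> inv_arr N f)"
    using that N.iso_Arr[OF that(2)] by (intro N.inverse_arrowsI) (simp_all flip: lw_Comp)
  then show "iso_arr N (c \<triangleright> f)" "inv_arr N (c \<triangleright> f) = c \<triangleright> inv_arr N f"
    by (simp_all add: N.inv_arrI)
qed

lemma iso_rw [simp]: "iso_arr N (u \<triangleleft> x)" "inv_arr N (u \<triangleleft> x) = inv_arr C u \<triangleleft> x"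
  if "x \<in> Obj N" "iso_arr C u"
proof -
  have "inverse_arrows N (u \<triangleleft> x) (inv_arr C u \<triangleleft> x)"
    using that C.iso_Arr[OF that(2)] by (intro N.inverse_arrowsI) (simp_all flip: rw_Comp)
  then show "iso_arr N (u \<triangleleft> x)" "inv_arr N (u \<triangleleft> x) = inv_arr C u \<triangleleft> x"
    by (simp_all add: N.inv_arrI)
qed

lemma MAssoc_simps [simp]:
  assumes "c \<in> Obj C" "d \<in> Obj C" "x \<in> Obj N"
  shows "MAssoc N c d x \<in> Arr N" "Dom N (MAssoc N c d x) = (c \<otimes>\<^sub>o\<^bsub>C\<^esub> d) \<star> x"
    "Cod N (MAssoc N c d x) = c \<star> d \<star> x" "iso_arr N (MAssoc N c d x)"
  using MAssoc_in_Hom[OF assms] MAssoc_iso[OF assms] by (simp_all add: Hom_def)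

lemma MUnit_simps [simp]:
  assumes "x \<in> Obj N"
  shows "MUnit N x \<in> Arr N" "Dom N (MUnit N x) = Unit C \<star> x"
    "Cod N (MUnit N x) = x" "iso_arr N (MUnit N x)"
  using MUnit_in_Hom[OF assms] MUnit_iso[OF assms] by (simp_all add: Hom_def)

lemma TObj_simp [simp]: "a \<in> Obj C \<Longrightarrow> b \<in> Obj C \<Longrightarrow> a \<otimes>\<^sub>o\<^bsub>C\<^esub> b \<in> Obj C"
  and Unit_simp [simp]: "Unit C \<in> Obj C"
  by (simp_all add: C.TObj_in_Obj C.Unit_in_Obj)

lemma pent:
  assumes "b \<in> Obj C" "c \<in> Obj C" "d \<in> Obj C" "x \<in> Obj N"
  shows "(b \<triangleright> MAssoc N c d x) \<diamondop> MAssoc N b (c \<otimes>\<^sub>o\<^bsub>C\<^esub> d) x \<diamondop> (Assoc C b c d \<triangleleft> x)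
          = MAssoc N b c (d \<star> x) \<diamondop> MAssoc N (b \<otimes>\<^sub>o\<^bsub>C\<^esub> c) d x"
  using module_pentagon[OF assms] by (simp add: lw_def rw_def)

lemma tri: "\<lbrakk>c \<in> Obj C; x \<in> Obj N\<rbrakk> \<Longrightarrow> (c \<triangleright> MUnit N x) \<diamondop> MAssoc N c (Unit C) x = RUnit C c \<triangleleft> x"
  using module_triangle by (simp add: lw_def rw_def)

lemma MUnit_nat: "h \<in> Arr N \<Longrightarrow> MUnit N (Cod N h) \<diamondop> (Unit C \<triangleright> h) = h \<diamondop> MUnit N (Dom N h)"
  using MUnit_natural[of h "Dom N h" "Cod N h"] by (simp add: lw_def Hom_def)

end

section \<open>The regular module category and the coherence of units\<close>

definition regmod :: "('k, 'c, 'd, 'z) tensor_cat_scheme \<Rightarrow> ('k, 'c, 'd, 'c, 'd) module_cat" where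
  "regmod C = \<lparr>Obj = Obj C, Arr = Arr C, Dom = Dom C, Cod = Cod C, Idn = Idn C, Comp = Comp C,
     Zero = Zero C, Add = Add C, Scale = Scale C, ActObj = TObj C, ActMor = TMor C,
     MAssoc = Assoc C, MUnit = LUnit C\<rparr>"

lemma regmod_simps [simp]:
  "Obj (regmod C) = Obj C" "Arr (regmod C) = Arr C" "Dom (regmod C) = Dom C" "Cod (regmod C) = Cod C"
  "Idn (regmod C) = Idn C" "Comp (regmod C) = Comp C" "Zero (regmod C) = Zero C"
  "Add (regmod C) = Add C" "Scale (regmod C) = Scale C" "ActObj (regmod C) = TObj C"
  "ActMor (regmod C) = TMor C" "MAssoc (regmod C) = Assoc C" "MUnit (regmod C) = LUnit C"
  by (simp_all add: regmod_def)

lemma regmod_arrows [simp]: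
  "Hom (regmod C) = Hom C" "inverse_arrows (regmod C) = inverse_arrows C"
  "iso_arr (regmod C) = iso_arr C" "inv_arr (regmod C) = inv_arr C"
  by (intro ext; simp add: Hom_def inverse_arrows_def iso_arr_def inv_arr_def)+

lemma (in monoidal_linear_category) module_category_regmod: "module_category C (regmod C)"
proof -
  have "category (regmod C)"
    using category_axioms unfolding category_def by simp
  moreover have "linear_category_axioms (regmod C)"
    using linear_category_axioms unfolding linear_category_def linear_category_axioms_def by simp
  moreover have "module_category_axioms C (regmod C)"
    unfolding module_category_axioms_def regmod_simps regmod_arrows
    using monoidal_linear_category_axioms unfolding monoidal_linear_category_def monoidal_linear_category_axioms_def
    by meson
  ultimately show ?thesis
    by (simp add: module_category_def monoidal_linear_category_axioms linear_category_def)
qed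

text \<open>\<open>C\<close> acts on itself by the tensor product, with the left unitor as unit
  constraint. The rewrites phrase all facts of \<open>reg\<close> in terms of \<open>C\<close>, so
  that a lemma on actions becomes one on tensor products.\<close>

sublocale monoidal_linear_category \<subseteq> reg: module_category C "regmod C"
  rewrites "Obj (regmod C) = Obj C" and "Arr (regmod C) = Arr C" and "Dom (regmod C) = Dom C"
    and "Cod (regmod C) = Cod C" and "Idn (regmod C) = Idn C" and "Comp (regmod C) = Comp C"
    and "Zero (regmod C) = Zero C" and "Add (regmod C) = Add C" and "Scale (regmod C) = Scale C"
    and "ActObj (regmod C) = TObj C" and "ActMor (regmod C) = TMor C"
    and "MAssoc (regmod C) = Assoc C" and "MUnit (regmod C) = LUnit C"
    and "Hom (regmod C) = Hom C" and "inverse_arrows (regmod C) = inverse_arrows C"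
    and "iso_arr (regmod C) = iso_arr C" and "inv_arr (regmod C) = inv_arr C"
  by (rule module_category_regmod) simp_all

context monoidal_linear_category
begin

abbreviation clw (infixr "\<triangleright>\<^sub>C" 80) where "c \<triangleright>\<^sub>C f \<equiv> reg.lw c f"
abbreviation crw (infixr "\<triangleleft>\<^sub>C" 80) where "u \<triangleleft>\<^sub>C x \<equiv> reg.rw u x"

end

context module_category
begin

lemma RUnit_simps [simp]:
  assumes "a \<in> Obj C"
  shows "RUnit C a \<in> Arr C" "Dom C (RUnit C a) = a \<otimes>\<^sub>o\<^bsub>C\<^esub> Unit C" "Cod C (RUnit C a) = a" "iso_arr C (RUnit C a)"
  using C.RUnit_in_Hom[OF assms] C.RUnit_iso[OF assms] by (simp_all add: Hom_def)

lemma RUnit_nat: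
  "f \<in> Arr C \<Longrightarrow> RUnit C (Cod C f) \<cdot>\<^bsub>C\<^esub> (f \<triangleleft>\<^sub>C Unit C) = f \<cdot>\<^bsub>C\<^esub> RUnit C (Dom C f)"
  using C.RUnit_natural[of f "Dom C f" "Cod C f"] by (simp add: C.reg.rw_def Hom_def)

lemma MAssoc_lw:
  assumes "c \<in> Obj C" "d \<in> Obj C" "f \<in> Arr N" "Dom N f = x" "Cod N f = y"
  shows "MAssoc N c d y \<diamondop> ((c \<otimes>\<^sub>o\<^bsub>C\<^esub> d) \<triangleright> f) = (c \<triangleright> d \<triangleright> f) \<diamondop> MAssoc N c d x"
  using MAssoc_natural[of "Idn C c" c c "Idn C d" d d f x y] assms
  by (simp add: Hom_def lw_def C.TMor_Idn)

lemma MAssoc_rw: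
  assumes "u \<in> Arr C" "d \<in> Obj C" "x \<in> Obj N" "Dom C u = c" "Cod C u = c'"
  shows "MAssoc N c' d x \<diamondop> ((u \<triangleleft>\<^sub>C d) \<triangleleft> x) = (u \<triangleleft> (d \<star> x)) \<diamondop> MAssoc N c d x"
  using MAssoc_natural[of u c c' "Idn C d" d d "Idn N x" x x] assms
  by (simp add: Hom_def rw_def C.reg.rw_def ActMor_Idn)

lemma MAssoc_mw:
  assumes "c \<in> Obj C" "v \<in> Arr C" "x \<in> Obj N" "Dom C v = d" "Cod C v = d'"
  shows "MAssoc N c d' x \<diamondop> ((c \<triangleright>\<^sub>C v) \<triangleleft> x) = (c \<triangleright> v \<triangleleft> x) \<diamondop> MAssoc N c d x"
  using MAssoc_natural[of "Idn C c" c c v d d' "Idn N x" x x] assms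
  by (simp add: Hom_def rw_def C.reg.lw_def lw_def)

lemmas natural_simps = MAssoc_lw MAssoc_rw MAssoc_mw
  N.prefix[OF MAssoc_lw] N.prefix[OF MAssoc_rw] N.prefix[OF MAssoc_mw]

text \<open>The action of the unit object is isomorphic to the identity functor through
  \<open>MUnit\<close>, hence faithful.\<close>

lemma lw_Unit_inj:
  assumes "Unit C \<triangleright> f = Unit C \<triangleright> g" "f \<in> Arr N" "g \<in> Arr N" "Dom N f = Dom N g" "Cod N f = Cod N g"
  shows "f = g"
proof (rule N.iso_cancel_right)
  show "f \<diamondop> MUnit N (Dom N f) = g \<diamondop> MUnit N (Dom N f)"
    using MUnit_nat[of f] MUnit_nat[of g] assms by simp
qed (use assms in simp_all)

lemma triC: "c \<in> Obj C \<Longrightarrow> d \<in> Obj C \<Longrightarrow> (c \<triangleright>\<^sub>C LUnit C d) \<cdot>\<^bsub>C\<^esub> Assoc C c (Unit C) d = RUnit C c \<triangleleft>\<^sub>C d"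
  by (rule C.reg.tri)

text \<open>Kelly's argument: both sides are compared after acting with the unit object and
  composing with the invertible arrow \<open>?t\<close>, where pentagon, triangle and naturality of
  the associator apply.\<close>

lemma MUnit_act:
  assumes c: "c \<in> Obj C" and x: "x \<in> Obj N"
  shows "MUnit N (c \<star> x) \<diamondop> MAssoc N (Unit C) c x = LUnit C c \<triangleleft> x"
proof (rule lw_Unit_inj)
  let ?I = "Unit C"
  let ?t = "MAssoc N ?I (?I \<otimes>\<^sub>o\<^bsub>C\<^esub> c) x \<diamondop> (Assoc C ?I ?I c \<triangleleft> x)"
  have "(?I \<triangleright> (MUnit N (c \<star> x) \<diamondop> MAssoc N ?I c x)) \<diamondop> ?t
      = (?I \<triangleright> MUnit N (c \<star> x)) \<diamondop> (?I \<triangleright> MAssoc N ?I c x) \<diamondop> ?t"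
    using c x by (simp add: lw_Comp)
  also have "\<dots> = (?I \<triangleright> MUnit N (c \<star> x)) \<diamondop> MAssoc N ?I ?I (c \<star> x) \<diamondop> MAssoc N (?I \<otimes>\<^sub>o\<^bsub>C\<^esub> ?I) c x"
    using c x by (simp add: pent)
  also have "\<dots> = (RUnit C ?I \<triangleleft> c \<star> x) \<diamondop> MAssoc N (?I \<otimes>\<^sub>o\<^bsub>C\<^esub> ?I) c x"
    using c x by (simp add: N.prefix[OF tri])
  also have "\<dots> = MAssoc N ?I c x \<diamondop> ((RUnit C ?I \<triangleleft>\<^sub>C c) \<triangleleft> x)"
    using c x by (simp add: natural_simps)
  also have "\<dots> = (?I \<triangleright> LUnit C c \<triangleleft> x) \<diamondop> ?t"
    using c x by (simp flip: triC add: rw_Comp natural_simps)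
  finally have *: "(?I \<triangleright> (MUnit N (c \<star> x) \<diamondop> MAssoc N ?I c x)) \<diamondop> ?t = (?I \<triangleright> LUnit C c \<triangleleft> x) \<diamondop> ?t" .
  have "iso_arr N ?t"
    using c x by (intro N.iso_Comp) simp_all
  from this * show "?I \<triangleright> (MUnit N (c \<star> x) \<diamondop> MAssoc N ?I c x) = ?I \<triangleright> LUnit C c \<triangleleft> x"
    by (rule N.iso_cancel_right) (use c x in simp_all)
qed (use assms in simp_all)

end

context monoidal_linear_category
begin

text \<open>The mirror image of \<open>MUnit_act\<close>: both sides are tensored with the unit on
  the right, which is faithful by naturality of \<open>RUnit\<close>, and postcomposed with an
  associator.\<close>

lemma RUnit_TObj:
  assumes "a \<in> Obj C" "b \<in> Obj C"
  shows "reg.lw a (RUnit C b) \<cdot>\<^bsub>C\<^esub> Assoc C a b (Unit C) = RUnit C (a \<otimes>\<^sub>o\<^bsub>C\<^esub> b)"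
proof -
  let ?I = "Unit C"
  let ?f = "reg.lw a (RUnit C b) \<cdot>\<^bsub>C\<^esub> Assoc C a b ?I"
  have "Assoc C a b ?I \<cdot>\<^bsub>C\<^esub> reg.rw ?f ?I
      = reg.lw a (reg.rw (RUnit C b) ?I) \<cdot>\<^bsub>C\<^esub> Assoc C a (b \<otimes>\<^sub>o\<^bsub>C\<^esub> ?I) ?I \<cdot>\<^bsub>C\<^esub> reg.rw (Assoc C a b ?I) ?I"
    using assms by (simp add: reg.rw_Comp reg.natural_simps)
  also have "\<dots> = reg.lw a (reg.lw b (LUnit C ?I)) \<cdot>\<^bsub>C\<^esub> Assoc C a b (?I \<otimes>\<^sub>o\<^bsub>C\<^esub> ?I) \<cdot>\<^bsub>C\<^esub> Assoc C (a \<otimes>\<^sub>o\<^bsub>C\<^esub> b) ?I ?I"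
    using assms by (simp flip: reg.tri add: reg.lw_Comp reg.pent)
  also have "\<dots> = Assoc C a b ?I \<cdot>\<^bsub>C\<^esub> reg.lw (a \<otimes>\<^sub>o\<^bsub>C\<^esub> b) (LUnit C ?I) \<cdot>\<^bsub>C\<^esub> Assoc C (a \<otimes>\<^sub>o\<^bsub>C\<^esub> b) ?I ?I"
    using assms by (simp add: reg.natural_simps)
  also have "\<dots> = Assoc C a b ?I \<cdot>\<^bsub>C\<^esub> reg.rw (RUnit C (a \<otimes>\<^sub>o\<^bsub>C\<^esub> b)) ?I"
    using assms by (simp add: reg.tri)
  finally have "Assoc C a b ?I \<cdot>\<^bsub>C\<^esub> reg.rw ?f ?I = Assoc C a b ?I \<cdot>\<^bsub>C\<^esub> reg.rw (RUnit C (a \<otimes>\<^sub>o\<^bsub>C\<^esub> b)) ?I" .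
  then have *: "reg.rw ?f ?I = reg.rw (RUnit C (a \<otimes>\<^sub>o\<^bsub>C\<^esub> b)) ?I"
    by (rule iso_cancel_left[rotated]) (use assms in simp_all)
  show ?thesis
  proof (rule iso_cancel_right)
    show "?f \<cdot>\<^bsub>C\<^esub> RUnit C (Dom C ?f) = RUnit C (a \<otimes>\<^sub>o\<^bsub>C\<^esub> b) \<cdot>\<^bsub>C\<^esub> RUnit C (Dom C ?f)"
      using reg.RUnit_nat[of ?f] reg.RUnit_nat[of "RUnit C (a \<otimes>\<^sub>o\<^bsub>C\<^esub> b)"] assms * by simp
  qed (use assms in simp_all)
qed

end

section \<open>Internal Homs as universal elements\<close>

text \<open>Linear structure is left out because the notion has to cover the center acting on
  \<open>Rex\<close>, both of which are plain category records, as well as opposites of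
  actions.\<close>

locale category_action = A: category A + X: category X
  for A :: "('a, 'b, 'z) cat_scheme" and X :: "('x, 'y, 'w) cat_scheme"
    and ao :: "'a \<Rightarrow> 'x \<Rightarrow> 'x" and am :: "'b \<Rightarrow> 'y \<Rightarrow> 'y" +
  assumes ao_Obj [simp]: "\<lbrakk>a \<in> Obj A; x \<in> Obj X\<rbrakk> \<Longrightarrow> ao a x \<in> Obj X"
    and am_Arr [simp]: "\<lbrakk>u \<in> Arr A; f \<in> Arr X\<rbrakk> \<Longrightarrow> am u f \<in> Arr X"
      "\<lbrakk>u \<in> Arr A; f \<in> Arr X\<rbrakk> \<Longrightarrow> Dom X (am u f) = ao (Dom A u) (Dom X f)"
      "\<lbrakk>u \<in> Arr A; f \<in> Arr X\<rbrakk> \<Longrightarrow> Cod X (am u f) = ao (Cod A u) (Cod X f)"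
    and am_Idn [simp]: "\<lbrakk>a \<in> Obj A; x \<in> Obj X\<rbrakk> \<Longrightarrow> am (Idn A a) (Idn X x) = Idn X (ao a x)"
    and am_Comp: "\<lbrakk>u \<in> Arr A; v \<in> Arr A; f \<in> Arr X; g \<in> Arr X; Dom A v = Cod A u; Dom X g = Cod X f\<rbrakk>
      \<Longrightarrow> am (v \<cdot>\<^bsub>A\<^esub> u) (g \<cdot>\<^bsub>X\<^esub> f) = am v g \<cdot>\<^bsub>X\<^esub> am u f"
begin

text \<open>\<open>e\<close> is a universal arrow to \<open>y\<close> from the functor that sends
  \<open>a\<close> to \<open>a.x\<close>: the value at \<open>y\<close> of a right adjoint,
  described by its counit alone.\<close>

definition universal :: "'x \<Rightarrow> 'x \<Rightarrow> 'a \<Rightarrow> 'y \<Rightarrow> bool" where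
  "universal x y g e \<longleftrightarrow> g \<in> Obj A \<and> e \<in> Hom X (ao g x) y \<and>
     (\<forall>a \<in> Obj A. \<forall>k \<in> Hom X (ao a x) y. \<exists>!u. u \<in> Hom A a g \<and> e \<cdot>\<^bsub>X\<^esub> am u (Idn X x) = k)"

lemma universalD:
  assumes "universal x y g e"
  shows "g \<in> Obj A" "e \<in> Hom X (ao g x) y"
    "\<lbrakk>a \<in> Obj A; k \<in> Hom X (ao a x) y\<rbrakk> \<Longrightarrow> \<exists>!u. u \<in> Hom A a g \<and> e \<cdot>\<^bsub>X\<^esub> am u (Idn X x) = k"
  using assms by (auto simp: universal_def)

lemma am_rw_Comp:
  assumes "u \<in> Arr A" "v \<in> Arr A" "Dom A v = Cod A u" "x \<in> Obj X"
  shows "am (v \<cdot>\<^bsub>A\<^esub> u) (Idn X x) = am v (Idn X x) \<cdot>\<^bsub>X\<^esub> am u (Idn X x)"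
  using am_Comp[of u v "Idn X x" "Idn X x"] assms by simp

text \<open>Each universal element factors through the other, and the composites are identities
  because they factor a universal element through itself. Compatibility with the universal elements
  alone already determines \<open>t\<close>.\<close>

lemma universal_unique:
  assumes U: "universal x y g e" and U': "universal x y g' e'" and x: "x \<in> Obj X"
  shows "\<exists>!t. t \<in> Hom A g' g \<and> iso_arr A t \<and> e \<cdot>\<^bsub>X\<^esub> am t (Idn X x) = e'"
proof -
  note [simp] = Hom_def
  obtain t where t: "t \<in> Hom A g' g" "e \<cdot>\<^bsub>X\<^esub> am t (Idn X x) = e'"
    using universalD(3)[OF U] universalD(1,2)[OF U'] by blast
  obtain s where s: "s \<in> Hom A g g'" "e' \<cdot>\<^bsub>X\<^esub> am s (Idn X x) = e"
    using universalD(3)[OF U'] universalD(1,2)[OF U] by blast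
  have "e \<cdot>\<^bsub>X\<^esub> am (t \<cdot>\<^bsub>A\<^esub> s) (Idn X x) = (e \<cdot>\<^bsub>X\<^esub> am t (Idn X x)) \<cdot>\<^bsub>X\<^esub> am s (Idn X x)"
    using t(1) s(1) x universalD(1,2)[OF U] by (simp add: am_rw_Comp)
  moreover have "e \<cdot>\<^bsub>X\<^esub> am (Idn A g) (Idn X x) = e"
    using x universalD(1,2)[OF U] by simp
  ultimately have ts: "t \<cdot>\<^bsub>A\<^esub> s = Idn A g"
    using universalD(3)[OF U universalD(1,2)[OF U]] t s universalD(1)[OF U] A.Idn_in_Hom A.Comp_in_Hom
    by metis
  have "e' \<cdot>\<^bsub>X\<^esub> am (s \<cdot>\<^bsub>A\<^esub> t) (Idn X x) = (e' \<cdot>\<^bsub>X\<^esub> am s (Idn X x)) \<cdot>\<^bsub>X\<^esub> am t (Idn X x)"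
    using t(1) s(1) x universalD(1,2)[OF U'] by (simp add: am_rw_Comp)
  moreover have "e' \<cdot>\<^bsub>X\<^esub> am (Idn A g') (Idn X x) = e'"
    using x universalD(1,2)[OF U'] by simp
  ultimately have "s \<cdot>\<^bsub>A\<^esub> t = Idn A g'"
    using universalD(3)[OF U' universalD(1,2)[OF U']] t s universalD(1)[OF U'] A.Idn_in_Hom A.Comp_in_Hom
    by metis
  with ts t s have "iso_arr A t"
    by (intro A.inv_arrI(1)[of t s] A.inverse_arrowsI) auto
  then show ?thesis
    using t universalD(3)[OF U universalD(1,2)[OF U']] by blast
qed

text \<open>Only the values at identities matter for the adjunction; \<open>HMor\<close> is then determined by them.\<close>

lemma internal_Hom_exists:
  assumes "\<And>x y. \<lbrakk>x \<in> Obj X; y \<in> Obj X\<rbrakk> \<Longrightarrow> \<exists>g e. universal x y g e"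
  shows "\<exists>H. is_internal_Hom A X ao am H"
proof -
  note [simp] = Hom_def
  obtain g e where U: "\<And>x y. \<lbrakk>x \<in> Obj X; y \<in> Obj X\<rbrakk> \<Longrightarrow> universal x y (g x y) (e x y)"
    using assms by metis
  note g = universalD(1)[OF U] and e = universalD(2)[OF U] and u = universalD(3)[OF U]
  have e': "e x y \<in> Arr X" "Dom X (e x y) = ao (g x y) x" "Cod X (e x y) = y"
    if "x \<in> Obj X" "y \<in> Obj X" for x y using e[OF that] by auto
  define hm where "hm f h = (THE u. u \<in> Hom A (g (Cod X f) (Dom X h)) (g (Dom X f) (Cod X h)) \<and>
      e (Dom X f) (Cod X h) \<cdot>\<^bsub>X\<^esub> am u (Idn X (Dom X f))
        = h \<cdot>\<^bsub>X\<^esub> e (Cod X f) (Dom X h) \<cdot>\<^bsub>X\<^esub> am (Idn A (g (Cod X f) (Dom X h))) f)" for f h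
  have hm: "hm f h \<in> Hom A (g (Cod X f) (Dom X h)) (g (Dom X f) (Cod X h)) \<and>
      e (Dom X f) (Cod X h) \<cdot>\<^bsub>X\<^esub> am (hm f h) (Idn X (Dom X f))
        = h \<cdot>\<^bsub>X\<^esub> e (Cod X f) (Dom X h) \<cdot>\<^bsub>X\<^esub> am (Idn A (g (Cod X f) (Dom X h))) f"
    if "f \<in> Arr X" "h \<in> Arr X" for f h
    unfolding hm_def by (rule theI'[OF u]) (use that g e' in simp_all)
  then have hm_Arr: "hm f h \<in> Arr A" "Dom A (hm f h) = g (Cod X f) (Dom X h)"
      "Cod A (hm f h) = g (Dom X f) (Cod X h)"
    if "f \<in> Arr X" "h \<in> Arr X" for f h
    using that by auto
  define H where "H = \<lparr>HObj = g, HMor = hm, HAdj = (\<lambda>x y a u. e x y \<cdot>\<^bsub>X\<^esub> am u (Idn X x))\<rparr>"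
  have "is_internal_Hom A X ao am H"
    unfolding is_internal_Hom_def
  proof (intro conjI ballI)
    fix x y a assume xya: "x \<in> Obj X" "y \<in> Obj X" "a \<in> Obj A"
    show "bij_betw (HAdj H x y a) (Hom A a (HObj H x y)) (Hom X (ao a x) y)"
    proof (rule bij_betwI')
      fix k k' assume "k \<in> Hom A a (HObj H x y)" "k' \<in> Hom A a (HObj H x y)"
      moreover from this have "e x y \<cdot>\<^bsub>X\<^esub> am k (Idn X x) \<in> Hom X (ao a x) y"
        using xya e'[OF xya(1,2)] by (simp add: H_def)
      ultimately have "k = k'" if "e x y \<cdot>\<^bsub>X\<^esub> am k (Idn X x) = e x y \<cdot>\<^bsub>X\<^esub> am k' (Idn X x)"
        using u[OF xya(1,2,3), of "e x y \<cdot>\<^bsub>X\<^esub> am k (Idn X x)"] that unfolding H_def internal_hom.simps by metis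
      then show "(HAdj H x y a k = HAdj H x y a k') = (k = k')"
        by (auto simp: H_def)
    next
      fix k assume "k \<in> Hom A a (HObj H x y)"
      then show "HAdj H x y a k \<in> Hom X (ao a x) y"
        using xya e'[OF xya(1,2)] by (simp add: H_def)
    next
      fix h assume "h \<in> Hom X (ao a x) y"
      then show "\<exists>k \<in> Hom A a (HObj H x y). h = HAdj H x y a k"
        using u[OF xya(1,2,3), of h] unfolding H_def internal_hom.simps by metis
    qed
  next
    fix v f h k
    assume v: "v \<in> Arr A" and f: "f \<in> Arr X" and h: "h \<in> Arr X"
      and k: "k \<in> Hom A (Cod A v) (HObj H (Cod X f) (Dom X h))"
    \<comment> \<open>Bifunctoriality: \<open>f\<close> and \<open>k\<close> act on different
      factors, so they may be exchanged.\<close>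
    have *: "am (Idn A (g (Cod X f) (Dom X h))) f \<cdot>\<^bsub>X\<^esub> am (k \<cdot>\<^bsub>A\<^esub> v) (Idn X (Dom X f))
        = am k (Idn X (Cod X f)) \<cdot>\<^bsub>X\<^esub> am v f"
      using v f h k g by (simp flip: am_Comp add: H_def)
    have "e (Dom X f) (Cod X h) \<cdot>\<^bsub>X\<^esub> am (hm f h \<cdot>\<^bsub>A\<^esub> k \<cdot>\<^bsub>A\<^esub> v) (Idn X (Dom X f))
        = (e (Dom X f) (Cod X h) \<cdot>\<^bsub>X\<^esub> am (hm f h) (Idn X (Dom X f))) \<cdot>\<^bsub>X\<^esub> am (k \<cdot>\<^bsub>A\<^esub> v) (Idn X (Dom X f))"
      using v f h k hm_Arr[OF f h] e' by (simp add: H_def am_rw_Comp)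
    also have "\<dots> = h \<cdot>\<^bsub>X\<^esub> e (Cod X f) (Dom X h) \<cdot>\<^bsub>X\<^esub> am (Idn A (g (Cod X f) (Dom X h))) f \<cdot>\<^bsub>X\<^esub> am (k \<cdot>\<^bsub>A\<^esub> v) (Idn X (Dom X f))"
      unfolding conjunct2[OF hm[OF f h]] using v f h k g e' by (simp add: H_def)
    also have "\<dots> = h \<cdot>\<^bsub>X\<^esub> (e (Cod X f) (Dom X h) \<cdot>\<^bsub>X\<^esub> am k (Idn X (Cod X f))) \<cdot>\<^bsub>X\<^esub> am v f"
      using * v f h k g e' by (simp add: H_def)
    finally show "HAdj H (Dom X f) (Cod X h) (Dom A v) (HMor H f h \<cdot>\<^bsub>A\<^esub> k \<cdot>\<^bsub>A\<^esub> v)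
        = h \<cdot>\<^bsub>X\<^esub> HAdj H (Cod X f) (Dom X h) (Cod A v) k \<cdot>\<^bsub>X\<^esub> am v f"
      by (simp add: H_def)
  qed (use g hm in \<open>auto simp: H_def\<close>)
  then show ?thesis by blast
qed

context
  fixes H assumes H: "is_internal_Hom A X ao am H"
begin

lemma HObj_Obj [simp]: "x \<in> Obj X \<Longrightarrow> y \<in> Obj X \<Longrightarrow> HObj H x y \<in> Obj A"
  using H by (simp add: is_internal_Hom_def)

lemma HMor_simps [simp]:
  assumes "f \<in> Arr X" "h \<in> Arr X"
  shows "HMor H f h \<in> Arr A" "Dom A (HMor H f h) = HObj H (Cod X f) (Dom X h)"
    "Cod A (HMor H f h) = HObj H (Dom X f) (Cod X h)"
  using H assms by (auto simp: is_internal_Hom_def Hom_def)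

lemma HAdj_bij:
  "\<lbrakk>x \<in> Obj X; y \<in> Obj X; a \<in> Obj A\<rbrakk> \<Longrightarrow> bij_betw (HAdj H x y a) (Hom A a (HObj H x y)) (Hom X (ao a x) y)"
  using H by (simp add: is_internal_Hom_def)

lemma HAdj_inj:
  assumes "HAdj H x y a k = HAdj H x y a k'" "x \<in> Obj X" "y \<in> Obj X"
    "k \<in> Hom A a (HObj H x y)" "k' \<in> Hom A a (HObj H x y)"
  shows "k = k'"
proof -
  have "a \<in> Obj A"
    using assms(4) by (auto simp: Hom_def)
  then show ?thesis
    using HAdj_bij[of x y a] assms by (auto simp: bij_betw_def dest: inj_onD)
qed

lemma HAdj_simps [simp]:
  assumes "x \<in> Obj X" "y \<in> Obj X" "k \<in> Arr A" "Dom A k = a" "Cod A k = HObj H x y"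
  shows "HAdj H x y a k \<in> Arr X" "Dom X (HAdj H x y a k) = ao a x" "Cod X (HAdj H x y a k) = y"
proof -
  have "HAdj H x y a k \<in> Hom X (ao a x) y"
    using HAdj_bij[of x y a] assms by (auto simp: Hom_def dest!: bij_betw_apply)
  then show "HAdj H x y a k \<in> Arr X" "Dom X (HAdj H x y a k) = ao a x" "Cod X (HAdj H x y a k) = y"
    by (simp_all add: Hom_def)
qed

lemma HAdj_natural:
  "\<lbrakk>u \<in> Arr A; f \<in> Arr X; h \<in> Arr X; k \<in> Arr A; Dom A k = Cod A u; Cod A k = HObj H (Cod X f) (Dom X h)\<rbrakk>
   \<Longrightarrow> HAdj H (Dom X f) (Cod X h) (Dom A u) (HMor H f h \<cdot>\<^bsub>A\<^esub> k \<cdot>\<^bsub>A\<^esub> u)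
          = h \<cdot>\<^bsub>X\<^esub> HAdj H (Cod X f) (Dom X h) (Cod A u) k \<cdot>\<^bsub>X\<^esub> am u f"
  using H by (simp add: is_internal_Hom_def Hom_def)

text \<open>Functoriality of \<open>HMor\<close> is a consequence of naturality: at identities it
  gives both sides the same image under the injective \<open>HAdj\<close>.\<close>

lemma HMor_Idn:
  assumes "x \<in> Obj X" "y \<in> Obj X"
  shows "HMor H (Idn X x) (Idn X y) = Idn A (HObj H x y)"
proof (rule HAdj_inj)
  show "HAdj H x y (HObj H x y) (HMor H (Idn X x) (Idn X y)) = HAdj H x y (HObj H x y) (Idn A (HObj H x y))"
    using HAdj_natural[of "Idn A (HObj H x y)" "Idn X x" "Idn X y" "Idn A (HObj H x y)"] assms by simp
qed (use assms in \<open>simp_all add: Hom_def\<close>)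

lemma HAdj_Comp:
  assumes "x \<in> Obj X" "y \<in> Obj X" "u \<in> Arr A" "k \<in> Arr A" "Dom A k = Cod A u" "Cod A k = HObj H x y"
  shows "HAdj H x y (Dom A u) (k \<cdot>\<^bsub>A\<^esub> u) = HAdj H x y (Cod A u) k \<cdot>\<^bsub>X\<^esub> am u (Idn X x)"
  using HAdj_natural[of u "Idn X x" "Idn X y" k] assms by (simp add: HMor_Idn)

lemma HAdj_HMor:
  assumes "f \<in> Arr X" "h \<in> Arr X" "k \<in> Arr A" "Dom A k = a" "Cod A k = HObj H (Cod X f) (Dom X h)"
  shows "HAdj H (Dom X f) (Cod X h) a (HMor H f h \<cdot>\<^bsub>A\<^esub> k)
    = h \<cdot>\<^bsub>X\<^esub> HAdj H (Cod X f) (Dom X h) a k \<cdot>\<^bsub>X\<^esub> am (Idn A a) f"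
proof -
  have "a \<in> Obj A" using assms by auto
  then show ?thesis
    using HAdj_natural[of "Idn A a" f h k] assms by simp
qed

abbreviation "counit x y \<equiv> HAdj H x y (HObj H x y) (Idn A (HObj H x y))"

lemma HAdj_counit:
  assumes "x \<in> Obj X" "y \<in> Obj X" "k \<in> Arr A" "Cod A k = HObj H x y" "Dom A k = a"
  shows "HAdj H x y a k = counit x y \<cdot>\<^bsub>X\<^esub> am k (Idn X x)"
  using HAdj_Comp[of x y k "Idn A (HObj H x y)"] assms by simp

text \<open>Yoneda: by naturality, \<open>HAdj\<close> is composition with the image of the
  identity. In this way an arbitrary structure of internal Homs can be compared with any other
  universal element.\<close>

lemma universal_counit:
  assumes "x \<in> Obj X" "y \<in> Obj X"
  shows "universal x y (HObj H x y) (counit x y)"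
  unfolding universal_def
proof (intro conjI ballI)
  fix a k assume a: "a \<in> Obj A" and k: "k \<in> Hom X (ao a x) y"
  obtain u where u: "u \<in> Hom A a (HObj H x y)" "HAdj H x y a u = k"
    using HAdj_bij[OF assms a] k unfolding bij_betw_def by (metis imageE)
  show "\<exists>!u. u \<in> Hom A a (HObj H x y) \<and> counit x y \<cdot>\<^bsub>X\<^esub> am u (Idn X x) = k"
  proof (rule ex1I)
    show "u \<in> Hom A a (HObj H x y) \<and> counit x y \<cdot>\<^bsub>X\<^esub> am u (Idn X x) = k"
      using u HAdj_counit[of x y u a] assms by (auto simp: Hom_def)
  next
    fix v assume v: "v \<in> Hom A a (HObj H x y) \<and> counit x y \<cdot>\<^bsub>X\<^esub> am v (Idn X x) = k"
    then have "HAdj H x y a v = k"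
      using HAdj_counit[of x y v a] assms by (auto simp: Hom_def)
    with u v show "v = u"
      using HAdj_inj[of x y a v u] assms by auto
  qed
qed (use assms in \<open>simp_all add: Hom_def\<close>)

end

end

sublocale module_category \<subseteq> act: category_action C N "ActObj N" "ActMor N"
  by unfold_locales (simp_all add: ActMor_Idn ActMor_Comp')

section \<open>Duals acting on module categories\<close>

context module_category
begin

text \<open>Unit and counit of the adjunction in which the action of \<open>d\<close> is left
  adjoint to that of \<open>c\<close>, for \<open>d\<close> a right dual of
  \<open>c\<close>.\<close>

definition eta where "eta d c coev w = MAssoc N c d w \<diamondop> (coev \<triangleleft> w) \<diamondop> inv_arr N (MUnit N w)"
definition eps where "eps d c ev y = MUnit N y \<diamondop> (ev \<triangleleft> y) \<diamondop> inv_arr N (MAssoc N d c y)"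

text \<open>The pentagon solved for the side with an inverse associator of \<open>C\<close>, the
  form that arises when a zigzag identity is made to act on an object.\<close>

lemma pent_inv:
  assumes "b \<in> Obj C" "c \<in> Obj C" "d \<in> Obj C" "x \<in> Obj N"
  shows "MAssoc N (b \<otimes>\<^sub>o\<^bsub>C\<^esub> c) d x \<diamondop> (inv_arr C (Assoc C b c d) \<triangleleft> x)
    = inv_arr N (MAssoc N b c (d \<star> x)) \<diamondop> (b \<triangleright> MAssoc N c d x) \<diamondop> MAssoc N b (c \<otimes>\<^sub>o\<^bsub>C\<^esub> d) x"
proof -
  have "inv_arr N (MAssoc N b c (d \<star> x)) \<diamondop> (b \<triangleright> MAssoc N c d x) \<diamondop> MAssoc N b (c \<otimes>\<^sub>o\<^bsub>C\<^esub> d) x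
      = inv_arr N (MAssoc N b c (d \<star> x)) \<diamondop> ((b \<triangleright> MAssoc N c d x) \<diamondop> MAssoc N b (c \<otimes>\<^sub>o\<^bsub>C\<^esub> d) x
        \<diamondop> (Assoc C b c d \<triangleleft> x)) \<diamondop> (inv_arr C (Assoc C b c d) \<triangleleft> x)"
    using assms by (simp flip: rw_Comp)
  also have "\<dots> = MAssoc N (b \<otimes>\<^sub>o\<^bsub>C\<^esub> c) d x \<diamondop> (inv_arr C (Assoc C b c d) \<triangleleft> x)"
    unfolding pent[OF assms] using assms by simp
  finally show ?thesis ..
qed

lemma pent_inv':
  assumes "b \<in> Obj C" "c \<in> Obj C" "d \<in> Obj C" "x \<in> Obj N"
  shows "MAssoc N b (c \<otimes>\<^sub>o\<^bsub>C\<^esub> d) x \<diamondop> (Assoc C b c d \<triangleleft> x)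
    = inv_arr N (b \<triangleright> MAssoc N c d x) \<diamondop> MAssoc N b c (d \<star> x) \<diamondop> MAssoc N (b \<otimes>\<^sub>o\<^bsub>C\<^esub> c) d x"
  by (rule N.move_inv_left[OF _ pent[OF assms], simplified]) (use assms in simp_all)

lemma MUnit_inv_nat:
  "f \<in> Arr N \<Longrightarrow> Dom N f = x \<Longrightarrow> Cod N f = y
    \<Longrightarrow> (Unit C \<triangleright> f) \<diamondop> inv_arr N (MUnit N x) = inv_arr N (MUnit N y) \<diamondop> f"
  by (rule N.square_inv) (use MUnit_nat[of f] in auto)

lemma MAssoc_inv_lw:
  assumes "c \<in> Obj C" "d \<in> Obj C" "f \<in> Arr N" "Dom N f = x" "Cod N f = y"
  shows "inv_arr N (MAssoc N c d y) \<diamondop> (c \<triangleright> d \<triangleright> f) = ((c \<otimes>\<^sub>o\<^bsub>C\<^esub> d) \<triangleright> f) \<diamondop> inv_arr N (MAssoc N c d x)"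
  by (rule N.square_inv[symmetric]) (use MAssoc_lw[OF assms] assms N.Dom_Obj[OF assms(3)] N.Cod_Obj[OF assms(3)] in auto)

lemma MAssoc_inv_mw:
  assumes "c \<in> Obj C" "v \<in> Arr C" "x \<in> Obj N" "Dom C v = d" "Cod C v = d'"
  shows "inv_arr N (MAssoc N c d' x) \<diamondop> (c \<triangleright> v \<triangleleft> x) = ((c \<triangleright>\<^sub>C v) \<triangleleft> x) \<diamondop> inv_arr N (MAssoc N c d x)"
  by (rule N.square_inv[symmetric]) (use MAssoc_mw[OF assms] assms C.Dom_Obj[OF assms(2)] C.Cod_Obj[OF assms(2)] in auto)

lemma MAssoc_inv_rw:
  assumes "u \<in> Arr C" "d \<in> Obj C" "x \<in> Obj N" "Dom C u = c" "Cod C u = c'"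
  shows "inv_arr N (MAssoc N c' d x) \<diamondop> (u \<triangleleft> (d \<star> x)) = ((u \<triangleleft>\<^sub>C d) \<triangleleft> x) \<diamondop> inv_arr N (MAssoc N c d x)"
  by (rule N.square_inv[symmetric]) (use MAssoc_rw[OF assms] assms C.Dom_Obj[OF assms(1)] C.Cod_Obj[OF assms(1)] in auto)

lemma dualityD:
  assumes "duality C d c ev k"
  shows "d \<in> Obj C" "c \<in> Obj C" "ev \<in> Arr C" "Dom C ev = d \<otimes>\<^sub>o\<^bsub>C\<^esub> c" "Cod C ev = Unit C"
    "k \<in> Arr C" "Dom C k = Unit C" "Cod C k = c \<otimes>\<^sub>o\<^bsub>C\<^esub> d"
    "RUnit C c \<cdot>\<^bsub>C\<^esub> (c \<triangleright>\<^sub>C ev) \<cdot>\<^bsub>C\<^esub> Assoc C c d c \<cdot>\<^bsub>C\<^esub> (k \<triangleleft>\<^sub>C c) = LUnit C c"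
    "LUnit C d \<cdot>\<^bsub>C\<^esub> (ev \<triangleleft>\<^sub>C d) \<cdot>\<^bsub>C\<^esub> inv_arr C (Assoc C d c d) \<cdot>\<^bsub>C\<^esub> (d \<triangleright>\<^sub>C k) = RUnit C d"
  using assms by (auto simp: duality_def Hom_def C.reg.lw_def C.reg.rw_def)

context
  fixes d c ev k assumes D: "duality C d c ev k"
begin

lemmas dual [simp] = dualityD(1-8)[OF D]

lemma eta_simps [simp]:
  assumes "w \<in> Obj N"
  shows "eta d c k w \<in> Arr N" "Dom N (eta d c k w) = w" "Cod N (eta d c k w) = c \<star> d \<star> w"
  using assms by (simp_all add: eta_def)

lemma eps_simps [simp]:
  assumes "w \<in> Obj N"
  shows "eps d c ev w \<in> Arr N" "Cod N (eps d c ev w) = w" "Dom N (eps d c ev w) = d \<star> c \<star> w"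
  using assms by (simp_all add: eps_def)

lemma eta_nat:
  assumes f: "f \<in> Arr N" and "Dom N f = x" "Cod N f = y"
  shows "(c \<triangleright> d \<triangleright> f) \<diamondop> eta d c k x = eta d c k y \<diamondop> f"
proof -
  have [simp]: "Dom N f = x" "Cod N f = y" "x \<in> Obj N" "y \<in> Obj N"
    using assms by auto
  have "(c \<triangleright> d \<triangleright> f) \<diamondop> eta d c k x
      = MAssoc N c d y \<diamondop> ((c \<otimes>\<^sub>o\<^bsub>C\<^esub> d) \<triangleright> f) \<diamondop> (k \<triangleleft> x) \<diamondop> inv_arr N (MUnit N x)"
    using f by (simp add: eta_def natural_simps)
  also have "\<dots> = MAssoc N c d y \<diamondop> (k \<triangleleft> y) \<diamondop> (Unit C \<triangleright> f) \<diamondop> inv_arr N (MUnit N x)"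
    using f by (simp add: N.prefix[OF interchange[of k f "Unit C"]])
  also have "\<dots> = eta d c k y \<diamondop> f"
    using f by (simp add: eta_def MUnit_inv_nat)
  finally show ?thesis .
qed

lemma eps_nat:
  assumes f: "f \<in> Arr N" and "Dom N f = x" "Cod N f = y"
  shows "eps d c ev y \<diamondop> (d \<triangleright> c \<triangleright> f) = f \<diamondop> eps d c ev x"
proof -
  have [simp]: "Dom N f = x" "Cod N f = y" "x \<in> Obj N" "y \<in> Obj N"
    using assms by auto
  have "eps d c ev y \<diamondop> (d \<triangleright> c \<triangleright> f)
      = MUnit N y \<diamondop> (ev \<triangleleft> y) \<diamondop> ((d \<otimes>\<^sub>o\<^bsub>C\<^esub> c) \<triangleright> f) \<diamondop> inv_arr N (MAssoc N d c x)"
    using f by (simp add: eps_def MAssoc_inv_lw)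
  also have "\<dots> = MUnit N y \<diamondop> (Unit C \<triangleright> f) \<diamondop> (ev \<triangleleft> x) \<diamondop> inv_arr N (MAssoc N d c x)"
    using f by (simp add: N.prefix[OF interchange[of ev f _ "Unit C", symmetric]])
  also have "\<dots> = f \<diamondop> eps d c ev x"
    using f N.prefix[OF MUnit_nat[of f]] by (simp add: eps_def)
  finally show ?thesis .
qed

text \<open>The zigzag identity for \<open>d\<close>, acting on \<open>w\<close>. Its associator is
  turned into module associators by \<open>pent_inv\<close>, and the units disappear by
  \<open>MUnit_act\<close> and \<open>tri\<close>.\<close>

lemma eps_eta:
  assumes w: "w \<in> Obj N"
  shows "eps d c ev (d \<star> w) \<diamondop> (d \<triangleright> eta d c k w) = Idn N (d \<star> w)"
proof -
  have "RUnit C d \<triangleleft> w = (LUnit C d \<cdot>\<^bsub>C\<^esub> (ev \<triangleleft>\<^sub>C d) \<cdot>\<^bsub>C\<^esub> inv_arr C (Assoc C d c d) \<cdot>\<^bsub>C\<^esub> (d \<triangleright>\<^sub>C k)) \<triangleleft> w"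
    using dualityD(10)[OF D] by simp
  also have "\<dots> = MUnit N (d \<star> w) \<diamondop> MAssoc N (Unit C) d w \<diamondop> ((ev \<triangleleft>\<^sub>C d) \<triangleleft> w) \<diamondop>
      (inv_arr C (Assoc C d c d) \<triangleleft> w) \<diamondop> ((d \<triangleright>\<^sub>C k) \<triangleleft> w)"
    using w by (simp add: rw_Comp N.prefix[OF MUnit_act])
  also have "\<dots> = eps d c ev (d \<star> w) \<diamondop> (d \<triangleright> MAssoc N c d w) \<diamondop> (d \<triangleright> k \<triangleleft> w) \<diamondop> MAssoc N d (Unit C) w"
    using w by (simp add: eps_def natural_simps N.prefix[OF pent_inv])
  finally have *: "RUnit C d \<triangleleft> w
    = eps d c ev (d \<star> w) \<diamondop> (d \<triangleright> MAssoc N c d w) \<diamondop> (d \<triangleright> k \<triangleleft> w) \<diamondop> MAssoc N d (Unit C) w" .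
  have "eps d c ev (d \<star> w) \<diamondop> (d \<triangleright> eta d c k w)
      = (eps d c ev (d \<star> w) \<diamondop> (d \<triangleright> MAssoc N c d w) \<diamondop> (d \<triangleright> k \<triangleleft> w) \<diamondop> MAssoc N d (Unit C) w)
        \<diamondop> inv_arr N (MAssoc N d (Unit C) w) \<diamondop> (d \<triangleright> inv_arr N (MUnit N w))"
    using w by (simp add: eta_def lw_Comp)
  also have "\<dots> = (d \<triangleright> MUnit N w) \<diamondop> MAssoc N d (Unit C) w
      \<diamondop> inv_arr N (MAssoc N d (Unit C) w) \<diamondop> (d \<triangleright> inv_arr N (MUnit N w))"
    unfolding *[symmetric] using w by (simp flip: tri)
  also have "\<dots> = Idn N (d \<star> w)"
    using w by (simp flip: lw_Comp)
  finally show ?thesis .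
qed

text \<open>The other triangle identity, from the zigzag for \<open>c\<close>. It is first obtained
  precomposed with the invertible \<open>MAssoc N (Unit C) c y\<close>, which is then
  cancelled.\<close>

lemma eta_eps:
  assumes y: "y \<in> Obj N"
  shows "(c \<triangleright> eps d c ev y) \<diamondop> eta d c k (c \<star> y) = Idn N (c \<star> y)"
proof -
  have "MUnit N (c \<star> y) \<diamondop> MAssoc N (Unit C) c y = LUnit C c \<triangleleft> y"
    using y by (simp add: MUnit_act)
  also have "\<dots> = (RUnit C c \<cdot>\<^bsub>C\<^esub> (c \<triangleright>\<^sub>C ev) \<cdot>\<^bsub>C\<^esub> Assoc C c d c \<cdot>\<^bsub>C\<^esub> (k \<triangleleft>\<^sub>C c)) \<triangleleft> y"
    using dualityD(9)[OF D] by simp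
  also have "\<dots> = (c \<triangleright> MUnit N y) \<diamondop> MAssoc N c (Unit C) y \<diamondop> ((c \<triangleright>\<^sub>C ev) \<triangleleft> y) \<diamondop>
      (Assoc C c d c \<triangleleft> y) \<diamondop> ((k \<triangleleft>\<^sub>C c) \<triangleleft> y)"
    using y by (simp add: rw_Comp N.prefix[OF tri])
  also have "\<dots> = (c \<triangleright> eps d c ev y) \<diamondop> MAssoc N c d (c \<star> y) \<diamondop> (k \<triangleleft> (c \<star> y)) \<diamondop> MAssoc N (Unit C) c y"
    using y by (simp add: eps_def lw_Comp natural_simps N.prefix[OF pent_inv'])
  finally have *: "MUnit N (c \<star> y) \<diamondop> MAssoc N (Unit C) c y
    = (c \<triangleright> eps d c ev y) \<diamondop> MAssoc N c d (c \<star> y) \<diamondop> (k \<triangleleft> (c \<star> y)) \<diamondop> MAssoc N (Unit C) c y" .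
  have "(c \<triangleright> eps d c ev y) \<diamondop> MAssoc N c d (c \<star> y) \<diamondop> (k \<triangleleft> (c \<star> y)) = MUnit N (c \<star> y)"
    by (rule N.iso_cancel_right[of "MAssoc N (Unit C) c y"]) (use * y in simp_all)
  then have "((c \<triangleright> eps d c ev y) \<diamondop> MAssoc N c d (c \<star> y) \<diamondop> (k \<triangleleft> (c \<star> y))) \<diamondop> inv_arr N (MUnit N (c \<star> y))
      = MUnit N (c \<star> y) \<diamondop> inv_arr N (MUnit N (c \<star> y))"
    by simp
  then show ?thesis
    using y by (simp add: eta_def)
qed

text \<open>Transposing an arrow out of \<open>d.w\<close> into one with target \<open>c.y\<close>
  and back is the identity, by naturality of the counit and a triangle identity.\<close>

lemma sharp_flat:
  assumes "f \<in> Arr N" "Dom N f = d \<star> w" "w \<in> Obj N"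
  shows "eps d c ev (Cod N f) \<diamondop> (d \<triangleright> ((c \<triangleright> f) \<diamondop> eta d c k w)) = f"
  using assms by (simp add: lw_Comp N.prefix[OF eps_nat] eps_eta)

text \<open>Transposition is injective, since an arrow is recovered from its transpose with the unit
  of the adjunction. It is the means of proving equations between arrows into
  \<open>c.y\<close>.\<close>

lemma sharp_inj:
  assumes "eps d c ev y \<diamondop> (d \<triangleright> f) = eps d c ev y \<diamondop> (d \<triangleright> g)" "f \<in> Arr N" "g \<in> Arr N"
    "Dom N f = Dom N g" "Cod N f = c \<star> y" "Cod N g = c \<star> y" "y \<in> Obj N"
  shows "f = g"
proof -
  have *: "(c \<triangleright> (eps d c ev y \<diamondop> (d \<triangleright> h))) \<diamondop> eta d c k (Dom N h) = h"
    if "h \<in> Arr N" "Cod N h = c \<star> y" for h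
    using that assms(7) by (simp add: lw_Comp eta_nat N.prefix[OF eta_eps])
  show ?thesis
    using *[OF assms(2,5)] *[OF assms(3,6)] assms(1,4) by metis
qed

end

declare dual [simp del]

end

context module_category
begin

context
  fixes d c ev k assumes D: "duality C d c ev k"
begin

lemmas dual' [simp] = dual[OF D] eps_simps[OF D]

text \<open>The counit for \<open>C\<close> acting on itself, applied to \<open>x\<close>, is the
  counit of the module category at \<open>b.x\<close> up to associators. Transposition in
  \<open>C\<close> and transposition in the module category therefore agree
  (\<open>sharp_act\<close>).\<close>

lemma eps_act:
  assumes "b \<in> Obj C" "x \<in> Obj N"
  shows "C.reg.eps d c ev b \<triangleleft> x = eps d c ev (b \<star> x) \<diamondop> (d \<triangleright> MAssoc N c b x) \<diamondop> MAssoc N d (c \<otimes>\<^sub>o\<^bsub>C\<^esub> b) x"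
  using assms by (simp add: C.reg.eps_def eps_def rw_Comp N.prefix[OF MUnit_act, symmetric] natural_simps pent_inv)

lemma sharp_act:
  assumes u: "u \<in> Arr C" "Cod C u = c \<otimes>\<^sub>o\<^bsub>C\<^esub> b" "b \<in> Obj C" "x \<in> Obj N" and a: "Dom C u = a"
  shows "(C.reg.eps d c ev b \<cdot>\<^bsub>C\<^esub> (d \<triangleright>\<^sub>C u)) \<triangleleft> x
    = eps d c ev (b \<star> x) \<diamondop> (d \<triangleright> (MAssoc N c b x \<diamondop> (u \<triangleleft> x))) \<diamondop> MAssoc N d a x"
proof -
  have [simp]: "a \<in> Obj C" "Dom C u = a" using a u(1) by auto
  have "C.reg.eps d c ev b \<in> Arr C" "Cod C (C.reg.eps d c ev b) = b" "Dom C (C.reg.eps d c ev b) = d \<otimes>\<^sub>o\<^bsub>C\<^esub> c \<otimes>\<^sub>o\<^bsub>C\<^esub> b"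
    using C.reg.eps_simps[OF D u(3)] by simp_all
  then show ?thesis
    using u by (simp add: rw_Comp eps_act lw_Comp natural_simps)
qed

end

declare dual' [simp del]

end

context monoidal_linear_category
begin

text \<open>The adjunction between right multiplication by an object and by its right dual.\<close>

definition reta where "reta d c k a = inv_arr C (Assoc C a c d) \<cdot>\<^bsub>C\<^esub> reg.lw a k \<cdot>\<^bsub>C\<^esub> inv_arr C (RUnit C a)"
definition reps where "reps d c ev b = RUnit C b \<cdot>\<^bsub>C\<^esub> reg.lw b ev \<cdot>\<^bsub>C\<^esub> Assoc C b d c"

context
  fixes d c ev k assumes D: "duality C d c ev k"
begin

lemmas rdual [simp] = reg.dual[OF D]

lemma reta_simps [simp]:
  assumes "a \<in> Obj C"
  shows "reta d c k a \<in> Arr C" "Dom C (reta d c k a) = a" "Cod C (reta d c k a) = (a \<otimes>\<^sub>o\<^bsub>C\<^esub> c) \<otimes>\<^sub>o\<^bsub>C\<^esub> d"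
  using assms by (simp_all add: reta_def)

lemma reps_simps [simp]:
  assumes "b \<in> Obj C"
  shows "reps d c ev b \<in> Arr C" "Cod C (reps d c ev b) = b" "Dom C (reps d c ev b) = (b \<otimes>\<^sub>o\<^bsub>C\<^esub> d) \<otimes>\<^sub>o\<^bsub>C\<^esub> c"
  using assms by (simp_all add: reps_def)

lemma reta_nat:
  assumes u: "u \<in> Arr C" and "Dom C u = a" "Cod C u = b"
  shows "reg.rw (reg.rw u c) d \<cdot>\<^bsub>C\<^esub> reta d c k a = reta d c k b \<cdot>\<^bsub>C\<^esub> u"
proof -
  have [simp]: "Dom C u = a" "Cod C u = b" "a \<in> Obj C" "b \<in> Obj C"
    using assms by auto
  have "reg.rw u (Unit C) \<cdot>\<^bsub>C\<^esub> inv_arr C (RUnit C a) = inv_arr C (RUnit C b) \<cdot>\<^bsub>C\<^esub> u"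
    by (rule square_inv) (use reg.RUnit_nat[OF u] u in simp_all)
  then show ?thesis
    using u by (simp add: reta_def prefix[OF reg.MAssoc_inv_rw[of u c d a b, symmetric]]
      prefix[OF reg.interchange[of u k a b "Unit C" "c \<otimes>\<^sub>o\<^bsub>C\<^esub> d", symmetric]])
qed

lemma reps_nat:
  assumes u: "u \<in> Arr C" and "Dom C u = a" "Cod C u = b"
  shows "u \<cdot>\<^bsub>C\<^esub> reps d c ev a = reps d c ev b \<cdot>\<^bsub>C\<^esub> reg.rw (reg.rw u d) c"
proof -
  have [simp]: "Dom C u = a" "Cod C u = b" "a \<in> Obj C" "b \<in> Obj C"
    using assms by auto
  have "u \<cdot>\<^bsub>C\<^esub> RUnit C a = RUnit C b \<cdot>\<^bsub>C\<^esub> reg.rw u (Unit C)"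
    using reg.RUnit_nat[OF u] u by simp
  from prefix[OF this] show ?thesis
    using u by (simp add: reps_def reg.natural_simps prefix[OF reg.interchange[of u ev]])
qed

text \<open>The zigzag identity for \<open>c\<close>, tensored with \<open>a\<close> on the left;
  \<open>RUnit_TObj\<close> splits the factor \<open>a\<close> off the unitor of
  \<open>a \<otimes> c\<close>.\<close>

lemma reps_reta:
  assumes a: "a \<in> Obj C"
  shows "reps d c ev (a \<otimes>\<^sub>o\<^bsub>C\<^esub> c) \<cdot>\<^bsub>C\<^esub> reg.rw (reta d c k a) c = Idn C (a \<otimes>\<^sub>o\<^bsub>C\<^esub> c)"
proof -
  have "reps d c ev (a \<otimes>\<^sub>o\<^bsub>C\<^esub> c) \<cdot>\<^bsub>C\<^esub> reg.rw (reta d c k a) c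
     = reg.lw a (RUnit C c) \<cdot>\<^bsub>C\<^esub> reg.lw a (reg.lw c ev) \<cdot>\<^bsub>C\<^esub> reg.lw a (Assoc C c d c)
       \<cdot>\<^bsub>C\<^esub> reg.lw a (reg.rw k c) \<cdot>\<^bsub>C\<^esub> Assoc C a (Unit C) c \<cdot>\<^bsub>C\<^esub> reg.rw (inv_arr C (RUnit C a)) c"
    using a by (simp flip: RUnit_TObj add: reps_def reta_def reg.rw_Comp reg.natural_simps
        prefix[OF reg.pent_inv])
  also have "\<dots> = reg.lw a (RUnit C c \<cdot>\<^bsub>C\<^esub> reg.lw c ev \<cdot>\<^bsub>C\<^esub> Assoc C c d c \<cdot>\<^bsub>C\<^esub> reg.rw k c)
     \<cdot>\<^bsub>C\<^esub> Assoc C a (Unit C) c \<cdot>\<^bsub>C\<^esub> reg.rw (inv_arr C (RUnit C a)) c"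
    using a by (simp add: reg.lw_Comp)
  also have "\<dots> = Idn C (a \<otimes>\<^sub>o\<^bsub>C\<^esub> c)"
    unfolding reg.dualityD(9)[OF D] using a by (simp add: prefix[OF reg.tri] flip: reg.rw_Comp)
  finally show ?thesis .
qed

lemma reta_reps:
  assumes b: "b \<in> Obj C"
  shows "reg.rw (reps d c ev b) d \<cdot>\<^bsub>C\<^esub> reta d c k (b \<otimes>\<^sub>o\<^bsub>C\<^esub> d) = Idn C (b \<otimes>\<^sub>o\<^bsub>C\<^esub> d)"
proof -
  have *: "Assoc C b (d \<otimes>\<^sub>o\<^bsub>C\<^esub> c) d \<cdot>\<^bsub>C\<^esub> reg.rw (Assoc C b d c) d \<cdot>\<^bsub>C\<^esub> inv_arr C (Assoc C (b \<otimes>\<^sub>o\<^bsub>C\<^esub> d) c d)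
      = inv_arr C (reg.lw b (Assoc C d c d)) \<cdot>\<^bsub>C\<^esub> Assoc C b d (c \<otimes>\<^sub>o\<^bsub>C\<^esub> d)"
    using b by (simp add: prefix[OF reg.pent_inv'])
  have "reg.rw (reps d c ev b) d \<cdot>\<^bsub>C\<^esub> reta d c k (b \<otimes>\<^sub>o\<^bsub>C\<^esub> d)
     = reg.lw b (LUnit C d) \<cdot>\<^bsub>C\<^esub> reg.lw b (reg.rw ev d) \<cdot>\<^bsub>C\<^esub>
        (Assoc C b (d \<otimes>\<^sub>o\<^bsub>C\<^esub> c) d \<cdot>\<^bsub>C\<^esub> reg.rw (Assoc C b d c) d \<cdot>\<^bsub>C\<^esub> inv_arr C (Assoc C (b \<otimes>\<^sub>o\<^bsub>C\<^esub> d) c d))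
        \<cdot>\<^bsub>C\<^esub> reg.lw (b \<otimes>\<^sub>o\<^bsub>C\<^esub> d) k \<cdot>\<^bsub>C\<^esub> inv_arr C (RUnit C (b \<otimes>\<^sub>o\<^bsub>C\<^esub> d))"
    using b by (simp flip: reg.tri add: reps_def reta_def reg.rw_Comp reg.natural_simps)
  also have "\<dots> = reg.lw b (LUnit C d \<cdot>\<^bsub>C\<^esub> reg.rw ev d \<cdot>\<^bsub>C\<^esub> inv_arr C (Assoc C d c d) \<cdot>\<^bsub>C\<^esub> reg.lw d k)
     \<cdot>\<^bsub>C\<^esub> Assoc C b d (Unit C) \<cdot>\<^bsub>C\<^esub> inv_arr C (RUnit C (b \<otimes>\<^sub>o\<^bsub>C\<^esub> d))"
    unfolding * using b by (simp add: reg.lw_Comp reg.natural_simps)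
  also have "\<dots> = Idn C (b \<otimes>\<^sub>o\<^bsub>C\<^esub> d)"
    unfolding reg.dualityD(10)[OF D] using b by (simp add: prefix[OF RUnit_TObj])
  finally show ?thesis .
qed

lemma rsharp_rflat:
  assumes "u \<in> Arr C" "Dom C u = a \<otimes>\<^sub>o\<^bsub>C\<^esub> c" "a \<in> Obj C"
  shows "reps d c ev (Cod C u) \<cdot>\<^bsub>C\<^esub> reg.rw (reg.rw u d \<cdot>\<^bsub>C\<^esub> reta d c k a) c = u"
  using assms by (simp add: reg.rw_Comp prefix[OF reps_nat[of u "a \<otimes>\<^sub>o\<^bsub>C\<^esub> c", symmetric]] reps_reta)

lemma rflat_rsharp:
  assumes "v \<in> Arr C" "Cod C v = b \<otimes>\<^sub>o\<^bsub>C\<^esub> d" "b \<in> Obj C"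
  shows "reg.rw (reps d c ev b \<cdot>\<^bsub>C\<^esub> reg.rw v c) d \<cdot>\<^bsub>C\<^esub> reta d c k (Dom C v) = v"
  using assms by (simp add: reg.rw_Comp reta_nat prefix[OF reta_reps])

end

declare rdual [simp del]

end

section \<open>Half-braidings\<close>

context module_category
begin

text \<open>The exchange \<open>b.(c.w) -> c.(b.w)\<close> induced by \<open>t\<close>. With the
  associators absorbed, multiplicativity of a half-braiding becomes the composition of two exchanges
  (\<open>expand_hexagon\<close>).\<close>

definition expand where
  "expand b c t w = MAssoc N c b w \<diamondop> (t \<triangleleft> w) \<diamondop> inv_arr N (MAssoc N b c w)"

lemma expand_simps [simp]:
  assumes "b \<in> Obj C" "c \<in> Obj C" "t \<in> Arr C" "Dom C t = b \<otimes>\<^sub>o\<^bsub>C\<^esub> c" "Cod C t = c \<otimes>\<^sub>o\<^bsub>C\<^esub> b" "w \<in> Obj N"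
  shows "expand b c t w \<in> Arr N" "Dom N (expand b c t w) = b \<star> c \<star> w" "Cod N (expand b c t w) = c \<star> b \<star> w"
  using assms by (simp_all add: expand_def)

lemma expand_nat:
  assumes "b \<in> Obj C" "c \<in> Obj C" "t \<in> Arr C" "Dom C t = b \<otimes>\<^sub>o\<^bsub>C\<^esub> c" "Cod C t = c \<otimes>\<^sub>o\<^bsub>C\<^esub> b"
    "f \<in> Arr N" "Dom N f = x" "Cod N f = y"
  shows "(c \<triangleright> b \<triangleright> f) \<diamondop> expand b c t x = expand b c t y \<diamondop> (b \<triangleright> c \<triangleright> f)"
proof -
  have [simp]: "x \<in> Obj N" "y \<in> Obj N" using assms by auto
  have "(c \<triangleright> b \<triangleright> f) \<diamondop> expand b c t x
      = MAssoc N c b y \<diamondop> ((c \<otimes>\<^sub>o\<^bsub>C\<^esub> b) \<triangleright> f) \<diamondop> (t \<triangleleft> x) \<diamondop> inv_arr N (MAssoc N b c x)"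
    using assms by (simp add: expand_def natural_simps)
  also have "\<dots> = MAssoc N c b y \<diamondop> (t \<triangleleft> y) \<diamondop> ((b \<otimes>\<^sub>o\<^bsub>C\<^esub> c) \<triangleright> f) \<diamondop> inv_arr N (MAssoc N b c x)"
    using assms by (simp add: N.prefix[OF interchange[of t f "b \<otimes>\<^sub>o\<^bsub>C\<^esub> c"]])
  also have "\<dots> = expand b c t y \<diamondop> (b \<triangleright> c \<triangleright> f)"
    using assms by (simp add: expand_def MAssoc_inv_lw)
  finally show ?thesis .
qed

end

context monoidal_linear_category
begin

text \<open>The value at \<open>c \<otimes> d\<close> that multiplicativity prescribes for the
  inverse of a half-braiding, given its values \<open>s\<close> at \<open>c\<close> and
  \<open>t\<close> at \<open>d\<close>.\<close>

definition hexagon where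
  "hexagon b c d s t = inv_arr C (Assoc C c d b) \<cdot>\<^bsub>C\<^esub> (c \<triangleright>\<^sub>C t) \<cdot>\<^bsub>C\<^esub> Assoc C c b d \<cdot>\<^bsub>C\<^esub> (s \<triangleleft>\<^sub>C d)
     \<cdot>\<^bsub>C\<^esub> inv_arr C (Assoc C b c d)"

end

context module_category
begin

lemma expand_hexagon:
  assumes "b \<in> Obj C" "c \<in> Obj C" "d \<in> Obj C" "w \<in> Obj N"
    "s \<in> Arr C" "Dom C s = b \<otimes>\<^sub>o\<^bsub>C\<^esub> c" "Cod C s = c \<otimes>\<^sub>o\<^bsub>C\<^esub> b"
    "t \<in> Arr C" "Dom C t = b \<otimes>\<^sub>o\<^bsub>C\<^esub> d" "Cod C t = d \<otimes>\<^sub>o\<^bsub>C\<^esub> b"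
  shows "MAssoc N c d (b \<star> w) \<diamondop> MAssoc N (c \<otimes>\<^sub>o\<^bsub>C\<^esub> d) b w \<diamondop> (C.hexagon b c d s t \<triangleleft> w)
    = (c \<triangleright> expand b d t w) \<diamondop> expand b c s (d \<star> w) \<diamondop> (b \<triangleright> MAssoc N c d w) \<diamondop> MAssoc N b (c \<otimes>\<^sub>o\<^bsub>C\<^esub> d) w"
  using assms
  by (simp add: C.hexagon_def expand_def rw_Comp lw_Comp natural_simps pent_inv pent_inv'
      N.prefix[OF pent_inv] N.prefix[OF pent_inv'])

end

locale rigid_category = monoidal_linear_category C
  for C :: "('k::field, 'c, 'd, 'z) tensor_cat_scheme" +
  assumes right_dual: "c \<in> Obj C \<Longrightarrow> duality C (RDual C c) c (REv C c) (RCoev C c)"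
    and left_dual: "c \<in> Obj C \<Longrightarrow> duality C c (LDual C c) (LEv C c) (LCoev C c)"
begin

lemma RDual_Obj [simp]: "c \<in> Obj C \<Longrightarrow> RDual C c \<in> Obj C"
  and LDual_Obj [simp]: "c \<in> Obj C \<Longrightarrow> LDual C c \<in> Obj C"
  using right_dual left_dual by (auto simp: duality_def)

text \<open>A lax half-braiding on a rigid category is invertible: the inverse at \<open>c\<close> is the
  mate of the component at the left dual of \<open>c\<close>.\<close>

lemma lax_half_braiding_iso:
  assumes b: "b \<in> Obj C"
    and t: "\<And>c. c \<in> Obj C \<Longrightarrow> t c \<in> Hom C (b \<otimes>\<^sub>o\<^bsub>C\<^esub> c) (c \<otimes>\<^sub>o\<^bsub>C\<^esub> b)"
    and nat: "\<And>f. f \<in> Arr C \<Longrightarrow> (f \<triangleleft>\<^sub>C b) \<cdot>\<^bsub>C\<^esub> t (Dom C f) = t (Cod C f) \<cdot>\<^bsub>C\<^esub> (b \<triangleright>\<^sub>C f)"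
    and hex: "\<And>c d. \<lbrakk>c \<in> Obj C; d \<in> Obj C\<rbrakk> \<Longrightarrow> t (c \<otimes>\<^sub>o\<^bsub>C\<^esub> d) = hexagon b c d (t c) (t d)"
    and unit: "LUnit C b \<cdot>\<^bsub>C\<^esub> t (Unit C) = RUnit C b"
    and c: "c \<in> Obj C"
  shows "iso_arr C (t c)"
proof -
  have t' [simp]: "t c \<in> Arr C" "Dom C (t c) = b \<otimes>\<^sub>o\<^bsub>C\<^esub> c" "Cod C (t c) = c \<otimes>\<^sub>o\<^bsub>C\<^esub> b" if "c \<in> Obj C" for c
    using t[OF that] by (auto simp: Hom_def)
  note b[simp] c[simp]
  \<comment> \<open>\<open>c\<close> is a right dual of its left dual \<open>l\<close>, so
    \<open>c\<close> acts as left adjoint of \<open>l\<close>, and the mate of the component at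
    \<open>l\<close> points from \<open>c.(b.w)\<close> to \<open>b.(c.w)\<close>.\<close>
  define l ev k where "l = LDual C c" and "ev = LEv C c" and "k = LCoev C c"
  have D: "duality C c l ev k"
    using left_dual[OF c] by (simp add: l_def ev_def k_def)
  note [simp] = reg.dual[OF D] reg.eta_simps[OF D] reg.eps_simps[OF D]
  \<comment> \<open>Passing from \<open>t\<close> to exchanges with a third factor \<open>w\<close>
    makes room for the unit and counit of the dual pair, which are natural in
    \<open>w\<close>.\<close>
  define T where "T c w = reg.expand b c (t c) w" for c w
  have T [simp]: "T c w \<in> Arr C" "Dom C (T c w) = b \<otimes>\<^sub>o\<^bsub>C\<^esub> c \<otimes>\<^sub>o\<^bsub>C\<^esub> w" "Cod C (T c w) = c \<otimes>\<^sub>o\<^bsub>C\<^esub> b \<otimes>\<^sub>o\<^bsub>C\<^esub> w"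
    if "c \<in> Obj C" "w \<in> Obj C" for c w
    using that by (simp_all add: T_def)
  have T_nat: "(c \<triangleright>\<^sub>C b \<triangleright>\<^sub>C f) \<cdot>\<^bsub>C\<^esub> T c x = T c y \<cdot>\<^bsub>C\<^esub> (b \<triangleright>\<^sub>C c \<triangleright>\<^sub>C f)"
    if "c \<in> Obj C" "f \<in> Arr C" "Dom C f = x" "Cod C f = y" for c f x y
    unfolding T_def using that by (intro reg.expand_nat) simp_all
  have T_nat': "(f \<triangleleft>\<^sub>C (b \<otimes>\<^sub>o\<^bsub>C\<^esub> w)) \<cdot>\<^bsub>C\<^esub> T x w = T y w \<cdot>\<^bsub>C\<^esub> (b \<triangleright>\<^sub>C f \<triangleleft>\<^sub>C w)"
    if f: "f \<in> Arr C" "Dom C f = x" "Cod C f = y" and w: "w \<in> Obj C" for f x y w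
  proof -
    have [simp]: "x \<in> Obj C" "y \<in> Obj C" using f by auto
    have "(f \<triangleleft>\<^sub>C (b \<otimes>\<^sub>o\<^bsub>C\<^esub> w)) \<cdot>\<^bsub>C\<^esub> T x w
        = Assoc C y b w \<cdot>\<^bsub>C\<^esub> ((f \<triangleleft>\<^sub>C b) \<cdot>\<^bsub>C\<^esub> t x) \<triangleleft>\<^sub>C w \<cdot>\<^bsub>C\<^esub> inv_arr C (Assoc C b x w)"
      using f w by (simp add: T_def reg.expand_def reg.natural_simps reg.rw_Comp)
    also have "\<dots> = Assoc C y b w \<cdot>\<^bsub>C\<^esub> (t y \<cdot>\<^bsub>C\<^esub> (b \<triangleright>\<^sub>C f)) \<triangleleft>\<^sub>C w \<cdot>\<^bsub>C\<^esub> inv_arr C (Assoc C b x w)"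
      using nat[OF f(1)] f by simp
    also have "\<dots> = T y w \<cdot>\<^bsub>C\<^esub> (b \<triangleright>\<^sub>C f \<triangleleft>\<^sub>C w)"
      using f w by (simp add: T_def reg.expand_def reg.rw_Comp reg.MAssoc_inv_mw)
    finally show ?thesis .
  qed
  have T_hex: "(c \<triangleright>\<^sub>C T d w) \<cdot>\<^bsub>C\<^esub> T c (d \<otimes>\<^sub>o\<^bsub>C\<^esub> w)
      = Assoc C c d (b \<otimes>\<^sub>o\<^bsub>C\<^esub> w) \<cdot>\<^bsub>C\<^esub> T (c \<otimes>\<^sub>o\<^bsub>C\<^esub> d) w \<cdot>\<^bsub>C\<^esub> (b \<triangleright>\<^sub>C inv_arr C (Assoc C c d w))"
    if "c \<in> Obj C" "d \<in> Obj C" "w \<in> Obj C" for c d w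
  proof -
    have "Assoc C c d (b \<otimes>\<^sub>o\<^bsub>C\<^esub> w) \<cdot>\<^bsub>C\<^esub> T (c \<otimes>\<^sub>o\<^bsub>C\<^esub> d) w \<cdot>\<^bsub>C\<^esub> (b \<triangleright>\<^sub>C inv_arr C (Assoc C c d w))
        = (Assoc C c d (b \<otimes>\<^sub>o\<^bsub>C\<^esub> w) \<cdot>\<^bsub>C\<^esub> Assoc C (c \<otimes>\<^sub>o\<^bsub>C\<^esub> d) b w \<cdot>\<^bsub>C\<^esub> (hexagon b c d (t c) (t d) \<triangleleft>\<^sub>C w))
          \<cdot>\<^bsub>C\<^esub> inv_arr C (Assoc C b (c \<otimes>\<^sub>o\<^bsub>C\<^esub> d) w) \<cdot>\<^bsub>C\<^esub> (b \<triangleright>\<^sub>C inv_arr C (Assoc C c d w))"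
      using that t'[of "c \<otimes>\<^sub>o\<^bsub>C\<^esub> d"] by (simp add: T_def reg.expand_def hex[symmetric] del: t')
    also have "\<dots> = (c \<triangleright>\<^sub>C T d w) \<cdot>\<^bsub>C\<^esub> T c (d \<otimes>\<^sub>o\<^bsub>C\<^esub> w)"
      using that by (subst reg.expand_hexagon) (simp_all add: T_def flip: reg.lw_Comp)
    finally show ?thesis ..
  qed
  have T_unit: "LUnit C (b \<otimes>\<^sub>o\<^bsub>C\<^esub> w) \<cdot>\<^bsub>C\<^esub> T (Unit C) w = b \<triangleright>\<^sub>C LUnit C w" if "w \<in> Obj C" for w
  proof -
    have "LUnit C (b \<otimes>\<^sub>o\<^bsub>C\<^esub> w) \<cdot>\<^bsub>C\<^esub> T (Unit C) w
        = (LUnit C b \<cdot>\<^bsub>C\<^esub> t (Unit C)) \<triangleleft>\<^sub>C w \<cdot>\<^bsub>C\<^esub> inv_arr C (Assoc C b (Unit C) w)"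
      using that by (simp add: T_def reg.expand_def prefix[OF reg.MUnit_act] reg.rw_Comp)
    also have "\<dots> = b \<triangleright>\<^sub>C LUnit C w"
      unfolding unit using that by (simp flip: reg.tri)
    finally show ?thesis .
  qed
  \<comment> \<open>The exchange respects evaluation: the hexagon combines two exchanges into the
    one with \<open>c \<otimes> l\<close>, naturality moves it past \<open>ev\<close>, and the
    exchange with the unit object is trivial. The next fact is its counterpart for
    coevaluation.\<close>
  have eps: "reg.eps c l ev (b \<otimes>\<^sub>o\<^bsub>C\<^esub> y) \<cdot>\<^bsub>C\<^esub> (c \<triangleright>\<^sub>C T l y) \<cdot>\<^bsub>C\<^esub> T c (l \<otimes>\<^sub>o\<^bsub>C\<^esub> y) = b \<triangleright>\<^sub>C reg.eps c l ev y"
    if y: "y \<in> Obj C" for y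
  proof -
    have "reg.eps c l ev (b \<otimes>\<^sub>o\<^bsub>C\<^esub> y) \<cdot>\<^bsub>C\<^esub> (c \<triangleright>\<^sub>C T l y) \<cdot>\<^bsub>C\<^esub> T c (l \<otimes>\<^sub>o\<^bsub>C\<^esub> y)
       = LUnit C (b \<otimes>\<^sub>o\<^bsub>C\<^esub> y) \<cdot>\<^bsub>C\<^esub> (ev \<triangleleft>\<^sub>C (b \<otimes>\<^sub>o\<^bsub>C\<^esub> y)) \<cdot>\<^bsub>C\<^esub> T (c \<otimes>\<^sub>o\<^bsub>C\<^esub> l) y \<cdot>\<^bsub>C\<^esub> (b \<triangleright>\<^sub>C inv_arr C (Assoc C c l y))"
      using y by (simp add: T_hex reg.eps_def)
    also have "\<dots> = (LUnit C (b \<otimes>\<^sub>o\<^bsub>C\<^esub> y) \<cdot>\<^bsub>C\<^esub> T (Unit C) y) \<cdot>\<^bsub>C\<^esub> (b \<triangleright>\<^sub>C ev \<triangleleft>\<^sub>C y) \<cdot>\<^bsub>C\<^esub> (b \<triangleright>\<^sub>C inv_arr C (Assoc C c l y))"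
      using y by (simp add: prefix[OF T_nat'[of ev "c \<otimes>\<^sub>o\<^bsub>C\<^esub> l" "Unit C"]])
    also have "\<dots> = b \<triangleright>\<^sub>C reg.eps c l ev y"
      unfolding T_unit[OF y] using y by (simp add: reg.eps_def reg.lw_Comp)
    finally show ?thesis .
  qed
  have eta: "(l \<triangleright>\<^sub>C T c w) \<cdot>\<^bsub>C\<^esub> T l (c \<otimes>\<^sub>o\<^bsub>C\<^esub> w) \<cdot>\<^bsub>C\<^esub> (b \<triangleright>\<^sub>C reg.eta c l k w) = reg.eta c l k (b \<otimes>\<^sub>o\<^bsub>C\<^esub> w)"
    if w: "w \<in> Obj C" for w
  proof -
    have u: "T (Unit C) w \<cdot>\<^bsub>C\<^esub> (b \<triangleright>\<^sub>C inv_arr C (LUnit C w)) = inv_arr C (LUnit C (b \<otimes>\<^sub>o\<^bsub>C\<^esub> w))"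
    proof -
      have "T (Unit C) w = inv_arr C (LUnit C (b \<otimes>\<^sub>o\<^bsub>C\<^esub> w)) \<cdot>\<^bsub>C\<^esub> (b \<triangleright>\<^sub>C LUnit C w)"
        using T_unit[OF w] w by (intro move_inv_left) simp_all
      then show ?thesis using w by (simp flip: reg.lw_Comp)
    qed
    have "(l \<triangleright>\<^sub>C T c w) \<cdot>\<^bsub>C\<^esub> T l (c \<otimes>\<^sub>o\<^bsub>C\<^esub> w) \<cdot>\<^bsub>C\<^esub> (b \<triangleright>\<^sub>C reg.eta c l k w)
      = Assoc C l c (b \<otimes>\<^sub>o\<^bsub>C\<^esub> w) \<cdot>\<^bsub>C\<^esub> T (l \<otimes>\<^sub>o\<^bsub>C\<^esub> c) w \<cdot>\<^bsub>C\<^esub> (b \<triangleright>\<^sub>C k \<triangleleft>\<^sub>C w) \<cdot>\<^bsub>C\<^esub> (b \<triangleright>\<^sub>C inv_arr C (LUnit C w))"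
      using w by (simp add: prefix[OF T_hex] reg.eta_def prefix[OF reg.lw_Comp[symmetric]] flip: reg.lw_Comp)
    also have "\<dots> = reg.eta c l k (b \<otimes>\<^sub>o\<^bsub>C\<^esub> w)"
      using w by (simp add: prefix[OF T_nat'[of k "Unit C" "l \<otimes>\<^sub>o\<^bsub>C\<^esub> c", symmetric]] u reg.eta_def)
    finally show ?thesis .
  qed
  \<comment> \<open>The mate of the exchange with \<open>l\<close>. Composed with the exchange at
    \<open>c\<close>, it collapses by \<open>eps\<close> on one side and by \<open>eta\<close> on
    the other.\<close>
  define S where "S w = reg.eps c l ev (b \<otimes>\<^sub>o\<^bsub>C\<^esub> c \<otimes>\<^sub>o\<^bsub>C\<^esub> w) \<cdot>\<^bsub>C\<^esub> (c \<triangleright>\<^sub>C T l (c \<otimes>\<^sub>o\<^bsub>C\<^esub> w)) \<cdot>\<^bsub>C\<^esub> (c \<triangleright>\<^sub>C b \<triangleright>\<^sub>C reg.eta c l k w)" for w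
  have "inverse_arrows C (T c w) (S w)" if w: "w \<in> Obj C" for w
  proof (rule inverse_arrowsI)
    have "S w \<cdot>\<^bsub>C\<^esub> T c w = (reg.eps c l ev (b \<otimes>\<^sub>o\<^bsub>C\<^esub> c \<otimes>\<^sub>o\<^bsub>C\<^esub> w) \<cdot>\<^bsub>C\<^esub> (c \<triangleright>\<^sub>C T l (c \<otimes>\<^sub>o\<^bsub>C\<^esub> w))
        \<cdot>\<^bsub>C\<^esub> T c (l \<otimes>\<^sub>o\<^bsub>C\<^esub> c \<otimes>\<^sub>o\<^bsub>C\<^esub> w)) \<cdot>\<^bsub>C\<^esub> (b \<triangleright>\<^sub>C c \<triangleright>\<^sub>C reg.eta c l k w)"
      using w by (simp add: S_def T_nat)
    then show "S w \<cdot>\<^bsub>C\<^esub> T c w = Idn C (Dom C (T c w))"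
      using w by (simp add: eps reg.eps_eta[OF D] flip: reg.lw_Comp)
    have "T c w \<cdot>\<^bsub>C\<^esub> S w = reg.eps c l ev (c \<otimes>\<^sub>o\<^bsub>C\<^esub> b \<otimes>\<^sub>o\<^bsub>C\<^esub> w) \<cdot>\<^bsub>C\<^esub>
       (c \<triangleright>\<^sub>C ((l \<triangleright>\<^sub>C T c w) \<cdot>\<^bsub>C\<^esub> T l (c \<otimes>\<^sub>o\<^bsub>C\<^esub> w) \<cdot>\<^bsub>C\<^esub> (b \<triangleright>\<^sub>C reg.eta c l k w)))"
      using w by (simp add: S_def prefix[OF reg.eps_nat[OF D, symmetric]] reg.lw_Comp)
    then show "T c w \<cdot>\<^bsub>C\<^esub> S w = Idn C (Cod C (T c w))"
      using w by (simp add: eta reg.eps_eta[OF D])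
  qed (use w in \<open>simp_all add: S_def\<close>)
  \<comment> \<open>With \<open>w\<close> the unit object, the exchange is \<open>t c\<close>
    tensored with the unit up to associators, and \<open>RUnit\<close> removes that factor.\<close>
  then have "iso_arr C (T c (Unit C))"
    by (rule inv_arrI(1)) simp
  then have *: "iso_arr C (inv_arr C (Assoc C c b (Unit C)) \<cdot>\<^bsub>C\<^esub> T c (Unit C) \<cdot>\<^bsub>C\<^esub> Assoc C b c (Unit C))"
    by (intro iso_Comp) simp_all
  have "inv_arr C (Assoc C c b (Unit C)) \<cdot>\<^bsub>C\<^esub> T c (Unit C) \<cdot>\<^bsub>C\<^esub> Assoc C b c (Unit C) = t c \<triangleleft>\<^sub>C Unit C"
    by (simp add: T_def reg.expand_def)
  with * have "iso_arr C (t c \<triangleleft>\<^sub>C Unit C)" by simp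
  then have "iso_arr C (RUnit C (c \<otimes>\<^sub>o\<^bsub>C\<^esub> b) \<cdot>\<^bsub>C\<^esub> (t c \<triangleleft>\<^sub>C Unit C) \<cdot>\<^bsub>C\<^esub> inv_arr C (RUnit C (b \<otimes>\<^sub>o\<^bsub>C\<^esub> c)))"
    by (intro iso_Comp) simp_all
  moreover have "RUnit C (c \<otimes>\<^sub>o\<^bsub>C\<^esub> b) \<cdot>\<^bsub>C\<^esub> (t c \<triangleleft>\<^sub>C Unit C) \<cdot>\<^bsub>C\<^esub> inv_arr C (RUnit C (b \<otimes>\<^sub>o\<^bsub>C\<^esub> c)) = t c"
    using prefix[OF reg.RUnit_nat[of "t c"]] by simp
  ultimately show ?thesis by simp
qed

end

section \<open>Universal families between module functors\<close>

locale rigid_module_category = C: rigid_category C + module_category C N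
  for C :: "('k::field, 'c, 'd, 'z) tensor_cat_scheme"
    and N :: "('k, 'c, 'd, 'p, 'q, 'x) module_cat_scheme"

locale module_functors = rigid_module_category C N
  for C :: "('k::field, 'c, 'd, 'z) tensor_cat_scheme"
    and N :: "('k, 'c, 'd, 'p, 'q, 'x) module_cat_scheme" +
  fixes M :: "('k, 'c, 'd, 'o, 'm, 'y) module_cat_scheme"
  assumes M: "module_category C M"
begin

lemma category_M: "category M"
  using M by (simp add: module_category_def linear_category_def)

lemmas M_simps [simp] = category.Dom_Obj[OF category_M] category.Cod_Obj[OF category_M]
  category.Idn_simps[OF category_M] module_category.Act_Obj[OF M] module_category.ActMor_simps[OF M]
  module_category.MAssoc_simps(1-3)[OF M] module_category.MUnit_simps(1-3)[OF M]

lemma functD: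
  assumes "is_module_functor C M N K"
  shows "x \<in> Obj M \<Longrightarrow> FObj K x \<in> Obj N"
    "f \<in> Arr M \<Longrightarrow> FMor K f \<in> Arr N" "f \<in> Arr M \<Longrightarrow> Dom N (FMor K f) = FObj K (Dom M f)"
    "f \<in> Arr M \<Longrightarrow> Cod N (FMor K f) = FObj K (Cod M f)"
    "\<lbrakk>c \<in> Obj C; x \<in> Obj M\<rbrakk> \<Longrightarrow> FCon K c x \<in> Arr N"
    "\<lbrakk>c \<in> Obj C; x \<in> Obj M\<rbrakk> \<Longrightarrow> Dom N (FCon K c x) = FObj K (c \<rhd>\<^sub>o\<^bsub>M\<^esub> x)"
    "\<lbrakk>c \<in> Obj C; x \<in> Obj M\<rbrakk> \<Longrightarrow> Cod N (FCon K c x) = c \<star> FObj K x"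
    "\<lbrakk>c \<in> Obj C; x \<in> Obj M\<rbrakk> \<Longrightarrow> iso_arr N (FCon K c x)"
  using assms by (auto simp: is_module_functor_def is_linear_functor_def is_functor_def Hom_def)

lemma functIdn:
  "is_module_functor C M N K \<Longrightarrow> x \<in> Obj M \<Longrightarrow> FMor K (Idn M x) = Idn N (FObj K x)"
  by (simp add: is_module_functor_def is_linear_functor_def is_functor_def)

lemma FCon_nat:
  assumes "is_module_functor C M N K" "c \<in> Obj C" "f \<in> Arr M" "Dom M f = x" "Cod M f = y"
  shows "FCon K c y \<diamondop> FMor K (Idn C c \<rhd>\<^sub>m\<^bsub>M\<^esub> f) = (c \<triangleright> FMor K f) \<diamondop> FCon K c x"
proof -
  have "FCon K (Cod C (Idn C c)) (Cod M f) \<diamondop> FMor K (Idn C c \<rhd>\<^sub>m\<^bsub>M\<^esub> f)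
      = (Idn C c \<rhd>\<^sub>m\<^bsub>N\<^esub> FMor K f) \<diamondop> FCon K (Dom C (Idn C c)) (Dom M f)"
    using assms(1,3) C.Idn_simps(1)[OF assms(2)] unfolding is_module_functor_def by meson
  then show ?thesis
    using assms by (simp add: lw_def)
qed

lemma FCon_nat':
  assumes K: "is_module_functor C M N K" and "u \<in> Arr C" "x \<in> Obj M" "Dom C u = c" "Cod C u = d"
  shows "FCon K d x \<diamondop> FMor K (u \<rhd>\<^sub>m\<^bsub>M\<^esub> Idn M x) = (u \<triangleleft> FObj K x) \<diamondop> FCon K c x"
proof -
  have "FCon K (Cod C u) (Cod M (Idn M x)) \<diamondop> FMor K (u \<rhd>\<^sub>m\<^bsub>M\<^esub> Idn M x)
      = (u \<rhd>\<^sub>m\<^bsub>N\<^esub> FMor K (Idn M x)) \<diamondop> FCon K (Dom C u) (Dom M (Idn M x))"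
    using K assms(2,3) unfolding is_module_functor_def by (meson M_simps(3))
  then show ?thesis
    using assms by (simp add: rw_def functIdn)
qed

lemma FCon_mult:
  assumes "is_module_functor C M N K" "c \<in> Obj C" "d \<in> Obj C" "x \<in> Obj M"
  shows "MAssoc N c d (FObj K x) \<diamondop> FCon K (c \<otimes>\<^sub>o\<^bsub>C\<^esub> d) x
     = (c \<triangleright> FCon K d x) \<diamondop> FCon K c (d \<rhd>\<^sub>o\<^bsub>M\<^esub> x) \<diamondop> FMor K (MAssoc M c d x)"
  using assms by (simp add: is_module_functor_def lw_def)

lemma FCon_unit:
  assumes "is_module_functor C M N K" "x \<in> Obj M"
  shows "MUnit N (FObj K x) \<diamondop> FCon K (Unit C) x = FMor K (MUnit M x)"
  using assms by (simp add: is_module_functor_def)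

end

locale module_functor_pair = module_functors C N M
  for C :: "('k::field, 'c, 'd, 'z) tensor_cat_scheme"
    and N :: "('k, 'c, 'd, 'p, 'q, 'x) module_cat_scheme"
    and M :: "('k, 'c, 'd, 'o, 'm, 'y) module_cat_scheme" +
  fixes F G :: "('c, 'o, 'm, 'p, 'q) mfunct"
  assumes F: "is_module_functor C M N F" and G: "is_module_functor C M N G"
begin

lemmas F_simps [simp] = functD[OF F]
lemmas G_simps [simp] = functD[OF G]

text \<open>Natural families from \<open>a.F\<close> to \<open>c.G\<close>, with no condition on
  module constraints: these are what an end can see. \<open>family1\<close> is the case without the
  factor \<open>c\<close>, kept separate to avoid a unit constraint.\<close>

definition family :: "'c \<Rightarrow> 'c \<Rightarrow> ('o \<Rightarrow> 'q) \<Rightarrow> bool" where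
  "family a c \<xi> \<longleftrightarrow> (\<forall>x \<in> Obj M. \<xi> x \<in> Hom N (a \<star> FObj F x) (c \<star> FObj G x)) \<and>
     (\<forall>f \<in> Arr M. (c \<triangleright> FMor G f) \<diamondop> \<xi> (Dom M f) = \<xi> (Cod M f) \<diamondop> (a \<triangleright> FMor F f))"

definition family1 :: "'c \<Rightarrow> ('o \<Rightarrow> 'q) \<Rightarrow> bool" where
  "family1 a \<xi> \<longleftrightarrow> (\<forall>x \<in> Obj M. \<xi> x \<in> Hom N (a \<star> FObj F x) (FObj G x)) \<and>
     (\<forall>f \<in> Arr M. FMor G f \<diamondop> \<xi> (Dom M f) = \<xi> (Cod M f) \<diamondop> (a \<triangleright> FMor F f))"

text \<open>\<open>g\<close> represents the contravariant functor that sends \<open>a\<close> to the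
  natural families from \<open>a.F\<close> to \<open>G\<close>. Compatibility is tested on the
  objects of \<open>M\<close>, where the values of a family are meaningful.\<close>

definition universal_family :: "'c \<Rightarrow> ('o \<Rightarrow> 'q) \<Rightarrow> bool" where
  "universal_family g \<epsilon> \<longleftrightarrow> g \<in> Obj C \<and> family1 g \<epsilon> \<and>
     (\<forall>a \<in> Obj C. \<forall>\<xi>. family1 a \<xi> \<longrightarrow>
        (\<exists>!u. u \<in> Hom C a g \<and> (\<forall>x \<in> Obj M. \<epsilon> x \<diamondop> (u \<triangleleft> FObj F x) = \<xi> x)))"

end

locale universal_pair = module_functor_pair C N M F G
  for C :: "('k::field, 'c, 'd, 'z) tensor_cat_scheme"
    and N :: "('k, 'c, 'd, 'p, 'q, 'x) module_cat_scheme"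
    and M :: "('k, 'c, 'd, 'o, 'm, 'y) module_cat_scheme" and F G :: "('c, 'o, 'm, 'p, 'q) mfunct" +
  fixes g :: 'c and \<epsilon> :: "'o \<Rightarrow> 'q"
  assumes universal: "universal_family g \<epsilon>"
begin

lemma g_Obj [simp]: "g \<in> Obj C"
  using universal by (simp add: universal_family_def)

lemma \<epsilon>_simps [simp]:
  assumes "x \<in> Obj M"
  shows "\<epsilon> x \<in> Arr N" "Dom N (\<epsilon> x) = g \<star> FObj F x" "Cod N (\<epsilon> x) = FObj G x"
  using universal assms by (auto simp: universal_family_def family1_def Hom_def)

lemma \<epsilon>_nat:
  "f \<in> Arr M \<Longrightarrow> Dom M f = x \<Longrightarrow> Cod M f = y \<Longrightarrow> FMor G f \<diamondop> \<epsilon> x = \<epsilon> y \<diamondop> (g \<triangleright> FMor F f)"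
  using universal by (auto simp: universal_family_def family1_def)

lemma universal_exists:
  assumes "a \<in> Obj C" "family1 a \<xi>"
  shows "\<exists>u. u \<in> Hom C a g \<and> (\<forall>x \<in> Obj M. \<epsilon> x \<diamondop> (u \<triangleleft> FObj F x) = \<xi> x)"
  using universal assms unfolding universal_family_def by blast

lemma family1_rw:
  assumes u: "u \<in> Hom C a g"
  shows "family1 a (\<lambda>x. \<epsilon> x \<diamondop> (u \<triangleleft> FObj F x))"
proof -
  have [simp]: "u \<in> Arr C" "Dom C u = a" "Cod C u = g" "a \<in> Obj C" using u by (auto simp: Hom_def)
  have "FMor G f \<diamondop> \<epsilon> (Dom M f) \<diamondop> (u \<triangleleft> FObj F (Dom M f))
      = (\<epsilon> (Cod M f) \<diamondop> (u \<triangleleft> FObj F (Cod M f))) \<diamondop> (a \<triangleright> FMor F f)" if "f \<in> Arr M" for f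
    using that interchange[of u "FMor F f" a g]
    by (simp add: N.prefix[OF \<epsilon>_nat] )
  then show ?thesis by (simp add: family1_def Hom_def)
qed

text \<open>Uniqueness in \<open>universal_family\<close> is phrased for a given family;
  \<open>family1_rw\<close> supplies the one obtained from \<open>v\<close>.\<close>

lemma universal_inj:
  assumes "u \<in> Hom C a g" "v \<in> Hom C a g"
    "\<And>x. x \<in> Obj M \<Longrightarrow> \<epsilon> x \<diamondop> (u \<triangleleft> FObj F x) = \<epsilon> x \<diamondop> (v \<triangleleft> FObj F x)"
  shows "u = v"
proof -
  have "a \<in> Obj C" using assms(1) by (auto simp: Hom_def)
  then have "\<exists>!w. w \<in> Hom C a g \<and> (\<forall>x \<in> Obj M. \<epsilon> x \<diamondop> (w \<triangleleft> FObj F x) = \<epsilon> x \<diamondop> (v \<triangleleft> FObj F x))"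
    using universal family1_rw[OF assms(2)] by (simp add: universal_family_def)
  then show ?thesis using assms by blast
qed

text \<open>Since \<open>RDual c\<close> acts as a left adjoint of \<open>c\<close>, the family \<open>c.\<epsilon>\<close> is universal again, now for
  families with values in \<open>c.G\<close>.\<close>

lemma universal_act_inj:
  assumes c: "c \<in> Obj C" and u: "u \<in> Hom C a (c \<otimes>\<^sub>o\<^bsub>C\<^esub> g)" and v: "v \<in> Hom C a (c \<otimes>\<^sub>o\<^bsub>C\<^esub> g)"
    and eq: "\<And>x. x \<in> Obj M \<Longrightarrow> (c \<triangleright> \<epsilon> x) \<diamondop> MAssoc N c g (FObj F x) \<diamondop> (u \<triangleleft> FObj F x)
      = (c \<triangleright> \<epsilon> x) \<diamondop> MAssoc N c g (FObj F x) \<diamondop> (v \<triangleleft> FObj F x)"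
  shows "u = v"
proof -
  note D = C.right_dual[OF c]
  let ?r = "RDual C c" and ?e = "C.reg.eps (RDual C c) c (REv C c) g"
  note [simp] = c C.reg.eps_simps[OF D] eps_simps[OF D]
  have uv [simp]: "u \<in> Arr C" "Dom C u = a" "Cod C u = c \<otimes>\<^sub>o\<^bsub>C\<^esub> g" "a \<in> Obj C"
      "v \<in> Arr C" "Dom C v = a" "Cod C v = c \<otimes>\<^sub>o\<^bsub>C\<^esub> g"
    using u v by (auto simp: Hom_def)
  have *: "\<epsilon> x \<diamondop> ((?e \<cdot>\<^bsub>C\<^esub> (?r \<triangleright>\<^sub>C w)) \<triangleleft> FObj F x) = eps ?r c (REv C c) (FObj G x) \<diamondop>
      (?r \<triangleright> ((c \<triangleright> \<epsilon> x) \<diamondop> MAssoc N c g (FObj F x) \<diamondop> (w \<triangleleft> FObj F x))) \<diamondop> MAssoc N ?r a (FObj F x)"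
    if "w \<in> Arr C" "Dom C w = a" "Cod C w = c \<otimes>\<^sub>o\<^bsub>C\<^esub> g" "x \<in> Obj M" for w x
    using that by (simp add: sharp_act[OF D, of w g _ a] N.prefix[OF eps_nat[OF D, symmetric]] lw_Comp)
  have "?e \<cdot>\<^bsub>C\<^esub> (?r \<triangleright>\<^sub>C u) = ?e \<cdot>\<^bsub>C\<^esub> (?r \<triangleright>\<^sub>C v)"
    by (rule universal_inj[of _ "?r \<otimes>\<^sub>o\<^bsub>C\<^esub> a"]) (simp_all add: Hom_def * eq)
  then show ?thesis
    by (rule C.reg.sharp_inj[OF D]) simp_all
qed

lemma universal_act_exists:
  assumes c: "c \<in> Obj C" and a: "a \<in> Obj C" and \<xi>: "family a c \<xi>"
  shows "\<exists>u. u \<in> Hom C a (c \<otimes>\<^sub>o\<^bsub>C\<^esub> g) \<and>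
    (\<forall>x \<in> Obj M. (c \<triangleright> \<epsilon> x) \<diamondop> MAssoc N c g (FObj F x) \<diamondop> (u \<triangleleft> FObj F x) = \<xi> x)"
proof -
  note D = C.right_dual[OF c]
  let ?r = "RDual C c" and ?e = "C.reg.eps (RDual C c) c (REv C c) g"
  note [simp] = c a C.reg.eps_simps[OF D] eps_simps[OF D] C.reg.eta_simps[OF D]
  have \<xi>' [simp]: "\<xi> x \<in> Arr N" "Dom N (\<xi> x) = a \<star> FObj F x" "Cod N (\<xi> x) = c \<star> FObj G x" if "x \<in> Obj M" for x
    using \<xi> that by (auto simp: family_def Hom_def)
  have \<xi>_nat: "(c \<triangleright> FMor G f) \<diamondop> \<xi> (Dom M f) = \<xi> (Cod M f) \<diamondop> (a \<triangleright> FMor F f)" if "f \<in> Arr M" for f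
    using \<xi> that by (auto simp: family_def)
  \<comment> \<open>The transpose of \<open>\<xi>\<close> along the adjunction between
    \<open>RDual c\<close> and \<open>c\<close>, a family from
    \<open>(RDual c \<otimes> a).F\<close> to \<open>G\<close>.\<close>
  define \<zeta> where "\<zeta> x = eps ?r c (REv C c) (FObj G x) \<diamondop> (?r \<triangleright> \<xi> x) \<diamondop> MAssoc N ?r a (FObj F x)" for x
  have "family1 (?r \<otimes>\<^sub>o\<^bsub>C\<^esub> a) \<zeta>"
    unfolding family1_def
  proof (intro conjI ballI)
    fix f assume f: "f \<in> Arr M"
    have "FMor G f \<diamondop> \<zeta> (Dom M f) = eps ?r c (REv C c) (FObj G (Cod M f)) \<diamondop>
        (?r \<triangleright> ((c \<triangleright> FMor G f) \<diamondop> \<xi> (Dom M f))) \<diamondop> MAssoc N ?r a (FObj F (Dom M f))"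
      using f by (simp add: \<zeta>_def lw_Comp N.prefix[OF eps_nat[OF D, symmetric]])
    also have "\<dots> = \<zeta> (Cod M f) \<diamondop> ((?r \<otimes>\<^sub>o\<^bsub>C\<^esub> a) \<triangleright> FMor F f)"
      unfolding \<xi>_nat[OF f] using f by (simp add: \<zeta>_def lw_Comp natural_simps)
    finally show "FMor G f \<diamondop> \<zeta> (Dom M f) = \<zeta> (Cod M f) \<diamondop> ((?r \<otimes>\<^sub>o\<^bsub>C\<^esub> a) \<triangleright> FMor F f)" .
  qed (simp add: \<zeta>_def Hom_def)
  then obtain w where w: "w \<in> Hom C (?r \<otimes>\<^sub>o\<^bsub>C\<^esub> a) g" "\<And>x. x \<in> Obj M \<Longrightarrow> \<epsilon> x \<diamondop> (w \<triangleleft> FObj F x) = \<zeta> x"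
    using universal_exists[of "?r \<otimes>\<^sub>o\<^bsub>C\<^esub> a" \<zeta>] by auto
  have w' [simp]: "w \<in> Arr C" "Dom C w = ?r \<otimes>\<^sub>o\<^bsub>C\<^esub> a" "Cod C w = g" using w(1) by (auto simp: Hom_def)
  \<comment> \<open>The arrow classified by the transposed family, transposed back in
    \<open>C\<close>.\<close>
  define u where "u = (c \<triangleright>\<^sub>C w) \<cdot>\<^bsub>C\<^esub> C.reg.eta ?r c (RCoev C c) a"
  have u [simp]: "u \<in> Arr C" "Dom C u = a" "Cod C u = c \<otimes>\<^sub>o\<^bsub>C\<^esub> g" by (simp_all add: u_def)
  have uw: "?e \<cdot>\<^bsub>C\<^esub> (?r \<triangleright>\<^sub>C u) = w"
    using C.reg.sharp_flat[OF D, of w a] by (simp add: u_def)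
  have "(c \<triangleright> \<epsilon> x) \<diamondop> MAssoc N c g (FObj F x) \<diamondop> (u \<triangleleft> FObj F x) = \<xi> x" if x: "x \<in> Obj M" for x
  proof (rule sharp_inj[OF D])
    let ?k = "(c \<triangleright> \<epsilon> x) \<diamondop> MAssoc N c g (FObj F x) \<diamondop> (u \<triangleleft> FObj F x)"
    have "(eps ?r c (REv C c) (FObj G x) \<diamondop> (?r \<triangleright> ?k)) \<diamondop> MAssoc N ?r a (FObj F x)
        = \<epsilon> x \<diamondop> ((?e \<cdot>\<^bsub>C\<^esub> (?r \<triangleright>\<^sub>C u)) \<triangleleft> FObj F x)"
      using x by (simp add: sharp_act[OF D, of u g _ a] N.prefix[OF eps_nat[OF D, symmetric]] lw_Comp)
    also have "\<dots> = \<zeta> x" unfolding uw by (rule w(2)[OF x])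
    also have "\<dots> = (eps ?r c (REv C c) (FObj G x) \<diamondop> (?r \<triangleright> \<xi> x)) \<diamondop> MAssoc N ?r a (FObj F x)"
      using x by (simp add: \<zeta>_def)
    finally show "eps ?r c (REv C c) (FObj G x) \<diamondop> (?r \<triangleright> ?k) = eps ?r c (REv C c) (FObj G x) \<diamondop> (?r \<triangleright> \<xi> x)"
      by (rule N.iso_cancel_right[rotated]) (use x in simp_all)
  qed (use x in simp_all)
  then show ?thesis by (intro exI[of _ u]) (simp add: Hom_def)
qed

end

section \<open>The canonical half-braiding of a universal family\<close>

context universal_pair
begin

text \<open>The component of \<open>\<epsilon>\<close> at \<open>c.x\<close>, turned by the module
  constraints of \<open>F\<close> and \<open>G\<close> into an arrow
  \<open>g.(c.F x) -> c.G x\<close>.\<close>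

definition \<zeta> :: "'c \<Rightarrow> 'o \<Rightarrow> 'q" where
  "\<zeta> c x = FCon G c x \<diamondop> \<epsilon> (c \<rhd>\<^sub>o\<^bsub>M\<^esub> x) \<diamondop> (g \<triangleright> inv_arr N (FCon F c x))"

lemma \<zeta>_simps [simp]:
  assumes "c \<in> Obj C" "x \<in> Obj M"
  shows "\<zeta> c x \<in> Arr N" "Dom N (\<zeta> c x) = g \<star> c \<star> FObj F x" "Cod N (\<zeta> c x) = c \<star> FObj G x"
  using assms by (simp_all add: \<zeta>_def)

lemma inv_FCon_nat:
  assumes c: "c \<in> Obj C" and f: "f \<in> Arr M"
  shows "FMor F (Idn C c \<rhd>\<^sub>m\<^bsub>M\<^esub> f) \<diamondop> inv_arr N (FCon F c (Dom M f))
    = inv_arr N (FCon F c (Cod M f)) \<diamondop> (c \<triangleright> FMor F f)"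
  by (rule N.square_inv[OF FCon_nat[OF F c f refl refl]]) (use c f in simp_all)

lemma inv_FCon_nat':
  assumes u: "u \<in> Arr C" "x \<in> Obj M"
  shows "FMor F (u \<rhd>\<^sub>m\<^bsub>M\<^esub> Idn M x) \<diamondop> inv_arr N (FCon F (Dom C u) x)
    = inv_arr N (FCon F (Cod C u) x) \<diamondop> (u \<triangleleft> FObj F x)"
  by (rule N.square_inv[OF FCon_nat'[OF F u refl refl]]) (use u in simp_all)

lemma \<zeta>_nat:
  assumes c: "c \<in> Obj C" and f: "f \<in> Arr M"
  shows "(c \<triangleright> FMor G f) \<diamondop> \<zeta> c (Dom M f) = \<zeta> c (Cod M f) \<diamondop> (g \<triangleright> c \<triangleright> FMor F f)"
proof -
  have "(c \<triangleright> FMor G f) \<diamondop> \<zeta> c (Dom M f)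
     = FCon G c (Cod M f) \<diamondop> FMor G (Idn C c \<rhd>\<^sub>m\<^bsub>M\<^esub> f) \<diamondop> \<epsilon> (c \<rhd>\<^sub>o\<^bsub>M\<^esub> Dom M f) \<diamondop> (g \<triangleright> inv_arr N (FCon F c (Dom M f)))"
    using c f by (simp add: \<zeta>_def N.prefix[OF FCon_nat[OF G c f refl refl, symmetric]])
  also have "\<dots> = FCon G c (Cod M f) \<diamondop> \<epsilon> (c \<rhd>\<^sub>o\<^bsub>M\<^esub> Cod M f) \<diamondop>
      (g \<triangleright> (FMor F (Idn C c \<rhd>\<^sub>m\<^bsub>M\<^esub> f) \<diamondop> inv_arr N (FCon F c (Dom M f))))"
    using c f by (simp add: lw_Comp N.prefix[OF \<epsilon>_nat[of "Idn C c \<rhd>\<^sub>m\<^bsub>M\<^esub> f"]])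
  also have "\<dots> = \<zeta> c (Cod M f) \<diamondop> (g \<triangleright> c \<triangleright> FMor F f)"
    using c f by (simp add: \<zeta>_def lw_Comp inv_FCon_nat)
  finally show ?thesis .
qed

text \<open>The inverse of the canonical half-braiding: universality of \<open>c.\<epsilon>\<close>
  produces arrows into \<open>c \<otimes> g\<close>, so this direction comes first. Invertibility is
  a separate matter, settled by \<open>lax_half_braiding_iso\<close>.\<close>

definition swap :: "'c \<Rightarrow> 'd" where
  "swap c = (SOME t. t \<in> Hom C (g \<otimes>\<^sub>o\<^bsub>C\<^esub> c) (c \<otimes>\<^sub>o\<^bsub>C\<^esub> g) \<and>
    (\<forall>x \<in> Obj M. (c \<triangleright> \<epsilon> x) \<diamondop> MAssoc N c g (FObj F x) \<diamondop> (t \<triangleleft> FObj F x)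
      = \<zeta> c x \<diamondop> MAssoc N g c (FObj F x)))"

lemma swap:
  assumes c: "c \<in> Obj C"
  shows "swap c \<in> Hom C (g \<otimes>\<^sub>o\<^bsub>C\<^esub> c) (c \<otimes>\<^sub>o\<^bsub>C\<^esub> g) \<and>
    (\<forall>x \<in> Obj M. (c \<triangleright> \<epsilon> x) \<diamondop> MAssoc N c g (FObj F x) \<diamondop> (swap c \<triangleleft> FObj F x)
      = \<zeta> c x \<diamondop> MAssoc N g c (FObj F x))"
proof -
  have "family (g \<otimes>\<^sub>o\<^bsub>C\<^esub> c) c (\<lambda>x. \<zeta> c x \<diamondop> MAssoc N g c (FObj F x))"
    unfolding family_def
  proof (intro conjI ballI)
    fix f assume f: "f \<in> Arr M"
    then show "(c \<triangleright> FMor G f) \<diamondop> \<zeta> c (Dom M f) \<diamondop> MAssoc N g c (FObj F (Dom M f))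
      = (\<zeta> c (Cod M f) \<diamondop> MAssoc N g c (FObj F (Cod M f))) \<diamondop> ((g \<otimes>\<^sub>o\<^bsub>C\<^esub> c) \<triangleright> FMor F f)"
      using c by (simp add: N.prefix[OF \<zeta>_nat] natural_simps)
  qed (use c in \<open>simp add: Hom_def\<close>)
  then have "\<exists>t. t \<in> Hom C (g \<otimes>\<^sub>o\<^bsub>C\<^esub> c) (c \<otimes>\<^sub>o\<^bsub>C\<^esub> g) \<and>
    (\<forall>x \<in> Obj M. (c \<triangleright> \<epsilon> x) \<diamondop> MAssoc N c g (FObj F x) \<diamondop> (t \<triangleleft> FObj F x)
      = \<zeta> c x \<diamondop> MAssoc N g c (FObj F x))"
    using universal_act_exists[OF c] c by simp
  then show ?thesis
    unfolding swap_def by (rule someI_ex)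
qed

lemma swap_simps [simp]:
  assumes "c \<in> Obj C"
  shows "swap c \<in> Arr C" "Dom C (swap c) = g \<otimes>\<^sub>o\<^bsub>C\<^esub> c" "Cod C (swap c) = c \<otimes>\<^sub>o\<^bsub>C\<^esub> g"
  using swap[OF assms] by (auto simp: Hom_def)

lemma swap_eq:
  assumes "c \<in> Obj C" "x \<in> Obj M"
  shows "(c \<triangleright> \<epsilon> x) \<diamondop> MAssoc N c g (FObj F x) \<diamondop> (swap c \<triangleleft> FObj F x) = \<zeta> c x \<diamondop> MAssoc N g c (FObj F x)"
  using swap assms by blast

lemma swap_eqI:
  assumes "c \<in> Obj C" "t \<in> Hom C (g \<otimes>\<^sub>o\<^bsub>C\<^esub> c) (c \<otimes>\<^sub>o\<^bsub>C\<^esub> g)"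
    "\<And>x. x \<in> Obj M \<Longrightarrow> (c \<triangleright> \<epsilon> x) \<diamondop> MAssoc N c g (FObj F x) \<diamondop> (t \<triangleleft> FObj F x) = \<zeta> c x \<diamondop> MAssoc N g c (FObj F x)"
  shows "swap c = t"
  by (rule universal_act_inj[OF assms(1) _ assms(2)]) (use assms swap swap_eq in auto)

lemma expand_swap:
  assumes "c \<in> Obj C" "x \<in> Obj M"
  shows "(c \<triangleright> \<epsilon> x) \<diamondop> expand g c (swap c) (FObj F x) = \<zeta> c x"
proof -
  have "(c \<triangleright> \<epsilon> x) \<diamondop> expand g c (swap c) (FObj F x)
      = ((c \<triangleright> \<epsilon> x) \<diamondop> MAssoc N c g (FObj F x) \<diamondop> (swap c \<triangleleft> FObj F x)) \<diamondop> inv_arr N (MAssoc N g c (FObj F x))"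
    using assms by (simp add: expand_def)
  then show ?thesis
    unfolding swap_eq[OF assms] using assms by simp
qed

text \<open>Both sides classify the same family, because \<open>\<epsilon>\<close> is natural along
  the action of \<open>f\<close> on \<open>x\<close> and the constraints of \<open>F\<close> and
  \<open>G\<close> are natural in the acting object.\<close>

lemma swap_nat:
  assumes f: "f \<in> Arr C"
  shows "(f \<triangleleft>\<^sub>C g) \<cdot>\<^bsub>C\<^esub> swap (Dom C f) = swap (Cod C f) \<cdot>\<^bsub>C\<^esub> (g \<triangleright>\<^sub>C f)"
proof (rule universal_act_inj)
  let ?c = "Dom C f" and ?d = "Cod C f"
  fix x assume x: "x \<in> Obj M"
  let ?fM = "f \<rhd>\<^sub>m\<^bsub>M\<^esub> Idn M x"
  have "(?d \<triangleright> \<epsilon> x) \<diamondop> MAssoc N ?d g (FObj F x) \<diamondop> ((f \<triangleleft>\<^sub>C g) \<cdot>\<^bsub>C\<^esub> swap ?c) \<triangleleft> FObj F x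
      = (f \<triangleleft> FObj G x) \<diamondop> (?c \<triangleright> \<epsilon> x) \<diamondop> MAssoc N ?c g (FObj F x) \<diamondop> (swap ?c \<triangleleft> FObj F x)"
    using f x by (simp add: rw_Comp natural_simps N.prefix[OF interchange[of f "\<epsilon> x" ?c]])
  also have "\<dots> = (f \<triangleleft> FObj G x) \<diamondop> FCon G ?c x \<diamondop> \<epsilon> (?c \<rhd>\<^sub>o\<^bsub>M\<^esub> x) \<diamondop> (g \<triangleright> inv_arr N (FCon F ?c x)) \<diamondop> MAssoc N g ?c (FObj F x)"
    using f x by (simp add: swap_eq \<zeta>_def)
  also have "\<dots> = FCon G ?d x \<diamondop> FMor G ?fM \<diamondop> \<epsilon> (?c \<rhd>\<^sub>o\<^bsub>M\<^esub> x) \<diamondop> (g \<triangleright> inv_arr N (FCon F ?c x)) \<diamondop> MAssoc N g ?c (FObj F x)"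
    using f x by (simp add: N.prefix[OF FCon_nat'[OF G f x refl refl, symmetric]])
  also have "\<dots> = FCon G ?d x \<diamondop> \<epsilon> (?d \<rhd>\<^sub>o\<^bsub>M\<^esub> x) \<diamondop> (g \<triangleright> (FMor F ?fM \<diamondop> inv_arr N (FCon F ?c x))) \<diamondop> MAssoc N g ?c (FObj F x)"
    using f x by (simp add: lw_Comp N.prefix[OF \<epsilon>_nat[of ?fM]])
  also have "\<dots> = (\<zeta> ?d x \<diamondop> MAssoc N g ?d (FObj F x)) \<diamondop> ((g \<triangleright>\<^sub>C f) \<triangleleft> FObj F x)"
    using f x by (simp add: lw_Comp inv_FCon_nat' \<zeta>_def natural_simps)
  also have "\<dots> = (?d \<triangleright> \<epsilon> x) \<diamondop> MAssoc N ?d g (FObj F x) \<diamondop> (swap ?d \<cdot>\<^bsub>C\<^esub> (g \<triangleright>\<^sub>C f)) \<triangleleft> FObj F x"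
    unfolding swap_eq[OF C.Cod_Obj[OF f] x, symmetric] using f x by (simp add: rw_Comp)
  finally show "(?d \<triangleright> \<epsilon> x) \<diamondop> MAssoc N ?d g (FObj F x) \<diamondop> ((f \<triangleleft>\<^sub>C g) \<cdot>\<^bsub>C\<^esub> swap ?c) \<triangleleft> FObj F x
     = (?d \<triangleright> \<epsilon> x) \<diamondop> MAssoc N ?d g (FObj F x) \<diamondop> (swap ?d \<cdot>\<^bsub>C\<^esub> (g \<triangleright>\<^sub>C f)) \<triangleleft> FObj F x" .
qed (use f in \<open>simp_all add: Hom_def\<close>)

lemma hexagon_simps [simp]:
  assumes "b \<in> Obj C" "c \<in> Obj C" "d \<in> Obj C"
    "s \<in> Arr C" "Dom C s = b \<otimes>\<^sub>o\<^bsub>C\<^esub> c" "Cod C s = c \<otimes>\<^sub>o\<^bsub>C\<^esub> b"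
    "t \<in> Arr C" "Dom C t = b \<otimes>\<^sub>o\<^bsub>C\<^esub> d" "Cod C t = d \<otimes>\<^sub>o\<^bsub>C\<^esub> b"
  shows "C.hexagon b c d s t \<in> Arr C" "Dom C (C.hexagon b c d s t) = b \<otimes>\<^sub>o\<^bsub>C\<^esub> c \<otimes>\<^sub>o\<^bsub>C\<^esub> d"
    "Cod C (C.hexagon b c d s t) = (c \<otimes>\<^sub>o\<^bsub>C\<^esub> d) \<otimes>\<^sub>o\<^bsub>C\<^esub> b"
  using assms by (simp_all add: C.hexagon_def)

text \<open>Both sides classify the same family. Unfolding the two exchanges replaces
  \<open>\<epsilon>\<close> at \<open>x\<close> by \<open>\<epsilon>\<close> at \<open>d.x\<close>
  and then at \<open>c.(d.x)\<close>; multiplicativity of the constraints of \<open>F\<close> and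
  \<open>G\<close> leads from there to \<open>\<epsilon>\<close> at
  \<open>(c \<otimes> d).x\<close>.\<close>

lemma swap_TObj:
  assumes c: "c \<in> Obj C" and d: "d \<in> Obj C"
  shows "swap (c \<otimes>\<^sub>o\<^bsub>C\<^esub> d) = C.hexagon g c d (swap c) (swap d)"
proof (rule swap_eqI)
  note [simp] = c d
  fix x assume x [simp]: "x \<in> Obj M"
  let ?cd = "c \<otimes>\<^sub>o\<^bsub>C\<^esub> d" and ?t = "C.hexagon g c d (swap c) (swap d)" and ?Fx = "FObj F x" and ?Gx = "FObj G x"
  have "MAssoc N c d ?Gx \<diamondop> (?cd \<triangleright> \<epsilon> x) \<diamondop> MAssoc N ?cd g ?Fx \<diamondop> (?t \<triangleleft> ?Fx)
     = (c \<triangleright> d \<triangleright> \<epsilon> x) \<diamondop> MAssoc N c d (g \<star> ?Fx) \<diamondop> MAssoc N ?cd g ?Fx \<diamondop> (?t \<triangleleft> ?Fx)"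
    by (simp add: natural_simps)
  also have "\<dots> = (c \<triangleright> ((d \<triangleright> \<epsilon> x) \<diamondop> expand g d (swap d) ?Fx)) \<diamondop> expand g c (swap c) (d \<star> ?Fx)
      \<diamondop> (g \<triangleright> MAssoc N c d ?Fx) \<diamondop> MAssoc N g ?cd ?Fx"
    by (simp add: expand_hexagon lw_Comp)
  also have "\<dots> = (c \<triangleright> FCon G d x) \<diamondop> (c \<triangleright> \<epsilon> (d \<rhd>\<^sub>o\<^bsub>M\<^esub> x)) \<diamondop> (c \<triangleright> g \<triangleright> inv_arr N (FCon F d x)) \<diamondop>
      expand g c (swap c) (d \<star> ?Fx) \<diamondop> (g \<triangleright> MAssoc N c d ?Fx) \<diamondop> MAssoc N g ?cd ?Fx"
    by (simp add: expand_swap \<zeta>_def lw_Comp)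
  \<comment> \<open>Naturality of the exchange moves the constraint of \<open>F\<close> to the
    right, so that \<open>expand_swap\<close> applies at the object \<open>d.x\<close>.\<close>
  also have "\<dots> = (c \<triangleright> FCon G d x) \<diamondop> ((c \<triangleright> \<epsilon> (d \<rhd>\<^sub>o\<^bsub>M\<^esub> x)) \<diamondop> expand g c (swap c) (FObj F (d \<rhd>\<^sub>o\<^bsub>M\<^esub> x))) \<diamondop>
      (g \<triangleright> c \<triangleright> inv_arr N (FCon F d x)) \<diamondop> (g \<triangleright> MAssoc N c d ?Fx) \<diamondop> MAssoc N g ?cd ?Fx"
    by (simp add: N.prefix[OF expand_nat])
  also have "\<dots> = (c \<triangleright> FCon G d x) \<diamondop> FCon G c (d \<rhd>\<^sub>o\<^bsub>M\<^esub> x) \<diamondop> \<epsilon> (c \<rhd>\<^sub>o\<^bsub>M\<^esub> d \<rhd>\<^sub>o\<^bsub>M\<^esub> x) \<diamondop>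
      (g \<triangleright> (inv_arr N (FCon F c (d \<rhd>\<^sub>o\<^bsub>M\<^esub> x)) \<diamondop> (c \<triangleright> inv_arr N (FCon F d x)) \<diamondop> MAssoc N c d ?Fx)) \<diamondop> MAssoc N g ?cd ?Fx"
    unfolding expand_swap[OF c module_category.Act_Obj[OF M d x]] by (simp add: \<zeta>_def lw_Comp)
  also have "inv_arr N (FCon F c (d \<rhd>\<^sub>o\<^bsub>M\<^esub> x)) \<diamondop> (c \<triangleright> inv_arr N (FCon F d x)) \<diamondop> MAssoc N c d ?Fx
      = FMor F (MAssoc M c d x) \<diamondop> inv_arr N (FCon F ?cd x)"
  proof -
    have "inv_arr N (FCon F c (d \<rhd>\<^sub>o\<^bsub>M\<^esub> x)) \<diamondop> (c \<triangleright> inv_arr N (FCon F d x)) \<diamondop> MAssoc N c d ?Fx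
      = inv_arr N (FCon F c (d \<rhd>\<^sub>o\<^bsub>M\<^esub> x)) \<diamondop> (c \<triangleright> inv_arr N (FCon F d x)) \<diamondop>
         (MAssoc N c d ?Fx \<diamondop> FCon F ?cd x) \<diamondop> inv_arr N (FCon F ?cd x)"
      by simp
    then show ?thesis
      unfolding FCon_mult[OF F c d x] by (simp add: N.prefix[OF lw_Comp[symmetric]])
  qed
  also have "(c \<triangleright> FCon G d x) \<diamondop> FCon G c (d \<rhd>\<^sub>o\<^bsub>M\<^esub> x) \<diamondop> \<epsilon> (c \<rhd>\<^sub>o\<^bsub>M\<^esub> d \<rhd>\<^sub>o\<^bsub>M\<^esub> x) \<diamondop>
      (g \<triangleright> (FMor F (MAssoc M c d x) \<diamondop> inv_arr N (FCon F ?cd x))) \<diamondop> MAssoc N g ?cd ?Fx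
      = ((c \<triangleright> FCon G d x) \<diamondop> FCon G c (d \<rhd>\<^sub>o\<^bsub>M\<^esub> x) \<diamondop> FMor G (MAssoc M c d x)) \<diamondop> \<epsilon> (?cd \<rhd>\<^sub>o\<^bsub>M\<^esub> x) \<diamondop>
      (g \<triangleright> inv_arr N (FCon F ?cd x)) \<diamondop> MAssoc N g ?cd ?Fx"
    by (simp add: lw_Comp N.prefix[OF \<epsilon>_nat[of "MAssoc M c d x"]])
  also have "\<dots> = MAssoc N c d ?Gx \<diamondop> \<zeta> ?cd x \<diamondop> MAssoc N g ?cd ?Fx"
    unfolding FCon_mult[OF G c d x, symmetric] by (simp add: \<zeta>_def)
  finally show "(?cd \<triangleright> \<epsilon> x) \<diamondop> MAssoc N ?cd g ?Fx \<diamondop> (?t \<triangleleft> ?Fx) = \<zeta> ?cd x \<diamondop> MAssoc N g ?cd ?Fx"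
    by (rule N.iso_cancel_left[rotated]) simp_all
qed (use assms in \<open>simp_all add: Hom_def\<close>)

text \<open>At the unit object the constraints of \<open>F\<close> and \<open>G\<close> are
  determined by \<open>MUnit\<close>, so naturality of \<open>\<epsilon>\<close> along
  \<open>MUnit M x\<close> identifies the family of \<open>swap\<close> with that of the
  unitors.\<close>

lemma swap_Unit: "LUnit C g \<cdot>\<^bsub>C\<^esub> swap (Unit C) = RUnit C g"
proof -
  let ?I = "Unit C"
  have "swap ?I = inv_arr C (LUnit C g) \<cdot>\<^bsub>C\<^esub> RUnit C g"
  proof (rule swap_eqI)
    fix x assume x [simp]: "x \<in> Obj M"
    let ?Fx = "FObj F x" and ?Gx = "FObj G x"
    have "MUnit N ?Gx \<diamondop> (?I \<triangleright> \<epsilon> x) \<diamondop> MAssoc N ?I g ?Fx \<diamondop> ((inv_arr C (LUnit C g) \<cdot>\<^bsub>C\<^esub> RUnit C g) \<triangleleft> ?Fx)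
       = \<epsilon> x \<diamondop> (MUnit N (g \<star> ?Fx) \<diamondop> MAssoc N ?I g ?Fx) \<diamondop> ((inv_arr C (LUnit C g) \<cdot>\<^bsub>C\<^esub> RUnit C g) \<triangleleft> ?Fx)"
      using N.prefix[OF MUnit_nat[of "\<epsilon> x"]] by simp
    also have "\<dots> = \<epsilon> x \<diamondop> (g \<triangleright> MUnit N ?Fx) \<diamondop> MAssoc N g ?I ?Fx"
      by (simp add: MUnit_act rw_Comp tri N.prefix[OF rw_Comp[symmetric]])
    also have "\<dots> = \<epsilon> x \<diamondop> (g \<triangleright> ((MUnit N ?Fx \<diamondop> FCon F ?I x) \<diamondop> inv_arr N (FCon F ?I x))) \<diamondop> MAssoc N g ?I ?Fx"
      by simp
    also have "\<dots> = FMor G (MUnit M x) \<diamondop> \<epsilon> (?I \<rhd>\<^sub>o\<^bsub>M\<^esub> x) \<diamondop> (g \<triangleright> inv_arr N (FCon F ?I x)) \<diamondop> MAssoc N g ?I ?Fx"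
      unfolding FCon_unit[OF F x] by (simp add: lw_Comp N.prefix[OF \<epsilon>_nat[of "MUnit M x"]])
    also have "\<dots> = MUnit N ?Gx \<diamondop> \<zeta> ?I x \<diamondop> MAssoc N g ?I ?Fx"
      unfolding FCon_unit[OF G x, symmetric] by (simp add: \<zeta>_def)
    finally show "(?I \<triangleright> \<epsilon> x) \<diamondop> MAssoc N ?I g ?Fx \<diamondop> ((inv_arr C (LUnit C g) \<cdot>\<^bsub>C\<^esub> RUnit C g) \<triangleleft> ?Fx)
        = \<zeta> ?I x \<diamondop> MAssoc N g ?I ?Fx"
      by (rule N.iso_cancel_left[rotated]) simp_all
  qed (simp_all add: Hom_def)
  then show ?thesis by simp
qed

lemma swap_iso [simp]: "c \<in> Obj C \<Longrightarrow> iso_arr C (swap c)"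
  by (rule C.lax_half_braiding_iso[of g]) (simp_all add: swap swap_nat swap_TObj swap_Unit)

text \<open>Each axiom is the inverse of a property of \<open>swap\<close>. The map
  \<open>\<sigma>\<close> is prescribed on the objects of \<open>C\<close> alone, since the
  half-braiding built from an end is known to agree with the inverse of \<open>swap\<close>
  there.\<close>

lemma half_braiding_swap:
  assumes "\<And>c. c \<in> Obj C \<Longrightarrow> \<sigma> c = inv_arr C (swap c)"
  shows "half_braiding C g \<sigma>"
  unfolding half_braiding_def
proof (intro conjI ballI)
  fix f assume f: "f \<in> Arr C"
  have "(g \<triangleright>\<^sub>C f) \<cdot>\<^bsub>C\<^esub> inv_arr C (swap (Dom C f)) = inv_arr C (swap (Cod C f)) \<cdot>\<^bsub>C\<^esub> (f \<triangleleft>\<^sub>C g)"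
    by (rule C.square_inv) (use f swap_nat[OF f] in simp_all)
  then show "(Idn C g \<otimes>\<^sub>m\<^bsub>C\<^esub> f) \<cdot>\<^bsub>C\<^esub> \<sigma> (Dom C f) = \<sigma> (Cod C f) \<cdot>\<^bsub>C\<^esub> (f \<otimes>\<^sub>m\<^bsub>C\<^esub> Idn C g)"
    using f by (simp add: assms C.reg.lw_def C.reg.rw_def)
next
  fix c d assume [simp]: "c \<in> Obj C" "d \<in> Obj C"
  have "inv_arr C (C.hexagon g c d (swap c) (swap d)) = Assoc C g c d \<cdot>\<^bsub>C\<^esub> (inv_arr C (swap c) \<triangleleft>\<^sub>C d) \<cdot>\<^bsub>C\<^esub>
      inv_arr C (Assoc C c g d) \<cdot>\<^bsub>C\<^esub> (c \<triangleright>\<^sub>C inv_arr C (swap d)) \<cdot>\<^bsub>C\<^esub> Assoc C c d g"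
    by (simp add: C.hexagon_def C.iso_Comp)
  then show "\<sigma> (c \<otimes>\<^sub>o\<^bsub>C\<^esub> d) = Assoc C g c d \<cdot>\<^bsub>C\<^esub> (\<sigma> c \<otimes>\<^sub>m\<^bsub>C\<^esub> Idn C d) \<cdot>\<^bsub>C\<^esub> inv_arr C (Assoc C c g d)
                         \<cdot>\<^bsub>C\<^esub> (Idn C c \<otimes>\<^sub>m\<^bsub>C\<^esub> \<sigma> d) \<cdot>\<^bsub>C\<^esub> Assoc C c d g"
    by (simp add: assms swap_TObj C.reg.lw_def C.reg.rw_def)
next
  have "LUnit C g \<cdot>\<^bsub>C\<^esub> swap (Unit C) \<cdot>\<^bsub>C\<^esub> inv_arr C (swap (Unit C)) = RUnit C g \<cdot>\<^bsub>C\<^esub> inv_arr C (swap (Unit C))"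
    by (rule C.prefix[OF swap_Unit]) simp_all
  then show "RUnit C g \<cdot>\<^bsub>C\<^esub> \<sigma> (Unit C) = LUnit C g"
    by (simp add: assms)
qed (simp_all add: assms Hom_def)

text \<open>Morphisms into the canonical half-braiding are those whose associated family is compatible
  with the module constraints.\<close>

lemma center_morphism_iff:
  assumes b: "b \<in> Obj C" and u: "u \<in> Hom C b g" and c: "c \<in> Obj C"
    and \<tau>: "\<tau> \<in> Arr C" "Dom C \<tau> = c \<otimes>\<^sub>o\<^bsub>C\<^esub> b" "Cod C \<tau> = b \<otimes>\<^sub>o\<^bsub>C\<^esub> c" "iso_arr C \<tau>"
    and \<sigma>: "\<sigma> = inv_arr C (swap c)"
  shows "\<sigma> \<cdot>\<^bsub>C\<^esub> (c \<triangleright>\<^sub>C u) = (u \<triangleleft>\<^sub>C c) \<cdot>\<^bsub>C\<^esub> \<tau> \<longleftrightarrow>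
    (\<forall>x \<in> Obj M. FCon G c x \<diamondop> \<epsilon> (c \<rhd>\<^sub>o\<^bsub>M\<^esub> x) \<diamondop> (u \<triangleleft> FObj F (c \<rhd>\<^sub>o\<^bsub>M\<^esub> x)) =
      (c \<triangleright> (\<epsilon> x \<diamondop> (u \<triangleleft> FObj F x))) \<diamondop> MAssoc N c b (FObj F x) \<diamondop> (inv_arr C \<tau> \<triangleleft> FObj F x)
        \<diamondop> inv_arr N (MAssoc N b c (FObj F x)) \<diamondop> (b \<triangleright> FCon F c x))"
    (is "_ \<longleftrightarrow> (\<forall>x \<in> Obj M. ?L x = ?R x)")
proof -
  note [simp] = b c \<tau>
  have [simp]: "u \<in> Arr C" "Dom C u = b" "Cod C u = g" using u by (auto simp: Hom_def)
  \<comment> \<open>The condition is put in terms of \<open>swap\<close>, whose composite with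
    \<open>c.\<epsilon>\<close> is known, and \<open>universal_act_inj\<close> then allows testing
    it on families.\<close>
  have "\<sigma> \<cdot>\<^bsub>C\<^esub> (c \<triangleright>\<^sub>C u) = (u \<triangleleft>\<^sub>C c) \<cdot>\<^bsub>C\<^esub> \<tau> \<longleftrightarrow> swap c \<cdot>\<^bsub>C\<^esub> (u \<triangleleft>\<^sub>C c) = (c \<triangleright>\<^sub>C u) \<cdot>\<^bsub>C\<^esub> inv_arr C \<tau>" (is "?a = ?b \<longleftrightarrow> ?c = ?d")
  proof
    assume "?a = ?b"
    then have "swap c \<cdot>\<^bsub>C\<^esub> ?a \<cdot>\<^bsub>C\<^esub> inv_arr C \<tau> = swap c \<cdot>\<^bsub>C\<^esub> ?b \<cdot>\<^bsub>C\<^esub> inv_arr C \<tau>" by simp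
    then show "?c = ?d" by (simp add: \<sigma>)
  next
    assume "?c = ?d"
    then have "\<sigma> \<cdot>\<^bsub>C\<^esub> ?c \<cdot>\<^bsub>C\<^esub> \<tau> = \<sigma> \<cdot>\<^bsub>C\<^esub> ?d \<cdot>\<^bsub>C\<^esub> \<tau>" by simp
    then show "?a = ?b" by (simp add: \<sigma>)
  qed
  also have "\<dots> \<longleftrightarrow> (\<forall>x \<in> Obj M. (c \<triangleright> \<epsilon> x) \<diamondop> MAssoc N c g (FObj F x) \<diamondop> (?c \<triangleleft> FObj F x)
      = (c \<triangleright> \<epsilon> x) \<diamondop> MAssoc N c g (FObj F x) \<diamondop> (?d \<triangleleft> FObj F x))"
    using universal_act_inj[OF c, of ?c "b \<otimes>\<^sub>o\<^bsub>C\<^esub> c" ?d] by (auto simp: Hom_def)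
  also have "\<dots> \<longleftrightarrow> (\<forall>x \<in> Obj M. ?L x = ?R x)"
  proof (rule ball_cong[OF refl])
    fix x assume x [simp]: "x \<in> Obj M"
    let ?Fx = "FObj F x" and ?e = "MAssoc N b c (FObj F x)" and ?f = "b \<triangleright> FCon F c x"
    let ?c' = "(c \<triangleright> \<epsilon> x) \<diamondop> MAssoc N c g (FObj F x) \<diamondop> (?c \<triangleleft> FObj F x)"
    let ?d' = "(c \<triangleright> \<epsilon> x) \<diamondop> MAssoc N c g (FObj F x) \<diamondop> (?d \<triangleleft> FObj F x)"
    have "?c' = ((c \<triangleright> \<epsilon> x) \<diamondop> MAssoc N c g (FObj F x) \<diamondop> (swap c \<triangleleft> FObj F x)) \<diamondop> ((u \<triangleleft>\<^sub>C c) \<triangleleft> ?Fx)"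
      by (simp add: rw_Comp)
    also have "\<dots> = FCon G c x \<diamondop> \<epsilon> (c \<rhd>\<^sub>o\<^bsub>M\<^esub> x) \<diamondop> ((g \<triangleright> inv_arr N (FCon F c x)) \<diamondop> (u \<triangleleft> (c \<star> ?Fx))) \<diamondop> ?e"
      unfolding swap_eq[OF c x] by (simp add: natural_simps \<zeta>_def)
    also have "\<dots> = ?L x \<diamondop> (b \<triangleright> inv_arr N (FCon F c x)) \<diamondop> ?e"
      by (simp add: N.prefix[OF interchange[of u _ b g]])
    finally have 1: "?c' = ?L x \<diamondop> (b \<triangleright> inv_arr N (FCon F c x)) \<diamondop> ?e" .
    then have 1: "?c' \<diamondop> inv_arr N ?e \<diamondop> ?f = ?L x"
      by (simp flip: lw_Comp)
    have 2: "?d' \<diamondop> inv_arr N ?e \<diamondop> ?f = ?R x"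
      by (simp add: rw_Comp lw_Comp natural_simps)
    have [simp]: "?c' \<in> Arr N" "?d' \<in> Arr N" "Dom N ?c' = (b \<otimes>\<^sub>o\<^bsub>C\<^esub> c) \<star> ?Fx" "Dom N ?d' = (b \<otimes>\<^sub>o\<^bsub>C\<^esub> c) \<star> ?Fx"
      by simp_all
    \<comment> \<open>Composition with this invertible arrow brings both families into the form of
      the statement, whose right side contains the constraint of the center action on
      \<open>F\<close>.\<close>
    have 3: "iso_arr N (inv_arr N ?e \<diamondop> ?f)"
      by (intro N.iso_Comp) simp_all
    have "?c' = ?d' \<longleftrightarrow> ?c' \<diamondop> inv_arr N ?e \<diamondop> ?f = ?d' \<diamondop> inv_arr N ?e \<diamondop> ?f"
    proof
      assume "?c' \<diamondop> inv_arr N ?e \<diamondop> ?f = ?d' \<diamondop> inv_arr N ?e \<diamondop> ?f"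
      then show "?c' = ?d'" by (rule N.iso_cancel_right[OF 3]) simp_all
    qed (rule arg_cong)
    then show "?c' = ?d' \<longleftrightarrow> ?L x = ?R x"
      unfolding 1 2 .
  qed
  finally show ?thesis .
qed

end

section \<open>Ends and universal families\<close>

context rigid_module_category
begin

text \<open>The arrow \<open>t\<close> is the intermediate step in the definition of the canonical isomorphism that still
  carries the factor \<open>c\<close> on the left.\<close>

lemma Hom_act_iso_eq:
  assumes H: "internal_Hom_of C N H" and c: "c \<in> Obj C" and c': "c' \<in> Obj C"
    and n: "n \<in> Obj N" and n': "n' \<in> Obj N"
    and a: "a = HObj H (c \<star> n) (c' \<star> n')" and h: "h = HObj H n n'"
  obtains t where "t \<in> Hom C (a \<otimes>\<^sub>o\<^bsub>C\<^esub> c) (c' \<otimes>\<^sub>o\<^bsub>C\<^esub> h)"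
    "Hom_act_iso C N H c n c' n' = (t \<triangleleft>\<^sub>C RDual C c) \<cdot>\<^bsub>C\<^esub> C.reta (RDual C c) c (RCoev C c) a"
    "(c' \<triangleright> act.counit H n n') \<diamondop> MAssoc N c' h n \<diamondop> (t \<triangleleft> n) = act.counit H (c \<star> n) (c' \<star> n') \<diamondop> MAssoc N a c n"
proof -
  note D = C.right_dual[OF c] and D' = C.right_dual[OF c']
  let ?r = "RDual C c'" and ?ac = "a \<otimes>\<^sub>o\<^bsub>C\<^esub> c"
  have [simp]: "a \<in> Obj C" "h \<in> Obj C" using act.HObj_Obj[OF H] a h c c' n n' by simp_all
  note [simp] = c c' n n' C.reg.eps_simps[OF D'] eps_simps[OF D'] C.reg.eta_simps[OF D'] eta_simps[OF D']
  let ?e0 = "act.counit H (c \<star> n) (c' \<star> n')" and ?E = "act.counit H n n'"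
  have e0 [simp]: "?e0 \<in> Arr N" "Dom N ?e0 = a \<star> c \<star> n" "Cod N ?e0 = c' \<star> n'"
    by (simp_all add: act.HAdj_simps[OF H] act.HObj_Obj[OF H] a)
  have E [simp]: "?E \<in> Arr N" "Dom N ?E = h \<star> n" "Cod N ?E = n'"
    by (simp_all add: act.HAdj_simps[OF H] act.HObj_Obj[OF H] h)
  \<comment> \<open>\<open>e2\<close> and \<open>e3\<close> are the intermediate arrows in the
    definition of \<open>Hom_act_iso\<close> that bear these names; its unfolding is folded back
    into them at the end.\<close>
  define e2 where "e2 = eps ?r c' (REv C c') n' \<diamondop> (?r \<triangleright> ?e0) \<diamondop> (?r \<triangleright> MAssoc N a c n) \<diamondop> MAssoc N ?r ?ac n"
  have e2 [simp]: "e2 \<in> Hom N ((?r \<otimes>\<^sub>o\<^bsub>C\<^esub> ?ac) \<star> n) n'"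
    by (simp add: e2_def Hom_def)
  define e3 where "e3 = inv_into (Hom C (?r \<otimes>\<^sub>o\<^bsub>C\<^esub> ?ac) h) (HAdj H n n' (?r \<otimes>\<^sub>o\<^bsub>C\<^esub> ?ac)) e2"
  have bij: "HAdj H n n' (?r \<otimes>\<^sub>o\<^bsub>C\<^esub> ?ac) ` Hom C (?r \<otimes>\<^sub>o\<^bsub>C\<^esub> ?ac) h = Hom N ((?r \<otimes>\<^sub>o\<^bsub>C\<^esub> ?ac) \<star> n) n'"
    using act.HAdj_bij[OF H n n', of "?r \<otimes>\<^sub>o\<^bsub>C\<^esub> ?ac"] by (simp add: bij_betw_def h)
  have "e3 \<in> Hom C (?r \<otimes>\<^sub>o\<^bsub>C\<^esub> ?ac) h"
    unfolding e3_def by (rule inv_into_into) (simp add: bij del: Hom_def)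
  then have e3 [simp]: "e3 \<in> Arr C" "Dom C e3 = ?r \<otimes>\<^sub>o\<^bsub>C\<^esub> ?ac" "Cod C e3 = h"
    by (simp_all add: Hom_def)
  have "HAdj H n n' (?r \<otimes>\<^sub>o\<^bsub>C\<^esub> ?ac) e3 = e2"
    unfolding e3_def by (rule f_inv_into_f) (simp add: bij)
  then have e3_eq: "?E \<diamondop> (e3 \<triangleleft> n) = e2"
    using act.HAdj_counit[OF H n n' e3(1)] by (simp add: h rw_def)
  define t where "t = (c' \<triangleright>\<^sub>C e3) \<cdot>\<^bsub>C\<^esub> C.reg.eta ?r c' (RCoev C c') ?ac"
  have t [simp]: "t \<in> Arr C" "Dom C t = ?ac" "Cod C t = c' \<otimes>\<^sub>o\<^bsub>C\<^esub> h" by (simp_all add: t_def)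
  have "C.reg.eps ?r c' (REv C c') h \<cdot>\<^bsub>C\<^esub> (?r \<triangleright>\<^sub>C t) = e3"
    using C.reg.sharp_flat[OF D', of e3 ?ac] by (simp add: t_def)
  then have t_act: "e3 \<triangleleft> n = eps ?r c' (REv C c') (h \<star> n) \<diamondop> (?r \<triangleright> (MAssoc N c' h n \<diamondop> (t \<triangleleft> n))) \<diamondop> MAssoc N ?r ?ac n"
    using sharp_act[OF D', of t h n ?ac] by simp
  \<comment> \<open>Compared after transposition along \<open>RDual c'\<close>, where both sides
    become \<open>e2\<close> once an associator is composed on the right.\<close>
  have "(c' \<triangleright> ?E) \<diamondop> MAssoc N c' h n \<diamondop> (t \<triangleleft> n) = ?e0 \<diamondop> MAssoc N a c n"
  proof (rule sharp_inj[OF D'])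
    show "eps ?r c' (REv C c') n' \<diamondop> (?r \<triangleright> ((c' \<triangleright> ?E) \<diamondop> MAssoc N c' h n \<diamondop> (t \<triangleleft> n)))
       = eps ?r c' (REv C c') n' \<diamondop> (?r \<triangleright> (?e0 \<diamondop> MAssoc N a c n))" (is "?L = ?R")
    proof (rule N.iso_cancel_right)
      have "?L \<diamondop> MAssoc N ?r ?ac n = ?E \<diamondop> (e3 \<triangleleft> n)"
        unfolding t_act by (simp add: lw_Comp N.prefix[OF eps_nat[OF D']])
      then show "?L \<diamondop> MAssoc N ?r ?ac n = ?R \<diamondop> MAssoc N ?r ?ac n"
        unfolding e3_eq e2_def by (simp add: lw_Comp)
    qed simp_all
  qed simp_all
  moreover have "Hom_act_iso C N H c n c' n' = (t \<triangleleft>\<^sub>C RDual C c) \<cdot>\<^bsub>C\<^esub> C.reta (RDual C c) c (RCoev C c) a"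
  proof -
    have 1: "(MUnit N n' \<diamondop> (REv C c' \<triangleleft> n') \<diamondop> inv_arr N (MAssoc N ?r c' n') \<diamondop> (?r \<triangleright> ?e0)) \<diamondop> (?r \<triangleright> MAssoc N a c n)
      \<diamondop> MAssoc N ?r ?ac n = e2"
      using D' by (simp add: e2_def eps_def dual(3-5))
    have 2: "(c' \<triangleright>\<^sub>C e3) \<cdot>\<^bsub>C\<^esub> Assoc C c' ?r ?ac \<cdot>\<^bsub>C\<^esub> (RCoev C c' \<triangleleft>\<^sub>C ?ac) \<cdot>\<^bsub>C\<^esub> inv_arr C (LUnit C ?ac) = t"
      using D' by (simp add: t_def C.reg.eta_def C.reg.dual(6-8))
    show ?thesis
      unfolding Hom_act_iso_def Let_def C.reta_def lw_def[symmetric] rw_def[symmetric]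
        C.reg.lw_def[symmetric] C.reg.rw_def[symmetric] a[symmetric] h[symmetric] 1[unfolded a[symmetric]] e3_def[symmetric] 2 ..
  qed
  ultimately show ?thesis
    using that[of t] by (simp add: Hom_def)
qed

end

context module_functor_pair
begin

context
  fixes H assumes H: "internal_Hom_of C N H"
begin

text \<open>The adjunction turns composition with \<open>HMor\<close> into composition with arrows
  of \<open>N\<close>. At an arrow \<open>f\<close> of \<open>M\<close>, the two sides of the wedge
  condition become the two sides of a naturality square.\<close>

lemma is_wedge_iff:
  assumes l: "\<And>x. x \<in> Obj M \<Longrightarrow> l x \<in> Hom C w (HObj H (FObj F x) (FObj G x))" and w: "w \<in> Obj C"
  shows "is_wedge M C (hom_bifun_obj H F G) (hom_bifun_mor H F G) w l
    \<longleftrightarrow> family1 w (\<lambda>x. HAdj H (FObj F x) (FObj G x) w (l x))"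
proof -
  note [simp] = w act.HObj_Obj[OF H] act.HMor_simps[OF H] act.HAdj_simps[OF H]
  have [simp]: "l x \<in> Arr C" "Dom C (l x) = w" "Cod C (l x) = HObj H (FObj F x) (FObj G x)" if "x \<in> Obj M" for x
    using l[OF that] by (auto simp: Hom_def)
  have "HMor H (FMor F (Idn M (Dom M f))) (FMor G f) \<cdot>\<^bsub>C\<^esub> l (Dom M f) = HMor H (FMor F f) (FMor G (Idn M (Cod M f))) \<cdot>\<^bsub>C\<^esub> l (Cod M f)
     \<longleftrightarrow> FMor G f \<diamondop> HAdj H (FObj F (Dom M f)) (FObj G (Dom M f)) w (l (Dom M f))
       = HAdj H (FObj F (Cod M f)) (FObj G (Cod M f)) w (l (Cod M f)) \<diamondop> (w \<triangleright> FMor F f)"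
    (is "?a = ?b \<longleftrightarrow> ?c = ?d") if f: "f \<in> Arr M" for f
  proof -
    let ?A = "HAdj H (FObj F (Dom M f)) (FObj G (Cod M f)) w"
    have "?A ?a = ?c"
      using act.HAdj_HMor[OF H, of "FMor F (Idn M (Dom M f))" "FMor G f" "l (Dom M f)" w] f
      by (simp add: functIdn[OF F])
    moreover have "?A ?b = ?d"
      using act.HAdj_HMor[OF H, of "FMor F f" "FMor G (Idn M (Cod M f))" "l (Cod M f)" w] f
      by (simp add: functIdn[OF G] lw_def)
    moreover have "?a = ?b \<longleftrightarrow> ?A ?a = ?A ?b"
      using act.HAdj_inj[OF H, of "FObj F (Dom M f)" "FObj G (Cod M f)" w ?a ?b] f by (auto simp: Hom_def)
    ultimately show ?thesis by simp
  qed
  then show ?thesis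
    by (simp add: is_wedge_def family1_def hom_bifun_obj_def hom_bifun_mor_def Hom_def cong: ball_cong_simp)
qed

lemma HAdj_rw:
  assumes "x \<in> Obj N" "y \<in> Obj N" "u \<in> Hom C a b" "k \<in> Hom C b (HObj H x y)"
  shows "HAdj H x y a (k \<cdot>\<^bsub>C\<^esub> u) = HAdj H x y b k \<diamondop> (u \<triangleleft> x)"
  using act.HAdj_Comp[OF H, of x y u k] assms by (auto simp: Hom_def rw_def)

lemma end_universal:
  assumes E: "is_end M C (hom_bifun_obj H F G) (hom_bifun_mor H F G) g j"
  shows "universal_family g (\<lambda>x. HAdj H (FObj F x) (FObj G x) g (j x))"
proof -
  have W: "is_wedge M C (hom_bifun_obj H F G) (hom_bifun_mor H F G) g j"
    using E by (simp add: is_end_def)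
  then have g: "g \<in> Obj C" and j: "\<And>x. x \<in> Obj M \<Longrightarrow> j x \<in> Hom C g (HObj H (FObj F x) (FObj G x))"
    by (auto simp: is_wedge_def hom_bifun_obj_def)
  show ?thesis
    unfolding universal_family_def
  proof (intro conjI ballI allI impI)
    show "family1 g (\<lambda>x. HAdj H (FObj F x) (FObj G x) g (j x))"
      by (rule is_wedge_iff[OF j g, THEN iffD1, OF _ W])
  next
    fix a \<xi> assume a: "a \<in> Obj C" and \<xi>: "family1 a \<xi>"
    have "\<exists>k \<in> Hom C a (HObj H (FObj F x) (FObj G x)). HAdj H (FObj F x) (FObj G x) a k = \<xi> x" if "x \<in> Obj M" for x
    proof -
      have "\<xi> x \<in> HAdj H (FObj F x) (FObj G x) a ` Hom C a (HObj H (FObj F x) (FObj G x))"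
        using bij_betw_imp_surj_on[OF act.HAdj_bij[OF H, of "FObj F x" "FObj G x" a]] \<xi> that a
        by (simp add: family1_def)
      then show ?thesis by (auto simp: image_iff)
    qed
    then obtain l where l: "\<And>x. x \<in> Obj M \<Longrightarrow> l x \<in> Hom C a (HObj H (FObj F x) (FObj G x))"
      "\<And>x. x \<in> Obj M \<Longrightarrow> HAdj H (FObj F x) (FObj G x) a (l x) = \<xi> x"
      by metis
    have "family1 a (\<lambda>x. HAdj H (FObj F x) (FObj G x) a (l x))"
      using \<xi> l(2) by (simp add: family1_def cong: ball_cong_simp)
    then have "\<exists>!u. u \<in> Hom C a g \<and> (\<forall>x \<in> Obj M. j x \<cdot>\<^bsub>C\<^esub> u = l x)"
      using E is_wedge_iff[of l a, OF l(1) a] unfolding is_end_def by blast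
    moreover have "j x \<cdot>\<^bsub>C\<^esub> u = l x \<longleftrightarrow> HAdj H (FObj F x) (FObj G x) g (j x) \<diamondop> (u \<triangleleft> FObj F x) = \<xi> x"
      if u: "u \<in> Hom C a g" and x: "x \<in> Obj M" for u x
    proof -
      have "j x \<cdot>\<^bsub>C\<^esub> u \<in> Hom C a (HObj H (FObj F x) (FObj G x))"
        using C.Comp_in_Hom[OF u j[OF x]] .
      then have "j x \<cdot>\<^bsub>C\<^esub> u = l x \<longleftrightarrow> HAdj H (FObj F x) (FObj G x) a (j x \<cdot>\<^bsub>C\<^esub> u) = HAdj H (FObj F x) (FObj G x) a (l x)"
        using act.HAdj_inj[OF H _ _ _ _ l(1)[OF x]] x by auto
      then show ?thesis
        using HAdj_rw[OF _ _ u j[OF x]] x l(2)[OF x] by simp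
    qed
    then have "(u \<in> Hom C a g \<and> (\<forall>x \<in> Obj M. j x \<cdot>\<^bsub>C\<^esub> u = l x)) \<longleftrightarrow>
      (u \<in> Hom C a g \<and> (\<forall>x \<in> Obj M. HAdj H (FObj F x) (FObj G x) g (j x) \<diamondop> (u \<triangleleft> FObj F x) = \<xi> x))" for u
      by blast
    ultimately show "\<exists>!u. u \<in> Hom C a g \<and> (\<forall>x \<in> Obj M. HAdj H (FObj F x) (FObj G x) g (j x) \<diamondop> (u \<triangleleft> FObj F x) = \<xi> x)"
      by (simp only:)
  qed (rule g)
qed

text \<open>The converse of \<open>end_universal\<close>: one universal family yields an end for
  every choice of internal Homs.\<close>

lemma universal_end:
  assumes U: "universal_family g \<epsilon>"
  shows "\<exists>j. is_end M C (hom_bifun_obj H F G) (hom_bifun_mor H F G) g j"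
proof -
  have g: "g \<in> Obj C" and \<epsilon>: "family1 g \<epsilon>" using U by (auto simp: universal_family_def)
  have "\<exists>k \<in> Hom C g (HObj H (FObj F x) (FObj G x)). HAdj H (FObj F x) (FObj G x) g k = \<epsilon> x" if "x \<in> Obj M" for x
    proof -
      have "\<epsilon> x \<in> HAdj H (FObj F x) (FObj G x) g ` Hom C g (HObj H (FObj F x) (FObj G x))"
        using bij_betw_imp_surj_on[OF act.HAdj_bij[OF H, of "FObj F x" "FObj G x" g]] \<epsilon> that g
        by (simp add: family1_def)
      then show ?thesis by (auto simp: image_iff)
    qed
  then obtain j where j: "\<And>x. x \<in> Obj M \<Longrightarrow> j x \<in> Hom C g (HObj H (FObj F x) (FObj G x))"
    "\<And>x. x \<in> Obj M \<Longrightarrow> HAdj H (FObj F x) (FObj G x) g (j x) = \<epsilon> x"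
    by metis
  have "is_end M C (hom_bifun_obj H F G) (hom_bifun_mor H F G) g j"
    unfolding is_end_def
  proof (intro conjI allI impI)
    have "family1 g (\<lambda>x. HAdj H (FObj F x) (FObj G x) g (j x))"
      using \<epsilon> j(2) by (simp add: family1_def cong: ball_cong_simp)
    then show "is_wedge M C (hom_bifun_obj H F G) (hom_bifun_mor H F G) g j"
      by (rule is_wedge_iff[OF j(1) g, THEN iffD2, rotated])
  next
    fix w l assume W: "is_wedge M C (hom_bifun_obj H F G) (hom_bifun_mor H F G) w l"
    then have w: "w \<in> Obj C" and l: "\<And>x. x \<in> Obj M \<Longrightarrow> l x \<in> Hom C w (HObj H (FObj F x) (FObj G x))"
      by (auto simp: is_wedge_def hom_bifun_obj_def)
    have "\<exists>!u. u \<in> Hom C w g \<and> (\<forall>x \<in> Obj M. \<epsilon> x \<diamondop> (u \<triangleleft> FObj F x) = HAdj H (FObj F x) (FObj G x) w (l x))"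
      using U W is_wedge_iff[of l w, OF l w] w unfolding universal_family_def by blast
    moreover have "j x \<cdot>\<^bsub>C\<^esub> u = l x \<longleftrightarrow> \<epsilon> x \<diamondop> (u \<triangleleft> FObj F x) = HAdj H (FObj F x) (FObj G x) w (l x)"
      if u: "u \<in> Hom C w g" and x: "x \<in> Obj M" for u x
    proof -
      have "j x \<cdot>\<^bsub>C\<^esub> u \<in> Hom C w (HObj H (FObj F x) (FObj G x))"
        using C.Comp_in_Hom[OF u j(1)[OF x]] .
      then have "j x \<cdot>\<^bsub>C\<^esub> u = l x \<longleftrightarrow> HAdj H (FObj F x) (FObj G x) w (j x \<cdot>\<^bsub>C\<^esub> u) = HAdj H (FObj F x) (FObj G x) w (l x)"
        using act.HAdj_inj[OF H _ _ _ _ l[OF x]] x by auto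
      then show ?thesis
        using HAdj_rw[OF _ _ u j(1)[OF x]] x j(2)[OF x] by simp
    qed
    then have "(u \<in> Hom C w g \<and> (\<forall>x \<in> Obj M. j x \<cdot>\<^bsub>C\<^esub> u = l x)) \<longleftrightarrow>
      (u \<in> Hom C w g \<and> (\<forall>x \<in> Obj M. \<epsilon> x \<diamondop> (u \<triangleleft> FObj F x) = HAdj H (FObj F x) (FObj G x) w (l x)))" for u
      by blast
    ultimately show "\<exists>!u. u \<in> Hom C w g \<and> (\<forall>x \<in> Obj M. j x \<cdot>\<^bsub>C\<^esub> u = l x)"
      by (simp only:)
  qed
  then show ?thesis by blast
qed

end

end

section \<open>The coaction and the half-braiding of an end\<close>

context universal_pair
begin

text \<open>The adjunction between tensoring with \<open>c\<close> and with \<open>RDual c\<close>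
  on the right turns the equations that characterise the coaction into those that characterise
  \<open>swap\<close>. Since \<open>swap\<close> is their only solution, the definite description is
  justified as well.\<close>

lemma end_coaction_eq:
  assumes H: "internal_Hom_of C N H"
    and j: "\<And>x. x \<in> Obj M \<Longrightarrow> j x \<in> Hom C g (HObj H (FObj F x) (FObj G x))"
    and \<epsilon>: "\<And>x. x \<in> Obj M \<Longrightarrow> \<epsilon> x = HAdj H (FObj F x) (FObj G x) g (j x)"
    and c: "c \<in> Obj C"
  shows "end_coaction C M N H F G g j c = (swap c \<triangleleft>\<^sub>C RDual C c) \<cdot>\<^bsub>C\<^esub> C.reta (RDual C c) c (RCoev C c) g"
proof -
  let ?r = "RDual C c" and ?e = "REv C c" and ?k = "RCoev C c"
  note D = C.right_dual[OF c]
  note [simp] = c act.HObj_Obj[OF H] act.HMor_simps[OF H] act.HAdj_simps[OF H] C.reta_simps[OF D] C.reps_simps[OF D]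
  have j' [simp]: "j x \<in> Arr C" "Dom C (j x) = g" "Cod C (j x) = HObj H (FObj F x) (FObj G x)" if "x \<in> Obj M" for x
    using j[OF that] by (auto simp: Hom_def)
  let ?R = "\<lambda>x. Hom_act_iso C N H c (FObj F x) c (FObj G x) \<cdot>\<^bsub>C\<^esub> HMor H (inv_arr N (FCon F c x)) (FCon G c x) \<cdot>\<^bsub>C\<^esub> j (c \<rhd>\<^sub>o\<^bsub>M\<^esub> x)"
  \<comment> \<open>An equivalence at a single object \<open>x\<close> and for an arbitrary
    candidate \<open>d\<close>, so that it serves both existence and uniqueness.\<close>
  have key: "((c \<triangleright>\<^sub>C j x) \<triangleleft>\<^sub>C ?r) \<cdot>\<^bsub>C\<^esub> d = ?R x \<longleftrightarrow>
      (c \<triangleright> \<epsilon> x) \<diamondop> MAssoc N c g (FObj F x) \<diamondop> ((C.reps ?r c ?e (c \<otimes>\<^sub>o\<^bsub>C\<^esub> g) \<cdot>\<^bsub>C\<^esub> (d \<triangleleft>\<^sub>C c)) \<triangleleft> FObj F x)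
        = \<zeta> c x \<diamondop> MAssoc N g c (FObj F x)"
    if d: "d \<in> Hom C g ((c \<otimes>\<^sub>o\<^bsub>C\<^esub> g) \<otimes>\<^sub>o\<^bsub>C\<^esub> ?r)" and x [simp]: "x \<in> Obj M" for d x
  proof -
    have d' [simp]: "d \<in> Arr C" "Dom C d = g" "Cod C d = (c \<otimes>\<^sub>o\<^bsub>C\<^esub> g) \<otimes>\<^sub>o\<^bsub>C\<^esub> ?r"
      using d by (auto simp: Hom_def)
    let ?Fx = "FObj F x" and ?Gx = "FObj G x"
    define h where "h = HObj H ?Fx ?Gx"
    define a where "a = HObj H (c \<star> ?Fx) (c \<star> ?Gx)"
    have [simp]: "h \<in> Obj C" "a \<in> Obj C" by (simp_all add: h_def a_def)
    note [simp] = h_def[symmetric] a_def[symmetric]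
    obtain t where t: "t \<in> Hom C (a \<otimes>\<^sub>o\<^bsub>C\<^esub> c) (c \<otimes>\<^sub>o\<^bsub>C\<^esub> h)"
      and t_iso: "Hom_act_iso C N H c ?Fx c ?Gx = (t \<triangleleft>\<^sub>C ?r) \<cdot>\<^bsub>C\<^esub> C.reta ?r c ?k a"
      and t_eq: "(c \<triangleright> act.counit H ?Fx ?Gx) \<diamondop> MAssoc N c h ?Fx \<diamondop> (t \<triangleleft> ?Fx)
        = act.counit H (c \<star> ?Fx) (c \<star> ?Gx) \<diamondop> MAssoc N a c ?Fx"
      using Hom_act_iso_eq[OF H c c _ _ a_def h_def] F_simps(1)[OF x] G_simps(1)[OF x] by blast
    have t' [simp]: "t \<in> Arr C" "Dom C t = a \<otimes>\<^sub>o\<^bsub>C\<^esub> c" "Cod C t = c \<otimes>\<^sub>o\<^bsub>C\<^esub> h" using t by (auto simp: Hom_def)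
    define k where "k = HMor H (inv_arr N (FCon F c x)) (FCon G c x) \<cdot>\<^bsub>C\<^esub> j (c \<rhd>\<^sub>o\<^bsub>M\<^esub> x)"
    have k [simp]: "k \<in> Arr C" "Dom C k = g" "Cod C k = a" by (simp_all add: k_def)
    have k_adj: "HAdj H (c \<star> ?Fx) (c \<star> ?Gx) g k = \<zeta> c x"
      using act.HAdj_HMor[OF H, of "inv_arr N (FCon F c x)" "FCon G c x" "j (c \<rhd>\<^sub>o\<^bsub>M\<^esub> x)" g]
      by (simp add: k_def \<zeta>_def \<epsilon> lw_def)
    let ?d' = "C.reps ?r c ?e (c \<otimes>\<^sub>o\<^bsub>C\<^esub> g) \<cdot>\<^bsub>C\<^esub> (d \<triangleleft>\<^sub>C c)"
    have d_eq: "d = (?d' \<triangleleft>\<^sub>C ?r) \<cdot>\<^bsub>C\<^esub> C.reta ?r c ?k g"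
      using C.rflat_rsharp[OF D, of d "c \<otimes>\<^sub>o\<^bsub>C\<^esub> g"] by simp
    have flat: "((w \<triangleleft>\<^sub>C ?r) \<cdot>\<^bsub>C\<^esub> C.reta ?r c ?k g = (v \<triangleleft>\<^sub>C ?r) \<cdot>\<^bsub>C\<^esub> C.reta ?r c ?k g) \<longleftrightarrow> w = v"
      if "w \<in> Hom C (g \<otimes>\<^sub>o\<^bsub>C\<^esub> c) (c \<otimes>\<^sub>o\<^bsub>C\<^esub> h)" "v \<in> Hom C (g \<otimes>\<^sub>o\<^bsub>C\<^esub> c) (c \<otimes>\<^sub>o\<^bsub>C\<^esub> h)" for w v
    proof -
      have "C.reps ?r c ?e (c \<otimes>\<^sub>o\<^bsub>C\<^esub> h) \<cdot>\<^bsub>C\<^esub> (((z \<triangleleft>\<^sub>C ?r) \<cdot>\<^bsub>C\<^esub> C.reta ?r c ?k g) \<triangleleft>\<^sub>C c) = z"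
        if "z \<in> Hom C (g \<otimes>\<^sub>o\<^bsub>C\<^esub> c) (c \<otimes>\<^sub>o\<^bsub>C\<^esub> h)" for z
        using C.rsharp_rflat[OF D, of z g] that by (auto simp only: Hom_def mem_Collect_eq g_Obj)
      from this[OF that(1)] this[OF that(2)] show ?thesis by metis
    qed
    have "((c \<triangleright>\<^sub>C j x) \<triangleleft>\<^sub>C ?r) \<cdot>\<^bsub>C\<^esub> d = (((c \<triangleright>\<^sub>C j x) \<cdot>\<^bsub>C\<^esub> ?d') \<triangleleft>\<^sub>C ?r) \<cdot>\<^bsub>C\<^esub> C.reta ?r c ?k g"
      by (subst d_eq) (simp add: C.reg.rw_Comp)
    moreover have "?R x = ((t \<cdot>\<^bsub>C\<^esub> (k \<triangleleft>\<^sub>C c)) \<triangleleft>\<^sub>C ?r) \<cdot>\<^bsub>C\<^esub> C.reta ?r c ?k g"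
      unfolding t_iso k_def[symmetric] by (simp add: C.reg.rw_Comp C.reta_nat[OF D])
    ultimately have "((c \<triangleright>\<^sub>C j x) \<triangleleft>\<^sub>C ?r) \<cdot>\<^bsub>C\<^esub> d = ?R x \<longleftrightarrow> (c \<triangleright>\<^sub>C j x) \<cdot>\<^bsub>C\<^esub> ?d' = t \<cdot>\<^bsub>C\<^esub> (k \<triangleleft>\<^sub>C c)"
      using flat by (simp add: Hom_def)
    \<comment> \<open>Arrows into \<open>c \<otimes> h\<close> are determined by their composites
      with \<open>c\<close> acting on the counit: transposition along \<open>RDual c\<close> reduces
      this to injectivity of \<open>HAdj\<close>.\<close>
    also have "\<dots> \<longleftrightarrow> (c \<triangleright> act.counit H ?Fx ?Gx) \<diamondop> MAssoc N c h ?Fx \<diamondop> (((c \<triangleright>\<^sub>C j x) \<cdot>\<^bsub>C\<^esub> ?d') \<triangleleft> ?Fx)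
       = (c \<triangleright> act.counit H ?Fx ?Gx) \<diamondop> MAssoc N c h ?Fx \<diamondop> ((t \<cdot>\<^bsub>C\<^esub> (k \<triangleleft>\<^sub>C c)) \<triangleleft> ?Fx)"
    proof
      note C.reg.eps_simps[OF D, simp] eps_simps[OF D, simp]
      assume eq: "(c \<triangleright> act.counit H ?Fx ?Gx) \<diamondop> MAssoc N c h ?Fx \<diamondop> (((c \<triangleright>\<^sub>C j x) \<cdot>\<^bsub>C\<^esub> ?d') \<triangleleft> ?Fx)
         = (c \<triangleright> act.counit H ?Fx ?Gx) \<diamondop> MAssoc N c h ?Fx \<diamondop> ((t \<cdot>\<^bsub>C\<^esub> (k \<triangleleft>\<^sub>C c)) \<triangleleft> ?Fx)"
      let ?s = "\<lambda>w. C.reg.eps ?r c ?e h \<cdot>\<^bsub>C\<^esub> (?r \<triangleright>\<^sub>C w)"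
      have sharp: "HAdj H ?Fx ?Gx (?r \<otimes>\<^sub>o\<^bsub>C\<^esub> g \<otimes>\<^sub>o\<^bsub>C\<^esub> c) (?s w)
          = eps ?r c ?e ?Gx \<diamondop> (?r \<triangleright> ((c \<triangleright> act.counit H ?Fx ?Gx) \<diamondop> MAssoc N c h ?Fx \<diamondop> (w \<triangleleft> ?Fx))) \<diamondop> MAssoc N ?r (g \<otimes>\<^sub>o\<^bsub>C\<^esub> c) ?Fx"
        if "w \<in> Hom C (g \<otimes>\<^sub>o\<^bsub>C\<^esub> c) (c \<otimes>\<^sub>o\<^bsub>C\<^esub> h)" for w
        using that act.HAdj_counit[OF H, of ?Fx ?Gx "?s w"]
        by (simp add: Hom_def sharp_act[OF D, of w h _ "g \<otimes>\<^sub>o\<^bsub>C\<^esub> c"] lw_Comp N.prefix[OF eps_nat[OF D]] flip: rw_def)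
      have "(c \<triangleright>\<^sub>C j x) \<cdot>\<^bsub>C\<^esub> ?d' \<in> Hom C (g \<otimes>\<^sub>o\<^bsub>C\<^esub> c) (c \<otimes>\<^sub>o\<^bsub>C\<^esub> h)"
        "t \<cdot>\<^bsub>C\<^esub> (k \<triangleleft>\<^sub>C c) \<in> Hom C (g \<otimes>\<^sub>o\<^bsub>C\<^esub> c) (c \<otimes>\<^sub>o\<^bsub>C\<^esub> h)"
        by (simp_all add: Hom_def)
      note sharp = this[THEN sharp]
      have "?s ((c \<triangleright>\<^sub>C j x) \<cdot>\<^bsub>C\<^esub> ?d') = ?s (t \<cdot>\<^bsub>C\<^esub> (k \<triangleleft>\<^sub>C c))"
      proof (rule act.HAdj_inj[OF H, of ?Fx ?Gx "?r \<otimes>\<^sub>o\<^bsub>C\<^esub> g \<otimes>\<^sub>o\<^bsub>C\<^esub> c"])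
        show "HAdj H ?Fx ?Gx (?r \<otimes>\<^sub>o\<^bsub>C\<^esub> g \<otimes>\<^sub>o\<^bsub>C\<^esub> c) (?s ((c \<triangleright>\<^sub>C j x) \<cdot>\<^bsub>C\<^esub> ?d'))
            = HAdj H ?Fx ?Gx (?r \<otimes>\<^sub>o\<^bsub>C\<^esub> g \<otimes>\<^sub>o\<^bsub>C\<^esub> c) (?s (t \<cdot>\<^bsub>C\<^esub> (k \<triangleleft>\<^sub>C c)))"
          unfolding sharp eq ..
      qed (simp_all add: Hom_def)
      then show "(c \<triangleright>\<^sub>C j x) \<cdot>\<^bsub>C\<^esub> ?d' = t \<cdot>\<^bsub>C\<^esub> (k \<triangleleft>\<^sub>C c)"
        by (rule C.reg.sharp_inj[OF D]) simp_all
    qed (rule arg_cong)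
    also have "(c \<triangleright> act.counit H ?Fx ?Gx) \<diamondop> MAssoc N c h ?Fx \<diamondop> (((c \<triangleright>\<^sub>C j x) \<cdot>\<^bsub>C\<^esub> ?d') \<triangleleft> ?Fx)
       = (c \<triangleright> \<epsilon> x) \<diamondop> MAssoc N c g ?Fx \<diamondop> (?d' \<triangleleft> ?Fx)"
      using act.HAdj_counit[OF H, of ?Fx ?Gx "j x" g]
      by (simp add: \<epsilon> rw_Comp lw_Comp natural_simps flip: rw_def)
    also have "(c \<triangleright> act.counit H ?Fx ?Gx) \<diamondop> MAssoc N c h ?Fx \<diamondop> ((t \<cdot>\<^bsub>C\<^esub> (k \<triangleleft>\<^sub>C c)) \<triangleleft> ?Fx)
       = ((c \<triangleright> act.counit H ?Fx ?Gx) \<diamondop> MAssoc N c h ?Fx \<diamondop> (t \<triangleleft> ?Fx)) \<diamondop> ((k \<triangleleft>\<^sub>C c) \<triangleleft> ?Fx)"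
      by (simp add: rw_Comp)
    also have "\<dots> = (act.counit H (c \<star> ?Fx) (c \<star> ?Gx) \<diamondop> (k \<triangleleft> (c \<star> ?Fx))) \<diamondop> MAssoc N g c ?Fx"
      unfolding t_eq by (simp add: natural_simps)
    also have "act.counit H (c \<star> ?Fx) (c \<star> ?Gx) \<diamondop> (k \<triangleleft> (c \<star> ?Fx)) = \<zeta> c x"
      using act.HAdj_counit[OF H, of "c \<star> ?Fx" "c \<star> ?Gx" k g] by (simp add: k_adj rw_def)
    finally show ?thesis .
  qed
  show ?thesis (is "_ = ?d")
    unfolding end_coaction_def
  proof (rule the_equality)
    have 1: "?d \<in> Hom C g ((c \<otimes>\<^sub>o\<^bsub>C\<^esub> g) \<otimes>\<^sub>o\<^bsub>C\<^esub> ?r)" by (simp add: Hom_def)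
    have "C.reps ?r c ?e (c \<otimes>\<^sub>o\<^bsub>C\<^esub> g) \<cdot>\<^bsub>C\<^esub> (?d \<triangleleft>\<^sub>C c) = swap c"
      using C.rsharp_rflat[OF D, of "swap c" g] by simp
    with 1 show "?d \<in> Hom C g ((c \<otimes>\<^sub>o\<^bsub>C\<^esub> g) \<otimes>\<^sub>o\<^bsub>C\<^esub> ?r) \<and> (\<forall>x \<in> Obj M. ((Idn C c \<otimes>\<^sub>m\<^bsub>C\<^esub> j x) \<otimes>\<^sub>m\<^bsub>C\<^esub> Idn C ?r) \<cdot>\<^bsub>C\<^esub> ?d = ?R x)"
      by (simp add: key swap_eq flip: C.reg.lw_def C.reg.rw_def del: C.assoc)
  next
    fix d assume d: "d \<in> Hom C g ((c \<otimes>\<^sub>o\<^bsub>C\<^esub> g) \<otimes>\<^sub>o\<^bsub>C\<^esub> ?r) \<and> (\<forall>x \<in> Obj M. ((Idn C c \<otimes>\<^sub>m\<^bsub>C\<^esub> j x) \<otimes>\<^sub>m\<^bsub>C\<^esub> Idn C ?r) \<cdot>\<^bsub>C\<^esub> d = ?R x)"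
    let ?d' = "C.reps ?r c ?e (c \<otimes>\<^sub>o\<^bsub>C\<^esub> g) \<cdot>\<^bsub>C\<^esub> (d \<triangleleft>\<^sub>C c)"
    have "swap c = ?d'"
      by (rule swap_eqI[OF c]) (use d key in \<open>auto simp: Hom_def C.reg.lw_def C.reg.rw_def\<close>)
    then show "d = ?d"
      using C.rflat_rsharp[OF D, of d "c \<otimes>\<^sub>o\<^bsub>C\<^esub> g"] d by (simp add: Hom_def)
  qed
qed

text \<open>The evaluation in the definition of the half-braiding undoes the transposition and
  leaves \<open>swap\<close>, whose inverse is taken.\<close>

lemma end_half_braiding_eq:
  assumes H: "internal_Hom_of C N H"
    and j: "\<And>x. x \<in> Obj M \<Longrightarrow> j x \<in> Hom C g (HObj H (FObj F x) (FObj G x))"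
    and \<epsilon>: "\<And>x. x \<in> Obj M \<Longrightarrow> \<epsilon> x = HAdj H (FObj F x) (FObj G x) g (j x)"
    and c: "c \<in> Obj C"
  shows "end_half_braiding C M N H F G g j c = inv_arr C (swap c)"
proof -
  let ?r = "RDual C c" and ?e = "REv C c" and ?k = "RCoev C c"
  note D = C.right_dual[OF c]
  note [simp] = c C.reta_simps[OF D] C.reps_simps[OF D]
  have "RUnit C (c \<otimes>\<^sub>o\<^bsub>C\<^esub> g) \<cdot>\<^bsub>C\<^esub> (Idn C (c \<otimes>\<^sub>o\<^bsub>C\<^esub> g) \<otimes>\<^sub>m\<^bsub>C\<^esub> ?e) \<cdot>\<^bsub>C\<^esub> Assoc C (c \<otimes>\<^sub>o\<^bsub>C\<^esub> g) ?r c
       \<cdot>\<^bsub>C\<^esub> (end_coaction C M N H F G g j c \<otimes>\<^sub>m\<^bsub>C\<^esub> Idn C c)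
     = C.reps ?r c ?e (c \<otimes>\<^sub>o\<^bsub>C\<^esub> g) \<cdot>\<^bsub>C\<^esub> (((swap c \<triangleleft>\<^sub>C ?r) \<cdot>\<^bsub>C\<^esub> C.reta ?r c ?k g) \<triangleleft>\<^sub>C c)"
    using D by (simp add: end_coaction_eq[OF H j \<epsilon> c] C.reps_def C.reg.dual(3-5) flip: C.reg.lw_def C.reg.rw_def)
  also have "\<dots> = swap c"
    using C.rsharp_rflat[OF D, of "swap c" g] by simp
  finally show ?thesis
    by (simp add: end_half_braiding_def)
qed

end

section \<open>Opposite categories\<close>

definition op_cat :: "('o, 'm, 'z) cat_scheme \<Rightarrow> ('o, 'm, 'z) cat_scheme" where
  "op_cat C = C\<lparr>Dom := Cod C, Cod := Dom C, Comp := (\<lambda>f g. Comp C g f)\<rparr>"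

definition op_lin :: "('k, 'o, 'm, 'z) lin_cat_scheme \<Rightarrow> ('k, 'o, 'm, 'z) lin_cat_scheme" where
  "op_lin C = (op_cat C)\<lparr>Zero := (\<lambda>x y. Zero C y x)\<rparr>"

text \<open>Arrows are reversed while the order of tensor factors is kept. Associators and unitors
  are therefore inverted, and right and left duals change places, with evaluations and coevaluations
  exchanged.\<close>

definition op_tensor :: "('k, 'c, 'd, 'z) tensor_cat_scheme \<Rightarrow> ('k, 'c, 'd, 'z) tensor_cat_scheme" where
  "op_tensor C = (op_lin C)\<lparr>Assoc := (\<lambda>a b c. inv_arr C (Assoc C a b c)), LUnit := (\<lambda>a. inv_arr C (LUnit C a)),
     RUnit := (\<lambda>a. inv_arr C (RUnit C a)), RDual := LDual C, REv := LCoev C, RCoev := LEv C,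
     LDual := RDual C, LEv := RCoev C, LCoev := REv C\<rparr>"

definition op_module ::
  "('k, 'c, 'd, 'o, 'm, 'y) module_cat_scheme \<Rightarrow> ('k, 'c, 'd, 'o, 'm, 'y) module_cat_scheme" where
  "op_module N = (op_lin N)\<lparr>MAssoc := (\<lambda>c d x. inv_arr N (MAssoc N c d x)), MUnit := (\<lambda>x. inv_arr N (MUnit N x))\<rparr>"

text \<open>The values on objects and arrows stay as they are; the constraint is read backwards and
  has to be inverted.\<close>

definition op_functor ::
  "('p, 'q, 'z) cat_scheme \<Rightarrow> ('c, 'o, 'm, 'p, 'q) mfunct \<Rightarrow> ('c, 'o, 'm, 'p, 'q) mfunct" where
  "op_functor N F = F\<lparr>FCon := (\<lambda>c x. inv_arr N (FCon F c x))\<rparr>"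

lemma op_cat_simps [simp]:
  "Obj (op_cat C) = Obj C" "Arr (op_cat C) = Arr C" "Dom (op_cat C) = Cod C" "Cod (op_cat C) = Dom C"
  "Idn (op_cat C) = Idn C" "f \<cdot>\<^bsub>op_cat C\<^esub> g = g \<cdot>\<^bsub>C\<^esub> f"
  by (simp_all add: op_cat_def)

lemma op_lin_simps [simp]:
  "Obj (op_lin C) = Obj C" "Arr (op_lin C) = Arr C" "Dom (op_lin C) = Cod C" "Cod (op_lin C) = Dom C"
  "Idn (op_lin C) = Idn C" "f \<cdot>\<^bsub>op_lin C\<^esub> g = g \<cdot>\<^bsub>C\<^esub> f"
  "Zero (op_lin C) x y = Zero C y x" "Add (op_lin C) = Add C" "Scale (op_lin C) = Scale C"
  by (simp_all add: op_cat_def op_lin_def)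

lemma op_tensor_simps [simp]:
  "Obj (op_tensor C) = Obj C" "Arr (op_tensor C) = Arr C" "Dom (op_tensor C) = Cod C" "Cod (op_tensor C) = Dom C"
  "Idn (op_tensor C) = Idn C" "f \<cdot>\<^bsub>op_tensor C\<^esub> g = g \<cdot>\<^bsub>C\<^esub> f"
  "Zero (op_tensor C) x y = Zero C y x" "Add (op_tensor C) = Add C" "Scale (op_tensor C) = Scale C"
  "Unit (op_tensor C) = Unit C" "TObj (op_tensor C) = TObj C" "TMor (op_tensor C) = TMor C"
  "Assoc (op_tensor C) a b c = inv_arr C (Assoc C a b c)" "LUnit (op_tensor C) a = inv_arr C (LUnit C a)"
  "RUnit (op_tensor C) a = inv_arr C (RUnit C a)" "RDual (op_tensor C) = LDual C" "REv (op_tensor C) = LCoev C"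
  "RCoev (op_tensor C) = LEv C" "LDual (op_tensor C) = RDual C" "LEv (op_tensor C) = RCoev C"
  "LCoev (op_tensor C) = REv C"
  by (simp_all add: op_cat_def op_lin_def op_tensor_def)

lemma op_module_simps [simp]:
  "Obj (op_module C) = Obj C" "Arr (op_module C) = Arr C" "Dom (op_module C) = Cod C" "Cod (op_module C) = Dom C"
  "Idn (op_module C) = Idn C" "f \<cdot>\<^bsub>op_module C\<^esub> g = g \<cdot>\<^bsub>C\<^esub> f"
  "Zero (op_module C) x y = Zero C y x" "Add (op_module C) = Add C" "Scale (op_module C) = Scale C"
  "ActObj (op_module C) = ActObj C" "ActMor (op_module C) = ActMor C"
  "MAssoc (op_module C) c d x = inv_arr C (MAssoc C c d x)" "MUnit (op_module C) x = inv_arr C (MUnit C x)"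
  by (simp_all add: op_cat_def op_lin_def op_module_def)

lemma op_functor_simps [simp]:
  "FObj (op_functor N F) = FObj F" "FMor (op_functor N F) = FMor F" "FCon (op_functor N F) c x = inv_arr N (FCon F c x)"
  by (simp_all add: op_functor_def)

lemma Hom_op [simp]:
  "Hom (op_cat C) x y = Hom C y x" "Hom (op_lin D) x y = Hom D y x" "Hom (op_tensor E) x y = Hom E y x"
  "Hom (op_module N) x y = Hom N y x"
  by (auto simp: Hom_def)

lemma inverse_arrows_op [simp]:
  "inverse_arrows (op_cat C) f g = inverse_arrows C f g" "inverse_arrows (op_lin D) f g = inverse_arrows D f g"
  "inverse_arrows (op_tensor E) f g = inverse_arrows E f g" "inverse_arrows (op_module N) f g = inverse_arrows N f g"
  by (auto simp: inverse_arrows_def)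

lemma iso_arr_op [simp]:
  "iso_arr (op_cat C) f = iso_arr C f" "iso_arr (op_lin D) f = iso_arr D f"
  "iso_arr (op_tensor E) f = iso_arr E f" "iso_arr (op_module N) f = iso_arr N f"
  "inv_arr (op_cat C) f = inv_arr C f" "inv_arr (op_lin D) f = inv_arr D f"
  "inv_arr (op_tensor E) f = inv_arr E f" "inv_arr (op_module N) f = inv_arr N f"
  by (simp_all add: iso_arr_def inv_arr_def)

lemma (in category) category_op: "category (op_cat C)"
  by unfold_locales (auto simp: Hom_def)

text \<open>Stated for any record with reversed data, because \<open>op_tensor\<close> and
  \<open>op_module\<close> extend the record of a linear category in different ways.\<close>

lemma (in linear_category) linear_category_op:
  assumes "Obj D = Obj C" "Arr D = Arr C" "Dom D = Cod C" "Cod D = Dom C" "Idn D = Idn C"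
    "\<And>f g. f \<cdot>\<^bsub>D\<^esub> g = g \<cdot>\<^bsub>C\<^esub> f" "\<And>x y. Zero D x y = Zero C y x" "Add D = Add C" "Scale D = Scale C"
  shows "linear_category D"
proof -
  have H: "Hom D x y = Hom C y x" for x y
    using assms by (auto simp: Hom_def)
  show ?thesis
    by unfold_locales (simp_all add: assms H Zero_in_Hom Add_in_Hom Scale_in_Hom Add_assoc Add_Zero
        Add_inverse Scale_one Scale_Scale Scale_add_left Scale_add_right Comp_Add_left Comp_Add_right
        Comp_Scale_left Comp_Scale_right Idn_in_Hom Comp_in_Hom Comp_assoc Comp_Idn_left Comp_Idn_right,
        simp_all add: Add_commute)
qed

context monoidal_linear_category
begin

lemma inv_pentagon:
  assumes "a \<in> Obj C" "b \<in> Obj C" "c \<in> Obj C" "d \<in> Obj C"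
  shows "(inv_arr C (Assoc C a b c) \<triangleleft>\<^sub>C d) \<cdot>\<^bsub>C\<^esub> inv_arr C (Assoc C a (b \<otimes>\<^sub>o\<^bsub>C\<^esub> c) d) \<cdot>\<^bsub>C\<^esub> (a \<triangleright>\<^sub>C inv_arr C (Assoc C b c d))
    = inv_arr C (Assoc C (a \<otimes>\<^sub>o\<^bsub>C\<^esub> b) c d) \<cdot>\<^bsub>C\<^esub> inv_arr C (Assoc C a b (c \<otimes>\<^sub>o\<^bsub>C\<^esub> d))"
proof -
  have "inv_arr C ((a \<triangleright>\<^sub>C Assoc C b c d) \<cdot>\<^bsub>C\<^esub> Assoc C a (b \<otimes>\<^sub>o\<^bsub>C\<^esub> c) d \<cdot>\<^bsub>C\<^esub> (Assoc C a b c \<triangleleft>\<^sub>C d))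
      = inv_arr C (Assoc C a b (c \<otimes>\<^sub>o\<^bsub>C\<^esub> d) \<cdot>\<^bsub>C\<^esub> Assoc C (a \<otimes>\<^sub>o\<^bsub>C\<^esub> b) c d)"
    using reg.pent[OF assms] by simp
  then show ?thesis
    using assms by (simp add: iso_Comp)
qed

lemma monoidal_op: "monoidal_linear_category (op_tensor C)"
proof -
  have lin: "linear_category (op_tensor C)"
    by (rule linear_category_op) simp_all
  note [simp] = Hom_def
  have "monoidal_linear_category_axioms (op_tensor C)"
  proof (rule monoidal_linear_category_axioms.intro, unfold op_tensor_simps Hom_op iso_arr_op)
    fix f a a' g b b' h c c' assume *: "f \<in> Hom C a' a" "g \<in> Hom C b' b" "h \<in> Hom C c' c"
    have "Assoc C a b c \<cdot>\<^bsub>C\<^esub> (f \<otimes>\<^sub>m\<^bsub>C\<^esub> g) \<otimes>\<^sub>m\<^bsub>C\<^esub> h = f \<otimes>\<^sub>m\<^bsub>C\<^esub> g \<otimes>\<^sub>m\<^bsub>C\<^esub> h \<cdot>\<^bsub>C\<^esub> Assoc C a' b' c'"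
      by (rule Assoc_natural[OF *])
    from square_inv[OF this] show "(f \<otimes>\<^sub>m\<^bsub>C\<^esub> g) \<otimes>\<^sub>m\<^bsub>C\<^esub> h \<cdot>\<^bsub>C\<^esub> inv_arr C (Assoc C a' b' c')
       = inv_arr C (Assoc C a b c) \<cdot>\<^bsub>C\<^esub> f \<otimes>\<^sub>m\<^bsub>C\<^esub> g \<otimes>\<^sub>m\<^bsub>C\<^esub> h"
      using * by auto
  next
    fix f a a' assume *: "f \<in> Hom C a' a"
    from square_inv[OF LUnit_natural[OF *]]
    show "Idn C (Unit C) \<otimes>\<^sub>m\<^bsub>C\<^esub> f \<cdot>\<^bsub>C\<^esub> inv_arr C (LUnit C a') = inv_arr C (LUnit C a) \<cdot>\<^bsub>C\<^esub> f"
      using * by auto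
    from square_inv[OF RUnit_natural[OF *]]
    show "f \<otimes>\<^sub>m\<^bsub>C\<^esub> Idn C (Unit C) \<cdot>\<^bsub>C\<^esub> inv_arr C (RUnit C a') = inv_arr C (RUnit C a) \<cdot>\<^bsub>C\<^esub> f"
      using * by auto
  next
    fix a b c d assume "a \<in> Obj C" "b \<in> Obj C" "c \<in> Obj C" "d \<in> Obj C"
    then show "(inv_arr C (Assoc C a b c) \<otimes>\<^sub>m\<^bsub>C\<^esub> Idn C d \<cdot>\<^bsub>C\<^esub> inv_arr C (Assoc C a (b \<otimes>\<^sub>o\<^bsub>C\<^esub> c) d)) \<cdot>\<^bsub>C\<^esub> Idn C a \<otimes>\<^sub>m\<^bsub>C\<^esub> inv_arr C (Assoc C b c d) =
       inv_arr C (Assoc C (a \<otimes>\<^sub>o\<^bsub>C\<^esub> b) c d) \<cdot>\<^bsub>C\<^esub> inv_arr C (Assoc C a b (c \<otimes>\<^sub>o\<^bsub>C\<^esub> d))"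
      using inv_pentagon[of a b c d] by (simp flip: reg.lw_def reg.rw_def)
  next
    fix a b assume *: "a \<in> Obj C" "b \<in> Obj C"
    then have "inv_arr C ((a \<triangleright>\<^sub>C LUnit C b) \<cdot>\<^bsub>C\<^esub> Assoc C a (Unit C) b) = inv_arr C (RUnit C a) \<triangleleft>\<^sub>C b"
      by (simp add: reg.tri)
    with * show "inv_arr C (Assoc C a (Unit C) b) \<cdot>\<^bsub>C\<^esub> Idn C a \<otimes>\<^sub>m\<^bsub>C\<^esub> inv_arr C (LUnit C b) = inv_arr C (RUnit C a) \<otimes>\<^sub>m\<^bsub>C\<^esub> Idn C b"
      by (simp add: iso_Comp flip: reg.lw_def reg.rw_def)
  next
    fix f a a' f' a'' g b b' g' b''
    assume *: "f \<in> Hom C a' a" "f' \<in> Hom C a'' a'" "g \<in> Hom C b' b" "g' \<in> Hom C b'' b'"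
    then show "(f \<cdot>\<^bsub>C\<^esub> f') \<otimes>\<^sub>m\<^bsub>C\<^esub> (g \<cdot>\<^bsub>C\<^esub> g') = f \<otimes>\<^sub>m\<^bsub>C\<^esub> g \<cdot>\<^bsub>C\<^esub> f' \<otimes>\<^sub>m\<^bsub>C\<^esub> g'"
      by (intro TMor_Comp[OF *(2,1,4,3)])
  qed (auto intro: TMor_Add_left TMor_Add_right TMor_Scale_left TMor_Scale_right TMor_Idn simp: Unit_in_Obj)
  then show ?thesis
    using lin by (simp add: monoidal_linear_category_def)
qed

end

text \<open>Reversal exchanges the two zigzag identities. Each is solved for a unitor, since unitors
  are inverted in the opposite category.\<close>

lemma (in monoidal_linear_category) duality_op:
  assumes D: "duality C d c ev k"
  shows "duality (op_tensor C) c d k ev"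
proof -
  note [simp] = reg.dual[OF D]
  have swap: "x \<cdot>\<^bsub>C\<^esub> inv_arr C r = inv_arr C l"
    if "l \<cdot>\<^bsub>C\<^esub> x = r" "iso_arr C l" "iso_arr C r" "x \<in> Arr C" "Cod C x = Dom C l" for l x r
  proof -
    have "x = inv_arr C l \<cdot>\<^bsub>C\<^esub> r"
      using that by (intro move_inv_left) auto
    moreover have "Cod C r = Cod C l"
      using that iso_Arr[of l] by auto
    ultimately show ?thesis
      using that iso_Arr[of r] by simp
  qed
  have 1: "((ev \<triangleleft>\<^sub>C d) \<cdot>\<^bsub>C\<^esub> inv_arr C (Assoc C d c d) \<cdot>\<^bsub>C\<^esub> (d \<triangleright>\<^sub>C k)) \<cdot>\<^bsub>C\<^esub> inv_arr C (RUnit C d) = inv_arr C (LUnit C d)"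
    by (rule swap[OF reg.dualityD(10)[OF D]]) simp_all
  have 2: "((c \<triangleright>\<^sub>C ev) \<cdot>\<^bsub>C\<^esub> Assoc C c d c \<cdot>\<^bsub>C\<^esub> (k \<triangleleft>\<^sub>C c)) \<cdot>\<^bsub>C\<^esub> inv_arr C (LUnit C c) = inv_arr C (RUnit C c)"
    by (rule swap[OF reg.dualityD(9)[OF D]]) simp_all
  show ?thesis
    using 1 2 by (simp add: duality_def Hom_iff flip: reg.lw_def reg.rw_def)
qed

lemma (in rigid_category) rigid_op: "rigid_category (op_tensor C)"
  by (intro rigid_category.intro monoidal_op rigid_category_axioms.intro)
    (simp_all add: duality_op right_dual left_dual)

lemma (in module_category) module_op: "module_category (op_tensor C) (op_module N)"
proof -
  have lin: "linear_category (op_module N)"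
    by (rule N.linear_category_op) simp_all
  note [simp] = Hom_def
  have "module_category_axioms (op_tensor C) (op_module N)"
  proof (rule module_category_axioms.intro, unfold op_tensor_simps op_module_simps Hom_op iso_arr_op)
    fix f c c' f' d d' h x x' assume *: "f \<in> Hom C c' c" "f' \<in> Hom C d' d" "h \<in> Hom N x' x"
    from N.square_inv[OF MAssoc_natural[OF *]]
    show "(f \<otimes>\<^sub>m\<^bsub>C\<^esub> f') \<rhd>\<^sub>m\<^bsub>N\<^esub> h \<diamondop> inv_arr N (MAssoc N c' d' x') = inv_arr N (MAssoc N c d x) \<diamondop> f \<rhd>\<^sub>m\<^bsub>N\<^esub> f' \<rhd>\<^sub>m\<^bsub>N\<^esub> h"
      using * C.reg.ActMor_simps by auto
  next
    fix f x x' assume *: "f \<in> Hom N x' x"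
    from N.square_inv[OF MUnit_natural[OF *]]
    show "Idn C (Unit C) \<rhd>\<^sub>m\<^bsub>N\<^esub> f \<diamondop> inv_arr N (MUnit N x') = inv_arr N (MUnit N x) \<diamondop> f"
      using * by auto
  next
    fix b c d x assume *: "b \<in> Obj C" "c \<in> Obj C" "d \<in> Obj C" "x \<in> Obj N"
    have "inv_arr N ((b \<triangleright> MAssoc N c d x) \<diamondop> MAssoc N b (c \<otimes>\<^sub>o\<^bsub>C\<^esub> d) x \<diamondop> (Assoc C b c d \<triangleleft> x))
          = inv_arr N (MAssoc N b c (d \<star> x) \<diamondop> MAssoc N (b \<otimes>\<^sub>o\<^bsub>C\<^esub> c) d x)"
      using pent[OF *] by simp
    then show "(inv_arr C (Assoc C b c d) \<rhd>\<^sub>m\<^bsub>N\<^esub> Idn N x \<diamondop> inv_arr N (MAssoc N b (c \<otimes>\<^sub>o\<^bsub>C\<^esub> d) x)) \<diamondop> Idn C b \<rhd>\<^sub>m\<^bsub>N\<^esub> inv_arr N (MAssoc N c d x)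
        = inv_arr N (MAssoc N (b \<otimes>\<^sub>o\<^bsub>C\<^esub> c) d x) \<diamondop> inv_arr N (MAssoc N b c (d \<star> x))"
      using * by (simp add: N.iso_Comp flip: lw_def rw_def)
  next
    fix c x assume *: "c \<in> Obj C" "x \<in> Obj N"
    then have "inv_arr N ((c \<triangleright> MUnit N x) \<diamondop> MAssoc N c (Unit C) x) = inv_arr C (RUnit C c) \<triangleleft> x"
      by (simp add: tri)
    with * show "inv_arr N (MAssoc N c (Unit C) x) \<diamondop> Idn C c \<rhd>\<^sub>m\<^bsub>N\<^esub> inv_arr N (MUnit N x) = inv_arr C (RUnit C c) \<rhd>\<^sub>m\<^bsub>N\<^esub> Idn N x"
      by (simp add: N.iso_Comp flip: lw_def rw_def)
  next
    fix f a a' f' a'' g b b' g' b''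
    assume *: "f \<in> Hom C a' a" "f' \<in> Hom C a'' a'" "g \<in> Hom N b' b" "g' \<in> Hom N b'' b'"
    then show "(f \<cdot>\<^bsub>C\<^esub> f') \<rhd>\<^sub>m\<^bsub>N\<^esub> (g \<diamondop> g') = f \<rhd>\<^sub>m\<^bsub>N\<^esub> g \<diamondop> f' \<rhd>\<^sub>m\<^bsub>N\<^esub> g'"
      by (intro ActMor_Comp[OF *(2,1,4,3)])
  qed (auto intro: ActMor_Add_left ActMor_Scale_left ActMor_Idn)
  then show ?thesis
    using lin by (simp add: module_category_def C.monoidal_op)
qed

context module_functors
begin

text \<open>The axioms for the inverted constraint are the inverses of the original ones;
  \<open>K\<close> sends the associators and unit constraints of \<open>M\<close> to invertible
  arrows.\<close>

lemma op_functor: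
  assumes K: "is_module_functor C M N K"
  shows "is_module_functor (op_tensor C) (op_module M) (op_module N) (op_functor N K)"
proof -
  note [simp] = functD[OF K]
  have mult: "inv_arr N (MAssoc N c d (FObj K x)) \<cdot>\<^bsub>op_module N\<^esub> inv_arr N (FCon K (c \<otimes>\<^sub>o\<^bsub>C\<^esub> d) x)
      = (c \<triangleright> inv_arr N (FCon K d x)) \<cdot>\<^bsub>op_module N\<^esub> inv_arr N (FCon K c (d \<rhd>\<^sub>o\<^bsub>M\<^esub> x)) \<cdot>\<^bsub>op_module N\<^esub> FMor K (inv_arr M (MAssoc M c d x))"
    if [simp]: "c \<in> Obj C" "d \<in> Obj C" "x \<in> Obj M" for c d x
  proof -
    let ?m = "MAssoc M c d x"
    note [simp] = module_category.MAssoc_simps(4)[OF M] category.inv_simps[OF category_M]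
    have comp: "FMor K (g \<cdot>\<^bsub>M\<^esub> f) = FMor K g \<diamondop> FMor K f" if "f \<in> Arr M" "g \<in> Arr M" "Dom M g = Cod M f" for f g
      using K that by (auto simp: is_module_functor_def is_linear_functor_def is_functor_def)
    have "inverse_arrows N (FMor K ?m) (FMor K (inv_arr M ?m))"
      by (intro N.inverse_arrowsI) (simp_all flip: comp add: functIdn[OF K])
    then have [simp]: "iso_arr N (FMor K ?m)" "inv_arr N (FMor K ?m) = FMor K (inv_arr M ?m)"
      by (simp_all add: N.inv_arrI)
    have "inv_arr N (MAssoc N c d (FObj K x) \<diamondop> FCon K (c \<otimes>\<^sub>o\<^bsub>C\<^esub> d) x)
      = inv_arr N ((c \<triangleright> FCon K d x) \<diamondop> FCon K c (d \<rhd>\<^sub>o\<^bsub>M\<^esub> x) \<diamondop> FMor K ?m)"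
      using FCon_mult[OF K] by simp
    then show ?thesis by (simp add: N.iso_Comp)
  qed
  have unit: "inv_arr N (MUnit N (FObj K x)) \<cdot>\<^bsub>op_module N\<^esub> inv_arr N (FCon K (Unit C) x) = FMor K (inv_arr M (MUnit M x))"
    if [simp]: "x \<in> Obj M" for x
  proof -
    let ?m = "MUnit M x"
    note [simp] = module_category.MUnit_simps(4)[OF M] category.inv_simps[OF category_M]
    have comp: "FMor K (g \<cdot>\<^bsub>M\<^esub> f) = FMor K g \<diamondop> FMor K f" if "f \<in> Arr M" "g \<in> Arr M" "Dom M g = Cod M f" for f g
      using K that by (auto simp: is_module_functor_def is_linear_functor_def is_functor_def)
    have "inverse_arrows N (FMor K ?m) (FMor K (inv_arr M ?m))"
      by (intro N.inverse_arrowsI) (simp_all flip: comp add: functIdn[OF K])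
    then have "inv_arr N (FMor K ?m) = FMor K (inv_arr M ?m)"
      by (simp_all add: N.inv_arrI)
    then show ?thesis by (simp add: N.iso_Comp flip: FCon_unit[OF K])
  qed
  have nat: "FCon K (Cod C f) (Cod M h) \<diamondop> FMor K (f \<rhd>\<^sub>m\<^bsub>M\<^esub> h)
          = (f \<rhd>\<^sub>m\<^bsub>N\<^esub> FMor K h) \<diamondop> FCon K (Dom C f) (Dom M h)" if "f \<in> Arr C" "h \<in> Arr M" for f h
    using K that unfolding is_module_functor_def by meson
  have nat': "FMor K (f \<rhd>\<^sub>m\<^bsub>M\<^esub> h) \<diamondop> inv_arr N (FCon K (Dom C f) (Dom M h))
     = inv_arr N (FCon K (Cod C f) (Cod M h)) \<diamondop> (f \<rhd>\<^sub>m\<^bsub>N\<^esub> FMor K h)" if "f \<in> Arr C" "h \<in> Arr M" for f h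
    by (rule N.square_inv[OF nat[OF that]]) (use that in simp_all)
  have "is_linear_functor M N K" using K by (simp add: is_module_functor_def)
  then have "is_linear_functor (op_module M) (op_module N) (op_functor N K)"
    by (auto simp: is_linear_functor_def is_functor_def)
  moreover note mult[unfolded lw_def] unit
  ultimately show ?thesis
    unfolding is_module_functor_def by (simp add: nat' Hom_def)
qed

end

context module_functor_pair
begin

lemma pair_op: "module_functor_pair (op_tensor C) (op_module N) (op_module M) (op_functor N F) (op_functor N G)"
proof -
  interpret M: module_category C M by (rule M)
  show ?thesis
    by (intro module_functor_pair.intro module_functors.intro rigid_module_category.intro C.rigid_op module_op
        module_functors_axioms.intro module_functor_pair_axioms.intro op_functor F G M.module_op)
qed

end

text \<open>The two notions differ in the bracketing of composites only, so their equivalence is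
  associativity for arrows whose composability comes from the other clauses. The general form of
  \<open>A'\<close> and \<open>X'\<close> covers \<open>op_tensor\<close> with
  \<open>op_module\<close> as well as \<open>op_cat\<close>.\<close>

lemma internal_coHom_op:
  assumes act: "category_action A X ao am"
    and A': "Obj A' = Obj A" "Arr A' = Arr A" "Dom A' = Cod A" "Cod A' = Dom A" "\<And>f g. f \<cdot>\<^bsub>A'\<^esub> g = g \<cdot>\<^bsub>A\<^esub> f"
    and X': "Obj X' = Obj X" "Arr X' = Arr X" "Dom X' = Cod X" "Cod X' = Dom X" "\<And>f g. f \<cdot>\<^bsub>X'\<^esub> g = g \<cdot>\<^bsub>X\<^esub> f"
  shows "is_internal_Hom A' X' ao am K \<longleftrightarrow> is_internal_coHom A X ao am K"
proof -
  interpret category_action A X ao am by fact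
  have H [simp]: "Hom A' x y = Hom A y x" "Hom X' p q = Hom X q p" for x y p q
    using A' X' by (auto simp: Hom_def)
  have eq: "(HAdj K (Cod X f) (Dom X h) (Cod A u) ((u \<cdot>\<^bsub>A\<^esub> k) \<cdot>\<^bsub>A\<^esub> HMor K f h)
         = (am u f \<cdot>\<^bsub>X\<^esub> HAdj K (Dom X f) (Cod X h) (Dom A u) k) \<cdot>\<^bsub>X\<^esub> h) =
       (HAdj K (Cod X f) (Dom X h) (Cod A u) (u \<cdot>\<^bsub>A\<^esub> k \<cdot>\<^bsub>A\<^esub> HMor K f h)
          = am u f \<cdot>\<^bsub>X\<^esub> HAdj K (Dom X f) (Cod X h) (Dom A u) k \<cdot>\<^bsub>X\<^esub> h)"
    if "u \<in> Arr A" "f \<in> Arr X" "h \<in> Arr X" "k \<in> Hom A (HObj K (Dom X f) (Cod X h)) (Dom A u)"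
      "HMor K f h \<in> Hom A (HObj K (Cod X f) (Dom X h)) (HObj K (Dom X f) (Cod X h))"
      "bij_betw (HAdj K (Dom X f) (Cod X h) (Dom A u)) (Hom A (HObj K (Dom X f) (Cod X h)) (Dom A u))
        (Hom X (Cod X h) (ao (Dom A u) (Dom X f)))" for u f h k
  proof -
    have "HAdj K (Dom X f) (Cod X h) (Dom A u) k \<in> Hom X (Cod X h) (ao (Dom A u) (Dom X f))"
      using bij_betw_apply[OF that(6,4)] .
    then show ?thesis
      using that by (simp add: Hom_def)
  qed
  show ?thesis
    unfolding is_internal_Hom_def is_internal_coHom_def A' X' H
    by (intro conj_cong refl ball_cong eq) auto
qed

lemma is_end_op: "is_end (op_module M) (op_tensor C) To Tm h i \<longleftrightarrow> is_coend M C To Tm h i"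
  unfolding is_end_def is_coend_def is_wedge_def is_cowedge_def
  by (simp add: eq_commute)

lemma hom_bifun_op [simp]:
  "hom_bifun_obj K (op_functor N F) (op_functor N G) = hom_bifun_obj K F G"
  "hom_bifun_mor K (op_functor N F) (op_functor N G) = hom_bifun_mor K F G"
  by (simp_all add: hom_bifun_obj_def hom_bifun_mor_def)

context module_category
begin

lemma lw_op: "module_category.lw (op_tensor C) (op_module N) c f = c \<triangleright> f"
  and rw_op: "module_category.rw (op_module N) u x = u \<triangleleft> x"
  using module_category.lw_def[OF module_op] module_category.rw_def[OF module_op] by (simp_all add: lw_def rw_def)

lemma internal_coHom_of_op: "internal_Hom_of (op_tensor C) (op_module N) K \<longleftrightarrow> internal_coHom_of C N K"
  using internal_coHom_op[OF act.category_action_axioms, of "op_tensor C" "op_module N" K] by simp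

end

lemma (in monoidal_linear_category) rw_op: "module_category.rw (regmod (op_tensor C)) u x = u \<triangleleft>\<^sub>C x"
  and lw_op: "module_category.lw (op_tensor C) (regmod (op_tensor C)) x u = x \<triangleright>\<^sub>C u"
  using module_category.rw_def[OF monoidal_linear_category.module_category_regmod[OF monoidal_op]]
    module_category.lw_def[OF monoidal_linear_category.module_category_regmod[OF monoidal_op]]
  by (simp_all add: reg.lw_def reg.rw_def)

context rigid_module_category
begin

text \<open>Over the opposite categories the chain of bijections behind \<open>Hom_act_iso\<close>
  is the chain behind \<open>coHom_act_iso\<close>, with associators inverted twice and other
  brackets. The typing is recorded because rebracketing longer composites depends on it.\<close>

lemma coHom_act_iso_op:
  assumes K: "internal_coHom_of C N K" and c: "c \<in> Obj C" and c': "c' \<in> Obj C"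
    and n: "n \<in> Obj N" and n': "n' \<in> Obj N"
  shows "Hom_act_iso (op_tensor C) (op_module N) K c n c' n' = coHom_act_iso C N K c n c' n'"
    "coHom_act_iso C N K c n c' n' \<in> Hom C ((c' \<otimes>\<^sub>o\<^bsub>C\<^esub> HObj K n n') \<otimes>\<^sub>o\<^bsub>C\<^esub> LDual C c) (HObj K (c \<star> n) (c' \<star> n'))"
proof -
  note [simp] = c c' n n'
  define a l ac e0 where "a = HObj K (c \<star> n) (c' \<star> n')" and "l = LDual C c'" and "ac = a \<otimes>\<^sub>o\<^bsub>C\<^esub> c"
    and "e0 = HAdj K (c \<star> n) (c' \<star> n') a (Idn C a)"
  note defs = this
  have Obj: "HObj K x y \<in> Obj C" if "x \<in> Obj N" "y \<in> Obj N" for x y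
    using K that by (simp add: is_internal_coHom_def)
  then have [simp]: "a \<in> Obj C" "l \<in> Obj C" "ac \<in> Obj C" by (simp_all add: defs)
  have bij: "bij_betw (HAdj K x y b) (Hom C (HObj K x y) b) (Hom N y (b \<star> x))" if "x \<in> Obj N" "y \<in> Obj N" "b \<in> Obj C" for x y b
    using K that by (simp add: is_internal_coHom_def)
  have "Idn C a \<in> Hom C (HObj K (c \<star> n) (c' \<star> n')) a"
    unfolding a_def[symmetric] by (rule C.Idn_in_Hom) simp
  then have "e0 \<in> Hom N (c' \<star> n') (a \<star> c \<star> n)"
    using bij_betw_apply[OF bij, of "c \<star> n" "c' \<star> n'" a] by (simp add: e0_def)
  then have [simp]: "e0 \<in> Arr N" "Dom N e0 = c' \<star> n'" "Cod N e0 = a \<star> c \<star> n"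
    by (simp_all add: Hom_def)
  note D = C.left_dual[OF c'] and D' = C.left_dual[OF c]
  have [simp]: "LCoev C c' \<in> Arr C" "Dom C (LCoev C c') = Unit C" "Cod C (LCoev C c') = l \<otimes>\<^sub>o\<^bsub>C\<^esub> c'"
    "LEv C c' \<in> Arr C" "Dom C (LEv C c') = c' \<otimes>\<^sub>o\<^bsub>C\<^esub> l" "Cod C (LEv C c') = Unit C"
    "LEv C c \<in> Arr C" "Dom C (LEv C c) = c \<otimes>\<^sub>o\<^bsub>C\<^esub> LDual C c" "Cod C (LEv C c) = Unit C"
    using dual[OF D] dual[OF D'] by (simp_all add: l_def)
  define e2 where "e2 = inv_arr N (MAssoc N l ac n) \<diamondop> (l \<triangleright> inv_arr N (MAssoc N a c n)) \<diamondop> (l \<triangleright> e0) \<diamondop> MAssoc N l c' n'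
    \<diamondop> (LCoev C c' \<triangleleft> n') \<diamondop> inv_arr N (MUnit N n')"
  have "e2 \<in> Hom N n' ((l \<otimes>\<^sub>o\<^bsub>C\<^esub> ac) \<star> n)"
    by (simp add: e2_def Hom_def ac_def)
  define e3 where "e3 = inv_into (Hom C (HObj K n n') (l \<otimes>\<^sub>o\<^bsub>C\<^esub> ac)) (HAdj K n n' (l \<otimes>\<^sub>o\<^bsub>C\<^esub> ac)) e2"
  have "e3 \<in> Hom C (HObj K n n') (l \<otimes>\<^sub>o\<^bsub>C\<^esub> ac)"
    unfolding e3_def
    by (rule inv_into_into) (use bij_betw_imp_surj_on[OF bij, of n n' "l \<otimes>\<^sub>o\<^bsub>C\<^esub> ac"] \<open>e2 \<in> _\<close> in simp)
  then have [simp]: "e3 \<in> Arr C" "Dom C e3 = HObj K n n'" "Cod C e3 = l \<otimes>\<^sub>o\<^bsub>C\<^esub> ac"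
    by (simp_all add: Hom_def)
  have e2_op: "(inv_arr N (MAssoc N l ac n) \<diamondop> (l \<triangleright> inv_arr N (MAssoc N a c n))) \<diamondop>
     (((l \<triangleright> e0) \<diamondop> MAssoc N l c' n') \<diamondop> (LCoev C c' \<triangleleft> n')) \<diamondop> inv_arr N (MUnit N n') = e2"
    and e2_co: "inv_arr N (MAssoc N l ac n) \<diamondop> (l \<triangleright> inv_arr N (MAssoc N a c n)) \<diamondop>
     (l \<triangleright> e0) \<diamondop> MAssoc N l c' n' \<diamondop> (LCoev C c' \<triangleleft> n') \<diamondop> inv_arr N (MUnit N n') = e2"
    by (simp_all add: e2_def ac_def)
  have inv: "inv_arr N (inv_arr N (MAssoc N l c' n')) = MAssoc N l c' n'"
    "inv_arr C (inv_arr C (LUnit C ac)) = LUnit C ac" "inv_arr C (inv_arr C (RUnit C a)) = RUnit C a"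
    "inv_arr C (inv_arr C (Assoc C a c (LDual C c))) = Assoc C a c (LDual C c)"
    by simp_all
  have op: "Hom_act_iso (op_tensor C) (op_module N) K c n c' n' = ((RUnit C a \<cdot>\<^bsub>C\<^esub> (a \<triangleright>\<^sub>C LEv C c)) \<cdot>\<^bsub>C\<^esub> Assoc C a c (LDual C c)) \<cdot>\<^bsub>C\<^esub>
      ((((LUnit C ac \<cdot>\<^bsub>C\<^esub> (LEv C c' \<triangleleft>\<^sub>C ac)) \<cdot>\<^bsub>C\<^esub> inv_arr C (Assoc C c' l ac)) \<cdot>\<^bsub>C\<^esub> (c' \<triangleright>\<^sub>C e3)) \<triangleleft>\<^sub>C LDual C c)"
    unfolding Hom_act_iso_def Let_def op_tensor_simps op_module_simps Hom_op iso_arr_op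
      lw_def[symmetric] rw_def[symmetric] C.reg.lw_def[symmetric] C.reg.rw_def[symmetric] defs(1)[symmetric]
      defs(2)[symmetric] defs(3)[symmetric] inv defs(4)[symmetric] e2_op e3_def[symmetric] ..
  have co: "coHom_act_iso C N K c n c' n' = RUnit C a \<cdot>\<^bsub>C\<^esub> (a \<triangleright>\<^sub>C LEv C c) \<cdot>\<^bsub>C\<^esub> Assoc C a c (LDual C c) \<cdot>\<^bsub>C\<^esub>
      ((LUnit C ac \<cdot>\<^bsub>C\<^esub> (LEv C c' \<triangleleft>\<^sub>C ac) \<cdot>\<^bsub>C\<^esub> inv_arr C (Assoc C c' l ac) \<cdot>\<^bsub>C\<^esub> (c' \<triangleright>\<^sub>C e3)) \<triangleleft>\<^sub>C LDual C c)"
    unfolding coHom_act_iso_def Let_def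
      lw_def[symmetric] rw_def[symmetric] C.reg.lw_def[symmetric] C.reg.rw_def[symmetric] defs(1)[symmetric]
      defs(2)[symmetric] defs(3)[symmetric] defs(4)[symmetric] e2_co e3_def[symmetric] ..
  show "Hom_act_iso (op_tensor C) (op_module N) K c n c' n' = coHom_act_iso C N K c n c' n'"
    unfolding op co by (simp add: ac_def Obj)
  show "coHom_act_iso C N K c n c' n' \<in> Hom C ((c' \<otimes>\<^sub>o\<^bsub>C\<^esub> HObj K n n') \<otimes>\<^sub>o\<^bsub>C\<^esub> LDual C c) (HObj K (c \<star> n) (c' \<star> n'))"
    unfolding co by (simp add: ac_def Obj Hom_def flip: a_def)
qed

end

context module_functor_pair
begin

text \<open>Coends are ends over the opposite categories, and their half-braidings are inverse to the
  half-braidings of these ends.\<close>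

lemma coend_half_braiding_op:
  assumes K: "internal_coHom_of C N K"
    and E: "is_coend M C (hom_bifun_obj K F G) (hom_bifun_mor K F G) h i"
    and U: "universal_pair (op_tensor C) (op_module N) (op_module M) (op_functor N F) (op_functor N G) h
      (\<lambda>x. HAdj K (FObj F x) (FObj G x) h (i x))"
    and c: "c \<in> Obj C"
  shows "coend_half_braiding C M N K F G h i c
    = universal_pair.swap (op_tensor C) (op_module N) (op_module M) (op_functor N F) (op_functor N G) h
        (\<lambda>x. HAdj K (FObj F x) (FObj G x) h (i x)) c" (is "_ = ?swap c")
proof -
  note [simp] = c
  let ?C = "op_tensor C" and ?N = "op_module N" and ?M = "op_module M"
    and ?F = "op_functor N F" and ?G = "op_functor N G"
  have h [simp]: "h \<in> Obj C" and i: "\<And>x. x \<in> Obj M \<Longrightarrow> i x \<in> Hom C (HObj K (FObj F x) (FObj G x)) h"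
    using E by (auto simp: is_coend_def is_cowedge_def hom_bifun_obj_def)
  have i' [simp]: "i x \<in> Arr C" "Dom C (i x) = HObj K (FObj F x) (FObj G x)" "Cod C (i x) = h" if "x \<in> Obj M" for x
    using i[OF that] by (auto simp: Hom_def)
  have K': "internal_Hom_of ?C ?N K"
    using K internal_coHom_of_op by blast
  have HMor: "HMor K f k \<in> Hom C (HObj K (Cod N f) (Dom N k)) (HObj K (Dom N f) (Cod N k))" if "f \<in> Arr N" "k \<in> Arr N" for f k
    using K that by (simp add: is_internal_coHom_def)
  have j: "i x \<in> Hom ?C h (HObj K (FObj ?F x) (FObj ?G x))" if "x \<in> Obj ?M" for x
    using i that by simp
  note D = C.left_dual[OF c]
  have [simp]: "LCoev C c \<in> Arr C" "Dom C (LCoev C c) = Unit C" "Cod C (LCoev C c) = LDual C c \<otimes>\<^sub>o\<^bsub>C\<^esub> c"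
    "LEv C c \<in> Arr C" "Dom C (LEv C c) = c \<otimes>\<^sub>o\<^bsub>C\<^esub> LDual C c" "Cod C (LEv C c) = Unit C"
    using dual[OF D] by simp_all
  have "i (c \<rhd>\<^sub>o\<^bsub>M\<^esub> x) \<cdot>\<^bsub>C\<^esub> HMor K (FCon F c x) (inv_arr N (FCon G c x)) \<cdot>\<^bsub>C\<^esub> coHom_act_iso C N K c (FObj F x) c (FObj G x)
    = (i (c \<rhd>\<^sub>o\<^bsub>M\<^esub> x) \<cdot>\<^bsub>C\<^esub> HMor K (FCon F c x) (inv_arr N (FCon G c x))) \<cdot>\<^bsub>C\<^esub> Hom_act_iso ?C ?N K c (FObj F x) c (FObj G x)"
    if x: "x \<in> Obj M" for x
    using coHom_act_iso_op[OF K c c F_simps(1)[OF x] G_simps(1)[OF x]] HMor[of "FCon F c x" "inv_arr N (FCon G c x)"] x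
    by (simp add: Hom_def)
  \<comment> \<open>Two definite descriptions with equivalent bodies.\<close>
  then have "coend_action C M N K F G h i c = end_coaction ?C ?M ?N K ?F ?G h i c"
    unfolding coend_action_def end_coaction_def by (simp cong: conj_cong ball_cong_simp)
  moreover have "end_coaction ?C ?M ?N K ?F ?G h i c
      = monoidal_linear_category.reta ?C (LDual C c) c (LEv C c) h \<cdot>\<^bsub>C\<^esub> (?swap c \<triangleleft>\<^sub>C LDual C c)"
    using universal_pair.end_coaction_eq[OF U K' j, of c] by (simp add: C.rw_op)
  moreover have "?swap c \<in> Arr C" "Dom C (?swap c) = c \<otimes>\<^sub>o\<^bsub>C\<^esub> h" "Cod C (?swap c) = h \<otimes>\<^sub>o\<^bsub>C\<^esub> c"
    using universal_pair.swap_simps[OF U, of c] by simp_all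
  moreover have "monoidal_linear_category.reta ?C (LDual C c) c (LEv C c) h \<in> Arr C"
      "Cod C (monoidal_linear_category.reta ?C (LDual C c) c (LEv C c) h) = h"
      "Dom C (monoidal_linear_category.reta ?C (LDual C c) c (LEv C c) h) = (h \<otimes>\<^sub>o\<^bsub>C\<^esub> c) \<otimes>\<^sub>o\<^bsub>C\<^esub> LDual C c"
    using monoidal_linear_category.reta_simps[OF C.monoidal_op C.duality_op[OF D], of h] by simp_all
  \<comment> \<open>In the opposite category \<open>LCoev\<close> is the evaluation of a dual pair,
    so composing with it undoes the transposition that relates the action to
    \<open>swap\<close>.\<close>
  ultimately show ?thesis
    using monoidal_linear_category.rsharp_rflat[OF C.monoidal_op C.duality_op[OF D], of "?swap c" h]
    by (simp add: coend_half_braiding_def monoidal_linear_category.reps_def[OF C.monoidal_op] C.rw_op C.lw_op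
        flip: C.reg.lw_def C.reg.rw_def)
qed

end

section \<open>The action of the center on module functors\<close>

lemma linear_functorD:
  assumes "is_linear_functor C D F"
  shows "x \<in> Obj C \<Longrightarrow> FObj F x \<in> Obj D"
    "f \<in> Arr C \<Longrightarrow> FMor F f \<in> Arr D" "f \<in> Arr C \<Longrightarrow> Dom D (FMor F f) = FObj F (Dom C f)"
    "f \<in> Arr C \<Longrightarrow> Cod D (FMor F f) = FObj F (Cod C f)"
    "x \<in> Obj C \<Longrightarrow> FMor F (Idn C x) = Idn D (FObj F x)"
    "\<lbrakk>f \<in> Arr C; g \<in> Arr C; Dom C g = Cod C f\<rbrakk> \<Longrightarrow> FMor F (g \<cdot>\<^bsub>C\<^esub> f) = FMor F g \<cdot>\<^bsub>D\<^esub> FMor F f"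
    "f \<in> Arr C \<Longrightarrow> FMor F (Scale C a f) = Scale D a (FMor F f)"
  using assms by (auto simp: is_linear_functor_def is_functor_def Hom_def)

lemma linear_functor_Add:
  assumes "is_linear_functor C D F" "f \<in> Hom C x y" "g \<in> Hom C x y" "x \<in> Obj C" "y \<in> Obj C"
  shows "FMor F (Add C f g) = Add D (FMor F f) (FMor F g)"
  using assms unfolding is_linear_functor_def by blast

lemma linear_functor_comp:
  assumes F: "is_linear_functor B C F" and G: "is_linear_functor C D G"
    and K: "\<And>x. x \<in> Obj B \<Longrightarrow> FObj K x = FObj G (FObj F x)" "\<And>f. f \<in> Arr B \<Longrightarrow> FMor K f = FMor G (FMor F f)"
    and B: "linear_category B"
  shows "is_linear_functor B D K"
proof -
  interpret B: linear_category B by fact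
  show ?thesis
    unfolding is_linear_functor_def is_functor_def
  proof (intro conjI ballI allI impI)
    fix x y f g assume f: "f \<in> Hom B x y" and g: "g \<in> Hom B x y" and xy: "x \<in> Obj B" "y \<in> Obj B"
    have "FMor F f \<in> Hom C (FObj F x) (FObj F y)" "FMor F g \<in> Hom C (FObj F x) (FObj F y)"
      using f g linear_functorD[OF F] by (auto simp: Hom_def)
    then show "FMor K (Add B f g) = Add D (FMor K f) (FMor K g)"
      using linear_functor_Add[OF F f g xy] linear_functor_Add[OF G] linear_functorD(1)[OF F] xy
        B.Add_in_Hom[OF f g] f g by (simp add: K Hom_def)
  next
    fix a f assume f: "f \<in> Arr B"
    then have "Scale B a f \<in> Arr B"
      using B.Scale_in_Hom[of f "Dom B f" "Cod B f"] by (simp add: Hom_def)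
    with f show "FMor K (Scale B a f) = Scale D a (FMor K f)"
      by (simp add: K linear_functorD[OF F] linear_functorD[OF G])
  qed (simp_all add: K linear_functorD[OF F] linear_functorD[OF G] Hom_def)
qed

context module_category
begin

text \<open>Naturality of the exchange in the acting object, whereas \<open>expand_nat\<close>
  concerns the object acted upon.\<close>

lemma expand_nat':
  assumes f: "f \<in> Arr C" "Dom C f = c" "Cod C f = d" and b: "b \<in> Obj C" and w: "w \<in> Obj N"
    and s: "s \<in> Hom C (b \<otimes>\<^sub>o\<^bsub>C\<^esub> c) (c \<otimes>\<^sub>o\<^bsub>C\<^esub> b)" and t: "t \<in> Hom C (b \<otimes>\<^sub>o\<^bsub>C\<^esub> d) (d \<otimes>\<^sub>o\<^bsub>C\<^esub> b)"
    and nat: "(f \<triangleleft>\<^sub>C b) \<cdot>\<^bsub>C\<^esub> s = t \<cdot>\<^bsub>C\<^esub> (b \<triangleright>\<^sub>C f)"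
  shows "(f \<triangleleft> (b \<star> w)) \<diamondop> expand b c s w = expand b d t w \<diamondop> (b \<triangleright> f \<triangleleft> w)"
proof -
  have [simp]: "c \<in> Obj C" "d \<in> Obj C" using f by auto
  note [simp] = s[unfolded C.Hom_iff] t[unfolded C.Hom_iff]
  have "(f \<triangleleft> (b \<star> w)) \<diamondop> expand b c s w
      = MAssoc N d b w \<diamondop> ((f \<triangleleft>\<^sub>C b) \<cdot>\<^bsub>C\<^esub> s) \<triangleleft> w \<diamondop> inv_arr N (MAssoc N b c w)"
    using f w b by (simp add: expand_def natural_simps rw_Comp)
  also have "\<dots> = expand b d t w \<diamondop> (b \<triangleright> f \<triangleleft> w)"
    unfolding nat using f w b by (simp add: expand_def rw_Comp MAssoc_inv_mw)
  finally show ?thesis .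
qed

lemma expand_unit:
  assumes "b \<in> Obj C" "w \<in> Obj N" "t \<in> Hom C (b \<otimes>\<^sub>o\<^bsub>C\<^esub> Unit C) (Unit C \<otimes>\<^sub>o\<^bsub>C\<^esub> b)"
    and unit: "LUnit C b \<cdot>\<^bsub>C\<^esub> t = RUnit C b"
  shows "MUnit N (b \<star> w) \<diamondop> expand b (Unit C) t w = b \<triangleright> MUnit N w"
proof -
  note [simp] = assms(3)[unfolded C.Hom_iff]
  have "MUnit N (b \<star> w) \<diamondop> expand b (Unit C) t w
      = (LUnit C b \<cdot>\<^bsub>C\<^esub> t) \<triangleleft> w \<diamondop> inv_arr N (MAssoc N b (Unit C) w)"
    using assms(1,2) by (simp add: expand_def N.prefix[OF MUnit_act] rw_Comp)
  also have "\<dots> = b \<triangleright> MUnit N w"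
    unfolding unit using assms(1,2) by (simp flip: tri)
  finally show ?thesis .
qed

end

context monoidal_linear_category
begin

lemma half_braidingD:
  assumes "half_braiding C b \<sigma>"
  shows "c \<in> Obj C \<Longrightarrow> \<sigma> c \<in> Arr C" "c \<in> Obj C \<Longrightarrow> Dom C (\<sigma> c) = c \<otimes>\<^sub>o\<^bsub>C\<^esub> b"
    "c \<in> Obj C \<Longrightarrow> Cod C (\<sigma> c) = b \<otimes>\<^sub>o\<^bsub>C\<^esub> c" "c \<in> Obj C \<Longrightarrow> iso_arr C (\<sigma> c)"
  using assms by (auto simp: half_braiding_def Hom_def)

text \<open>The axioms of a half-braiding put into the inverse orientation, in which it enters
  \<open>expand\<close> and the constraints of the center action.\<close>

lemma half_braiding_inv:
  assumes \<sigma>: "half_braiding C b \<sigma>" and b [simp]: "b \<in> Obj C"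
  shows "f \<in> Arr C \<Longrightarrow> (f \<triangleleft>\<^sub>C b) \<cdot>\<^bsub>C\<^esub> inv_arr C (\<sigma> (Dom C f)) = inv_arr C (\<sigma> (Cod C f)) \<cdot>\<^bsub>C\<^esub> (b \<triangleright>\<^sub>C f)"
    "\<lbrakk>c \<in> Obj C; d \<in> Obj C\<rbrakk> \<Longrightarrow> inv_arr C (\<sigma> (c \<otimes>\<^sub>o\<^bsub>C\<^esub> d)) = hexagon b c d (inv_arr C (\<sigma> c)) (inv_arr C (\<sigma> d))"
    "LUnit C b \<cdot>\<^bsub>C\<^esub> inv_arr C (\<sigma> (Unit C)) = RUnit C b"
proof -
  note [simp] = half_braidingD[OF \<sigma>]
  show "(f \<triangleleft>\<^sub>C b) \<cdot>\<^bsub>C\<^esub> inv_arr C (\<sigma> (Dom C f)) = inv_arr C (\<sigma> (Cod C f)) \<cdot>\<^bsub>C\<^esub> (b \<triangleright>\<^sub>C f)" if f: "f \<in> Arr C"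
  proof (rule square_inv)
    show "\<sigma> (Cod C f) \<cdot>\<^bsub>C\<^esub> (f \<triangleleft>\<^sub>C b) = (b \<triangleright>\<^sub>C f) \<cdot>\<^bsub>C\<^esub> \<sigma> (Dom C f)"
      using \<sigma> f by (simp add: half_braiding_def reg.lw_def reg.rw_def)
  qed (use f in simp_all)
  show "inv_arr C (\<sigma> (c \<otimes>\<^sub>o\<^bsub>C\<^esub> d)) = hexagon b c d (inv_arr C (\<sigma> c)) (inv_arr C (\<sigma> d))"
    if [simp]: "c \<in> Obj C" "d \<in> Obj C"
  proof -
    have "\<sigma> (c \<otimes>\<^sub>o\<^bsub>C\<^esub> d) = Assoc C b c d \<cdot>\<^bsub>C\<^esub> (\<sigma> c \<triangleleft>\<^sub>C d) \<cdot>\<^bsub>C\<^esub> inv_arr C (Assoc C c b d) \<cdot>\<^bsub>C\<^esub> (c \<triangleright>\<^sub>C \<sigma> d) \<cdot>\<^bsub>C\<^esub> Assoc C c d b"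
      using \<sigma> that by (simp add: half_braiding_def reg.lw_def reg.rw_def)
    then show ?thesis
      by (simp add: iso_Comp hexagon_def)
  qed
  have "RUnit C b \<cdot>\<^bsub>C\<^esub> \<sigma> (Unit C) = LUnit C b" using \<sigma> by (simp add: half_braiding_def)
  then have "LUnit C b \<cdot>\<^bsub>C\<^esub> inv_arr C (\<sigma> (Unit C)) = (RUnit C b \<cdot>\<^bsub>C\<^esub> \<sigma> (Unit C)) \<cdot>\<^bsub>C\<^esub> inv_arr C (\<sigma> (Unit C))" by simp
  then show "LUnit C b \<cdot>\<^bsub>C\<^esub> inv_arr C (\<sigma> (Unit C)) = RUnit C b" by simp
qed

lemma center_simps [simp]:
  "(b, \<sigma>) \<in> Obj (center C) \<longleftrightarrow> b \<in> Obj C \<and> half_braiding C b \<sigma>"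
  "((b, \<sigma>), f, (c, \<tau>)) \<in> Arr (center C) \<longleftrightarrow> b \<in> Obj C \<and> half_braiding C b \<sigma> \<and> c \<in> Obj C \<and> half_braiding C c \<tau> \<and>
     f \<in> Hom C b c \<and> (\<forall>a \<in> Obj C. \<tau> a \<cdot>\<^bsub>C\<^esub> (a \<triangleright>\<^sub>C f) = (f \<triangleleft>\<^sub>C a) \<cdot>\<^bsub>C\<^esub> \<sigma> a)"
  "Dom (center C) (z, f, w) = z" "Cod (center C) (z, f, w) = w"
  "Idn (center C) z = (z, Idn C (fst z), z)"
  "(w', h, v) \<cdot>\<^bsub>center C\<^esub> (z, f, w) = (z, h \<cdot>\<^bsub>C\<^esub> f, v)"
  by (simp_all add: center_def reg.lw_def reg.rw_def)

lemma category_center: "category (center C)"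
proof
  fix f assume "f \<in> Arr (center C)"
  then show "Dom (center C) f \<in> Obj (center C)" "Cod (center C) f \<in> Obj (center C)"
    by (cases f; auto)+
next
  fix x assume x: "x \<in> Obj (center C)"
  obtain b \<sigma> where [simp]: "x = (b, \<sigma>)" by (cases x)
  note half_braidingD[of b \<sigma>, simp]
  show "Idn (center C) x \<in> Hom (center C) x x"
    using x by (auto simp: Hom_def)
next
  fix f x y g w
  assume f: "f \<in> Hom (center C) x y" and g: "g \<in> Hom (center C) y w"
  obtain b \<sigma> c \<tau> d \<rho> where [simp]: "x = (b, \<sigma>)" "y = (c, \<tau>)" "w = (d, \<rho>)" by (cases x, cases y, cases w)
  obtain u v where [simp]: "f = (x, u, y)" "g = (y, v, w)"
    using f g by (cases f; cases g) (auto simp: Hom_def)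
  have [simp]: "u \<in> Arr C" "Dom C u = b" "Cod C u = c" "v \<in> Arr C" "Dom C v = c" "Cod C v = d"
    "b \<in> Obj C" "c \<in> Obj C" "d \<in> Obj C"
    and hb: "half_braiding C b \<sigma>" "half_braiding C c \<tau>" "half_braiding C d \<rho>"
    using f g by (auto simp: Hom_def)
  note [simp] = hb[THEN half_braidingD(1)] hb[THEN half_braidingD(2)] hb[THEN half_braidingD(3)]
  have "\<rho> a \<cdot>\<^bsub>C\<^esub> (a \<triangleright>\<^sub>C (v \<cdot>\<^bsub>C\<^esub> u)) = ((v \<cdot>\<^bsub>C\<^esub> u) \<triangleleft>\<^sub>C a) \<cdot>\<^bsub>C\<^esub> \<sigma> a" if a: "a \<in> Obj C" for a
  proof -
    have v: "\<rho> a \<cdot>\<^bsub>C\<^esub> (a \<triangleright>\<^sub>C v) = (v \<triangleleft>\<^sub>C a) \<cdot>\<^bsub>C\<^esub> \<tau> a" and u: "\<tau> a \<cdot>\<^bsub>C\<^esub> (a \<triangleright>\<^sub>C u) = (u \<triangleleft>\<^sub>C a) \<cdot>\<^bsub>C\<^esub> \<sigma> a"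
      using f g a by (auto simp: Hom_def)
    have "\<rho> a \<cdot>\<^bsub>C\<^esub> (a \<triangleright>\<^sub>C (v \<cdot>\<^bsub>C\<^esub> u)) = (\<rho> a \<cdot>\<^bsub>C\<^esub> (a \<triangleright>\<^sub>C v)) \<cdot>\<^bsub>C\<^esub> (a \<triangleright>\<^sub>C u)"
      using a by (simp add: reg.lw_Comp)
    also have "\<dots> = (v \<triangleleft>\<^sub>C a) \<cdot>\<^bsub>C\<^esub> \<tau> a \<cdot>\<^bsub>C\<^esub> (a \<triangleright>\<^sub>C u)"
      unfolding v using a by simp
    also have "\<dots> = ((v \<cdot>\<^bsub>C\<^esub> u) \<triangleleft>\<^sub>C a) \<cdot>\<^bsub>C\<^esub> \<sigma> a"
      unfolding u using a by (simp add: reg.rw_Comp)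
    finally show ?thesis .
  qed
  then show "g \<cdot>\<^bsub>center C\<^esub> f \<in> Hom (center C) x w"
    using f g by (auto simp: Hom_def)
next
  fix f x y g w h v
  assume "f \<in> Hom (center C) x y" "g \<in> Hom (center C) y w" "h \<in> Hom (center C) w v"
  then show "(h \<cdot>\<^bsub>center C\<^esub> g) \<cdot>\<^bsub>center C\<^esub> f = h \<cdot>\<^bsub>center C\<^esub> g \<cdot>\<^bsub>center C\<^esub> f"
    by (cases f; cases g; cases h; cases x; cases y; cases w; cases v) (auto simp: Hom_def)
next
  fix f x y assume "f \<in> Hom (center C) x y"
  then show "Idn (center C) y \<cdot>\<^bsub>center C\<^esub> f = f" "f \<cdot>\<^bsub>center C\<^esub> Idn (center C) x = f"
    by (cases f; cases x; cases y; auto simp: Hom_def)+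
qed

end

context module_functors
begin

lemma Rex_simps [simp]:
  "K \<in> Obj (Rex C M N) \<longleftrightarrow> is_module_functor C M N K \<and> right_exact M N K"
  "(K, \<eta>, L) \<in> Arr (Rex C M N) \<longleftrightarrow> is_module_functor C M N K \<and> right_exact M N K \<and>
     is_module_functor C M N L \<and> right_exact M N L \<and> is_module_nat_transf C M N K L \<eta> \<and> \<eta> \<in> extensional (Obj M)"
  "Dom (Rex C M N) (K, \<eta>, L) = K" "Cod (Rex C M N) (K, \<eta>, L) = L"
  "Idn (Rex C M N) K = (K, restrict (\<lambda>x. Idn N (FObj K x)) (Obj M), K)"
  "(L', \<theta>, L) \<cdot>\<^bsub>Rex C M N\<^esub> (K, \<eta>, K') = (K, restrict (\<lambda>x. \<theta> x \<diamondop> \<eta> x) (Obj M), L)"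
  by (simp_all add: Rex_def)

lemma module_nat_transfD:
  assumes "is_module_nat_transf C M N K L \<eta>"
  shows "x \<in> Obj M \<Longrightarrow> \<eta> x \<in> Arr N" "x \<in> Obj M \<Longrightarrow> Dom N (\<eta> x) = FObj K x" "x \<in> Obj M \<Longrightarrow> Cod N (\<eta> x) = FObj L x"
    "f \<in> Arr M \<Longrightarrow> FMor L f \<diamondop> \<eta> (Dom M f) = \<eta> (Cod M f) \<diamondop> FMor K f"
    "\<lbrakk>c \<in> Obj C; x \<in> Obj M\<rbrakk> \<Longrightarrow> FCon L c x \<diamondop> \<eta> (c \<rhd>\<^sub>o\<^bsub>M\<^esub> x) = (c \<triangleright> \<eta> x) \<diamondop> FCon K c x"
  using assms by (auto simp: is_module_nat_transf_def is_nat_transf_def Hom_def lw_def)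

text \<open>Restriction to the objects of \<open>M\<close> makes the family extensional, as arrows
  of \<open>Rex\<close> require.\<close>

lemma module_nat_transfI:
  assumes "\<And>x. x \<in> Obj M \<Longrightarrow> \<eta> x \<in> Hom N (FObj K x) (FObj L x)"
    "\<And>f. f \<in> Arr M \<Longrightarrow> FMor L f \<diamondop> \<eta> (Dom M f) = \<eta> (Cod M f) \<diamondop> FMor K f"
    "\<And>c x. \<lbrakk>c \<in> Obj C; x \<in> Obj M\<rbrakk> \<Longrightarrow> FCon L c x \<diamondop> \<eta> (c \<rhd>\<^sub>o\<^bsub>M\<^esub> x) = (c \<triangleright> \<eta> x) \<diamondop> FCon K c x"
  shows "is_module_nat_transf C M N K L (restrict \<eta> (Obj M))"
  using assms by (simp add: is_module_nat_transf_def is_nat_transf_def lw_def)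

lemma module_nat_transf_Comp:
  assumes \<eta>: "is_module_nat_transf C M N J K \<eta>" and \<theta>: "is_module_nat_transf C M N K L \<theta>"
    and J: "is_module_functor C M N J" and K: "is_module_functor C M N K" and L: "is_module_functor C M N L"
  shows "is_module_nat_transf C M N J L (restrict (\<lambda>x. \<theta> x \<diamondop> \<eta> x) (Obj M))"
proof (rule module_nat_transfI)
  note [simp] = module_nat_transfD(1-3)[OF \<eta>] module_nat_transfD(1-3)[OF \<theta>] functD[OF J] functD[OF K] functD[OF L]
  show "\<theta> x \<diamondop> \<eta> x \<in> Hom N (FObj J x) (FObj L x)" if "x \<in> Obj M" for x
    using that by (simp add: Hom_def)
  show "FMor L f \<diamondop> \<theta> (Dom M f) \<diamondop> \<eta> (Dom M f) = (\<theta> (Cod M f) \<diamondop> \<eta> (Cod M f)) \<diamondop> FMor J f" if "f \<in> Arr M" for f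
    using that N.prefix[OF module_nat_transfD(4)[OF \<theta> that]] by (simp add: module_nat_transfD(4)[OF \<eta>])
  show "FCon L c x \<diamondop> \<theta> (c \<rhd>\<^sub>o\<^bsub>M\<^esub> x) \<diamondop> \<eta> (c \<rhd>\<^sub>o\<^bsub>M\<^esub> x) = (c \<triangleright> (\<theta> x \<diamondop> \<eta> x)) \<diamondop> FCon J c x"
    if "c \<in> Obj C" "x \<in> Obj M" for c x
    using that N.prefix[OF module_nat_transfD(5)[OF \<theta> that]] by (simp add: module_nat_transfD(5)[OF \<eta>] lw_Comp)
qed

lemma Rex_cases:
  assumes "t \<in> Hom (Rex C M N) K L"
  obtains \<eta> where "t = (K, \<eta>, L)" "is_module_functor C M N K" "right_exact M N K" "is_module_functor C M N L" "right_exact M N L"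
    "is_module_nat_transf C M N K L \<eta>" "\<eta> \<in> extensional (Obj M)"
  using assms by (cases t) (auto simp: Hom_def)

lemma category_Rex: "category (Rex C M N)"
proof
  fix f assume "f \<in> Arr (Rex C M N)"
  then show "Dom (Rex C M N) f \<in> Obj (Rex C M N)" "Cod (Rex C M N) f \<in> Obj (Rex C M N)"
    by (cases f; auto)+
next
  fix K assume K: "K \<in> Obj (Rex C M N)"
  then have K': "is_module_functor C M N K" by simp
  note [simp] = functD[OF K']
  have "is_module_nat_transf C M N K K (restrict (\<lambda>x. Idn N (FObj K x)) (Obj M))"
    by (rule module_nat_transfI) (simp_all add: Hom_def)
  with K show "Idn (Rex C M N) K \<in> Hom (Rex C M N) K K"
    by (simp add: Hom_def)
next
  fix f x y g w assume f: "f \<in> Hom (Rex C M N) x y" and g: "g \<in> Hom (Rex C M N) y w"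
  show "g \<cdot>\<^bsub>Rex C M N\<^esub> f \<in> Hom (Rex C M N) x w"
    by (rule Rex_cases[OF f], rule Rex_cases[OF g]) (simp add: Hom_def module_nat_transf_Comp)
next
  fix f x y g w h v
  assume f: "f \<in> Hom (Rex C M N) x y" and g: "g \<in> Hom (Rex C M N) y w" and h: "h \<in> Hom (Rex C M N) w v"
  show "(h \<cdot>\<^bsub>Rex C M N\<^esub> g) \<cdot>\<^bsub>Rex C M N\<^esub> f = h \<cdot>\<^bsub>Rex C M N\<^esub> g \<cdot>\<^bsub>Rex C M N\<^esub> f"
    by (rule Rex_cases[OF f], rule Rex_cases[OF g], rule Rex_cases[OF h])
      (auto intro!: restrict_ext N.assoc simp: module_nat_transfD)
next
  fix f x y assume f: "f \<in> Hom (Rex C M N) x y"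
  obtain \<eta> where *: "f = (x, \<eta>, y)" "is_module_nat_transf C M N x y \<eta>" "\<eta> \<in> extensional (Obj M)"
    using Rex_cases[OF f] by metis
  note [simp] = module_nat_transfD(1-3)[OF *(2)]
  have "restrict (\<lambda>a. restrict (\<lambda>a. Idn N (FObj y a)) (Obj M) a \<diamondop> \<eta> a) (Obj M) = \<eta>"
    "restrict (\<lambda>a. \<eta> a \<diamondop> restrict (\<lambda>a. Idn N (FObj x a)) (Obj M) a) (Obj M) = \<eta>"
    using *(3) by (auto intro!: extensionalityI[of _ "Obj M"])
  then show "Idn (Rex C M N) y \<cdot>\<^bsub>Rex C M N\<^esub> f = f" "f \<cdot>\<^bsub>Rex C M N\<^esub> Idn (Rex C M N) x = f"
    by (simp_all add: *(1))
qed

end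

text \<open>Right exactness of the action in the second variable keeps \<open>b.K\<close> right
  exact, hence inside \<open>Rex\<close>.\<close>

locale center_action = module_functors C N M
  for C :: "('k::field, 'c, 'd, 'z) tensor_cat_scheme"
    and N :: "('k, 'c, 'd, 'p, 'q, 'x) module_cat_scheme"
    and M :: "('k, 'c, 'd, 'o, 'm, 'y) module_cat_scheme" +
  assumes right_exact_act: "c \<in> Obj C
      \<Longrightarrow> right_exact N N \<lparr>FObj = (\<lambda>x. c \<rhd>\<^sub>o\<^bsub>N\<^esub> x), FMor = (\<lambda>g. Idn C c \<rhd>\<^sub>m\<^bsub>N\<^esub> g)\<rparr>"
begin

lemma FObj_center_act [simp]: "FObj (center_act_obj C N (b, \<sigma>) K) x = b \<star> FObj K x"
  and FMor_center_act [simp]: "FMor (center_act_obj C N (b, \<sigma>) K) f = b \<triangleright> FMor K f"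
  by (simp_all add: center_act_obj_def lw_def)

lemma FCon_center_act [simp]:
  assumes "is_module_functor C M N K" "half_braiding C b \<sigma>" "b \<in> Obj C" "c \<in> Obj C" "x \<in> Obj M"
  shows "FCon (center_act_obj C N (b, \<sigma>) K) c x = expand b c (inv_arr C (\<sigma> c)) (FObj K x) \<diamondop> (b \<triangleright> FCon K c x)"
proof -
  note [simp] = functD[OF assms(1)] C.half_braidingD[OF assms(2)] assms(3-5)
  show ?thesis
    by (simp add: center_act_obj_def expand_def flip: lw_def rw_def)
qed

text \<open>Naturality, hexagon and unit axiom of the inverse half-braiding give, in this order,
  naturality, multiplicativity and unit axiom of the new constraint; those of \<open>K\<close> take
  care of the other factor.\<close>

lemma center_act_module_functor:
  assumes K: "is_module_functor C M N K" and \<sigma>: "half_braiding C b \<sigma>" and b: "b \<in> Obj C"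
  shows "is_module_functor C M N (center_act_obj C N (b, \<sigma>) K)"
proof -
  note [simp] = functD[OF K] C.half_braidingD[OF \<sigma>] b
  have lin: "is_linear_functor N N \<lparr>FObj = (\<lambda>x. b \<star> x), FMor = (\<lambda>g. Idn C b \<rhd>\<^sub>m\<^bsub>N\<^esub> g)\<rparr>"
    using right_exact_act[OF b] by (simp add: right_exact_def)
  let ?t = "\<lambda>c. inv_arr C (\<sigma> c)"
  have linK: "is_linear_functor M N K" using K by (simp add: is_module_functor_def)
  have "is_linear_functor M N (center_act_obj C N (b, \<sigma>) K)"
    by (rule linear_functor_comp[OF linK lin]) (use M in \<open>simp_all add: lw_def module_category_def\<close>)
  moreover have "iso_arr N (expand b c (?t c) (FObj K x) \<diamondop> (b \<triangleright> FCon K c x))" if "c \<in> Obj C" "x \<in> Obj M" for c x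
    using that unfolding expand_def by (intro N.iso_Comp) simp_all
  moreover have "(expand b (Cod C f) (?t (Cod C f)) (FObj K (Cod M h)) \<diamondop> (b \<triangleright> FCon K (Cod C f) (Cod M h))) \<diamondop> (b \<triangleright> FMor K (f \<rhd>\<^sub>m\<^bsub>M\<^esub> h))
     = (f \<rhd>\<^sub>m\<^bsub>N\<^esub> (b \<triangleright> FMor K h)) \<diamondop> expand b (Dom C f) (?t (Dom C f)) (FObj K (Dom M h)) \<diamondop> (b \<triangleright> FCon K (Dom C f) (Dom M h))"
    if [simp]: "f \<in> Arr C" "h \<in> Arr M" for f h
  proof -
    let ?c = "Dom C f" and ?d = "Cod C f" and ?x = "FObj K (Dom M h)" and ?y = "FObj K (Cod M h)"
    have "FCon K ?d (Cod M h) \<diamondop> FMor K (f \<rhd>\<^sub>m\<^bsub>M\<^esub> h) = (f \<rhd>\<^sub>m\<^bsub>N\<^esub> FMor K h) \<diamondop> FCon K ?c (Dom M h)"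
      using K that unfolding is_module_functor_def by meson
    then have "(expand b ?d (?t ?d) ?y \<diamondop> (b \<triangleright> FCon K ?d (Cod M h))) \<diamondop> (b \<triangleright> FMor K (f \<rhd>\<^sub>m\<^bsub>M\<^esub> h))
       = expand b ?d (?t ?d) ?y \<diamondop> (b \<triangleright> ((f \<rhd>\<^sub>m\<^bsub>N\<^esub> FMor K h) \<diamondop> FCon K ?c (Dom M h)))"
      by (simp flip: lw_Comp)
    also have "\<dots> = expand b ?d (?t ?d) ?y \<diamondop> (b \<triangleright> ?d \<triangleright> FMor K h) \<diamondop> (b \<triangleright> f \<triangleleft> ?x) \<diamondop> (b \<triangleright> FCon K ?c (Dom M h))"
      by (simp add: lw_Comp ActMor_lw_rw)
    also have "\<dots> = (?d \<triangleright> b \<triangleright> FMor K h) \<diamondop> (expand b ?d (?t ?d) ?x \<diamondop> (b \<triangleright> f \<triangleleft> ?x)) \<diamondop> (b \<triangleright> FCon K ?c (Dom M h))"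
      by (simp add: N.prefix[OF expand_nat[symmetric, of b ?d "?t ?d" "FMor K h"]])
    also have "expand b ?d (?t ?d) ?x \<diamondop> (b \<triangleright> f \<triangleleft> ?x) = (f \<triangleleft> (b \<star> ?x)) \<diamondop> expand b ?c (?t ?c) ?x"
      by (rule expand_nat'[symmetric]) (simp_all add: C.half_braiding_inv[OF \<sigma>] Hom_def)
    finally show ?thesis by (simp add: ActMor_lw_rw)
  qed
  moreover have "MAssoc N c d (b \<star> FObj K x) \<diamondop> expand b (c \<otimes>\<^sub>o\<^bsub>C\<^esub> d) (?t (c \<otimes>\<^sub>o\<^bsub>C\<^esub> d)) (FObj K x) \<diamondop> (b \<triangleright> FCon K (c \<otimes>\<^sub>o\<^bsub>C\<^esub> d) x)
     = (c \<triangleright> (expand b d (?t d) (FObj K x) \<diamondop> (b \<triangleright> FCon K d x))) \<diamondop> (expand b c (?t c) (FObj K (d \<rhd>\<^sub>o\<^bsub>M\<^esub> x)) \<diamondop> (b \<triangleright> FCon K c (d \<rhd>\<^sub>o\<^bsub>M\<^esub> x)))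
        \<diamondop> (b \<triangleright> FMor K (MAssoc M c d x))"
    if [simp]: "c \<in> Obj C" "d \<in> Obj C" "x \<in> Obj M" for c d x
  proof -
    let ?w = "FObj K x" and ?cd = "c \<otimes>\<^sub>o\<^bsub>C\<^esub> d"
    have [simp]: "C.hexagon b c d (?t c) (?t d) \<in> Arr C"
      "Dom C (C.hexagon b c d (?t c) (?t d)) = b \<otimes>\<^sub>o\<^bsub>C\<^esub> ?cd" "Cod C (C.hexagon b c d (?t c) (?t d)) = ?cd \<otimes>\<^sub>o\<^bsub>C\<^esub> b"
      by (simp_all add: C.hexagon_def)
    have "MAssoc N c d (b \<star> ?w) \<diamondop> expand b ?cd (?t ?cd) ?w \<diamondop> (b \<triangleright> FCon K ?cd x)
      = (MAssoc N c d (b \<star> ?w) \<diamondop> MAssoc N ?cd b ?w \<diamondop> (C.hexagon b c d (?t c) (?t d) \<triangleleft> ?w)) \<diamondop> inv_arr N (MAssoc N b ?cd ?w) \<diamondop> (b \<triangleright> FCon K ?cd x)"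
      unfolding C.half_braiding_inv(2)[OF \<sigma> b that(1,2)] expand_def[of b ?cd] by simp
    also have "\<dots> = (c \<triangleright> expand b d (?t d) ?w) \<diamondop> expand b c (?t c) (d \<star> ?w) \<diamondop> (b \<triangleright> (MAssoc N c d ?w \<diamondop> FCon K ?cd x))"
      by (subst expand_hexagon) (simp_all add: lw_Comp)
    also have "\<dots> = (c \<triangleright> expand b d (?t d) ?w) \<diamondop> (expand b c (?t c) (d \<star> ?w) \<diamondop> (b \<triangleright> c \<triangleright> FCon K d x)) \<diamondop>
        (b \<triangleright> FCon K c (d \<rhd>\<^sub>o\<^bsub>M\<^esub> x)) \<diamondop> (b \<triangleright> FMor K (MAssoc M c d x))"
      unfolding FCon_mult[OF K that] by (simp add: lw_Comp)
    also have "expand b c (?t c) (d \<star> ?w) \<diamondop> (b \<triangleright> c \<triangleright> FCon K d x) = (c \<triangleright> b \<triangleright> FCon K d x) \<diamondop> expand b c (?t c) (FObj K (d \<rhd>\<^sub>o\<^bsub>M\<^esub> x))"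
      by (rule expand_nat[symmetric]) simp_all
    finally show ?thesis by (simp add: lw_Comp)
  qed
  moreover have "MUnit N (b \<star> FObj K x) \<diamondop> expand b (Unit C) (?t (Unit C)) (FObj K x) \<diamondop> (b \<triangleright> FCon K (Unit C) x) = b \<triangleright> FMor K (MUnit M x)"
    if [simp]: "x \<in> Obj M" for x
  proof -
    have "MUnit N (b \<star> FObj K x) \<diamondop> expand b (Unit C) (?t (Unit C)) (FObj K x) = b \<triangleright> MUnit N (FObj K x)"
      by (rule expand_unit) (simp_all add: C.half_braiding_inv[OF \<sigma>] Hom_def)
    from N.prefix[OF this, of "b \<triangleright> FCon K (Unit C) x"] show ?thesis
      by (simp flip: lw_Comp FCon_unit[OF K])
  qed
  ultimately show ?thesis
    unfolding is_module_functor_def lw_def[symmetric]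
    by (simp add: K \<sigma> b Hom_def)
qed

lemma center_act_right_exact:
  assumes K: "right_exact M N K" and b: "b \<in> Obj C" and lin: "is_linear_functor M N (center_act_obj C N (b, \<sigma>) K)"
  shows "right_exact M N (center_act_obj C N (b, \<sigma>) K)"
  using right_exact_act[OF b] K lin unfolding right_exact_def by (simp add: lw_def)

text \<open>Compatibility with the constraints has two sources: \<open>f\<close> commutes with the
  half-braidings because it is an arrow of the center, and \<open>\<eta>\<close> commutes with the
  constraints of \<open>K\<close> and \<open>L\<close>.\<close>

lemma center_act_nat_transf:
  assumes \<eta>: "is_module_nat_transf C M N K L \<eta>" and K: "is_module_functor C M N K" and L: "is_module_functor C M N L"
    and f: "((b, \<sigma>), f, (c, \<tau>)) \<in> Arr (center C)"
  shows "is_module_nat_transf C M N (center_act_obj C N (b, \<sigma>) K) (center_act_obj C N (c, \<tau>) L)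
    (restrict (\<lambda>x. f \<rhd>\<^sub>m\<^bsub>N\<^esub> \<eta> x) (Obj M))"
proof (rule module_nat_transfI)
  have \<sigma>: "half_braiding C b \<sigma>" and \<tau>: "half_braiding C c \<tau>" and [simp]: "b \<in> Obj C" "c \<in> Obj C"
    and f' [simp]: "f \<in> Arr C" "Dom C f = b" "Cod C f = c"
    and fc: "\<And>a. a \<in> Obj C \<Longrightarrow> \<tau> a \<cdot>\<^bsub>C\<^esub> (a \<triangleright>\<^sub>C f) = (f \<triangleleft>\<^sub>C a) \<cdot>\<^bsub>C\<^esub> \<sigma> a"
    using f by (auto simp: Hom_def)
  note [simp] = module_nat_transfD(1-3)[OF \<eta>] functD[OF K] functD[OF L] C.half_braidingD[OF \<sigma>] C.half_braidingD[OF \<tau>]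
  show "f \<rhd>\<^sub>m\<^bsub>N\<^esub> \<eta> x \<in> Hom N (FObj (center_act_obj C N (b, \<sigma>) K) x) (FObj (center_act_obj C N (c, \<tau>) L) x)" if "x \<in> Obj M" for x
    using that by (simp add: Hom_def)
  show "FMor (center_act_obj C N (c, \<tau>) L) h \<diamondop> f \<rhd>\<^sub>m\<^bsub>N\<^esub> \<eta> (Dom M h) = f \<rhd>\<^sub>m\<^bsub>N\<^esub> \<eta> (Cod M h) \<diamondop> FMor (center_act_obj C N (b, \<sigma>) K) h"
    if h: "h \<in> Arr M" for h
  proof -
    have "(c \<triangleright> FMor L h) \<diamondop> (c \<triangleright> \<eta> (Dom M h)) = (c \<triangleright> \<eta> (Cod M h)) \<diamondop> (c \<triangleright> FMor K h)"
      using h by (simp add: module_nat_transfD(4)[OF \<eta> h] flip: lw_Comp)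
    from N.prefix[OF this] show ?thesis
      using h interchange[of f "FMor K h" b c] by (simp add: ActMor_lw_rw)
  qed
  show "FCon (center_act_obj C N (c, \<tau>) L) a x \<diamondop> f \<rhd>\<^sub>m\<^bsub>N\<^esub> \<eta> (a \<rhd>\<^sub>o\<^bsub>M\<^esub> x)
      = (a \<triangleright> f \<rhd>\<^sub>m\<^bsub>N\<^esub> \<eta> x) \<diamondop> FCon (center_act_obj C N (b, \<sigma>) K) a x"
    if [simp]: "a \<in> Obj C" "x \<in> Obj M" for a x
  proof -
    let ?s = "inv_arr C (\<sigma> a)" and ?t = "inv_arr C (\<tau> a)"
    have inv: "?t \<cdot>\<^bsub>C\<^esub> (f \<triangleleft>\<^sub>C a) = (a \<triangleright>\<^sub>C f) \<cdot>\<^bsub>C\<^esub> ?s"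
      by (rule C.square_inv[symmetric, OF fc]) simp_all
    have ex: "expand c a ?t w \<diamondop> (f \<triangleleft> (a \<star> w)) = (a \<triangleright> f \<triangleleft> w) \<diamondop> expand b a ?s w" if [simp]: "w \<in> Obj N" for w
    proof -
      have "expand c a ?t w \<diamondop> (f \<triangleleft> (a \<star> w)) = MAssoc N a c w \<diamondop> (?t \<cdot>\<^bsub>C\<^esub> (f \<triangleleft>\<^sub>C a)) \<triangleleft> w \<diamondop> inv_arr N (MAssoc N b a w)"
        by (simp add: expand_def rw_Comp MAssoc_inv_rw)
      then show ?thesis
        unfolding inv by (simp add: expand_def rw_Comp natural_simps)
    qed
    have "(expand c a ?t (FObj L x) \<diamondop> (c \<triangleright> FCon L a x)) \<diamondop> f \<rhd>\<^sub>m\<^bsub>N\<^esub> \<eta> (a \<rhd>\<^sub>o\<^bsub>M\<^esub> x)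
      = expand c a ?t (FObj L x) \<diamondop> (c \<triangleright> (FCon L a x \<diamondop> \<eta> (a \<rhd>\<^sub>o\<^bsub>M\<^esub> x))) \<diamondop> (f \<triangleleft> FObj K (a \<rhd>\<^sub>o\<^bsub>M\<^esub> x))"
      by (simp add: ActMor_lw_rw lw_Comp)
    also have "\<dots> = (expand c a ?t (FObj L x) \<diamondop> (c \<triangleright> a \<triangleright> \<eta> x)) \<diamondop> (c \<triangleright> FCon K a x) \<diamondop> (f \<triangleleft> FObj K (a \<rhd>\<^sub>o\<^bsub>M\<^esub> x))"
      unfolding module_nat_transfD(5)[OF \<eta> that] by (simp add: lw_Comp)
    also have "(c \<triangleright> FCon K a x) \<diamondop> (f \<triangleleft> FObj K (a \<rhd>\<^sub>o\<^bsub>M\<^esub> x)) = (f \<triangleleft> (a \<star> FObj K x)) \<diamondop> (b \<triangleright> FCon K a x)"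
      by (rule interchange) simp_all
    also have "expand c a ?t (FObj L x) \<diamondop> (c \<triangleright> a \<triangleright> \<eta> x) = (a \<triangleright> c \<triangleright> \<eta> x) \<diamondop> expand c a ?t (FObj K x)"
      by (rule expand_nat[symmetric]) simp_all
    finally have "(expand c a ?t (FObj L x) \<diamondop> (c \<triangleright> FCon L a x)) \<diamondop> f \<rhd>\<^sub>m\<^bsub>N\<^esub> \<eta> (a \<rhd>\<^sub>o\<^bsub>M\<^esub> x)
      = (a \<triangleright> f \<rhd>\<^sub>m\<^bsub>N\<^esub> \<eta> x) \<diamondop> expand b a ?s (FObj K x) \<diamondop> (b \<triangleright> FCon K a x)"
      by (simp add: N.prefix[OF ex] ActMor_lw_rw lw_Comp)
    then show ?thesis using \<sigma> \<tau> K L by simp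
  qed
qed

sublocale center: category_action "center C" "Rex C M N" "center_act_obj C N" "center_act_mor C M N"
proof -
  interpret Z: category "center C" by (rule C.category_center)
  interpret R: category "Rex C M N" by (rule category_Rex)
  show "category_action (center C) (Rex C M N) (center_act_obj C N) (center_act_mor C M N)"
  proof
    fix a x assume a: "a \<in> Obj (center C)" and x: "x \<in> Obj (Rex C M N)"
    obtain b \<sigma> where [simp]: "a = (b, \<sigma>)" by (cases a)
    have mf: "is_module_functor C M N (center_act_obj C N a x)"
      using a x center_act_module_functor by simp
    then have "is_linear_functor M N (center_act_obj C N a x)"
      by (simp add: is_module_functor_def)
    with mf show "center_act_obj C N a x \<in> Obj (Rex C M N)"
      using a x center_act_right_exact by simp
    then show "center_act_mor C M N (Idn (center C) a) (Idn (Rex C M N) x) = Idn (Rex C M N) (center_act_obj C N a x)"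
      using a x functD(1) by (auto simp: center_act_mor_def ActMor_Idn intro!: restrict_ext)
  next
    fix u f assume u: "u \<in> Arr (center C)" and f: "f \<in> Arr (Rex C M N)"
    obtain b \<sigma> v c \<tau> K \<eta> L where [simp]: "u = ((b, \<sigma>), v, (c, \<tau>))" "f = (K, \<eta>, L)"
      by (cases u, cases f) auto
    have K: "is_module_functor C M N K" "is_module_functor C M N L" "right_exact M N K" "right_exact M N L"
      and b: "b \<in> Obj C" "half_braiding C b \<sigma>" and c: "c \<in> Obj C" "half_braiding C c \<tau>"
      using u f by auto
    have "is_module_functor C M N (center_act_obj C N (b, \<sigma>) K)" "is_module_functor C M N (center_act_obj C N (c, \<tau>) L)"
      using K b c center_act_module_functor by auto
    moreover from this have "right_exact M N (center_act_obj C N (b, \<sigma>) K)" "right_exact M N (center_act_obj C N (c, \<tau>) L)"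
      using K b c by (auto intro!: center_act_right_exact simp: is_module_functor_def)
    moreover have "is_module_nat_transf C M N (center_act_obj C N (b, \<sigma>) K) (center_act_obj C N (c, \<tau>) L)
      (restrict (\<lambda>x. v \<rhd>\<^sub>m\<^bsub>N\<^esub> \<eta> x) (Obj M))"
      using u f K by (intro center_act_nat_transf) auto
    ultimately show "center_act_mor C M N u f \<in> Arr (Rex C M N)"
      "Dom (Rex C M N) (center_act_mor C M N u f) = center_act_obj C N (Dom (center C) u) (Dom (Rex C M N) f)"
      "Cod (Rex C M N) (center_act_mor C M N u f) = center_act_obj C N (Cod (center C) u) (Cod (Rex C M N) f)"
      by (simp_all add: center_act_mor_def)
  next
    fix u v f g assume *: "u \<in> Arr (center C)" "v \<in> Arr (center C)" "f \<in> Arr (Rex C M N)" "g \<in> Arr (Rex C M N)"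
      "Dom (center C) v = Cod (center C) u" "Dom (Rex C M N) g = Cod (Rex C M N) f"
    obtain b \<sigma> u' c \<tau> v' d \<rho> where [simp]: "u = ((b, \<sigma>), u', (c, \<tau>))" "v = ((c, \<tau>), v', (d, \<rho>))"
      using *(5) by (cases u, cases v) auto
    obtain J K L \<eta> \<theta> where [simp]: "f = (J, \<eta>, K)" "g = (K, \<theta>, L)"
      using *(6) by (cases f, cases g) auto
    have \<eta>: "is_module_nat_transf C M N J K \<eta>" and \<theta>: "is_module_nat_transf C M N K L \<theta>"
      using * by auto
    note [simp] = module_nat_transfD(1-3)[OF \<eta>] module_nat_transfD(1-3)[OF \<theta>]
    show "center_act_mor C M N (v \<cdot>\<^bsub>center C\<^esub> u) (g \<cdot>\<^bsub>Rex C M N\<^esub> f) = center_act_mor C M N v g \<cdot>\<^bsub>Rex C M N\<^esub> center_act_mor C M N u f"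
      using * by (auto simp: center_act_mor_def Hom_def intro!: restrict_ext ActMor_Comp')
  qed
qed

end

text \<open>Translates conditions with inverted constraints, as they arise over the opposite
  categories, into conditions on the constraints themselves.\<close>

lemma (in category) square_inv_iff:
  assumes k: "iso_arr C k" and f: "iso_arr C f" and lr: "l \<in> Arr C" "r \<in> Arr C" "Dom C l = Dom C f"
    "Cod C l = Dom C k" "Dom C r = Cod C f" "Cod C r = Cod C k"
  shows "l \<cdot>\<^bsub>C\<^esub> inv_arr C f = inv_arr C k \<cdot>\<^bsub>C\<^esub> r \<longleftrightarrow> k \<cdot>\<^bsub>C\<^esub> l = r \<cdot>\<^bsub>C\<^esub> f"
proof
  assume "l \<cdot>\<^bsub>C\<^esub> inv_arr C f = inv_arr C k \<cdot>\<^bsub>C\<^esub> r"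
  from arg_cong[OF this, of "\<lambda>z. k \<cdot>\<^bsub>C\<^esub> z \<cdot>\<^bsub>C\<^esub> f"] show "k \<cdot>\<^bsub>C\<^esub> l = r \<cdot>\<^bsub>C\<^esub> f"
    using assms iso_Arr[OF f] iso_Arr[OF k] by simp
next
  assume "k \<cdot>\<^bsub>C\<^esub> l = r \<cdot>\<^bsub>C\<^esub> f"
  then show "l \<cdot>\<^bsub>C\<^esub> inv_arr C f = inv_arr C k \<cdot>\<^bsub>C\<^esub> r"
    by (rule square_inv[OF _ f k]) (use lr in simp_all)
qed

lemma (in category_action) category_action_op: "category_action (op_cat A) (op_cat X) ao am"
  by (intro category_action.intro A.category_op X.category_op category_action_axioms.intro)
    (simp_all add: am_Comp)

section \<open>Universal elements over the center\<close>

context module_functors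
begin

lemma pairI: "is_module_functor C M N F \<Longrightarrow> is_module_functor C M N G \<Longrightarrow> module_functor_pair C N M F G"
  by (intro module_functor_pair.intro module_functor_pair_axioms.intro) unfold_locales

end

context module_functor_pair
begin

lemma op_family1_iff:
  "module_functor_pair.family1 (op_tensor C) (op_module N) (op_module M) (op_functor N F) (op_functor N G) a \<xi> \<longleftrightarrow>
    (\<forall>x \<in> Obj M. \<xi> x \<in> Hom N (FObj G x) (a \<star> FObj F x)) \<and>
     (\<forall>f \<in> Arr M. (a \<triangleright> FMor F f) \<diamondop> \<xi> (Dom M f) = \<xi> (Cod M f) \<diamondop> FMor G f)"
  by (auto simp: module_functor_pair.family1_def[OF pair_op] lw_op)

lemma op_universal_family_iff:
  "module_functor_pair.universal_family (op_tensor C) (op_module N) (op_module M) (op_functor N F) (op_functor N G) h \<epsilon> \<longleftrightarrow>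
    h \<in> Obj C \<and> module_functor_pair.family1 (op_tensor C) (op_module N) (op_module M) (op_functor N F) (op_functor N G) h \<epsilon> \<and>
     (\<forall>a \<in> Obj C. \<forall>\<xi>. module_functor_pair.family1 (op_tensor C) (op_module N) (op_module M) (op_functor N F) (op_functor N G) a \<xi> \<longrightarrow>
        (\<exists>!u. u \<in> Hom C h a \<and> (\<forall>x \<in> Obj M. (u \<triangleleft> FObj F x) \<diamondop> \<epsilon> x = \<xi> x)))"
  by (simp add: module_functor_pair.universal_family_def[OF pair_op] rw_op)

text \<open>Half-braidings are inverted over the opposite categories, so
  \<open>center_morphism_iff\<close> is applied there to the inverses of \<open>\<tau>\<close> and
  \<open>s\<close>.\<close>

lemma op_center_morphism_iff:
  assumes U: "universal_pair (op_tensor C) (op_module N) (op_module M) (op_functor N F) (op_functor N G) h \<epsilon>"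
    and b: "b \<in> Obj C" and u: "u \<in> Hom C h b" and c: "c \<in> Obj C"
    and \<tau>: "\<tau> \<in> Arr C" "Dom C \<tau> = c \<otimes>\<^sub>o\<^bsub>C\<^esub> b" "Cod C \<tau> = b \<otimes>\<^sub>o\<^bsub>C\<^esub> c" "iso_arr C \<tau>"
    and s: "s = universal_pair.swap (op_tensor C) (op_module N) (op_module M) (op_functor N F) (op_functor N G) h \<epsilon> c"
  shows "\<tau> \<cdot>\<^bsub>C\<^esub> (c \<triangleright>\<^sub>C u) = (u \<triangleleft>\<^sub>C c) \<cdot>\<^bsub>C\<^esub> s \<longleftrightarrow>
    (\<forall>x \<in> Obj M. (u \<triangleleft> FObj F (c \<rhd>\<^sub>o\<^bsub>M\<^esub> x)) \<diamondop> \<epsilon> (c \<rhd>\<^sub>o\<^bsub>M\<^esub> x) \<diamondop> inv_arr N (FCon G c x) =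
      (b \<triangleright> inv_arr N (FCon F c x)) \<diamondop> MAssoc N b c (FObj F x) \<diamondop> (\<tau> \<triangleleft> FObj F x)
        \<diamondop> inv_arr N (MAssoc N c b (FObj F x)) \<diamondop> (c \<triangleright> ((u \<triangleleft> FObj F x) \<diamondop> \<epsilon> x)))"
proof -
  note [simp] = b c \<tau>
  have [simp]: "u \<in> Arr C" "Dom C u = h" "Cod C u = b" "h \<in> Obj C" using u by (auto simp: Hom_def)
  have s_simps [simp]: "s \<in> Arr C" "Dom C s = c \<otimes>\<^sub>o\<^bsub>C\<^esub> h" "Cod C s = h \<otimes>\<^sub>o\<^bsub>C\<^esub> c" "iso_arr C s"
    using universal_pair.swap_simps[OF U, of c] universal_pair.swap_iso[OF U, of c] by (simp_all add: s)
  have \<epsilon> [simp]: "\<epsilon> x \<in> Arr N" "Dom N (\<epsilon> x) = FObj G x" "Cod N (\<epsilon> x) = h \<star> FObj F x" if "x \<in> Obj M" for x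
    using universal_pair.\<epsilon>_simps[OF U, of x] that by simp_all
  have "\<tau> \<cdot>\<^bsub>C\<^esub> (c \<triangleright>\<^sub>C u) = (u \<triangleleft>\<^sub>C c) \<cdot>\<^bsub>C\<^esub> s \<longleftrightarrow> (c \<triangleright>\<^sub>C u) \<cdot>\<^bsub>C\<^esub> inv_arr C s = inv_arr C \<tau> \<cdot>\<^bsub>C\<^esub> (u \<triangleleft>\<^sub>C c)"
    (is "?a = ?b \<longleftrightarrow> ?c = ?d")
  proof
    assume "?a = ?b"
    then have "inv_arr C \<tau> \<cdot>\<^bsub>C\<^esub> ?a \<cdot>\<^bsub>C\<^esub> inv_arr C s = inv_arr C \<tau> \<cdot>\<^bsub>C\<^esub> ?b \<cdot>\<^bsub>C\<^esub> inv_arr C s" by simp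
    then show "?c = ?d" by simp
  next
    assume "?c = ?d"
    then have "\<tau> \<cdot>\<^bsub>C\<^esub> ?c \<cdot>\<^bsub>C\<^esub> s = \<tau> \<cdot>\<^bsub>C\<^esub> ?d \<cdot>\<^bsub>C\<^esub> s" by simp
    then show "?a = ?b" by simp
  qed
  then show ?thesis
    using universal_pair.center_morphism_iff[OF U, of b u c "inv_arr C \<tau>" "inv_arr C s"] u
    by (simp add: s[symmetric] lw_op rw_op C.lw_op C.rw_op cong: ball_cong_simp)
qed

end

context center_action
begin

text \<open>An arrow from \<open>a.F\<close> to \<open>G\<close> in \<open>Rex\<close> is a natural
  family that respects the constraints, and these are the families classified by arrows of the
  center. Universality among all natural families thus restricts to universality over the
  center.\<close>

lemma universal_center:
  assumes F: "F \<in> Obj (Rex C M N)" and G: "G \<in> Obj (Rex C M N)"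
    and U: "universal_pair C N M F G g \<epsilon>"
    and \<sigma>: "\<And>c. c \<in> Obj C \<Longrightarrow> \<sigma> c = inv_arr C (universal_pair.swap C N M F G g \<epsilon> c)"
  shows "(g, \<sigma>) \<in> Obj (center C)"
    "center.universal F G (g, \<sigma>) (center_act_obj C N (g, \<sigma>) F, restrict \<epsilon> (Obj M), G)"
proof -
  interpret U: universal_pair C N M F G g \<epsilon> by (rule U)
  have hb: "half_braiding C g \<sigma>"
    by (rule U.half_braiding_swap) (rule \<sigma>)
  then show g: "(g, \<sigma>) \<in> Obj (center C)" by simp
  have iff: "((b, \<tau>), u, (g, \<sigma>)) \<in> Arr (center C) \<longleftrightarrow> (\<forall>c \<in> Obj C. \<forall>x \<in> Obj M.
      FCon G c x \<diamondop> \<epsilon> (c \<rhd>\<^sub>o\<^bsub>M\<^esub> x) \<diamondop> (u \<triangleleft> FObj F (c \<rhd>\<^sub>o\<^bsub>M\<^esub> x)) =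
      (c \<triangleright> (\<epsilon> x \<diamondop> (u \<triangleleft> FObj F x))) \<diamondop> FCon (center_act_obj C N (b, \<tau>) F) c x)"
    if u: "u \<in> Hom C b g" and b: "b \<in> Obj C" and \<tau>: "half_braiding C b \<tau>" for b \<tau> u
  proof -
    note [simp] = b C.half_braidingD[OF \<tau>]
    have "((b, \<tau>), u, (g, \<sigma>)) \<in> Arr (center C) \<longleftrightarrow> (\<forall>c \<in> Obj C. \<sigma> c \<cdot>\<^bsub>C\<^esub> (c \<triangleright>\<^sub>C u) = (u \<triangleleft>\<^sub>C c) \<cdot>\<^bsub>C\<^esub> \<tau> c)"
      using u \<tau> hb by simp
    also have "\<dots> \<longleftrightarrow> (\<forall>c \<in> Obj C. \<forall>x \<in> Obj M. FCon G c x \<diamondop> \<epsilon> (c \<rhd>\<^sub>o\<^bsub>M\<^esub> x) \<diamondop> (u \<triangleleft> FObj F (c \<rhd>\<^sub>o\<^bsub>M\<^esub> x)) =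
      (c \<triangleright> (\<epsilon> x \<diamondop> (u \<triangleleft> FObj F x))) \<diamondop> MAssoc N c b (FObj F x) \<diamondop> (inv_arr C (\<tau> c) \<triangleleft> FObj F x)
        \<diamondop> inv_arr N (MAssoc N b c (FObj F x)) \<diamondop> (b \<triangleright> FCon F c x))"
      by (intro ball_cong refl U.center_morphism_iff u b \<sigma>) simp_all
    also have "\<dots> \<longleftrightarrow> (\<forall>c \<in> Obj C. \<forall>x \<in> Obj M. FCon G c x \<diamondop> \<epsilon> (c \<rhd>\<^sub>o\<^bsub>M\<^esub> x) \<diamondop> (u \<triangleleft> FObj F (c \<rhd>\<^sub>o\<^bsub>M\<^esub> x)) =
      (c \<triangleright> (\<epsilon> x \<diamondop> (u \<triangleleft> FObj F x))) \<diamondop> FCon (center_act_obj C N (b, \<tau>) F) c x)"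
      using u by (intro ball_cong refl) (simp add: FCon_center_act[OF U.F \<tau>] expand_def Hom_def)
    finally show ?thesis .
  qed
  let ?e = "(center_act_obj C N (g, \<sigma>) F, restrict \<epsilon> (Obj M), G)"
  have gF: "center_act_obj C N (g, \<sigma>) F \<in> Obj (Rex C M N)"
    by (rule center.ao_Obj[OF g F])
  have "is_module_nat_transf C M N (center_act_obj C N (g, \<sigma>) F) G (restrict \<epsilon> (Obj M))"
  proof (rule module_nat_transfI)
    \<comment> \<open>The identity is an arrow of the center; read through \<open>iff\<close>, this
      means that \<open>\<epsilon>\<close> itself respects the constraints.\<close>
    have "((g, \<sigma>), Idn C g, (g, \<sigma>)) \<in> Arr (center C)"
      using center.A.Idn_in_Hom[OF g] by (auto simp: center.A.Hom_iff simp del: C.center_simps(2))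
    then show "FCon G c x \<diamondop> \<epsilon> (c \<rhd>\<^sub>o\<^bsub>M\<^esub> x) = (c \<triangleright> \<epsilon> x) \<diamondop> FCon (center_act_obj C N (g, \<sigma>) F) c x"
      if "c \<in> Obj C" "x \<in> Obj M" for c x
      using iff[of "Idn C g" g \<sigma>] hb that by (simp add: C.Idn_in_Hom del: C.center_simps(2))
  qed (simp_all add: Hom_def U.\<epsilon>_nat)
  with gF G have e: "?e \<in> Hom (Rex C M N) (center_act_obj C N (g, \<sigma>) F) G"
    by (simp add: Hom_def)
  show "center.universal F G (g, \<sigma>) ?e"
    unfolding center.universal_def
  proof (intro conjI ballI)
    fix a k assume a: "a \<in> Obj (center C)" and k: "k \<in> Hom (Rex C M N) (center_act_obj C N a F) G"
    obtain b \<tau> where a_eq [simp]: "a = (b, \<tau>)" by (cases a)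
    have b [simp]: "b \<in> Obj C" and \<tau>: "half_braiding C b \<tau>" using a by auto
    obtain \<eta> where k_eq: "k = (center_act_obj C N a F, \<eta>, G)" and \<eta>: "is_module_nat_transf C M N (center_act_obj C N a F) G \<eta>"
      and ext: "\<eta> \<in> extensional (Obj M)"
      using Rex_cases[OF k] by metis
    have "U.family1 b \<eta>"
      using module_nat_transfD[OF \<eta>] by (simp add: U.family1_def Hom_def)
    then have ex1: "\<exists>!u. u \<in> Hom C b g \<and> (\<forall>x \<in> Obj M. \<epsilon> x \<diamondop> (u \<triangleleft> FObj F x) = \<eta> x)"
      using U.universal by (simp add: U.universal_family_def)
    \<comment> \<open>An equality of arrows in \<open>Rex\<close> is one on the objects of
      \<open>M\<close>, as both families are extensional.\<close>
    have comp: "?e \<cdot>\<^bsub>Rex C M N\<^esub> center_act_mor C M N ((b, \<tau>), u, (g, \<sigma>)) (Idn (Rex C M N) F) = k \<longleftrightarrow>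
        (\<forall>x \<in> Obj M. \<epsilon> x \<diamondop> (u \<triangleleft> FObj F x) = \<eta> x)" for u
      using ext by (auto simp: k_eq center_act_mor_def rw_def fun_eq_iff restrict_def extensional_def)
    show "\<exists>!u. u \<in> Hom (center C) a (g, \<sigma>) \<and> ?e \<cdot>\<^bsub>Rex C M N\<^esub> center_act_mor C M N u (Idn (Rex C M N) F) = k"
    proof (rule ex_ex1I)
      obtain u where u: "u \<in> Hom C b g" "\<And>x. x \<in> Obj M \<Longrightarrow> \<epsilon> x \<diamondop> (u \<triangleleft> FObj F x) = \<eta> x"
        using ex1 by blast
      have "((b, \<tau>), u, (g, \<sigma>)) \<in> Arr (center C)"
        unfolding iff[OF u(1) b \<tau>] using module_nat_transfD(5)[OF \<eta>] by (simp add: u(2))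
      then show "\<exists>u. u \<in> Hom (center C) a (g, \<sigma>) \<and> ?e \<cdot>\<^bsub>Rex C M N\<^esub> center_act_mor C M N u (Idn (Rex C M N) F) = k"
        using u(2) comp[of u] by (intro exI[of _ "((b, \<tau>), u, (g, \<sigma>))"]) (simp add: center.A.Hom_iff)
    next
      fix v w
      assume v: "v \<in> Hom (center C) a (g, \<sigma>) \<and> ?e \<cdot>\<^bsub>Rex C M N\<^esub> center_act_mor C M N v (Idn (Rex C M N) F) = k"
        and w: "w \<in> Hom (center C) a (g, \<sigma>) \<and> ?e \<cdot>\<^bsub>Rex C M N\<^esub> center_act_mor C M N w (Idn (Rex C M N) F) = k"
      obtain v' where v': "v = ((b, \<tau>), v', (g, \<sigma>))" "v' \<in> Hom C b g"
        using v by (cases v) (auto simp: center.A.Hom_iff)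
      obtain w' where w': "w = ((b, \<tau>), w', (g, \<sigma>))" "w' \<in> Hom C b g"
        using w by (cases w) (auto simp: center.A.Hom_iff)
      show "v = w"
        using ex1 v w v' w' comp[of v'] comp[of w'] by metis
    qed
  qed (use g e in simp_all)
qed

text \<open>The opposites of the center and of \<open>Rex\<close> are not the center and
  \<open>Rex\<close> of the opposite data: half-braidings are inverted, and right exactness would
  become left exactness. The argument of \<open>universal_center\<close> is therefore repeated, with
  the universal family over the opposite categories translated back.\<close>

lemma op_universal_center:
  assumes F: "F \<in> Obj (Rex C M N)" and G: "G \<in> Obj (Rex C M N)"
    and U: "universal_pair (op_tensor C) (op_module N) (op_module M) (op_functor N F) (op_functor N G) h \<epsilon>"
    and \<sigma>: "\<And>c. c \<in> Obj C \<Longrightarrow>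
      \<sigma> c = universal_pair.swap (op_tensor C) (op_module N) (op_module M) (op_functor N F) (op_functor N G) h \<epsilon> c"
  shows "(h, \<sigma>) \<in> Obj (center C)"
    "category_action.universal (op_cat (center C)) (op_cat (Rex C M N)) (center_act_obj C N) (center_act_mor C M N)
       F G (h, \<sigma>) (G, restrict \<epsilon> (Obj M), center_act_obj C N (h, \<sigma>) F)"
proof -
  interpret P: module_functor_pair C N M F G
    using F G by (intro pairI) simp_all
  note swap = universal_pair.swap_simps[OF U, simplified] universal_pair.swap_iso[OF U, simplified]
  have h [simp]: "h \<in> Obj C" using universal_pair.g_Obj[OF U] by simp
  have \<epsilon> [simp]: "\<epsilon> x \<in> Arr N" "Dom N (\<epsilon> x) = FObj G x" "Cod N (\<epsilon> x) = h \<star> FObj F x" if "x \<in> Obj M" for x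
    using universal_pair.\<epsilon>_simps[OF U, of x] that by simp_all
  have UF: "module_functor_pair.universal_family (op_tensor C) (op_module N) (op_module M) (op_functor N F) (op_functor N G) h \<epsilon>"
    by (rule universal_pair.universal[OF U])
  have \<epsilon>_nat: "(h \<triangleright> FMor F f) \<diamondop> \<epsilon> (Dom M f) = \<epsilon> (Cod M f) \<diamondop> FMor G f" if "f \<in> Arr M" for f
    using UF that by (simp add: P.op_universal_family_iff P.op_family1_iff)
  \<comment> \<open>The construction yields a half-braiding over the opposite category, whose
    inverse is one over \<open>C\<close>.\<close>
  have hb_op: "half_braiding (op_tensor C) h (\<lambda>c. inv_arr C (\<sigma> c))"
    by (rule universal_pair.half_braiding_swap[OF U]) (simp add: \<sigma>)
  have hb: "half_braiding C h \<sigma>"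
  proof -
    interpret O: monoidal_linear_category "op_tensor C" by (rule C.monoidal_op)
    have \<sigma>' [simp]: "\<sigma> c \<in> Arr C" "Dom C (\<sigma> c) = c \<otimes>\<^sub>o\<^bsub>C\<^esub> h" "Cod C (\<sigma> c) = h \<otimes>\<^sub>o\<^bsub>C\<^esub> c" "iso_arr C (\<sigma> c)" if "c \<in> Obj C" for c
      using that swap \<sigma> by simp_all
    \<comment> \<open>The axioms of the inverted half-braiding over the opposite category, rewritten
      as equations in \<open>C\<close>.\<close>
    note inv = O.half_braiding_inv[OF hb_op, simplified, unfolded C.lw_op C.rw_op O.hexagon_def[unfolded C.lw_op C.rw_op] op_tensor_simps iso_arr_op]
    have "RUnit C h \<cdot>\<^bsub>C\<^esub> \<sigma> (Unit C) = RUnit C h \<cdot>\<^bsub>C\<^esub> (\<sigma> (Unit C) \<cdot>\<^bsub>C\<^esub> inv_arr C (LUnit C h)) \<cdot>\<^bsub>C\<^esub> LUnit C h"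
      by simp
    then have "RUnit C h \<cdot>\<^bsub>C\<^esub> \<sigma> (Unit C) = LUnit C h"
      unfolding inv(3) by simp
    with inv(1,2) show ?thesis
      unfolding half_braiding_def C.reg.lw_def[symmetric] C.reg.rw_def[symmetric]
      by (simp add: Hom_def)
  qed
  show "(h, \<sigma>) \<in> Obj (center C)"
    using hb by simp
  have iff: "((h, \<sigma>), u, (b, \<tau>)) \<in> Arr (center C) \<longleftrightarrow> (\<forall>c \<in> Obj C. \<forall>x \<in> Obj M.
      FCon (center_act_obj C N (b, \<tau>) F) c x \<diamondop> (u \<triangleleft> FObj F (c \<rhd>\<^sub>o\<^bsub>M\<^esub> x)) \<diamondop> \<epsilon> (c \<rhd>\<^sub>o\<^bsub>M\<^esub> x) =
      (c \<triangleright> ((u \<triangleleft> FObj F x) \<diamondop> \<epsilon> x)) \<diamondop> FCon G c x)"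
    if u: "u \<in> Hom C h b" and b: "b \<in> Obj C" and \<tau>: "half_braiding C b \<tau>" for b \<tau> u
  proof -
    note [simp] = b C.half_braidingD[OF \<tau>]
    have [simp]: "u \<in> Arr C" "Dom C u = h" "Cod C u = b" using u by (auto simp: Hom_def)
    have "((h, \<sigma>), u, (b, \<tau>)) \<in> Arr (center C) \<longleftrightarrow> (\<forall>c \<in> Obj C. \<tau> c \<cdot>\<^bsub>C\<^esub> (c \<triangleright>\<^sub>C u) = (u \<triangleleft>\<^sub>C c) \<cdot>\<^bsub>C\<^esub> \<sigma> c)"
      using u \<tau> hb by simp
    also have "\<dots> \<longleftrightarrow> (\<forall>c \<in> Obj C. \<forall>x \<in> Obj M. (u \<triangleleft> FObj F (c \<rhd>\<^sub>o\<^bsub>M\<^esub> x)) \<diamondop> \<epsilon> (c \<rhd>\<^sub>o\<^bsub>M\<^esub> x) \<diamondop> inv_arr N (FCon G c x) =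
      (b \<triangleright> inv_arr N (FCon F c x)) \<diamondop> MAssoc N b c (FObj F x) \<diamondop> (\<tau> c \<triangleleft> FObj F x)
        \<diamondop> inv_arr N (MAssoc N c b (FObj F x)) \<diamondop> (c \<triangleright> ((u \<triangleleft> FObj F x) \<diamondop> \<epsilon> x)))"
      by (intro ball_cong refl P.op_center_morphism_iff[OF U] u b \<sigma>) simp_all
    also have "\<dots> \<longleftrightarrow> (\<forall>c \<in> Obj C. \<forall>x \<in> Obj M. FCon (center_act_obj C N (b, \<tau>) F) c x \<diamondop> (u \<triangleleft> FObj F (c \<rhd>\<^sub>o\<^bsub>M\<^esub> x)) \<diamondop> \<epsilon> (c \<rhd>\<^sub>o\<^bsub>M\<^esub> x) =
      (c \<triangleright> ((u \<triangleleft> FObj F x) \<diamondop> \<epsilon> x)) \<diamondop> FCon G c x)"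
    proof (intro ball_cong refl)
      fix c x assume [simp]: "c \<in> Obj C" "x \<in> Obj M"
      let ?K = "expand b c (inv_arr C (\<tau> c)) (FObj F x) \<diamondop> (b \<triangleright> FCon F c x)"
      let ?K' = "(b \<triangleright> inv_arr N (FCon F c x)) \<diamondop> MAssoc N b c (FObj F x) \<diamondop> (\<tau> c \<triangleleft> FObj F x) \<diamondop> inv_arr N (MAssoc N c b (FObj F x))"
      let ?l = "(u \<triangleleft> FObj F (c \<rhd>\<^sub>o\<^bsub>M\<^esub> x)) \<diamondop> \<epsilon> (c \<rhd>\<^sub>o\<^bsub>M\<^esub> x)" and ?r = "c \<triangleright> ((u \<triangleleft> FObj F x) \<diamondop> \<epsilon> x)"
      have K: "iso_arr N ?K" "inv_arr N ?K = ?K'"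
        unfolding expand_def by (simp_all add: N.iso_Comp)
      have [simp]: "?K \<in> Arr N" "Dom N ?K = b \<star> FObj F (c \<rhd>\<^sub>o\<^bsub>M\<^esub> x)" "Cod N ?K = c \<star> b \<star> FObj F x"
        "?l \<in> Arr N" "?r \<in> Arr N" "Dom N ?l = FObj G (c \<rhd>\<^sub>o\<^bsub>M\<^esub> x)" "Cod N ?l = b \<star> FObj F (c \<rhd>\<^sub>o\<^bsub>M\<^esub> x)"
        "Dom N ?r = c \<star> FObj G x" "Cod N ?r = c \<star> b \<star> FObj F x"
        by simp_all
      have "?l \<diamondop> inv_arr N (FCon G c x) = inv_arr N ?K \<diamondop> ?r \<longleftrightarrow> ?K \<diamondop> ?l = ?r \<diamondop> FCon G c x"
        by (rule N.square_inv_iff) (use K(1) in simp_all)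
      then show "((u \<triangleleft> FObj F (c \<rhd>\<^sub>o\<^bsub>M\<^esub> x)) \<diamondop> \<epsilon> (c \<rhd>\<^sub>o\<^bsub>M\<^esub> x) \<diamondop> inv_arr N (FCon G c x) =
          (b \<triangleright> inv_arr N (FCon F c x)) \<diamondop> MAssoc N b c (FObj F x) \<diamondop> (\<tau> c \<triangleleft> FObj F x)
        \<diamondop> inv_arr N (MAssoc N c b (FObj F x)) \<diamondop> ?r) \<longleftrightarrow>
        (FCon (center_act_obj C N (b, \<tau>) F) c x \<diamondop> ?l = ?r \<diamondop> FCon G c x)"
        unfolding K(2) FCon_center_act[OF P.F \<tau> b \<open>c \<in> Obj C\<close> \<open>x \<in> Obj M\<close>] by simp
    qed
    finally show ?thesis .
  qed
  let ?e = "(G, restrict \<epsilon> (Obj M), center_act_obj C N (h, \<sigma>) F)"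
  have hc: "(h, \<sigma>) \<in> Obj (center C)" using hb by simp
  have hF: "center_act_obj C N (h, \<sigma>) F \<in> Obj (Rex C M N)"
    by (rule center.ao_Obj[OF hc F])
  have "is_module_nat_transf C M N G (center_act_obj C N (h, \<sigma>) F) (restrict \<epsilon> (Obj M))"
  proof (rule module_nat_transfI)
    have "((h, \<sigma>), Idn C h, (h, \<sigma>)) \<in> Arr (center C)"
      using center.A.Idn_in_Hom[OF hc] by (auto simp: center.A.Hom_iff simp del: C.center_simps(2))
    then have "FCon (center_act_obj C N (h, \<sigma>) F) c x \<diamondop> (Idn C h \<triangleleft> FObj F (c \<rhd>\<^sub>o\<^bsub>M\<^esub> x)) \<diamondop> \<epsilon> (c \<rhd>\<^sub>o\<^bsub>M\<^esub> x)
        = (c \<triangleright> ((Idn C h \<triangleleft> FObj F x) \<diamondop> \<epsilon> x)) \<diamondop> FCon G c x"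
      if "c \<in> Obj C" "x \<in> Obj M" for c x
      using iff[of "Idn C h" h \<sigma>] hb that C.Idn_in_Hom[OF h] h by blast
    then show "FCon (center_act_obj C N (h, \<sigma>) F) c x \<diamondop> \<epsilon> (c \<rhd>\<^sub>o\<^bsub>M\<^esub> x) = (c \<triangleright> \<epsilon> x) \<diamondop> FCon G c x"
      if "c \<in> Obj C" "x \<in> Obj M" for c x
      using that by simp
  qed (simp_all add: Hom_def \<epsilon>_nat)
  with hF G have e: "?e \<in> Hom (Rex C M N) G (center_act_obj C N (h, \<sigma>) F)"
    by (simp add: Hom_def)
  show "category_action.universal (op_cat (center C)) (op_cat (Rex C M N)) (center_act_obj C N) (center_act_mor C M N)
       F G (h, \<sigma>) ?e"
    unfolding category_action.universal_def[OF center.category_action_op] op_cat_simps Hom_op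
  proof (intro conjI ballI)
    fix a k assume a: "a \<in> Obj (center C)" and k: "k \<in> Hom (Rex C M N) G (center_act_obj C N a F)"
    obtain b \<tau> where a_eq [simp]: "a = (b, \<tau>)" by (cases a)
    have b [simp]: "b \<in> Obj C" and \<tau>: "half_braiding C b \<tau>" using a by auto
    obtain \<eta> where k_eq: "k = (G, \<eta>, center_act_obj C N a F)" and \<eta>: "is_module_nat_transf C M N G (center_act_obj C N a F) \<eta>"
      and ext: "\<eta> \<in> extensional (Obj M)"
      using Rex_cases[OF k] by metis
    have "module_functor_pair.family1 (op_tensor C) (op_module N) (op_module M) (op_functor N F) (op_functor N G) b \<eta>"
      using module_nat_transfD[OF \<eta>] by (simp add: P.op_family1_iff Hom_def)
    then have ex1: "\<exists>!u. u \<in> Hom C h b \<and> (\<forall>x \<in> Obj M. (u \<triangleleft> FObj F x) \<diamondop> \<epsilon> x = \<eta> x)"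
      using UF b unfolding P.op_universal_family_iff by blast
    have comp: "center_act_mor C M N ((h, \<sigma>), u, (b, \<tau>)) (Idn (Rex C M N) F) \<cdot>\<^bsub>Rex C M N\<^esub> ?e = k \<longleftrightarrow>
        (\<forall>x \<in> Obj M. (u \<triangleleft> FObj F x) \<diamondop> \<epsilon> x = \<eta> x)" for u
      using ext by (auto simp: k_eq center_act_mor_def rw_def fun_eq_iff restrict_def extensional_def)
    show "\<exists>!u. u \<in> Hom (center C) (h, \<sigma>) a \<and> center_act_mor C M N u (Idn (Rex C M N) F) \<cdot>\<^bsub>Rex C M N\<^esub> ?e = k"
    proof (rule ex_ex1I)
      obtain u where u: "u \<in> Hom C h b" "\<And>x. x \<in> Obj M \<Longrightarrow> (u \<triangleleft> FObj F x) \<diamondop> \<epsilon> x = \<eta> x"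
        using ex1 by blast
      have "((h, \<sigma>), u, (b, \<tau>)) \<in> Arr (center C)"
        unfolding iff[OF u(1) b \<tau>] using module_nat_transfD(5)[OF \<eta>] by (simp add: u(2) del: FCon_center_act)
      then show "\<exists>u. u \<in> Hom (center C) (h, \<sigma>) a \<and> center_act_mor C M N u (Idn (Rex C M N) F) \<cdot>\<^bsub>Rex C M N\<^esub> ?e = k"
        using u(2) comp[of u] by (intro exI[of _ "((h, \<sigma>), u, (b, \<tau>))"]) (simp add: center.A.Hom_iff)
    next
      fix v w
      assume v: "v \<in> Hom (center C) (h, \<sigma>) a \<and> center_act_mor C M N v (Idn (Rex C M N) F) \<cdot>\<^bsub>Rex C M N\<^esub> ?e = k"
        and w: "w \<in> Hom (center C) (h, \<sigma>) a \<and> center_act_mor C M N w (Idn (Rex C M N) F) \<cdot>\<^bsub>Rex C M N\<^esub> ?e = k"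
      obtain v' where v': "v = ((h, \<sigma>), v', (b, \<tau>))" "v' \<in> Hom C h b"
        using v by (cases v) (auto simp: center.A.Hom_iff)
      obtain w' where w': "w = ((h, \<sigma>), w', (b, \<tau>))" "w' \<in> Hom C h b"
        using w by (cases w) (auto simp: center.A.Hom_iff)
      show "v = w"
        using ex1 v w v' w' comp[of v'] comp[of w'] by metis
    qed
  qed (use hc e in simp_all)
qed

end

section \<open>Linear algebra of finite-dimensional modules\<close>

text \<open>The columns are the images of the unit vectors. Induction runs over the vectors
  \<open>p k\<close>, which keep the first \<open>k\<close> coordinates of \<open>x\<close>.\<close>

lemma linear_map_mat:
  fixes f :: "'a::field vec \<Rightarrow> 'a vec"
  assumes f: "\<And>x. x \<in> carrier_vec d \<Longrightarrow> f x \<in> carrier_vec n"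
    and add: "\<And>x y. \<lbrakk>x \<in> carrier_vec d; y \<in> carrier_vec d\<rbrakk> \<Longrightarrow> f (x + y) = f x + f y"
    and smult: "\<And>a x. x \<in> carrier_vec d \<Longrightarrow> f (a \<cdot>\<^sub>v x) = a \<cdot>\<^sub>v f x"
  shows "\<exists>X \<in> carrier_mat n d. \<forall>x \<in> carrier_vec d. X *\<^sub>v x = f x"
proof -
  define X where "X = mat n d (\<lambda>(i, j). f (unit_vec d j) $ i)"
  have "X *\<^sub>v x = f x" if x: "x \<in> carrier_vec d" for x
  proof -
    define p where "p k = vec d (\<lambda>j. if j < k then x $ j else 0)" for k
    have p: "p k \<in> carrier_vec d" for k by (simp add: p_def)
    have part: "k \<le> d \<Longrightarrow> f (p k) = vec n (\<lambda>i. \<Sum>j<k. f (unit_vec d j) $ i * x $ j)" for k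
    proof (induction k)
      case 0
      have "p 0 = 0 \<cdot>\<^sub>v x" using x by (intro eq_vecI) (auto simp: p_def)
      then have "f (p 0) = 0 \<cdot>\<^sub>v f x" using smult[OF x] by simp
      then show ?case using f[OF x] by auto
    next
      case (Suc k)
      have "p (Suc k) = p k + x $ k \<cdot>\<^sub>v unit_vec d k"
        using Suc.prems x by (intro eq_vecI) (auto simp: p_def less_Suc_eq)
      then have "f (p (Suc k)) = f (p k) + x $ k \<cdot>\<^sub>v f (unit_vec d k)"
        using add[OF p, of "x $ k \<cdot>\<^sub>v unit_vec d k"] smult by simp
      also have "\<dots> = vec n (\<lambda>i. \<Sum>j<Suc k. f (unit_vec d j) $ i * x $ j)"
        using Suc f[of "unit_vec d k"] by (intro eq_vecI) auto
      finally show ?case .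
    qed
    have "p d = x" using x by (intro eq_vecI) (auto simp: p_def)
    then show ?thesis
      using part[of d] x by (intro eq_vecI) (auto simp: X_def scalar_prod_def atLeast0LessThan)
  qed
  then show ?thesis by (intro bexI[of _ X]) (simp_all add: X_def)
qed

lemma mat_eq_by_vec:
  assumes "X \<in> carrier_mat n d" "Y \<in> carrier_mat n d"
    "\<And>x. x \<in> carrier_vec d \<Longrightarrow> X *\<^sub>v x = Y *\<^sub>v (x :: 'a::field vec)"
  shows "X = Y"
proof (rule eq_matI)
  fix i j assume "i < dim_row Y" "j < dim_col Y"
  then have ij: "i < n" "j < d" using assms by auto
  have "X $$ (i, j) = (X *\<^sub>v unit_vec d j) $ i" "Y $$ (i, j) = (Y *\<^sub>v unit_vec d j) $ i"
    using assms(1,2) ij by (auto simp: row_def)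
  then show "X $$ (i, j) = Y $$ (i, j)" using assms(3)[of "unit_vec d j"] by simp
qed (use assms in auto)

text \<open>The maps \<open>f _ i\<close> with \<open>i < m\<close> are functionals without a common
  nonzero zero. If \<open>m < n\<close>, padding with zero rows gives a square matrix that misses
  \<open>unit_vec n m\<close>; it is singular, and a kernel vector contradicts the
  hypothesis.\<close>

lemma injective_mat_le:
  fixes f :: "'a::field vec \<Rightarrow> nat \<Rightarrow> 'a"
  assumes add: "\<And>x y i. \<lbrakk>x \<in> carrier_vec n; y \<in> carrier_vec n; i < m\<rbrakk> \<Longrightarrow> f (x + y) i = f x i + f y i"
    and smult: "\<And>a x i. \<lbrakk>x \<in> carrier_vec n; i < m\<rbrakk> \<Longrightarrow> f (a \<cdot>\<^sub>v x) i = a * f x i"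
    and inj: "\<And>x. \<lbrakk>x \<in> carrier_vec n; \<And>i. i < m \<Longrightarrow> f x i = 0\<rbrakk> \<Longrightarrow> x = 0\<^sub>v n"
  shows "n \<le> m"
proof (rule ccontr)
  assume "\<not> n \<le> m"
  then have nm: "m < n" by simp
  let ?f = "\<lambda>x. vec n (\<lambda>i. if i < m then f x i else 0)"
  have "\<exists>X \<in> carrier_mat n n. \<forall>x \<in> carrier_vec n. X *\<^sub>v x = ?f x"
    by (rule linear_map_mat) (auto simp: add smult)
  then obtain X where X: "X \<in> carrier_mat n n" "\<And>x. x \<in> carrier_vec n \<Longrightarrow> X *\<^sub>v x = ?f x" by blast
  have "det X = 0"
  proof (rule ccontr)
    assume "det X \<noteq> 0"
    from det_non_zero_imp_unit[OF X(1) this] obtain Y where Y: "Y \<in> carrier_mat n n" "X * Y = 1\<^sub>m n"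
      by (auto simp: Units_def ring_mat_def)
    have "unit_vec n m = X *\<^sub>v (Y *\<^sub>v unit_vec n m)"
      using X(1) Y by (simp flip: assoc_mult_mat_vec[of X n n Y n])
    also have "\<dots> = ?f (Y *\<^sub>v unit_vec n m)" using X(2) Y(1) by simp
    finally have "unit_vec n m $ m = ?f (Y *\<^sub>v unit_vec n m) $ m" by simp
    then show False using nm by simp
  qed
  then obtain v where v: "v \<in> carrier_vec n" "v \<noteq> 0\<^sub>v n" "X *\<^sub>v v = 0\<^sub>v n"
    using det_0_iff_vec_prod_zero_field[OF X(1)] by blast
  have "f v i = 0" if "i < m" for i
  proof -
    have "?f v = 0\<^sub>v n" using X(2)[OF v(1)] v(3) by simp
    then have "?f v $ i = 0" using that nm by (simp only: index_zero_vec)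
    then show ?thesis using that nm by simp
  qed
  with inj[OF v(1)] v(2) show False by blast
qed

text \<open>A complement of a subspace, presented by a projection \<open>Q\<close> with section \<open>S\<close>; the rank is minimal
  among the pairs \<open>(Q, S)\<close> for which \<open>1 - S Q\<close> takes values in the subspace.\<close>

lemma complement_exists:
  fixes U :: "'a::field vec set"
  assumes U: "U \<subseteq> carrier_vec n" and add: "\<And>x y. \<lbrakk>x \<in> U; y \<in> U\<rbrakk> \<Longrightarrow> x + y \<in> U"
    and smult: "\<And>a x. x \<in> U \<Longrightarrow> a \<cdot>\<^sub>v x \<in> U" and zero: "0\<^sub>v n \<in> U"
  shows "\<exists>k Q S. Q \<in> carrier_mat k n \<and> S \<in> carrier_mat n k \<and> Q * S = 1\<^sub>m k \<and>
    (\<forall>x \<in> carrier_vec n. x - S *\<^sub>v (Q *\<^sub>v x) \<in> U) \<and> (\<forall>u \<in> U. Q *\<^sub>v u = 0\<^sub>v k \<and> (u \<noteq> 0\<^sub>v n \<longrightarrow> k < n))"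
proof -
  define P where "P k \<longleftrightarrow> (\<exists>Q S. Q \<in> carrier_mat k n \<and> S \<in> carrier_mat n k \<and> Q * S = 1\<^sub>m k \<and>
    (\<forall>x \<in> carrier_vec n. x - S *\<^sub>v (Q *\<^sub>v x) \<in> U))" for k
  have diff: "x - y \<in> U" if "x \<in> U" "y \<in> U" for x y
  proof -
    have "x - y = x + (-1) \<cdot>\<^sub>v y" using that U by (intro eq_vecI) auto
    then show ?thesis using add[OF that(1) smult[OF that(2)]] by simp
  qed
  have "P n"
    unfolding P_def by (intro exI[of _ "1\<^sub>m n"]) (auto simp: zero minus_cancel_vec)
  define k where "k = (LEAST k. P k)"
  have k: "P k" "k \<le> n" unfolding k_def using \<open>P n\<close> by (auto intro: LeastI Least_le)
  have least: "\<not> P l" if "l < k" for l using that not_less_Least k_def by blast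
  obtain Q S where Q: "Q \<in> carrier_mat k n" and S: "S \<in> carrier_mat n k" and QS: "Q * S = 1\<^sub>m k"
    and QU: "\<And>x. x \<in> carrier_vec n \<Longrightarrow> x - S *\<^sub>v (Q *\<^sub>v x) \<in> U"
    using k(1) unfolding P_def by blast
  \<comment> \<open>Minimality of the rank: if \<open>w = Q u\<close> were nonzero for some
    \<open>u\<close> in \<open>U\<close>, a coordinate \<open>i\<close> with \<open>w $ i\<close>
    nonzero could be eliminated modulo \<open>w\<close>, which gives a pair of rank one
    less.\<close>
  have Q0: "Q *\<^sub>v u = 0\<^sub>v k" if u: "u \<in> U" for u
  proof (rule ccontr)
    assume neq: "Q *\<^sub>v u \<noteq> 0\<^sub>v k"
    define w where "w = Q *\<^sub>v u"
    have uc: "u \<in> carrier_vec n" using u U by auto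
    have w: "w \<in> carrier_vec k" using Q uc by (simp add: w_def)
    obtain i where i: "i < k" "w $ i \<noteq> 0"
      using neq w by (metis eq_vecI carrier_vecD index_zero_vec w_def)
    then obtain l where l: "k = Suc l" by (cases k) auto
    \<comment> \<open>\<open>up\<close> skips the index \<open>i\<close> and \<open>dn\<close>
      closes the gap. The map \<open>?f\<close> is the projection along \<open>w\<close> onto the
      remaining coordinates, and \<open>?g\<close> is a section of it.\<close>
    define up where "up r = (if r < i then r else Suc r)" for r
    define dn where "dn r = (if r < i then r else r - 1)" for r
    let ?f = "\<lambda>x. vec l (\<lambda>r. x $ up r - w $ up r / w $ i * x $ i)"
    let ?g = "\<lambda>y :: 'a vec. vec k (\<lambda>r. if r = i then 0 else y $ dn r)"
    have up: "up r < k" "up r \<noteq> i" "dn (up r) = r" if "r < l" for r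
      using that l by (auto simp: up_def dn_def)
    have dn: "dn r < l" "up (dn r) = r" if "r < k" "r \<noteq> i" for r
      using that l i by (auto simp: up_def dn_def)
    have "\<exists>X \<in> carrier_mat l k. \<forall>x \<in> carrier_vec k. X *\<^sub>v x = ?f x"
      by (rule linear_map_mat) (auto simp: up i(1) algebra_simps add_divide_distrib intro!: eq_vecI)
    then obtain X where X: "X \<in> carrier_mat l k" "\<And>x. x \<in> carrier_vec k \<Longrightarrow> X *\<^sub>v x = ?f x" by blast
    have "\<exists>Y \<in> carrier_mat k l. \<forall>y \<in> carrier_vec l. Y *\<^sub>v y = ?g y"
      by (rule linear_map_mat) (auto simp: dn)
    then obtain Y where Y: "Y \<in> carrier_mat k l" "\<And>y. y \<in> carrier_vec l \<Longrightarrow> Y *\<^sub>v y = ?g y" by blast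
    have XY: "X * Y = 1\<^sub>m l"
    proof (rule mat_eq_by_vec)
      fix y :: "'a vec" assume y: "y \<in> carrier_vec l"
      have "?f (?g y) = y" using y i by (intro eq_vecI) (auto simp: up)
      then show "X * Y *\<^sub>v y = 1\<^sub>m l *\<^sub>v y" using X Y y by simp
    qed (use X Y in auto)
    have "P l"
      unfolding P_def
    proof (rule exI[of _ "X * Q"], rule exI[of _ "S * Y"], intro conjI ballI)
      have "Q * (S * Y) = Y" using assoc_mult_mat[OF Q S Y(1)] QS Y(1) by simp
      then show "X * Q * (S * Y) = 1\<^sub>m l" using assoc_mult_mat[OF X(1) Q, of "S * Y" l] S Y(1) XY by simp
      fix x :: "'a vec" assume x: "x \<in> carrier_vec n"
      let ?y = "Q *\<^sub>v x"
      have y: "?y \<in> carrier_vec k" using Q x by simp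
      have "Y *\<^sub>v (X *\<^sub>v ?y) = ?g (?f ?y)" unfolding X(2)[OF y] by (rule Y(2)) simp
      also have "\<dots> = ?y - (?y $ i / w $ i) \<cdot>\<^sub>v w"
        using y w i by (intro eq_vecI) (auto simp: dn)
      finally have "S *\<^sub>v (Y *\<^sub>v (X *\<^sub>v ?y)) = S *\<^sub>v ?y - (?y $ i / w $ i) \<cdot>\<^sub>v (S *\<^sub>v w)"
        using S y w by (simp add: mult_minus_distrib_mat_vec mult_mat_vec)
      \<comment> \<open>The error of the new pair differs from that of the old one by a multiple of
        \<open>S *\<^sub>v w\<close>, which lies in \<open>U\<close> as well.\<close>
      then have eq: "x - S * Y *\<^sub>v (X * Q *\<^sub>v x) = (x - S *\<^sub>v ?y) + (?y $ i / w $ i) \<cdot>\<^sub>v (S *\<^sub>v w)"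
        using X Y Q S x w by (intro eq_vecI) auto
      have "S *\<^sub>v w = u - (u - S *\<^sub>v (Q *\<^sub>v u))"
        using S uc w by (intro eq_vecI) (auto simp: w_def)
      then have "S *\<^sub>v w \<in> U" using diff[OF u QU[OF uc]] by simp
      then show "x - S * Y *\<^sub>v (X * Q *\<^sub>v x) \<in> U"
        unfolding eq using QU[OF x] add smult by simp
    qed (use X Y Q S in auto)
    then show False using least[of l] l by simp
  qed
  \<comment> \<open>A square \<open>Q\<close> would be invertible and could not kill a nonzero
    \<open>u\<close>.\<close>
  have "k < n" if u: "u \<in> U" "u \<noteq> 0\<^sub>v n" for u
  proof (rule ccontr)
    assume "\<not> k < n"
    then have kn: "k = n" using k(2) by simp
    have uc: "u \<in> carrier_vec n" using u U by auto
    have "S * Q = 1\<^sub>m n"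
      using mat_mult_left_right_inverse[of Q n S] Q S QS kn by simp
    then have "u = S *\<^sub>v (Q *\<^sub>v u)"
      using Q S uc by (simp flip: assoc_mult_mat_vec[of S n k Q n])
    also have "\<dots> = 0\<^sub>v n" using Q0[OF u(1)] S by (intro eq_vecI) (auto simp: scalar_prod_def)
    finally show False using u(2) by simp
  qed
  with Q S QS QU Q0 show ?thesis by blast
qed

lemma smult_mat_mult_vec:
  "X \<in> carrier_mat n m \<Longrightarrow> v \<in> carrier_vec m \<Longrightarrow> (a \<cdot>\<^sub>m X) *\<^sub>v v = a \<cdot>\<^sub>v (X *\<^sub>v (v :: 'a::field vec))"
  by (intro eq_vecI) (auto simp: scalar_prod_def sum_distrib_left mult.assoc)

lemma zero_mat_mult_vec [simp]:
  "v \<in> carrier_vec m \<Longrightarrow> 0\<^sub>m n m *\<^sub>v v = 0\<^sub>v n"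
  "X \<in> carrier_mat n m \<Longrightarrow> X *\<^sub>v 0\<^sub>v m = 0\<^sub>v n"
  by (intro eq_vecI; auto simp: scalar_prod_def)+

text \<open>A linear contravariant functor to finite-dimensional vector spaces in elementary terms.
  By \<open>cokernel\<close>, an element killed by \<open>t\<close> descends along a cokernel of
  \<open>t\<close>; by \<open>finite_dim\<close>, there are coordinates \<open>\<phi> e i\<close>
  for \<open>i < m\<close> that vanish together at zero only.\<close>

locale presheaf =
  fixes C :: "('k::field, 'o, 'm, 'z) lin_cat_scheme"
    and E :: "'o \<Rightarrow> 'e set" and R :: "'m \<Rightarrow> 'e \<Rightarrow> 'e"
    and add :: "'e \<Rightarrow> 'e \<Rightarrow> 'e" and scale :: "'k \<Rightarrow> 'e \<Rightarrow> 'e" and zero :: "'o \<Rightarrow> 'e"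
  assumes R_in: "\<lbrakk>u \<in> Hom C x y; e \<in> E y\<rbrakk> \<Longrightarrow> R u e \<in> E x"
    and R_Idn: "\<lbrakk>x \<in> Obj C; e \<in> E x\<rbrakk> \<Longrightarrow> R (Idn C x) e = e"
    and R_Comp: "\<lbrakk>u \<in> Hom C x y; v \<in> Hom C y w; e \<in> E w\<rbrakk> \<Longrightarrow> R (v \<cdot>\<^bsub>C\<^esub> u) e = R u (R v e)"
    and R_Add: "\<lbrakk>u \<in> Hom C x y; v \<in> Hom C x y; e \<in> E y\<rbrakk> \<Longrightarrow> R (Add C u v) e = add (R u e) (R v e)"
    and R_Scale: "\<lbrakk>u \<in> Hom C x y; e \<in> E y\<rbrakk> \<Longrightarrow> R (Scale C a u) e = scale a (R u e)"
    and R_Zero: "\<lbrakk>x \<in> Obj C; y \<in> Obj C; e \<in> E y\<rbrakk> \<Longrightarrow> R (Zero C x y) e = zero x"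
    and R_add: "\<lbrakk>u \<in> Hom C x y; e \<in> E y; e' \<in> E y\<rbrakk> \<Longrightarrow> R u (add e e') = add (R u e) (R u e')"
    and zero_in: "x \<in> Obj C \<Longrightarrow> zero x \<in> E x"
    and add_in: "\<lbrakk>x \<in> Obj C; e \<in> E x; e' \<in> E x\<rbrakk> \<Longrightarrow> add e e' \<in> E x"
    and add_zero: "\<lbrakk>x \<in> Obj C; e \<in> E x\<rbrakk> \<Longrightarrow> add (zero x) e = e" "\<lbrakk>x \<in> Obj C; e \<in> E x\<rbrakk> \<Longrightarrow> add e (zero x) = e"
    and cokernel: "\<lbrakk>is_cokernel C t p; e \<in> E (Dom C p); R t e = zero (Dom C t)\<rbrakk> \<Longrightarrow> \<exists>e' \<in> E (Cod C p). R p e' = e"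
    and finite_dim: "x \<in> Obj C \<Longrightarrow> \<exists>m (\<phi> :: 'e \<Rightarrow> nat \<Rightarrow> 'k). (\<forall>e \<in> E x. \<forall>e' \<in> E x. \<forall>i. \<phi> (add e e') i = \<phi> e i + \<phi> e' i) \<and>
       (\<forall>a. \<forall>e \<in> E x. \<forall>i. \<phi> (scale a e) i = a * \<phi> e i) \<and> (\<forall>e \<in> E x. (\<forall>i<m. \<phi> e i = 0) \<longrightarrow> e = zero x)"

definition represents :: "('o, 'm, 'z) cat_scheme \<Rightarrow> ('o \<Rightarrow> 'e set) \<Rightarrow> ('m \<Rightarrow> 'e \<Rightarrow> 'e) \<Rightarrow> 'o \<Rightarrow> 'e \<Rightarrow> bool" where
  "represents C E R g \<epsilon> \<longleftrightarrow> g \<in> Obj C \<and> \<epsilon> \<in> E g \<and>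
     (\<forall>a \<in> Obj C. \<forall>\<xi> \<in> E a. \<exists>!u. u \<in> Hom C a g \<and> R u \<epsilon> = \<xi>)"

section \<open>Modules over a finite-dimensional algebra\<close>

locale fd_alg =
  fixes d and A :: "'k::field vec ring"
  assumes alg: "fd_algebra d A"
begin

abbreviation "D \<equiv> fd_module_cat A"

lemma A_ring: "ring A" and A_carrier [simp]: "carrier A = carrier_vec d"
  and A_add: "\<lbrakk>x \<in> carrier_vec d; y \<in> carrier_vec d\<rbrakk> \<Longrightarrow> x \<oplus>\<^bsub>A\<^esub> y = x + y"
  and A_smult: "\<lbrakk>x \<in> carrier_vec d; y \<in> carrier_vec d\<rbrakk> \<Longrightarrow> (a \<cdot>\<^sub>v x) \<otimes>\<^bsub>A\<^esub> y = a \<cdot>\<^sub>v (x \<otimes>\<^bsub>A\<^esub> y)"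
    "\<lbrakk>x \<in> carrier_vec d; y \<in> carrier_vec d\<rbrakk> \<Longrightarrow> x \<otimes>\<^bsub>A\<^esub> (a \<cdot>\<^sub>v y) = a \<cdot>\<^sub>v (x \<otimes>\<^bsub>A\<^esub> y)"
  using alg by (auto simp: fd_algebra_def)

lemma A_mult [simp]: "\<lbrakk>x \<in> carrier_vec d; y \<in> carrier_vec d\<rbrakk> \<Longrightarrow> x \<otimes>\<^bsub>A\<^esub> y \<in> carrier_vec d"
  and A_one [simp]: "\<one>\<^bsub>A\<^esub> \<in> carrier_vec d"
  using A_ring ring.ring_simprules(5)[of A x y] ring.ring_simprules(6)[of A] by simp_all

lemma D_simps [simp]:
  "Obj D = {V. fd_module A V}"
  "(V, X, W) \<in> Arr D \<longleftrightarrow> fd_module A V \<and> fd_module A W \<and> X \<in> carrier_mat (fst W) (fst V) \<and>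
     (\<forall>x \<in> carrier_vec d. X * snd V x = snd W x * X)"
  "Dom D (V, X, W) = V" "Cod D (V, X, W) = W" "Idn D V = (V, 1\<^sub>m (fst V), V)"
  "(V', Y, W) \<cdot>\<^bsub>D\<^esub> (V, X, W') = (V, Y * X, W)" "Zero D V W = (V, 0\<^sub>m (fst W) (fst V), W)"
  "Add D (V, X, W) (V', Y, W') = (V, X + Y, W)" "Scale D a (V, X, W) = (V, a \<cdot>\<^sub>m X, W)"
  by (simp_all add: fd_module_cat_def)

lemma Hom_D: "t \<in> Hom D V W \<longleftrightarrow> (\<exists>X. t = (V, X, W) \<and> (V, X, W) \<in> Arr D)"
  by (cases t) (auto simp: Hom_def)

lemma moduleD:
  assumes "fd_module A V"
  shows "x \<in> carrier_vec d \<Longrightarrow> snd V x \<in> carrier_mat (fst V) (fst V)"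
    "\<lbrakk>x \<in> carrier_vec d; y \<in> carrier_vec d\<rbrakk> \<Longrightarrow> snd V (x + y) = snd V x + snd V y"
    "x \<in> carrier_vec d \<Longrightarrow> snd V (a \<cdot>\<^sub>v x) = a \<cdot>\<^sub>m snd V x"
    "\<lbrakk>x \<in> carrier_vec d; y \<in> carrier_vec d\<rbrakk> \<Longrightarrow> snd V (x \<otimes>\<^bsub>A\<^esub> y) = snd V x * snd V y"
    "snd V \<one>\<^bsub>A\<^esub> = 1\<^sub>m (fst V)"
  using assms A_add by (auto simp: fd_module_def)

text \<open>The matrix of the orbit map, which sends an element of the algebra to its action on
  \<open>v\<close>.\<close>

definition pmat :: "'k fdmod \<Rightarrow> 'k vec \<Rightarrow> 'k mat" where
  "pmat V v = (SOME X. X \<in> carrier_mat (fst V) d \<and> (\<forall>x \<in> carrier_vec d. X *\<^sub>v x = snd V x *\<^sub>v v))"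

lemma pmat:
  assumes V: "fd_module A V" and v: "v \<in> carrier_vec (fst V)"
  shows "pmat V v \<in> carrier_mat (fst V) d" "x \<in> carrier_vec d \<Longrightarrow> pmat V v *\<^sub>v x = snd V x *\<^sub>v v"
proof -
  have "\<exists>X \<in> carrier_mat (fst V) d. \<forall>x \<in> carrier_vec d. X *\<^sub>v x = snd V x *\<^sub>v v"
  proof (rule linear_map_mat)
    fix x y :: "'k vec" and a assume x: "x \<in> carrier_vec d" and y: "y \<in> carrier_vec d"
    note [simp] = moduleD[OF V]
    show "snd V x *\<^sub>v v \<in> carrier_vec (fst V)" using v x moduleD(1)[OF V x] by (intro mult_mat_vec_carrier)
    show "snd V (x + y) *\<^sub>v v = snd V x *\<^sub>v v + snd V y *\<^sub>v v"
      using v x y by (simp add: add_mult_distrib_mat_vec[of _ "fst V" "fst V"])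
    show "snd V (a \<cdot>\<^sub>v x) *\<^sub>v v = a \<cdot>\<^sub>v (snd V x *\<^sub>v v)"
      using v x by (simp add: smult_mat_mult_vec[of _ "fst V" "fst V"])
  qed
  then have "\<exists>X. X \<in> carrier_mat (fst V) d \<and> (\<forall>x \<in> carrier_vec d. X *\<^sub>v x = snd V x *\<^sub>v v)" by blast
  then have "pmat V v \<in> carrier_mat (fst V) d \<and> (\<forall>x \<in> carrier_vec d. pmat V v *\<^sub>v x = snd V x *\<^sub>v v)"
    unfolding pmat_def by (rule someI_ex)
  then show "pmat V v \<in> carrier_mat (fst V) d" "x \<in> carrier_vec d \<Longrightarrow> pmat V v *\<^sub>v x = snd V x *\<^sub>v v" by blast+
qed

definition lmat :: "'k vec \<Rightarrow> 'k mat" where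
  "lmat a = (SOME X. X \<in> carrier_mat d d \<and> (\<forall>x \<in> carrier_vec d. X *\<^sub>v x = a \<otimes>\<^bsub>A\<^esub> x))"

lemma lmat:
  assumes a: "a \<in> carrier_vec d"
  shows "lmat a \<in> carrier_mat d d" "x \<in> carrier_vec d \<Longrightarrow> lmat a *\<^sub>v x = a \<otimes>\<^bsub>A\<^esub> x"
proof -
  have "\<exists>X \<in> carrier_mat d d. \<forall>x \<in> carrier_vec d. X *\<^sub>v x = a \<otimes>\<^bsub>A\<^esub> x"
  proof (rule linear_map_mat)
    fix x y :: "'k vec" assume "x \<in> carrier_vec d" "y \<in> carrier_vec d"
    then show "a \<otimes>\<^bsub>A\<^esub> (x + y) = a \<otimes>\<^bsub>A\<^esub> x + a \<otimes>\<^bsub>A\<^esub> y"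
      using a ring.ring_simprules(23)[OF A_ring, of x y a] by (simp add: A_add)
  qed (use a in \<open>simp_all add: A_smult\<close>)
  then have "\<exists>X. X \<in> carrier_mat d d \<and> (\<forall>x \<in> carrier_vec d. X *\<^sub>v x = a \<otimes>\<^bsub>A\<^esub> x)" by blast
  then have "lmat a \<in> carrier_mat d d \<and> (\<forall>x \<in> carrier_vec d. lmat a *\<^sub>v x = a \<otimes>\<^bsub>A\<^esub> x)"
    unfolding lmat_def by (rule someI_ex)
  then show "lmat a \<in> carrier_mat d d" "x \<in> carrier_vec d \<Longrightarrow> lmat a *\<^sub>v x = a \<otimes>\<^bsub>A\<^esub> x" by blast+
qed

text \<open>The regular module: \<open>lmat a\<close> is left multiplication by
  \<open>a\<close>.\<close>

definition P :: "'k fdmod" where "P = (d, lmat)"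

lemma P_module: "fd_module A P"
proof -
  have add: "lmat (x + y) = lmat x + lmat y" if "x \<in> carrier_vec d" "y \<in> carrier_vec d" for x y
  proof (rule mat_eq_by_vec[of _ d d])
    fix v :: "'k vec" assume v: "v \<in> carrier_vec d"
    show "lmat (x + y) *\<^sub>v v = (lmat x + lmat y) *\<^sub>v v"
      using that v lmat ring.ring_simprules(13)[OF A_ring, of x y v]
      by (simp add: add_mult_distrib_mat_vec[of _ d d] A_add)
  qed (use that lmat in auto)
  have smult: "lmat (a \<cdot>\<^sub>v x) = a \<cdot>\<^sub>m lmat x" if "x \<in> carrier_vec d" for a x
  proof (rule mat_eq_by_vec[of _ d d])
    fix v :: "'k vec" assume v: "v \<in> carrier_vec d"
    have "(a \<cdot>\<^sub>m lmat x) *\<^sub>v v = a \<cdot>\<^sub>v (lmat x *\<^sub>v v)"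
      using that v lmat(1)[OF that] by (simp add: smult_mat_mult_vec[of _ d d])
    then show "lmat (a \<cdot>\<^sub>v x) *\<^sub>v v = (a \<cdot>\<^sub>m lmat x) *\<^sub>v v"
      using that v lmat by (simp add: A_smult)
  qed (use that lmat in auto)
  have mult: "lmat (x \<otimes>\<^bsub>A\<^esub> y) = lmat x * lmat y" if "x \<in> carrier_vec d" "y \<in> carrier_vec d" for x y
  proof (rule mat_eq_by_vec[of _ d d])
    fix v :: "'k vec" assume v: "v \<in> carrier_vec d"
    have "(lmat x * lmat y) *\<^sub>v v = lmat x *\<^sub>v (lmat y *\<^sub>v v)"
      using that v lmat by (intro assoc_mult_mat_vec[of _ d d _ d]) auto
    then show "lmat (x \<otimes>\<^bsub>A\<^esub> y) *\<^sub>v v = (lmat x * lmat y) *\<^sub>v v"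
      using that v lmat ring.ring_simprules(11)[OF A_ring, of x y v] by simp
  qed (use that lmat in \<open>auto intro!: mult_carrier_mat[of _ d d]\<close>)
  have one: "lmat \<one>\<^bsub>A\<^esub> = 1\<^sub>m d"
    by (rule mat_eq_by_vec[of _ d d]) (use lmat ring.ring_simprules(12)[OF A_ring] in auto)
  show ?thesis
    using add smult mult one lmat by (simp add: fd_module_def P_def A_add)
qed

lemma fst_P [simp]: "fst P = d" by (simp add: P_def)

text \<open>The arrow out of the regular module that sends the unit of the algebra to
  \<open>v\<close>; all arrows out of the regular module are of this form.\<close>

definition pt :: "'k fdmod \<Rightarrow> 'k vec \<Rightarrow> 'k fdmod \<times> 'k mat \<times> 'k fdmod" where
  "pt V v = (P, pmat V v, V)"

lemma pt_Arr:
  assumes V: "fd_module A V" and v: "v \<in> carrier_vec (fst V)"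
  shows "pt V v \<in> Hom D P V"
proof -
  have "pmat V v * snd P a = snd V a * pmat V v" if a: "a \<in> carrier_vec d" for a
  proof (rule mat_eq_by_vec[of _ "fst V" d])
    fix x :: "'k vec" assume x: "x \<in> carrier_vec d"
    have "pmat V v * lmat a *\<^sub>v x = pmat V v *\<^sub>v (lmat a *\<^sub>v x)"
      using pmat[OF V v] lmat a x by (intro assoc_mult_mat_vec[of _ "fst V" d _ d]) auto
    also have "\<dots> = snd V (a \<otimes>\<^bsub>A\<^esub> x) *\<^sub>v v"
      using pmat[OF V v] lmat a x by simp
    also have "\<dots> = snd V a *\<^sub>v (snd V x *\<^sub>v v)"
      using moduleD[OF V] a x v by (simp add: assoc_mult_mat_vec[of _ "fst V" "fst V" _ "fst V"])
    also have "\<dots> = snd V a * pmat V v *\<^sub>v x"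
      using moduleD(1)[OF V a] pmat[OF V v] x by (simp add: assoc_mult_mat_vec[of _ "fst V" "fst V" _ d])
    finally show "pmat V v * snd P a *\<^sub>v x = snd V a * pmat V v *\<^sub>v x" by (simp add: P_def)
  qed (use a moduleD(1)[OF V a] pmat[OF V v] lmat in \<open>auto simp: P_def intro!: mult_carrier_mat[of _ "fst V" "fst V"] mult_carrier_mat[of _ "fst V" d]\<close>)
  then show ?thesis
    using V v pmat[OF V v] P_module by (simp add: Hom_def pt_def)
qed

lemma pmat_eqI:
  assumes "fd_module A V" "v \<in> carrier_vec (fst V)" "X \<in> carrier_mat (fst V) d"
    "\<And>x. x \<in> carrier_vec d \<Longrightarrow> X *\<^sub>v x = snd V x *\<^sub>v v"
  shows "pmat V v = X"
  by (rule mat_eq_by_vec[of _ "fst V" d]) (use assms pmat[OF assms(1,2)] in auto)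

text \<open>The Yoneda correspondence between vectors and arrows out of the regular module turns
  composition into application of the matrix.\<close>

lemma comp_pt:
  assumes X: "(V, X, W) \<in> Arr D" and v: "v \<in> carrier_vec (fst V)"
  shows "(V, X, W) \<cdot>\<^bsub>D\<^esub> pt V v = pt W (X *\<^sub>v v)"
proof -
  have V: "fd_module A V" and W: "fd_module A W" and X': "X \<in> carrier_mat (fst W) (fst V)"
    and eq: "\<And>x. x \<in> carrier_vec d \<Longrightarrow> X * snd V x = snd W x * X" using X by auto
  have "pmat W (X *\<^sub>v v) = X * pmat V v"
  proof (rule pmat_eqI[OF W])
    fix x :: "'k vec" assume x: "x \<in> carrier_vec d"
    have "X * pmat V v *\<^sub>v x = X *\<^sub>v (snd V x *\<^sub>v v)"
      using pmat[OF V v] X' x by (simp add: assoc_mult_mat_vec[of _ _ "fst V" _ d])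
    also have "\<dots> = X * snd V x *\<^sub>v v"
      using X' moduleD(1)[OF V x] v by (simp add: assoc_mult_mat_vec[of _ _ "fst V" _ "fst V"])
    also have "\<dots> = snd W x *\<^sub>v (X *\<^sub>v v)"
      unfolding eq[OF x] using X' moduleD(1)[OF W x] v by (simp add: assoc_mult_mat_vec[of _ "fst W" "fst W" _ "fst V"])
    finally show "X * pmat V v *\<^sub>v x = snd W x *\<^sub>v (X *\<^sub>v v)" .
  qed (use X' v pmat[OF V v] in auto)
  then show ?thesis by (simp add: pt_def)
qed

lemma pt_linear:
  assumes V: "fd_module A V" and v: "v \<in> carrier_vec (fst V)"
  shows "w \<in> carrier_vec (fst V) \<Longrightarrow> pt V (v + w) = Add D (pt V v) (pt V w)" "pt V (a \<cdot>\<^sub>v v) = Scale D a (pt V v)"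
    "pt V (0\<^sub>v (fst V)) = Zero D P V"
proof -
  note p = pmat[OF V]
  have "pmat V (v + w) = pmat V v + pmat V w" if w: "w \<in> carrier_vec (fst V)"
  proof (rule pmat_eqI[OF V])
    fix x :: "'k vec" assume x: "x \<in> carrier_vec d"
    then show "(pmat V v + pmat V w) *\<^sub>v x = snd V x *\<^sub>v (v + w)"
      using v w p moduleD(1)[OF V x]
      by (simp add: add_mult_distrib_mat_vec[of _ "fst V" d] mult_add_distrib_mat_vec[of _ "fst V" "fst V"])
  qed (use v w p in auto)
  then show "w \<in> carrier_vec (fst V) \<Longrightarrow> pt V (v + w) = Add D (pt V v) (pt V w)" by (simp add: pt_def)
  have "pmat V (a \<cdot>\<^sub>v v) = a \<cdot>\<^sub>m pmat V v"
  proof (rule pmat_eqI[OF V])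
    fix x :: "'k vec" assume x: "x \<in> carrier_vec d"
    have "(a \<cdot>\<^sub>m pmat V v) *\<^sub>v x = a \<cdot>\<^sub>v (pmat V v *\<^sub>v x)"
      using x p(1)[OF v] by (simp add: smult_mat_mult_vec[of _ "fst V" d])
    then show "(a \<cdot>\<^sub>m pmat V v) *\<^sub>v x = snd V x *\<^sub>v (a \<cdot>\<^sub>v v)"
      using v p(2)[OF v x] mult_mat_vec[OF moduleD(1)[OF V x] v] by simp
  qed (use v p in auto)
  then show "pt V (a \<cdot>\<^sub>v v) = Scale D a (pt V v)" by (simp add: pt_def)
  have "pmat V (0\<^sub>v (fst V)) = 0\<^sub>m (fst V) d"
  proof (rule pmat_eqI[OF V])
    fix x :: "'k vec" assume x: "x \<in> carrier_vec d"
    show "0\<^sub>m (fst V) d *\<^sub>v x = snd V x *\<^sub>v 0\<^sub>v (fst V)"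
      using x moduleD(1)[OF V x] by simp
  qed auto
  then show "pt V (0\<^sub>v (fst V)) = Zero D P V" by (simp add: pt_def)
qed

text \<open>The image of \<open>pt V v\<close> is the submodule generated by \<open>v\<close>, and a
  linear complement of it carries the quotient module. The dimension drops because \<open>v\<close>
  lies in the submodule. Surjectivity of \<open>Q\<close> serves to lift arrows out of the regular
  module.\<close>

lemma cokernel_pt:
  assumes V: "fd_module A V" and v: "v \<in> carrier_vec (fst V)" "v \<noteq> 0\<^sub>v (fst V)"
  obtains W Q where "is_cokernel D (pt V v) (V, Q, W)" "fst W < fst V"
    "\<And>w. w \<in> carrier_vec (fst W) \<Longrightarrow> \<exists>u \<in> carrier_vec (fst V). Q *\<^sub>v u = w"
proof -
  let ?n = "fst V" and ?\<rho> = "snd V"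
  define U where "U = (\<lambda>x. ?\<rho> x *\<^sub>v v) ` carrier_vec d"
  note m = moduleD[OF V]
  have act: "?\<rho> a *\<^sub>v u \<in> U" if "a \<in> carrier_vec d" "u \<in> U" for a u
  proof -
    obtain x where x: "x \<in> carrier_vec d" "u = ?\<rho> x *\<^sub>v v" using \<open>u \<in> U\<close> by (auto simp: U_def)
    have "?\<rho> a *\<^sub>v u = ?\<rho> (a \<otimes>\<^bsub>A\<^esub> x) *\<^sub>v v"
      using x that m v by (simp add: assoc_mult_mat_vec[of _ ?n ?n _ ?n])
    then show ?thesis using x that by (auto simp: U_def)
  qed
  have Ucar: "U \<subseteq> carrier_vec ?n" using m(1) v by (auto simp: U_def intro!: mult_mat_vec_carrier)
  have smultU: "a \<cdot>\<^sub>v u \<in> U" if "u \<in> U" for a u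
  proof -
    obtain x where x: "x \<in> carrier_vec d" "u = ?\<rho> x *\<^sub>v v" using \<open>u \<in> U\<close> by (auto simp: U_def)
    have "a \<cdot>\<^sub>v u = ?\<rho> (a \<cdot>\<^sub>v x) *\<^sub>v v"
      using x m v by (simp add: smult_mat_mult_vec[of _ "fst V" "fst V"])
    then show ?thesis using x by (auto simp: U_def)
  qed
  have addU: "x + y \<in> U" if "x \<in> U" "y \<in> U" for x y
  proof -
    from \<open>x \<in> U\<close> obtain a where a: "a \<in> carrier_vec d" "x = ?\<rho> a *\<^sub>v v" unfolding U_def by blast
    from \<open>y \<in> U\<close> obtain b where b: "b \<in> carrier_vec d" "y = ?\<rho> b *\<^sub>v v" unfolding U_def by blast
    note ab = a b
    have "x + y = ?\<rho> (a + b) *\<^sub>v v"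
      using ab m v by (simp add: add_mult_distrib_mat_vec[of _ ?n ?n])
    then show ?thesis using ab by (auto simp: U_def)
  qed
  have vU: "v \<in> U" using m(5) v by (auto simp: U_def intro!: image_eqI[of _ _ "\<one>\<^bsub>A\<^esub>"])
  have "0\<^sub>v ?n = 0 \<cdot>\<^sub>v v" using v by auto
  then have zeroU: "0\<^sub>v ?n \<in> U" using smultU[OF vU, of 0] by simp
  obtain k Q S where Q: "Q \<in> carrier_mat k ?n" and S: "S \<in> carrier_mat ?n k" and QS: "Q * S = 1\<^sub>m k"
    and QU: "\<And>x. x \<in> carrier_vec ?n \<Longrightarrow> x - S *\<^sub>v (Q *\<^sub>v x) \<in> U" and Q0: "\<And>u. u \<in> U \<Longrightarrow> Q *\<^sub>v u = 0\<^sub>v k"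
    and kn: "\<And>u. \<lbrakk>u \<in> U; u \<noteq> 0\<^sub>v ?n\<rbrakk> \<Longrightarrow> k < ?n"
    using complement_exists[OF Ucar addU smultU zeroU] by blast
  \<comment> \<open>A matrix that kills \<open>U\<close> factors through the projection
    \<open>Q\<close>, by way of the section \<open>S\<close>.\<close>
  have factor: "h * S * Q = h"
    if h: "h \<in> carrier_mat l ?n" and h0: "\<And>u. u \<in> U \<Longrightarrow> h *\<^sub>v u = 0\<^sub>v l" for h :: "'k mat" and l
  proof (rule mat_eq_by_vec[of _ l ?n])
    fix x :: "'k vec" assume x: "x \<in> carrier_vec ?n"
    have "h *\<^sub>v (x - S *\<^sub>v (Q *\<^sub>v x)) = 0\<^sub>v l" using h0[OF QU[OF x]] .
    then have "h *\<^sub>v x - h *\<^sub>v (S *\<^sub>v (Q *\<^sub>v x)) = 0\<^sub>v l"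
      using h S Q x by (simp add: mult_minus_distrib_mat_vec[of h l ?n])
    then have "h *\<^sub>v x = h *\<^sub>v (S *\<^sub>v (Q *\<^sub>v x))"
    proof -
      assume 0: "h *\<^sub>v x - h *\<^sub>v (S *\<^sub>v (Q *\<^sub>v x)) = 0\<^sub>v l"
      show ?thesis
      proof (rule eq_vecI)
        fix i assume "i < dim_vec (h *\<^sub>v (S *\<^sub>v (Q *\<^sub>v x)))"
        then have i: "i < l" using h by simp
        have "(h *\<^sub>v x - h *\<^sub>v (S *\<^sub>v (Q *\<^sub>v x))) $ i = 0" using 0 i by simp
        then show "(h *\<^sub>v x) $ i = (h *\<^sub>v (S *\<^sub>v (Q *\<^sub>v x))) $ i" using h i by simp
      qed (use h in simp)
    qed
    moreover have "h * S * Q *\<^sub>v x = h * S *\<^sub>v (Q *\<^sub>v x)"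
      by (rule assoc_mult_mat_vec[of _ l k _ ?n]) (use h S Q x in auto)
    moreover have "\<dots> = h *\<^sub>v (S *\<^sub>v (Q *\<^sub>v x))"
      by (rule assoc_mult_mat_vec[of _ l ?n _ k]) (use h S Q x in auto)
    ultimately show "h * S * Q *\<^sub>v x = h *\<^sub>v x" by simp
  qed (use h S Q in \<open>auto intro!: mult_carrier_mat[of _ l k] mult_carrier_mat[of _ l ?n]\<close>)
  \<comment> \<open>Lift by \<open>S\<close>, act, and project. The projection respects the actions
    because \<open>U\<close> is stable under the algebra (\<open>Qmod\<close>).\<close>
  define W where "W = (k, \<lambda>a. Q * ?\<rho> a * S)"
  have Qmod: "Q * ?\<rho> a = (Q * ?\<rho> a * S) * Q" if a: "a \<in> carrier_vec d" for a
  proof (rule factor[symmetric])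
    show "Q * ?\<rho> a \<in> carrier_mat k ?n" using Q m(1)[OF a] by simp
    show "Q * ?\<rho> a *\<^sub>v u = 0\<^sub>v k" if "u \<in> U" for u
      using that Ucar Q m(1)[OF a] Q0[OF act[OF a that]] by (subst assoc_mult_mat_vec[of _ k ?n _ ?n]) auto
  qed
  have carW: "Q * ?\<rho> a * S \<in> carrier_mat k k" if "a \<in> carrier_vec d" for a
    using Q S m(1)[OF that] by simp
  have W: "fd_module A W"
    unfolding fd_module_def W_def fst_conv snd_conv A_carrier
  proof (intro conjI ballI allI)
    fix a b :: "'k vec" and s assume a: "a \<in> carrier_vec d" and b: "b \<in> carrier_vec d"
    note ma = m(1)[OF a] and mb = m(1)[OF b]
    show "Q * ?\<rho> (a \<oplus>\<^bsub>A\<^esub> b) * S = Q * ?\<rho> a * S + Q * ?\<rho> b * S"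
      using a b Q S ma mb
      by (simp add: A_add m mult_add_distrib_mat[of Q k ?n _ ?n] add_mult_distrib_mat[of _ k ?n _ S k])
    show "Q * ?\<rho> (s \<cdot>\<^sub>v a) * S = s \<cdot>\<^sub>m (Q * ?\<rho> a * S)"
      using a Q S ma by (simp add: m mult_smult_distrib[of Q k ?n _ ?n] mult_smult_assoc_mat[of _ k ?n S k])
    have "Q * ?\<rho> (a \<otimes>\<^bsub>A\<^esub> b) * S = (Q * ?\<rho> a) * ?\<rho> b * S"
      using a b Q ma mb by (simp add: m assoc_mult_mat[of Q k ?n _ ?n _ ?n])
    also have "\<dots> = ((Q * ?\<rho> a * S) * Q) * ?\<rho> b * S" using Qmod[OF a] by simp
    also have "\<dots> = (Q * ?\<rho> a * S) * (Q * ?\<rho> b) * S"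
      using carW[OF a] Q mb by (subst assoc_mult_mat[of _ k k Q ?n "?\<rho> b" ?n]) auto
    also have "\<dots> = (Q * ?\<rho> a * S) * (Q * ?\<rho> b * S)"
      using carW[OF a] Q mb S by (intro assoc_mult_mat[of _ k k _ ?n _ k]) auto
    finally show "Q * ?\<rho> (a \<otimes>\<^bsub>A\<^esub> b) * S = (Q * ?\<rho> a * S) * (Q * ?\<rho> b * S)" .
  qed (use carW Q QS m(5) in auto)
  have QArr: "(V, Q, W) \<in> Arr D"
    using V W Q Qmod by (simp add: W_def)
  have "is_cokernel D (pt V v) (V, Q, W)"
    unfolding is_cokernel_def
  proof (intro conjI ballI impI)
    have ptA: "pt V v \<in> Hom D P V" by (rule pt_Arr[OF V v(1)])
    then show "pt V v \<in> Arr D" by (simp add: Hom_def)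
    show "(V, Q, W) \<in> Arr D" by (rule QArr)
    show "Dom D (V, Q, W) = Cod D (pt V v)" by (simp add: pt_def)
    have "pt W (Q *\<^sub>v v) = Zero D P W" using Q0[OF vU] pt_linear(3)[OF W, of "0\<^sub>v k"] by (simp add: W_def)
    then show "(V, Q, W) \<cdot>\<^bsub>D\<^esub> pt V v = Zero D (Dom D (pt V v)) (Cod D (V, Q, W))"
      unfolding comp_pt[OF QArr v(1)] by (simp add: pt_def)
    fix h assume h: "h \<in> Arr D" "Dom D h = Cod D (pt V v) \<and> h \<cdot>\<^bsub>D\<^esub> pt V v = Zero D (Dom D (pt V v)) (Cod D h)"
    obtain Y Z where hY: "h = (V, Y, Z)" using h by (cases h) (auto simp: pt_def)
    then have YA: "(V, Y, Z) \<in> Arr D" using h by simp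
    then have Z: "fd_module A Z" and Y: "Y \<in> carrier_mat (fst Z) ?n"
      and Ym: "\<And>x. x \<in> carrier_vec d \<Longrightarrow> Y * ?\<rho> x = snd Z x * Y" by auto
    have "pmat Z (Y *\<^sub>v v) = 0\<^sub>m (fst Z) d"
      using h comp_pt[OF YA v(1)] by (simp add: hY pt_def)
    then have Y0: "Y *\<^sub>v v = 0\<^sub>v (fst Z)"
      using pmat(2)[OF Z, of "Y *\<^sub>v v" "\<one>\<^bsub>A\<^esub>"] Y v moduleD(5)[OF Z] by (auto simp: scalar_prod_def)
    have "Y *\<^sub>v u = 0\<^sub>v (fst Z)" if "u \<in> U" for u
    proof -
      obtain x where x: "x \<in> carrier_vec d" "u = ?\<rho> x *\<^sub>v v" using \<open>u \<in> U\<close> by (auto simp: U_def)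
      have "Y *\<^sub>v u = Y * ?\<rho> x *\<^sub>v v" using Y m(1)[OF x(1)] v x(2) by (simp add: assoc_mult_mat_vec[of Y _ ?n _ ?n])
      also have "\<dots> = snd Z x *\<^sub>v (Y *\<^sub>v v)"
        unfolding Ym[OF x(1)] using Y moduleD(1)[OF Z x(1)] v by (intro assoc_mult_mat_vec[of _ "fst Z" "fst Z" _ ?n]) auto
      also have "\<dots> = 0\<^sub>v (fst Z)"
        unfolding Y0 using moduleD(1)[OF Z x(1)] by simp
      finally show ?thesis .
    qed
    note YSQ = factor[OF Y this]
    have YS: "Y * S \<in> carrier_mat (fst Z) k" using Y S by simp
    have YSm: "Y * S * (Q * ?\<rho> x * S) = snd Z x * (Y * S)" if x: "x \<in> carrier_vec d" for x
    proof -
      have "Y * S * (Q * ?\<rho> x * S) = Y * S * (Q * (?\<rho> x * S))"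
        using Q S m(1)[OF x] by (simp add: assoc_mult_mat[of Q k ?n _ ?n S k])
      also have "\<dots> = Y * S * Q * (?\<rho> x * S)"
        using YS Q S m(1)[OF x] by (intro assoc_mult_mat[of _ "fst Z" k _ ?n _ k, symmetric]) auto
      also have "\<dots> = Y * (?\<rho> x * S)"
        by (simp only: YSQ)
      also have "\<dots> = Y * ?\<rho> x * S"
        using Y S m(1)[OF x] by (intro assoc_mult_mat[of _ "fst Z" ?n _ ?n _ k, symmetric]) auto
      also have "\<dots> = snd Z x * (Y * S)"
        unfolding Ym[OF x] using Y S moduleD(1)[OF Z x] by (intro assoc_mult_mat[of _ "fst Z" "fst Z" _ ?n _ k]) auto
      finally show ?thesis .
    qed
    show "\<exists>!u. u \<in> Hom D (Cod D (V, Q, W)) (Cod D h) \<and> u \<cdot>\<^bsub>D\<^esub> (V, Q, W) = h"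
    proof (rule ex1I)
      show "(W, Y * S, Z) \<in> Hom D (Cod D (V, Q, W)) (Cod D h) \<and> (W, Y * S, Z) \<cdot>\<^bsub>D\<^esub> (V, Q, W) = h"
        using W Z YS YSm YSQ by (simp add: hY Hom_def) (simp add: W_def)
    next
      fix u assume u: "u \<in> Hom D (Cod D (V, Q, W)) (Cod D h) \<and> u \<cdot>\<^bsub>D\<^esub> (V, Q, W) = h"
      then obtain B where B: "u = (W, B, Z)" "B \<in> carrier_mat (fst Z) k" "B * Q = Y"
        by (auto simp: Hom_D hY W_def)
      have "Y * S = B * (Q * S)" unfolding B(3)[symmetric] using B(2) Q S by (intro assoc_mult_mat[of _ "fst Z" k _ ?n _ k]) auto
      then show "u = (W, Y * S, Z)" using B QS by simp
    qed
  qed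
  moreover have "fst W < fst V" using kn[OF vU v(2)] by (simp add: W_def)
  moreover have "\<exists>u \<in> carrier_vec (fst V). Q *\<^sub>v u = w" if "w \<in> carrier_vec (fst W)" for w
  proof (rule bexI[of _ "S *\<^sub>v w"])
    have "Q *\<^sub>v (S *\<^sub>v w) = Q * S *\<^sub>v w"
      using Q S that by (intro assoc_mult_mat_vec[of _ k ?n _ k, symmetric]) (auto simp: W_def)
    then show "Q *\<^sub>v (S *\<^sub>v w) = w" using QS that by (simp add: W_def)
  qed (use S that in \<open>auto simp: W_def\<close>)
  ultimately show ?thesis using that by blast
qed

text \<open>Inclusions and projections are written as block matrices with empty blocks, so that the
  multiplication rule for four blocks covers them too.\<close>

lemma biproduct_exists:
  assumes V: "fd_module A V" and W: "fd_module A W"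
  obtains S i1 i2 p1 p2 where "fd_module A S" "i1 \<in> Hom D V S" "i2 \<in> Hom D W S" "p1 \<in> Hom D S V" "p2 \<in> Hom D S W"
    "p1 \<cdot>\<^bsub>D\<^esub> i1 = Idn D V" "p2 \<cdot>\<^bsub>D\<^esub> i2 = Idn D W" "p1 \<cdot>\<^bsub>D\<^esub> i2 = Zero D W V" "p2 \<cdot>\<^bsub>D\<^esub> i1 = Zero D V W"
proof -
  let ?n = "fst V" and ?m = "fst W"
  note mV = moduleD[OF V] and mW = moduleD[OF W]
  let ?r = "\<lambda>a. four_block_mat (snd V a) (0\<^sub>m ?n ?m) (0\<^sub>m ?m ?n) (snd W a)"
  define S where "S = (?n + ?m, ?r)"
  let ?i1 = "four_block_mat (1\<^sub>m ?n) (0\<^sub>m ?n 0) (0\<^sub>m ?m ?n) (0\<^sub>m ?m 0) :: 'k mat"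
  let ?i2 = "four_block_mat (0\<^sub>m ?n ?m) (0\<^sub>m ?n 0) (1\<^sub>m ?m) (0\<^sub>m ?m 0) :: 'k mat"
  let ?p1 = "four_block_mat (1\<^sub>m ?n) (0\<^sub>m ?n ?m) (0\<^sub>m 0 ?n) (0\<^sub>m 0 ?m) :: 'k mat"
  let ?p2 = "four_block_mat (0\<^sub>m ?m ?n) (1\<^sub>m ?m) (0\<^sub>m 0 ?n) (0\<^sub>m 0 ?m) :: 'k mat"
  define I1 I2 P1 P2 where "I1 = ?i1" and "I2 = ?i2" and "P1 = ?p1" and "P2 = ?p2"
  note defs = this
  have blk: "four_block_mat X (0\<^sub>m a 0) (0\<^sub>m 0 b) (0\<^sub>m 0 0) = X" if "X \<in> carrier_mat a b" for X :: "'k mat" and a b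
    using that by (intro eq_matI) auto
  have S: "fd_module A S"
    unfolding fd_module_def S_def fst_conv snd_conv A_carrier
  proof (intro conjI ballI allI)
    fix a b :: "'k vec" and s assume a: "a \<in> carrier_vec d" and b: "b \<in> carrier_vec d"
    note [simp] = mV(1)[OF a] mV(1)[OF b] mW(1)[OF a] mW(1)[OF b]
    show "?r a \<in> carrier_mat (?n + ?m) (?n + ?m)" by simp
    show "?r (a \<oplus>\<^bsub>A\<^esub> b) = ?r a + ?r b"
      using a b by (simp add: A_add mV mW add_four_block_mat[of _ ?n ?n _ ?m _ ?m])
    show "?r (s \<cdot>\<^sub>v a) = s \<cdot>\<^sub>m ?r a"
      using a by (simp add: mV mW smult_four_block_mat[of _ ?n ?n _ ?m _ ?m])
    show "?r (a \<otimes>\<^bsub>A\<^esub> b) = ?r a * ?r b"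
      using a b by (subst mult_four_block_mat[of _ ?n ?n _ ?m _ ?m _ _ ?n _ ?m])
        (use a b in \<open>simp_all add: mV mW left_mult_zero_mat[OF mV(1)[OF b]] left_mult_zero_mat[OF mW(1)[OF b]]
          right_mult_zero_mat[OF mV(1)[OF a]] right_mult_zero_mat[OF mW(1)[OF a]]
          right_add_zero_mat[OF mult_carrier_mat[OF mV(1)[OF a] mV(1)[OF b]]]
          left_add_zero_mat[OF mult_carrier_mat[OF mW(1)[OF a] mW(1)[OF b]]]\<close>)
  qed (use mV(5) mW(5) in \<open>auto intro!: eq_matI\<close>)
  note one_zero = left_mult_one_mat[OF one_carrier_mat] right_add_zero_mat[OF one_carrier_mat]
    left_add_zero_mat[OF one_carrier_mat] left_mult_zero_mat[OF one_carrier_mat]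
    right_mult_zero_mat[OF one_carrier_mat] left_mult_one_mat[OF zero_carrier_mat] right_add_zero_mat[OF zero_carrier_mat]
  have comm: "?i1 * snd V a = ?r a * ?i1" "?i2 * snd W a = ?r a * ?i2" "?p1 * ?r a = snd V a * ?p1" "?p2 * ?r a = snd W a * ?p2"
    if a: "a \<in> carrier_vec d" for a
  proof -
    note [simp] = mV(1)[OF a] mW(1)[OF a] left_mult_zero_mat[OF mV(1)[OF a]] left_mult_zero_mat[OF mW(1)[OF a]]
      right_mult_zero_mat[OF mV(1)[OF a]] right_mult_zero_mat[OF mW(1)[OF a]] right_add_zero_mat[OF mV(1)[OF a]]
      right_add_zero_mat[OF mW(1)[OF a]] left_add_zero_mat[OF mV(1)[OF a]] left_add_zero_mat[OF mW(1)[OF a]]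
      left_mult_one_mat[OF mV(1)[OF a]] left_mult_one_mat[OF mW(1)[OF a]]
      right_mult_one_mat[OF mV(1)[OF a]] right_mult_one_mat[OF mW(1)[OF a]]
    have "?i1 * snd V a = ?i1 * four_block_mat (snd V a) (0\<^sub>m ?n 0) (0\<^sub>m 0 ?n) (0\<^sub>m 0 0)" by (simp add: blk)
    also have "\<dots> = ?r a * ?i1"
      by (subst mult_four_block_mat[of _ ?n ?n _ 0 _ ?m _ _ ?n _ 0], simp_all, subst mult_four_block_mat[of _ ?n ?n _ ?m _ ?m _ _ ?n _ 0]) simp_all
    finally show "?i1 * snd V a = ?r a * ?i1" .
    have "?i2 * snd W a = ?i2 * four_block_mat (snd W a) (0\<^sub>m ?m 0) (0\<^sub>m 0 ?m) (0\<^sub>m 0 0)" by (simp add: blk)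
    also have "\<dots> = ?r a * ?i2"
      by (subst mult_four_block_mat[of _ ?n ?m _ 0 _ ?m _ _ ?m _ 0], simp_all, subst mult_four_block_mat[of _ ?n ?n _ ?m _ ?m _ _ ?m _ 0]) simp_all
    finally show "?i2 * snd W a = ?r a * ?i2" .
    have "snd V a * ?p1 = four_block_mat (snd V a) (0\<^sub>m ?n 0) (0\<^sub>m 0 ?n) (0\<^sub>m 0 0) * ?p1" by (simp add: blk)
    also have "\<dots> = ?p1 * ?r a"
      by (subst mult_four_block_mat[of _ ?n ?n _ 0 _ 0 _ _ ?n _ ?m], simp_all, subst mult_four_block_mat[of _ ?n ?n _ ?m _ 0 _ _ ?n _ ?m]) simp_all
    finally show "?p1 * ?r a = snd V a * ?p1" ..
    have "snd W a * ?p2 = four_block_mat (snd W a) (0\<^sub>m ?m 0) (0\<^sub>m 0 ?m) (0\<^sub>m 0 0) * ?p2" by (simp add: blk)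
    also have "\<dots> = ?p2 * ?r a"
      by (subst mult_four_block_mat[of _ ?m ?m _ 0 _ 0 _ _ ?n _ ?m], simp_all, subst mult_four_block_mat[of _ ?m ?n _ ?m _ 0 _ _ ?n _ ?m]) simp_all
    finally show "?p2 * ?r a = snd W a * ?p2" ..
  qed
  have car: "?i1 \<in> carrier_mat (?n + ?m) ?n" "?i2 \<in> carrier_mat (?n + ?m) ?m" "?p1 \<in> carrier_mat ?n (?n + ?m)" "?p2 \<in> carrier_mat ?m (?n + ?m)"
    by (intro carrier_matI; simp)+
  note facts = comm[folded defs] car[folded defs]
  have "(V, I1, S) \<in> Hom D V S" "(W, I2, S) \<in> Hom D W S" "(S, P1, V) \<in> Hom D S V" "(S, P2, W) \<in> Hom D S W"
    using V W S facts by (simp_all add: Hom_def) (simp_all add: S_def)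
  moreover have "P1 * I1 = 1\<^sub>m ?n"
    unfolding defs by (subst mult_four_block_mat[of _ ?n ?n _ ?m _ 0 _ _ ?n _ 0]) (simp_all add: one_zero blk)
  moreover have "P2 * I2 = 1\<^sub>m ?m"
    unfolding defs by (subst mult_four_block_mat[of _ ?m ?n _ ?m _ 0 _ _ ?m _ 0]) (simp_all add: one_zero blk)
  moreover have "P1 * I2 = 0\<^sub>m ?n ?m"
    unfolding defs by (subst mult_four_block_mat[of _ ?n ?n _ ?m _ 0 _ _ ?m _ 0]) (simp_all add: one_zero blk)
  moreover have "P2 * I1 = 0\<^sub>m ?m ?n"
    unfolding defs by (subst mult_four_block_mat[of _ ?m ?n _ ?m _ 0 _ _ ?n _ 0]) (simp_all add: one_zero blk)
  ultimately show ?thesis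
    using S by (intro that[of S "(V, I1, S)" "(W, I2, S)" "(S, P1, V)" "(S, P2, W)"]) simp_all
qed

end

section \<open>Representability\<close>

lemma (in fd_alg) Idn_commute:
  "fd_module A V \<Longrightarrow> x \<in> carrier_vec d \<Longrightarrow> 1\<^sub>m (fst V) * snd V x = snd V x * 1\<^sub>m (fst V)"
  using left_mult_one_mat[OF moduleD(1)[of V x]] right_mult_one_mat[OF moduleD(1)[of V x]] by simp

lemma (in fd_alg) D_category: "category D"
proof
  fix f assume "f \<in> Arr D"
  then show "Dom D f \<in> Obj D" "Cod D f \<in> Obj D" by (cases f; auto)+
next
  fix x assume "x \<in> Obj D"
  then show "Idn D x \<in> Hom D x x"
    using Idn_commute[of x] by (simp add: Hom_def)
next
  fix f x y g w assume f: "f \<in> Hom D x y" and g: "g \<in> Hom D y w"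
  obtain X Y where [simp]: "f = (x, X, y)" "g = (y, Y, w)" using f g by (auto simp: Hom_D)
  have X: "X \<in> carrier_mat (fst y) (fst x)" and Y: "Y \<in> carrier_mat (fst w) (fst y)"
    and m: "fd_module A x" "fd_module A y" "fd_module A w" using f g by (auto simp: Hom_def)
  have "Y * X * snd x a = snd w a * (Y * X)" if a: "a \<in> carrier_vec d" for a
  proof -
    note act = m[THEN moduleD(1), OF a]
    have "Y * X * snd x a = Y * (X * snd x a)" by (rule assoc_mult_mat[OF Y X act(1)])
    also have "X * snd x a = snd y a * X" using f a by (auto simp: Hom_def)
    also have "Y * (snd y a * X) = Y * snd y a * X" by (rule assoc_mult_mat[OF Y act(2) X, symmetric])
    also have "Y * snd y a = snd w a * Y" using g a by (auto simp: Hom_def)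
    also have "snd w a * Y * X = snd w a * (Y * X)" by (rule assoc_mult_mat[OF act(3) Y X])
    finally show ?thesis .
  qed
  then show "g \<cdot>\<^bsub>D\<^esub> f \<in> Hom D x w"
    using X Y m by (simp add: Hom_def mult_carrier_mat[OF Y X])
next
  fix f x y g w h v assume f: "f \<in> Hom D x y" and g: "g \<in> Hom D y w" and h: "h \<in> Hom D w v"
  obtain X Y Z where [simp]: "f = (x, X, y)" "g = (y, Y, w)" "h = (w, Z, v)" using f g h by (auto simp: Hom_D)
  have "Z * Y * X = Z * (Y * X)"
    using f g h by (intro assoc_mult_mat[of _ "fst v" "fst w" _ "fst y" _ "fst x"]) (auto simp: Hom_def)
  then show "(h \<cdot>\<^bsub>D\<^esub> g) \<cdot>\<^bsub>D\<^esub> f = h \<cdot>\<^bsub>D\<^esub> g \<cdot>\<^bsub>D\<^esub> f" by simp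
next
  fix f x y assume "f \<in> Hom D x y"
  then show "Idn D y \<cdot>\<^bsub>D\<^esub> f = f" "f \<cdot>\<^bsub>D\<^esub> Idn D x = f"
    by (auto simp: Hom_D)
qed

lemma (in fd_alg) presheaf_represents:
  assumes E: "presheaf D E R ad sc ze"
  shows "\<exists>g \<epsilon>. represents D E R g \<epsilon>"
proof -
  interpret presheaf D E R ad sc ze by (rule E)
  have Hom_I: "(V, X, W) \<in> Hom D V W \<longleftrightarrow> (V, X, W) \<in> Arr D" for V X W by (simp add: Hom_def)
  have PO: "P \<in> Obj D" using P_module by simp
  define reduced where "reduced V e \<longleftrightarrow> fd_module A V \<and> e \<in> E V \<and>
    (\<forall>v \<in> carrier_vec (fst V). R (pt V v) e = ze P \<longrightarrow> v = 0\<^sub>v (fst V))" for V e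
  obtain m \<phi> where \<phi>_add: "\<And>e e' i. \<lbrakk>e \<in> E P; e' \<in> E P\<rbrakk> \<Longrightarrow> \<phi> (ad e e') i = \<phi> e i + \<phi> e' i"
    and \<phi>_scale: "\<And>a e i. e \<in> E P \<Longrightarrow> \<phi> (sc a e) i = a * \<phi> e (i::nat)"
    and \<phi>_inj: "\<And>e. \<lbrakk>e \<in> E P; \<forall>i<m. \<phi> e i = 0\<rbrakk> \<Longrightarrow> e = ze P"
    using finite_dim[OF PO] by metis
  \<comment> \<open>The map sending \<open>v\<close> to \<open>R (pt V v) e\<close> is linear and
    injective into \<open>E P\<close>, and the latter has \<open>m\<close> coordinates.\<close>
  have bound: "fst V \<le> m" if "reduced V e" for V e
  proof -
    have V: "fd_module A V" and e: "e \<in> E V"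
      and inj: "\<And>v. v \<in> carrier_vec (fst V) \<Longrightarrow> R (pt V v) e = ze P \<Longrightarrow> v = 0\<^sub>v (fst V)"
      using that by (auto simp: reduced_def)
    note pt = pt_Arr[OF V]
    show ?thesis
    proof (rule injective_mat_le[of "fst V" m "\<lambda>v. \<phi> (R (pt V v) e)"])
      fix x y :: "'k vec" and i a assume x: "x \<in> carrier_vec (fst V)"
      show "\<phi> (R (pt V (a \<cdot>\<^sub>v x)) e) i = a * \<phi> (R (pt V x) e) i"
        using R_in[OF pt[OF x] e] by (simp add: pt_linear(2)[OF V x] R_Scale[OF pt[OF x] e] \<phi>_scale)
      assume y: "y \<in> carrier_vec (fst V)"
      show "\<phi> (R (pt V (x + y)) e) i = \<phi> (R (pt V x) e) i + \<phi> (R (pt V y) e) i"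
        using R_in[OF pt[OF x] e] R_in[OF pt[OF y] e]
        by (simp add: pt_linear(1)[OF V x y] R_Add[OF pt[OF x] pt[OF y] e] \<phi>_add)
    next
      fix x :: "'k vec" assume x: "x \<in> carrier_vec (fst V)" and 0: "\<And>i. i < m \<Longrightarrow> \<phi> (R (pt V x) e) i = 0"
      show "x = 0\<^sub>v (fst V)"
        using inj[OF x] \<phi>_inj[OF R_in[OF pt[OF x] e]] 0 by blast
    qed
  qed
  \<comment> \<open>Induction on the dimension: a nonzero vector that kills \<open>e\<close>
    generates a submodule, and \<open>e\<close> descends to the smaller quotient.\<close>
  have quot: "\<exists>W p e'. reduced W e' \<and> p \<in> Hom D V W \<and> R p e' = e" if "fd_module A V" "e \<in> E V" for V e
    using that
  proof (induction "fst V" arbitrary: V e rule: less_induct)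
    case less
    show ?case
    proof (cases "reduced V e")
      case True
      have "Idn D V \<in> Hom D V V" using less.prems(1) by (intro category.Idn_in_Hom[OF D_category]) simp
      moreover have "R (Idn D V) e = e" using R_Idn[of V e] less.prems by simp
      ultimately show ?thesis using True by blast
    next
      case False
      then obtain v where v: "v \<in> carrier_vec (fst V)" "R (pt V v) e = ze P" "v \<noteq> 0\<^sub>v (fst V)"
        using less.prems by (auto simp: reduced_def)
      obtain W Q where W: "is_cokernel D (pt V v) (V, Q, W)" "fst W < fst V"
        using cokernel_pt[OF less.prems(1) v(1,3)] by metis
      have Q: "(V, Q, W) \<in> Arr D" using W(1) by (simp add: is_cokernel_def)
      have "Dom D (pt V v) = P" by (simp add: pt_def)
      then obtain e' where e': "e' \<in> E W" "R (V, Q, W) e' = e"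
        using cokernel[OF W(1), of e] less.prems v(2) by auto
      have "fd_module A W" using Q by simp
      from less.hyps[OF W(2) this e'(1)] obtain Z p e'' where Z: "reduced Z e''" "p \<in> Hom D W Z" "R p e'' = e'" by blast
      have "R (p \<cdot>\<^bsub>D\<^esub> (V, Q, W)) e'' = e"
        using R_Comp[of "(V, Q, W)" V W p Z e''] Q Z e' by (simp add: Hom_I reduced_def del: D_simps)
      moreover have "p \<cdot>\<^bsub>D\<^esub> (V, Q, W) \<in> Hom D V Z"
        using Z(2) Q by (intro category.Comp_in_Hom[OF D_category, of _ _ W]) (auto simp: Hom_I simp del: D_simps)
      ultimately show ?thesis using Z(1) by blast
    qed
  qed
  define S where "S = {n. \<exists>V e. reduced V e \<and> fst V = n}"
  have "S \<subseteq> {..m}" using bound by (auto simp: S_def)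
  then have fin: "finite S" by (rule finite_subset) simp
  have "S \<noteq> {}"
    using quot[OF P_module zero_in[OF PO]] by (auto simp: S_def)
  then have "Max S \<in> S" using fin by simp
  then obtain g \<epsilon> where g: "reduced g \<epsilon>" and gmax: "fst g = Max S" by (auto simp: S_def)
  have max: "fst V \<le> fst g" if "reduced V e" for V e
  proof -
    have "fst V \<in> S" using that unfolding S_def by blast
    then show ?thesis using fin gmax by simp
  qed
  have gM: "fd_module A g" and \<epsilon>: "\<epsilon> \<in> E g" and g_inj: "\<And>v. v \<in> carrier_vec (fst g) \<Longrightarrow> R (pt g v) \<epsilon> = ze P \<Longrightarrow> v = 0\<^sub>v (fst g)"
    using g by (auto simp: reduced_def)
  have "\<exists>!u. u \<in> Hom D a g \<and> R u \<epsilon> = \<xi>" if a: "fd_module A a" and \<xi>: "\<xi> \<in> E a" for a \<xi>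
  proof (rule ex_ex1I)
    obtain s i1 i2 p1 p2 where s: "fd_module A s" "i1 \<in> Hom D g s" "i2 \<in> Hom D a s" "p1 \<in> Hom D s g" "p2 \<in> Hom D s a"
      "p1 \<cdot>\<^bsub>D\<^esub> i1 = Idn D g" "p2 \<cdot>\<^bsub>D\<^esub> i2 = Idn D a" "p1 \<cdot>\<^bsub>D\<^esub> i2 = Zero D a g" "p2 \<cdot>\<^bsub>D\<^esub> i1 = Zero D g a"
      using biproduct_exists[OF gM a] by metis
    \<comment> \<open>The element on the biproduct that restricts to \<open>\<epsilon>\<close> along
      \<open>i1\<close> and to \<open>\<xi>\<close> along \<open>i2\<close>. The reduced quotient
      \<open>q\<close> to which it descends receives arrows from both \<open>g\<close> and
      \<open>a\<close>.\<close>
    define k where "k = ad (R p1 \<epsilon>) (R p2 \<xi>)"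
    have pk: "R p1 \<epsilon> \<in> E s" "R p2 \<xi> \<in> E s" using R_in s \<epsilon> \<xi> by blast+
    then have k: "k \<in> E s" unfolding k_def using add_in s(1) by simp
    have k1: "R i1 k = \<epsilon>"
      using R_add[OF s(2) pk] R_Comp[OF s(2,4) \<epsilon>] R_Comp[OF s(2,5) \<xi>] R_Idn[of g \<epsilon>] R_Zero[of g a \<xi>] add_zero(2)[of g \<epsilon>] gM a \<epsilon> \<xi> s
      by (simp add: k_def del: D_simps(2-))
    have k2: "R i2 k = \<xi>"
      using R_add[OF s(3) pk] R_Comp[OF s(3,4) \<epsilon>] R_Comp[OF s(3,5) \<xi>] R_Idn[of a \<xi>] R_Zero[of a g \<epsilon>] add_zero(1)[of a \<xi>] gM a \<epsilon> \<xi> s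
      by (simp add: k_def del: D_simps(2-))
    obtain q p k' where q: "reduced q k'" "p \<in> Hom D s q" "R p k' = k" using quot[OF s(1) k] by blast
    have qM: "fd_module A q" and k': "k' \<in> E q" using q by (auto simp: reduced_def)
    note D = D_category
    define u1 where "u1 = p \<cdot>\<^bsub>D\<^esub> i1"
    define u2 where "u2 = p \<cdot>\<^bsub>D\<^esub> i2"
    have u1: "u1 \<in> Hom D g q" "R u1 k' = \<epsilon>"
      using category.Comp_in_Hom[OF D s(2) q(2)] R_Comp[OF s(2) q(2) k'] q k1 by (simp_all add: u1_def)
    have u2: "u2 \<in> Hom D a q" "R u2 k' = \<xi>"
      using category.Comp_in_Hom[OF D s(3) q(2)] R_Comp[OF s(3) q(2) k'] q k2 by (simp_all add: u2_def)
    obtain X where X: "u1 = (g, X, q)" "(g, X, q) \<in> Arr D" using u1(1) by (auto simp: Hom_D)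
    have X': "X \<in> carrier_mat (fst q) (fst g)" using X by simp
    \<comment> \<open>A vector in the kernel of \<open>X\<close> kills \<open>\<epsilon>\<close>,
      hence is zero because \<open>g\<close> is reduced. With the maximality of
      \<open>fst g\<close>, the matrix \<open>X\<close> is square and invertible, so
      \<open>q\<close> may be replaced by \<open>g\<close>.\<close>
    have Xinj: "v = 0\<^sub>v (fst g)" if v: "v \<in> carrier_vec (fst g)" and 0: "X *\<^sub>v v = 0\<^sub>v (fst q)" for v
    proof (rule g_inj[OF v])
      have "R (pt g v) \<epsilon> = R (u1 \<cdot>\<^bsub>D\<^esub> pt g v) k'"
        using R_Comp[OF pt_Arr[OF gM v] u1(1) k'] u1(2) by simp
      also have "u1 \<cdot>\<^bsub>D\<^esub> pt g v = Zero D P q"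
        using comp_pt[OF X(2) v] pt_linear(3)[OF qM, of "0\<^sub>v (fst q)"] 0 by (simp add: X(1) del: D_simps)
      also have "R (Zero D P q) k' = ze P" using R_Zero[OF PO _ k'] qM by simp
      finally show "R (pt g v) \<epsilon> = ze P" .
    qed
    have "fst g \<le> fst q"
    proof (rule injective_mat_le[of "fst g" "fst q" "\<lambda>v i. (X *\<^sub>v v) $ i"])
      fix v :: "'k vec" assume v: "v \<in> carrier_vec (fst g)" and 0: "\<And>i. i < fst q \<Longrightarrow> (X *\<^sub>v v) $ i = 0"
      show "v = 0\<^sub>v (fst g)" by (rule Xinj[OF v]) (use X' 0 in \<open>auto intro!: eq_vecI\<close>)
    qed (use X' in \<open>auto simp: mult_add_distrib_mat_vec[OF X'] mult_mat_vec[OF X']\<close>)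
    then have dim: "fst q = fst g" using max[OF q(1)] by simp
    have "det X \<noteq> 0"
      using Xinj det_0_iff_vec_prod_zero_field[of X "fst g"] X' dim by auto
    then obtain Y where Y: "Y \<in> carrier_mat (fst g) (fst q)" "X * Y = 1\<^sub>m (fst q)" "Y * X = 1\<^sub>m (fst g)"
      using det_non_zero_imp_unit[of X "fst g"] X' dim by (auto simp: Units_def ring_mat_def)
    have YA: "(q, Y, g) \<in> Arr D"
    proof -
      have "Y * snd q x = snd g x * Y" if x: "x \<in> carrier_vec d" for x
      proof -
        have gx: "snd g x \<in> carrier_mat (fst g) (fst g)" and qx: "snd q x \<in> carrier_mat (fst q) (fst q)"
          using moduleD(1)[OF gM x] moduleD(1)[OF qM x] .
        have "X * snd g x = snd q x * X" using X x by simp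
        then have "Y * (X * snd g x) * Y = Y * (snd q x * X) * Y" by simp
        moreover have "Y * (X * snd g x) = snd g x"
          using assoc_mult_mat[OF Y(1) X' gx] Y(3) gx by simp
        moreover have "Y * (snd q x * X) * Y = Y * snd q x"
        proof -
          have "Y * (snd q x * X) * Y = Y * (snd q x * X * Y)"
            by (rule assoc_mult_mat[of _ "fst g" "fst q" _ "fst g" _ "fst q"]) (use Y X' qx in auto)
          also have "snd q x * X * Y = snd q x" using assoc_mult_mat[OF qx X' Y(1)] Y(2) qx by simp
          finally show ?thesis .
        qed
        ultimately show ?thesis by simp
      qed
      then show ?thesis using gM qM Y by simp
    qed
    let ?w = "(q, Y, g)"
    have w: "?w \<in> Hom D q g" using YA by (simp add: Hom_I del: D_simps)
    have "R ?w \<epsilon> = R (u1 \<cdot>\<^bsub>D\<^esub> ?w) k'" using R_Comp[OF w u1(1) k'] u1(2) by simp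
    also have "u1 \<cdot>\<^bsub>D\<^esub> ?w = Idn D q" using Y by (simp add: X(1))
    finally have Rw: "R ?w \<epsilon> = k'" using R_Idn[OF _ k'] qM by simp
    have "?w \<cdot>\<^bsub>D\<^esub> u2 \<in> Hom D a g" by (rule category.Comp_in_Hom[OF D u2(1) w])
    moreover have "R (?w \<cdot>\<^bsub>D\<^esub> u2) \<epsilon> = \<xi>" using R_Comp[OF u2(1) w \<epsilon>] Rw u2(2) by simp
    ultimately show "\<exists>u. u \<in> Hom D a g \<and> R u \<epsilon> = \<xi>" by blast
  next
    fix u v assume u: "u \<in> Hom D a g \<and> R u \<epsilon> = \<xi>" and v: "v \<in> Hom D a g \<and> R v \<epsilon> = \<xi>"
    obtain X where X: "u = (a, X, g)" "(a, X, g) \<in> Arr D" using u by (auto simp: Hom_D)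
    obtain Y where Y: "v = (a, Y, g)" "(a, Y, g) \<in> Arr D" using v by (auto simp: Hom_D)
    have X': "X \<in> carrier_mat (fst g) (fst a)" and Y': "Y \<in> carrier_mat (fst g) (fst a)" using X Y by auto
    have "X *\<^sub>v x = Y *\<^sub>v x" if x: "x \<in> carrier_vec (fst a)" for x
    proof -
      let ?y = "X *\<^sub>v x + (-1) \<cdot>\<^sub>v (Y *\<^sub>v x)"
      have Xx: "X *\<^sub>v x \<in> carrier_vec (fst g)" and Yx: "Y *\<^sub>v x \<in> carrier_vec (fst g)" using X' Y' x by auto
      then have mYx: "(-1) \<cdot>\<^sub>v (Y *\<^sub>v x) \<in> carrier_vec (fst g)" by simp
      have same: "R (pt g (X *\<^sub>v x)) \<epsilon> = R (pt g (Y *\<^sub>v x)) \<epsilon>"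
        using R_Comp[OF pt_Arr[OF a x], of u g \<epsilon>] R_Comp[OF pt_Arr[OF a x], of v g \<epsilon>] u v \<epsilon>
          comp_pt[OF X(2) x] comp_pt[OF Y(2) x] by (simp add: X(1) Y(1) del: D_simps)
      have "R (pt g ?y) \<epsilon> = ad (R (pt g (X *\<^sub>v x)) \<epsilon>) (sc (-1) (R (pt g (Y *\<^sub>v x)) \<epsilon>))"
        using pt_linear(1)[OF gM Xx mYx] pt_linear(2)[OF gM Yx, of "-1"]
          R_Add[OF pt_Arr[OF gM Xx] pt_Arr[OF gM mYx] \<epsilon>] R_Scale[OF pt_Arr[OF gM Yx] \<epsilon>, of "-1"] by simp
      also have "\<dots> = ad (R (pt g (X *\<^sub>v x)) \<epsilon>) (sc (-1) (R (pt g (X *\<^sub>v x)) \<epsilon>))" by (simp only: same)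
      \<comment> \<open>The operations of a presheaf come without a law for negatives, so a sum of
        the form \<open>e + (-1) e\<close> is evaluated by reading it as the restriction along the
        zero vector.\<close>
      also have "\<dots> = R (pt g (X *\<^sub>v x + (-1) \<cdot>\<^sub>v (X *\<^sub>v x))) \<epsilon>"
        using pt_linear(1)[OF gM Xx, of "(-1) \<cdot>\<^sub>v (X *\<^sub>v x)"] pt_linear(2)[OF gM Xx, of "-1"] Xx
          R_Add[OF pt_Arr[OF gM Xx] pt_Arr[OF gM, of "(-1) \<cdot>\<^sub>v (X *\<^sub>v x)"] \<epsilon>] R_Scale[OF pt_Arr[OF gM Xx] \<epsilon>, of "-1"] by simp
      also have "X *\<^sub>v x + (-1) \<cdot>\<^sub>v (X *\<^sub>v x) = 0\<^sub>v (fst g)"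
      proof -
        have "z + (-1) \<cdot>\<^sub>v z = 0\<^sub>v (fst g)" if "z \<in> carrier_vec (fst g)" for z :: "'k vec"
          using that by (intro eq_vecI) auto
        then show ?thesis using Xx .
      qed
      also have "R (pt g (0\<^sub>v (fst g))) \<epsilon> = ze P"
        using pt_linear(3)[OF gM, of "0\<^sub>v (fst g)"] R_Zero[OF PO _ \<epsilon>] gM by simp
      finally have "?y = 0\<^sub>v (fst g)" using g_inj[of ?y] Xx mYx by simp
      moreover have "z = w" if "z + (-1) \<cdot>\<^sub>v w = 0\<^sub>v (fst g)" "z \<in> carrier_vec (fst g)" "w \<in> carrier_vec (fst g)" for z w :: "'k vec"
      proof (rule eq_vecI)
        fix i assume "i < dim_vec w"
        moreover from this have "(z + (-1) \<cdot>\<^sub>v w) $ i = 0" using that by simp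
        ultimately show "z $ i = w $ i" using that(2,3) by simp
      qed (use that in simp)
      ultimately show ?thesis using Xx Yx by blast
    qed
    then have "X = Y" using X' Y' by (intro mat_eq_by_vec[of _ "fst g" "fst a"]) auto
    then show "u = v" by (simp add: X Y)
  qed
  then have "represents D E R g \<epsilon>"
    using gM \<epsilon> by (simp add: represents_def)
  then show ?thesis by blast
qed

lemma (in linear_category) Scale_0:
  assumes f: "f \<in> Hom C x y"
  shows "Scale C 0 f = Zero C x y"
proof -
  have xy: "x \<in> Obj C" "y \<in> Obj C" using f by (auto simp: Hom_def)
  let ?z = "Scale C 0 f"
  have z: "?z \<in> Hom C x y" by (rule Scale_in_Hom[OF f])
  obtain w where w: "w \<in> Hom C x y" "Add C ?z w = Zero C x y" using Add_inverse[OF z] by blast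
  have "Add C ?z ?z = ?z" using Scale_add_left[OF f, of 0 0] by simp
  then have "Add C (Add C ?z ?z) w = Zero C x y" using w by simp
  then have "Add C ?z (Zero C x y) = Zero C x y" using Add_assoc[OF z z w(1)] w(2) by simp
  moreover have "Add C ?z (Zero C x y) = ?z"
    using Add_commute[OF z Zero_in_Hom[OF xy]] Add_Zero[OF z] by simp
  ultimately show ?thesis by simp
qed

lemma (in linear_category) Comp_Zero:
  assumes x: "x \<in> Obj C" and f: "f \<in> Hom C y z"
  shows "f \<cdot>\<^bsub>C\<^esub> Zero C x y = Zero C x z" "Zero C z x \<cdot>\<^bsub>C\<^esub> f = Zero C y x"
proof -
  have yz: "y \<in> Obj C" "z \<in> Obj C" using f by (auto simp: Hom_def)
  note zero = Zero_in_Hom[OF x yz(1)] Zero_in_Hom[OF yz(2) x]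
  show "f \<cdot>\<^bsub>C\<^esub> Zero C x y = Zero C x z"
    using Comp_Scale_right[OF zero(1) f, of 0] Scale_0[OF zero(1)] Scale_0[OF Comp_in_Hom[OF zero(1) f]] by simp
  show "Zero C z x \<cdot>\<^bsub>C\<^esub> f = Zero C y x"
    using Comp_Scale_left[OF f zero(2), of 0] Scale_0[OF zero(2)] Scale_0[OF Comp_in_Hom[OF f zero(2)]] by simp
qed

lemma (in fd_alg) Scale_0_D: "f \<in> Hom D x y \<Longrightarrow> Scale D 0 f = Zero D x y"
  by (auto simp: Hom_D intro!: eq_matI)

lemma (in fd_alg) Zero_D:
  assumes "x \<in> Obj D" "y \<in> Obj D"
  shows "Zero D x y \<in> Hom D x y"
proof -
  have m: "fd_module A x" "fd_module A y" using assms by simp_all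
  have "0\<^sub>m (fst y) (fst x) * snd x a = snd y a * 0\<^sub>m (fst y) (fst x)" if a: "a \<in> carrier_vec d" for a
    using left_mult_zero_mat[OF moduleD(1)[OF m(1) a]] right_mult_zero_mat[OF moduleD(1)[OF m(2) a]] by simp
  then show ?thesis using m by (simp add: Hom_def)
qed

text \<open>Linear functors are defined by preservation of sums and multiples; a zero arrow is
  reached as a multiple by \<open>0\<close>.\<close>

lemma linear_functor_Zero:
  assumes F: "is_linear_functor C D F" and C: "category C" and xy: "x \<in> Obj C" "y \<in> Obj C"
    and z: "Zero C x y \<in> Hom C x y" "Scale C 0 (Zero C x y) = Zero C x y"
    and D: "\<And>f x y. f \<in> Hom D x y \<Longrightarrow> Scale D 0 f = Zero D x y"
  shows "FMor F (Zero C x y) = Zero D (FObj F x) (FObj F y)"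
proof -
  have "FMor F (Zero C x y) = Scale D 0 (FMor F (Zero C x y))"
    using linear_functorD(7)[OF F, of "Zero C x y" 0] z by (simp add: Hom_def)
  also have "\<dots> = Zero D (FObj F x) (FObj F y)"
    using linear_functorD(2-4)[OF F, of "Zero C x y"] z by (intro D) (auto simp: Hom_def)
  finally show ?thesis .
qed

section \<open>Transport along an equivalence with a category of modules\<close>

locale finite_equivalence = C: linear_category C + fd_alg d A
  for C :: "('k::field, 'o, 'm, 'z) lin_cat_scheme" and d and A :: "'k vec ring" +
  fixes F :: "('o, 'm, 'k fdmod, 'k fdmod \<times> 'k mat \<times> 'k fdmod) funct"
    and G :: "('k fdmod, 'k fdmod \<times> 'k mat \<times> 'k fdmod, 'o, 'm) funct"
    and \<eta> \<epsilon>
  assumes F: "is_linear_functor C D F" and G: "is_linear_functor D C G"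
    and \<eta>: "is_nat_iso C C id_functor (comp_functor G F) \<eta>"
    and \<epsilon>: "is_nat_iso D D (comp_functor F G) id_functor \<epsilon>"
begin

sublocale D: category D by (rule D_category)

lemmas F_simps [simp] = linear_functorD(1-6)[OF F]
lemmas G_simps [simp] = linear_functorD(1-6)[OF G]

lemma \<eta>_simps [simp]:
  assumes "x \<in> Obj C"
  shows "\<eta> x \<in> Arr C" "Dom C (\<eta> x) = x" "Cod C (\<eta> x) = FObj G (FObj F x)" "iso_arr C (\<eta> x)"
  using \<eta> assms by (auto simp: is_nat_iso_def is_nat_transf_def id_functor_def comp_functor_def Hom_def)

lemma \<eta>_nat: "f \<in> Arr C \<Longrightarrow> FMor G (FMor F f) \<cdot>\<^bsub>C\<^esub> \<eta> (Dom C f) = \<eta> (Cod C f) \<cdot>\<^bsub>C\<^esub> f"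
  using \<eta> by (auto simp: is_nat_iso_def is_nat_transf_def id_functor_def comp_functor_def)

lemma \<epsilon>_simps [simp]:
  assumes "x \<in> Obj D"
  shows "\<epsilon> x \<in> Arr D" "Dom D (\<epsilon> x) = FObj F (FObj G x)" "Cod D (\<epsilon> x) = x" "iso_arr D (\<epsilon> x)"
  using \<epsilon> assms by (simp_all add: is_nat_iso_def is_nat_transf_def id_functor_def comp_functor_def Hom_def del: D_simps)

lemma \<epsilon>_nat: "f \<in> Arr D \<Longrightarrow> f \<cdot>\<^bsub>D\<^esub> \<epsilon> (Dom D f) = \<epsilon> (Cod D f) \<cdot>\<^bsub>D\<^esub> FMor F (FMor G f)"
  using \<epsilon> unfolding is_nat_iso_def is_nat_transf_def id_functor_def comp_functor_def by (simp del: D_simps)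

text \<open>Naturality of the invertible \<open>\<eta>\<close> recovers \<open>f\<close> from its
  image. The equivalence carries no triangle identities, so the properties of \<open>F\<close> and
  of \<open>G\<close> are derived separately.\<close>

lemma F_faithful:
  assumes "f \<in> Hom C x y" "g \<in> Hom C x y" "FMor F f = FMor F g"
  shows "f = g"
proof (rule C.iso_cancel_left)
  have "f \<in> Arr C" "g \<in> Arr C" "Dom C f = x" "Cod C f = y" "Dom C g = x" "Cod C g = y" "x \<in> Obj C" "y \<in> Obj C"
    using assms by (auto simp: Hom_def)
  note [simp] = this
  show "\<eta> y \<cdot>\<^bsub>C\<^esub> f = \<eta> y \<cdot>\<^bsub>C\<^esub> g"
    using \<eta>_nat[of f] \<eta>_nat[of g] assms(3) by simp
  show "iso_arr C (\<eta> y)" "f \<in> Arr C" "g \<in> Arr C" "Cod C f = Dom C (\<eta> y)" "Cod C g = Dom C (\<eta> y)" by simp_all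
qed

lemma G_faithful:
  assumes "f \<in> Hom D x y" "g \<in> Hom D x y" "FMor G f = FMor G g"
  shows "f = g"
proof (rule D.iso_cancel_right)
  have a: "f \<in> Arr D" "g \<in> Arr D" "Dom D f = x" "Cod D f = y" "Dom D g = x" "Cod D g = y" "x \<in> Obj D"
    using assms D.Dom_Obj[of f] by (auto simp: Hom_def simp del: D_simps)
  show "f \<cdot>\<^bsub>D\<^esub> \<epsilon> x = g \<cdot>\<^bsub>D\<^esub> \<epsilon> x"
    using \<epsilon>_nat[of f] \<epsilon>_nat[of g] assms(3) a by (simp del: D_simps)
  show "iso_arr D (\<epsilon> x)" "f \<in> Arr D" "g \<in> Arr D" "Dom D f = Cod D (\<epsilon> x)" "Dom D g = Cod D (\<epsilon> x)"
    using a by (simp_all del: D_simps)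
qed

text \<open>The preimage is \<open>FMor F h\<close> conjugated by \<open>\<epsilon>\<close>.
  Naturality of \<open>\<epsilon>\<close> shows that \<open>F\<close> does not distinguish its image
  from \<open>h\<close>, and \<open>F\<close> is faithful.\<close>

lemma G_full:
  assumes x: "x \<in> Obj D" and y: "y \<in> Obj D" and h: "h \<in> Hom C (FObj G x) (FObj G y)"
  obtains k where "k \<in> Hom D x y" "FMor G k = h"
proof -
  note [simp del] = D_simps
  note [simp] = x y
  have [simp]: "h \<in> Arr C" "Dom C h = FObj G x" "Cod C h = FObj G y" using h by (auto simp: Hom_def)
  let ?k = "\<epsilon> y \<cdot>\<^bsub>D\<^esub> FMor F h \<cdot>\<^bsub>D\<^esub> inv_arr D (\<epsilon> x)"
  have k: "?k \<in> Arr D" "Dom D ?k = x" "Cod D ?k = y" by simp_all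
  have "\<epsilon> y \<cdot>\<^bsub>D\<^esub> FMor F (FMor G ?k) = \<epsilon> y \<cdot>\<^bsub>D\<^esub> FMor F h"
    using \<epsilon>_nat[OF k(1)] k by simp
  then have "FMor F (FMor G ?k) = FMor F h"
    by (rule D.iso_cancel_left[rotated]) (use k in simp_all)
  then have "FMor G ?k = h"
    by (rule F_faithful[of _ "FObj G x" "FObj G y", rotated 2]) (use k in \<open>simp_all add: Hom_def\<close>)
  then show ?thesis using that[of ?k] k by (simp add: Hom_def)
qed

lemma G_Zero: "\<lbrakk>x \<in> Obj D; y \<in> Obj D\<rbrakk> \<Longrightarrow> FMor G (Zero D x y) = Zero C (FObj G x) (FObj G y)"
  by (rule linear_functor_Zero[OF G D_category _ _ Zero_D Scale_0_D[OF Zero_D] C.Scale_0])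

lemma F_Zero: "\<lbrakk>x \<in> Obj C; y \<in> Obj C\<rbrakk> \<Longrightarrow> FMor F (Zero C x y) = Zero D (FObj F x) (FObj F y)"
  by (rule linear_functor_Zero[OF F C.category_axioms _ _ C.Zero_in_Hom C.Scale_0[OF C.Zero_in_Hom] Scale_0_D])

text \<open>An arrow to an arbitrary \<open>z\<close> is composed with \<open>\<eta> z\<close> to
  end in the image of \<open>G\<close>. There fullness and faithfulness of \<open>G\<close> make the
  universal property in the module category applicable.\<close>

lemma G_cokernel:
  assumes "is_cokernel D t p"
  shows "is_cokernel C (FMor G t) (FMor G p)"
proof -
  note [simp del] = D_simps
  have t [simp]: "t \<in> Arr D" "p \<in> Arr D" "Dom D p = Cod D t" and pt: "p \<cdot>\<^bsub>D\<^esub> t = Zero D (Dom D t) (Cod D p)"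
    and uni: "\<And>h. \<lbrakk>h \<in> Arr D; Dom D h = Cod D t; h \<cdot>\<^bsub>D\<^esub> t = Zero D (Dom D t) (Cod D h)\<rbrakk> \<Longrightarrow>
        \<exists>!u. u \<in> Hom D (Cod D p) (Cod D h) \<and> u \<cdot>\<^bsub>D\<^esub> p = h"
    using assms by (auto simp: is_cokernel_def)
  show ?thesis
    unfolding is_cokernel_def
  proof (intro conjI ballI impI)
    have "FMor G p \<cdot>\<^bsub>C\<^esub> FMor G t = FMor G (p \<cdot>\<^bsub>D\<^esub> t)" by simp
    then show "FMor G p \<cdot>\<^bsub>C\<^esub> FMor G t = Zero C (Dom C (FMor G t)) (Cod C (FMor G p))"
      unfolding pt by (simp add: G_Zero)
    fix h assume h: "h \<in> Arr C" "Dom C h = Cod C (FMor G t) \<and> h \<cdot>\<^bsub>C\<^esub> FMor G t = Zero C (Dom C (FMor G t)) (Cod C h)"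
    let ?z = "Cod C h" and ?b = "Cod D t" and ?q = "Cod D p"
    have [simp]: "?z \<in> Obj C" "Dom C h = FObj G ?b" "h \<in> Arr C" using h by auto
    have h0: "h \<cdot>\<^bsub>C\<^esub> FMor G t = Zero C (FObj G (Dom D t)) ?z" using h by simp
    obtain k where k: "k \<in> Hom D ?b (FObj F ?z)" "FMor G k = \<eta> ?z \<cdot>\<^bsub>C\<^esub> h"
    proof -
      have "\<eta> ?z \<cdot>\<^bsub>C\<^esub> h \<in> Hom C (FObj G ?b) (FObj G (FObj F ?z))" by (simp add: Hom_def)
      then show ?thesis using that by (rule G_full[rotated 2]) simp_all
    qed
    have k' [simp]: "k \<in> Arr D" "Dom D k = ?b" "Cod D k = FObj F ?z" using k by (auto simp: Hom_def)
    have "FMor G (k \<cdot>\<^bsub>D\<^esub> t) = \<eta> ?z \<cdot>\<^bsub>C\<^esub> h \<cdot>\<^bsub>C\<^esub> FMor G t"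
      by (simp add: k(2))
    also have "\<dots> = Zero C (FObj G (Dom D t)) (FObj G (FObj F ?z))"
      unfolding h0 by (rule C.Comp_Zero(1)) (simp_all add: Hom_def)
    also have "\<dots> = FMor G (Zero D (Dom D t) (FObj F ?z))" by (simp add: G_Zero)
    finally have G0: "FMor G (k \<cdot>\<^bsub>D\<^esub> t) = FMor G (Zero D (Dom D t) (FObj F ?z))" .
    have k0: "k \<cdot>\<^bsub>D\<^esub> t = Zero D (Dom D t) (FObj F ?z)"
      by (rule G_faithful[OF _ Zero_D G0]) (simp_all add: Hom_def)
    obtain u where u: "u \<in> Hom D ?q (FObj F ?z)" "u \<cdot>\<^bsub>D\<^esub> p = k"
      and u_unique: "\<And>v. \<lbrakk>v \<in> Hom D ?q (FObj F ?z); v \<cdot>\<^bsub>D\<^esub> p = k\<rbrakk> \<Longrightarrow> v = u"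
      using uni[of k] k0 by (metis k')
    have [simp]: "u \<in> Arr D" "Dom D u = ?q" "Cod D u = FObj F ?z" using u(1) by (auto simp: Hom_def)
    have Gu: "FMor G u \<cdot>\<^bsub>C\<^esub> FMor G p = \<eta> ?z \<cdot>\<^bsub>C\<^esub> h"
      using u(2) k(2) G_simps(6)[of p u] by simp
    show "\<exists>!u. u \<in> Hom C (Cod C (FMor G p)) ?z \<and> u \<cdot>\<^bsub>C\<^esub> FMor G p = h"
    proof (rule ex1I)
      show "inv_arr C (\<eta> ?z) \<cdot>\<^bsub>C\<^esub> FMor G u \<in> Hom C (Cod C (FMor G p)) ?z \<and> (inv_arr C (\<eta> ?z) \<cdot>\<^bsub>C\<^esub> FMor G u) \<cdot>\<^bsub>C\<^esub> FMor G p = h"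
        by (simp add: Hom_def Gu)
    next
      fix w assume w: "w \<in> Hom C (Cod C (FMor G p)) ?z \<and> w \<cdot>\<^bsub>C\<^esub> FMor G p = h"
      then have [simp]: "w \<in> Arr C" "Dom C w = FObj G ?q" "Cod C w = ?z" by (auto simp: Hom_def)
      obtain v where v: "v \<in> Hom D ?q (FObj F ?z)" "FMor G v = \<eta> ?z \<cdot>\<^bsub>C\<^esub> w"
      proof -
        have "\<eta> ?z \<cdot>\<^bsub>C\<^esub> w \<in> Hom C (FObj G ?q) (FObj G (FObj F ?z))" by (simp add: Hom_def)
        then show ?thesis using that by (rule G_full[rotated 2]) simp_all
      qed
      have [simp]: "v \<in> Arr D" "Dom D v = ?q" "Cod D v = FObj F ?z" using v(1) by (auto simp: Hom_def)
      have "FMor G (v \<cdot>\<^bsub>D\<^esub> p) = FMor G k" using v(2) w k(2) by simp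
      then have "v \<cdot>\<^bsub>D\<^esub> p = k" by (rule G_faithful[where x = ?b and y = "FObj F ?z", rotated 2]) (simp_all add: Hom_def)
      then have "v = u" by (rule u_unique[OF v(1)])
      then show "w = inv_arr C (\<eta> ?z) \<cdot>\<^bsub>C\<^esub> FMor G u" using v(2) by simp
    qed
  qed simp_all
qed

text \<open>The presheaf is pulled back along \<open>G\<close>, which preserves cokernels. A pair
  representing the pullback represents the given presheaf, since \<open>\<eta>\<close> identifies
  every object with one in the image of \<open>G\<close>.\<close>

lemma presheaf_represents:
  assumes E: "presheaf C E R ad sc ze"
  shows "\<exists>g \<epsilon>'. represents C E R g \<epsilon>'"
proof -
  interpret E: presheaf C E R ad sc ze by (rule E)
  note [simp del] = D_simps
  have "presheaf D (\<lambda>x. E (FObj G x)) (\<lambda>u. R (FMor G u)) ad sc (\<lambda>x. ze (FObj G x))"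
  proof (rule presheaf.intro)
    fix u x y e assume "u \<in> Hom D x y" and e: "e \<in> E (FObj G y)"
    then have u: "FMor G u \<in> Hom C (FObj G x) (FObj G y)" "u \<in> Arr D" and xy: "x \<in> Obj D" "y \<in> Obj D"
      and u': "u \<in> Hom D x y" using D.Dom_Obj D.Cod_Obj by (auto simp: Hom_def)
    show "R (FMor G u) e \<in> E (FObj G x)" by (rule E.R_in[OF u(1) e])
    show "R (FMor G (Scale D a u)) e = sc a (R (FMor G u) e)" for a
      using E.R_Scale[OF u(1) e] linear_functorD(7)[OF G u(2)] by simp
    show "R (FMor G (Add D u v)) e = ad (R (FMor G u) e) (R (FMor G v) e)" if v: "v \<in> Hom D x y" for v
    proof -
      have "FMor G v \<in> Hom C (FObj G x) (FObj G y)" using v by (auto simp: Hom_def)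
      then show ?thesis using E.R_Add[OF u(1) _ e] linear_functor_Add[OF G u' v xy] by simp
    qed
    show "R (FMor G u) (ad e e') = ad (R (FMor G u) e) (R (FMor G u) e')" if "e' \<in> E (FObj G y)" for e'
      by (rule E.R_add[OF u(1) e that])
  next
    fix u x y v w e assume u': "u \<in> Hom D x y" and v: "v \<in> Hom D y w" and e: "e \<in> E (FObj G w)"
    then have "FMor G u \<in> Hom C (FObj G x) (FObj G y)" "FMor G v \<in> Hom C (FObj G y) (FObj G w)" by (auto simp: Hom_def)
    from E.R_Comp[OF this e] show "R (FMor G (v \<cdot>\<^bsub>D\<^esub> u)) e = R (FMor G u) (R (FMor G v) e)"
      using u' v by (simp add: Hom_def)
  next
    fix x e assume x: "x \<in> Obj D"
    show "ze (FObj G x) \<in> E (FObj G x)" by (rule E.zero_in) (use x in simp)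
    show "\<exists>m (\<phi> :: _ \<Rightarrow> nat \<Rightarrow> _). (\<forall>e \<in> E (FObj G x). \<forall>e' \<in> E (FObj G x). \<forall>i. \<phi> (ad e e') i = \<phi> e i + \<phi> e' i) \<and>
       (\<forall>a. \<forall>e \<in> E (FObj G x). \<forall>i. \<phi> (sc a e) i = a * \<phi> e i) \<and> (\<forall>e \<in> E (FObj G x). (\<forall>i<m. \<phi> e i = 0) \<longrightarrow> e = ze (FObj G x))"
      by (rule E.finite_dim) (use x in simp)
    assume e: "e \<in> E (FObj G x)"
    then show "R (FMor G (Idn D x)) e = e" using x E.R_Idn by simp
    show "ad (ze (FObj G x)) e = e" "ad e (ze (FObj G x)) = e" using x e E.add_zero by simp_all
    show "ad e e' \<in> E (FObj G x)" if "e' \<in> E (FObj G x)" for e' using x e that E.add_in by simp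
  next
    fix x y e assume xy: "x \<in> Obj D" "y \<in> Obj D" and e: "e \<in> E (FObj G y)"
    show "R (FMor G (Zero D x y)) e = ze (FObj G x)" using E.R_Zero[OF _ _ e] xy by (simp add: G_Zero)
  next
    fix t p e assume k: "is_cokernel D t p" and e: "e \<in> E (FObj G (Dom D p))" "R (FMor G t) e = ze (FObj G (Dom D t))"
    then have "t \<in> Arr D" "p \<in> Arr D" by (simp_all add: is_cokernel_def)
    with E.cokernel[OF G_cokernel[OF k], of e] e show "\<exists>e' \<in> E (FObj G (Cod D p)). R (FMor G p) e' = e"
      by simp
  qed
  from fd_alg.presheaf_represents[OF fd_alg_axioms this]
  obtain g e where g: "g \<in> Obj D" "e \<in> E (FObj G g)"
    and rep: "\<And>a \<xi>. \<lbrakk>a \<in> Obj D; \<xi> \<in> E (FObj G a)\<rbrakk> \<Longrightarrow> \<exists>!u. u \<in> Hom D a g \<and> R (FMor G u) e = \<xi>"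
    by (auto simp: represents_def)
  have "represents C E R (FObj G g) e"
    unfolding represents_def
  proof (intro conjI ballI)
    fix a \<xi> assume [simp]: "a \<in> Obj C" and \<xi>: "\<xi> \<in> E a"
    let ?i = "inv_arr C (\<eta> a)"
    have i: "?i \<in> Hom C (FObj G (FObj F a)) a" and h: "\<eta> a \<in> Hom C a (FObj G (FObj F a))" by (auto simp: Hom_def)
    have "R ?i \<xi> \<in> E (FObj G (FObj F a))" by (rule E.R_in[OF i \<xi>])
    then obtain u where u: "u \<in> Hom D (FObj F a) g" "R (FMor G u) e = R ?i \<xi>"
      and u_unique: "\<And>v. \<lbrakk>v \<in> Hom D (FObj F a) g; R (FMor G v) e = R ?i \<xi>\<rbrakk> \<Longrightarrow> v = u"
      using rep[of "FObj F a" "R ?i \<xi>"] by (metis F_simps(1) \<open>a \<in> Obj C\<close>)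
    have [simp]: "u \<in> Arr D" "Dom D u = FObj F a" "Cod D u = g" using u(1) by (auto simp: Hom_def)
    have Gu: "FMor G u \<in> Hom C (FObj G (FObj F a)) (FObj G g)" by (simp add: Hom_def)
    show "\<exists>!u. u \<in> Hom C a (FObj G g) \<and> R u e = \<xi>"
    proof (rule ex1I)
      have "R (FMor G u \<cdot>\<^bsub>C\<^esub> \<eta> a) e = R (\<eta> a) (R ?i \<xi>)"
        using E.R_Comp[OF h Gu g(2)] u(2) by simp
      also have "\<dots> = \<xi>" using E.R_Comp[OF h i \<xi>] E.R_Idn[of a \<xi>] \<xi> by simp
      finally show "FMor G u \<cdot>\<^bsub>C\<^esub> \<eta> a \<in> Hom C a (FObj G g) \<and> R (FMor G u \<cdot>\<^bsub>C\<^esub> \<eta> a) e = \<xi>"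
        by (simp add: Hom_def)
    next
      fix w assume w: "w \<in> Hom C a (FObj G g) \<and> R w e = \<xi>"
      then have [simp]: "w \<in> Arr C" "Dom C w = a" "Cod C w = FObj G g" by (auto simp: Hom_def)
      obtain v where v: "v \<in> Hom D (FObj F a) g" "FMor G v = w \<cdot>\<^bsub>C\<^esub> ?i"
      proof -
        have "w \<cdot>\<^bsub>C\<^esub> ?i \<in> Hom C (FObj G (FObj F a)) (FObj G g)" by (simp add: Hom_def)
        then show ?thesis using that by (rule G_full[rotated 2]) (use g in simp_all)
      qed
      have "R (FMor G v) e = R ?i \<xi>" using v(2) E.R_Comp[OF i, of w "FObj G g" e] w g by simp
      then have "v = u" by (rule u_unique[OF v(1)])
      then show "w = FMor G u \<cdot>\<^bsub>C\<^esub> \<eta> a" using v(2) by simp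
    qed
  qed (use g in simp_all)
  then show ?thesis by blast
qed

end

lemma finite_linear_categoryE:
  fixes C :: "('k::field, 'o, 'm, 'z) lin_cat_scheme"
  assumes "finite_linear_category C"
  obtains d A F G \<eta> \<epsilon> where "finite_equivalence C d A F G \<eta> \<epsilon>"
proof -
  from assms obtain d and A :: "'k vec ring"
    and F :: "('o, 'm, 'k fdmod, 'k fdmod \<times> 'k mat \<times> 'k fdmod) funct"
    and G :: "('k fdmod, 'k fdmod \<times> 'k mat \<times> 'k fdmod, 'o, 'm) funct" and \<eta> \<epsilon> where "linear_category C" "fd_algebra d A"
    "is_linear_functor C (fd_module_cat A) F" "is_linear_functor (fd_module_cat A) C G"
    "is_nat_iso C C id_functor (comp_functor G F) \<eta>"
    "is_nat_iso (fd_module_cat A) (fd_module_cat A) (comp_functor F G) id_functor \<epsilon>"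
    unfolding finite_linear_category_def linearly_equivalent_def by blast
  then have "finite_equivalence C d A F G \<eta> \<epsilon>"
    by (intro finite_equivalence.intro fd_alg.intro finite_equivalence_axioms.intro)
  then show ?thesis by (rule that)
qed

lemma presheaf_represents:
  assumes "finite_linear_category C" "presheaf C E R ad sc ze"
  shows "\<exists>g \<epsilon>. represents C E R g \<epsilon>"
  using finite_linear_categoryE[OF assms(1)] finite_equivalence.presheaf_represents[OF _ assms(2)] by metis

section \<open>Right exact functors and generation by the regular module\<close>

lemma right_exactD:
  assumes "right_exact C D F"
  shows "is_linear_functor C D F" "is_cokernel C f q \<Longrightarrow> is_cokernel D (FMor F f) (FMor F q)"
  using assms by (simp_all add: right_exact_def)

lemma cokernel_factor:
  assumes "is_cokernel C t p" "h \<in> Arr C" "Dom C h = Cod C t" "Cod C h = z" "h \<cdot>\<^bsub>C\<^esub> t = Zero C (Dom C t) z"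
  shows "\<exists>u. u \<in> Hom C (Cod C p) z \<and> u \<cdot>\<^bsub>C\<^esub> p = h"
  using assms unfolding is_cokernel_def by blast

lemma cokernel_cancel:
  assumes "is_cokernel C t p" "linear_category C" "u \<in> Hom C (Cod C p) z" "v \<in> Hom C (Cod C p) z" "u \<cdot>\<^bsub>C\<^esub> p = v \<cdot>\<^bsub>C\<^esub> p"
  shows "u = v"
proof -
  interpret linear_category C by fact
  have [simp]: "t \<in> Arr C" "p \<in> Arr C" "Dom C p = Cod C t" "u \<in> Arr C" "Dom C u = Cod C p" "Cod C u = z"
    using assms(1,3) by (auto simp: is_cokernel_def Hom_def)
  have "(u \<cdot>\<^bsub>C\<^esub> p) \<cdot>\<^bsub>C\<^esub> t = u \<cdot>\<^bsub>C\<^esub> Zero C (Dom C t) (Cod C p)"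
    using assms(1) by (simp add: is_cokernel_def)
  also have "\<dots> = Zero C (Dom C t) z" by (rule Comp_Zero(1)) (use assms(3) in simp_all)
  finally have "(u \<cdot>\<^bsub>C\<^esub> p) \<cdot>\<^bsub>C\<^esub> t = Zero C (Dom C t) (Cod C (u \<cdot>\<^bsub>C\<^esub> p))" by simp
  moreover have "u \<cdot>\<^bsub>C\<^esub> p \<in> Arr C" "Dom C (u \<cdot>\<^bsub>C\<^esub> p) = Cod C t" by simp_all
  moreover have "\<forall>h \<in> Arr C. Dom C h = Cod C t \<and> h \<cdot>\<^bsub>C\<^esub> t = Zero C (Dom C t) (Cod C h) \<longrightarrow>
      (\<exists>!u. u \<in> Hom C (Cod C p) (Cod C h) \<and> u \<cdot>\<^bsub>C\<^esub> p = h)"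
    using assms(1) unfolding is_cokernel_def by blast
  ultimately have "\<exists>!w. w \<in> Hom C (Cod C p) (Cod C (u \<cdot>\<^bsub>C\<^esub> p)) \<and> w \<cdot>\<^bsub>C\<^esub> p = u \<cdot>\<^bsub>C\<^esub> p"
    by blast
  moreover have "u \<in> Hom C (Cod C p) (Cod C (u \<cdot>\<^bsub>C\<^esub> p))" "v \<in> Hom C (Cod C p) (Cod C (u \<cdot>\<^bsub>C\<^esub> p))"
    using assms(3,4) by simp_all
  ultimately show ?thesis using assms(5) by metis
qed

text \<open>Induction on the dimension: \<open>V\<close> is divided by the submodule generated by a
  unit vector. As \<open>K\<close> preserves this cokernel, \<open>h\<close> factors through the
  image of the quotient, and the hypothesis passes on because arrows out of the regular module lift
  along \<open>Q\<close>.\<close>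

lemma (in fd_alg) joint_epi:
  assumes N: "linear_category N" and K: "right_exact D N K" and V: "fd_module A V"
    and h: "h \<in> Hom N (FObj K V) z" and 0: "\<And>t. t \<in> Hom D P V \<Longrightarrow> h \<cdot>\<^bsub>N\<^esub> FMor K t = Zero N (FObj K P) z"
  shows "h = Zero N (FObj K V) z"
  using V h 0
proof (induction "fst V" arbitrary: V h rule: less_induct)
  case less
  interpret N: linear_category N by (rule N)
  note K' = right_exactD[OF K]
  have KO: "FObj K W \<in> Obj N" if "fd_module A W" for W
    using linear_functorD(1)[OF K'(1), of W] that by simp
  show ?case
  proof (cases "fst V = 0")
    case True
    \<comment> \<open>On the zero module the identity is a zero arrow, and \<open>K\<close>
      preserves zero arrows.\<close>
    then have "Idn D V = Zero D V V" by (auto intro: eq_matI)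
    then have "FMor K (Idn D V) = FMor K (Zero D V V)" by simp
    then have "Idn N (FObj K V) = Zero N (FObj K V) (FObj K V)"
      using linear_functor_Zero[OF K'(1) D_category _ _ Zero_D Scale_0_D[OF Zero_D] N.Scale_0, of V V]
        linear_functorD(5)[OF K'(1), of V] less.prems(1) by simp
    then have "h = h \<cdot>\<^bsub>N\<^esub> Zero N (FObj K V) (FObj K V)"
      using N.Comp_Idn_right[OF less.prems(2)] by simp
    then show ?thesis using N.Comp_Zero(1)[OF KO less.prems(2)] less.prems(1) by simp
  next
    case False
    then have "unit_vec (fst V) 0 \<noteq> (0\<^sub>v (fst V) :: 'k vec)"
      by (metis index_unit_vec(1) index_zero_vec(1) neq0_conv zero_neq_one)
    then obtain W Q where W: "is_cokernel D (pt V (unit_vec (fst V) 0)) (V, Q, W)" "fst W < fst V"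
      and lift: "\<And>w. w \<in> carrier_vec (fst W) \<Longrightarrow> \<exists>u \<in> carrier_vec (fst V). Q *\<^sub>v u = w"
      using cokernel_pt[OF less.prems(1) unit_vec_carrier] by metis
    let ?v = "unit_vec (fst V) 0 :: 'k vec"
    have Q: "(V, Q, W) \<in> Arr D" using W(1) by (simp add: is_cokernel_def)
    then have WM: "fd_module A W" by simp
    have cok: "is_cokernel N (FMor K (pt V ?v)) (FMor K (V, Q, W))" by (rule K'(2)[OF W(1)])
    have v: "pt V ?v \<in> Hom D P V" by (rule pt_Arr[OF less.prems(1)]) simp
    have [simp]: "Dom N (FMor K (pt V ?v)) = FObj K P" "Cod N (FMor K (pt V ?v)) = FObj K V"
      "Cod N (FMor K (V, Q, W)) = FObj K W" "Dom N (FMor K (V, Q, W)) = FObj K V" "FMor K (V, Q, W) \<in> Arr N"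
      using linear_functorD(2-4)[OF K'(1), of "pt V ?v"] linear_functorD(2-4)[OF K'(1) Q] v unfolding Hom_def by simp_all
    have hA: "h \<in> Arr N" "Dom N h = FObj K V" "Cod N h = z" using less.prems(2) by (auto simp: Hom_def)
    obtain k where k: "k \<in> Hom N (FObj K W) z" "k \<cdot>\<^bsub>N\<^esub> FMor K (V, Q, W) = h"
      using cokernel_factor[OF cok hA(1), of z] hA less.prems(3)[OF v] by auto
    have "k = Zero N (FObj K W) z"
    proof (rule less.hyps[OF W(2) WM k(1)])
      fix t assume t: "t \<in> Hom D P W"
      then obtain X where X: "t = (P, X, W)" "(P, X, W) \<in> Arr D" by (auto simp: Hom_D)
      have X': "X \<in> carrier_mat (fst W) d" using X by simp
      \<comment> \<open>An arrow out of the regular module is determined by its value at the unit of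
        the algebra; lifting that value to \<open>V\<close> lifts the arrow.\<close>
      have "pmat W (X *\<^sub>v \<one>\<^bsub>A\<^esub>) = X"
      proof (rule pmat_eqI[OF WM _ X'])
        fix x :: "'k vec" assume x: "x \<in> carrier_vec d"
        have "snd W x *\<^sub>v (X *\<^sub>v \<one>\<^bsub>A\<^esub>) = snd W x * X *\<^sub>v \<one>\<^bsub>A\<^esub>"
          by (rule assoc_mult_mat_vec[OF moduleD(1)[OF WM x] X' A_one, symmetric])
        also have "snd W x * X = X * lmat x" using X x by (simp add: P_def)
        also have "X * lmat x *\<^sub>v \<one>\<^bsub>A\<^esub> = X *\<^sub>v (lmat x *\<^sub>v \<one>\<^bsub>A\<^esub>)"
          by (rule assoc_mult_mat_vec[OF X' lmat(1)[OF x] A_one])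
        also have "lmat x *\<^sub>v \<one>\<^bsub>A\<^esub> = x"
          using lmat(2)[OF x A_one] ring.ring_simprules(25)[OF A_ring, of x] ring.is_monoid[OF A_ring] x
          by (simp add: monoid.r_one)
        finally show "X *\<^sub>v x = snd W x *\<^sub>v (X *\<^sub>v \<one>\<^bsub>A\<^esub>)" ..
      qed (use X' in simp)
      then have t_pt: "t = pt W (X *\<^sub>v \<one>\<^bsub>A\<^esub>)" by (simp add: X pt_def)
      obtain u where u: "u \<in> carrier_vec (fst V)" "Q *\<^sub>v u = X *\<^sub>v \<one>\<^bsub>A\<^esub>"
        using lift[of "X *\<^sub>v \<one>\<^bsub>A\<^esub>"] X' by auto
      have tQ: "t = (V, Q, W) \<cdot>\<^bsub>D\<^esub> pt V u" using comp_pt[OF Q u(1)] u(2) t_pt by simp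
      have pu: "pt V u \<in> Hom D P V" by (rule pt_Arr[OF less.prems(1) u(1)])
      have Ku: "FMor K (pt V u) \<in> Hom N (FObj K P) (FObj K V)"
        using linear_functorD(2-4)[OF K'(1), of "pt V u"] pu unfolding Hom_def by simp
      have "FMor K t = FMor K (V, Q, W) \<cdot>\<^bsub>N\<^esub> FMor K (pt V u)"
        unfolding tQ by (rule linear_functorD(6)[OF K'(1)]) (use pu Q in \<open>simp_all add: Hom_def\<close>)
      then have "k \<cdot>\<^bsub>N\<^esub> FMor K t = (k \<cdot>\<^bsub>N\<^esub> FMor K (V, Q, W)) \<cdot>\<^bsub>N\<^esub> FMor K (pt V u)"
        using k(1) Ku by (simp add: Hom_def)
      then show "k \<cdot>\<^bsub>N\<^esub> FMor K t = Zero N (FObj K P) z"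
        using k(2) less.prems(3)[OF pu] by simp
    qed
    then show ?thesis
      using k N.Comp_Zero(2)[of z "FMor K (V, Q, W)" "FObj K V" "FObj K W"] hA by (simp add: Hom_def) (metis N.Cod_Obj)
  qed
qed

context finite_equivalence
begin

text \<open>Reduction to modules: the statement for \<open>K\<close> composed with \<open>G\<close>,
  applied to \<open>h\<close> moved along the inverse of \<open>\<eta> x\<close>.\<close>

lemma joint_epi:
  assumes N: "linear_category N" and K: "right_exact C N K" and x: "x \<in> Obj C"
    and h: "h \<in> Hom N (FObj K x) z"
    and 0: "\<And>t. t \<in> Hom C (FObj G P) x \<Longrightarrow> h \<cdot>\<^bsub>N\<^esub> FMor K t = Zero N (FObj K (FObj G P)) z"
  shows "h = Zero N (FObj K x) z"
proof -
  note [simp del] = D_simps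
  interpret N: linear_category N by (rule N)
  note K' = right_exactD[OF K]
  note [simp] = linear_functorD(1-6)[OF K'(1)] x
  have [simp]: "h \<in> Arr N" "Dom N h = FObj K x" "Cod N h = z" using h by (auto simp: Hom_def)
  have z [simp]: "z \<in> Obj N" using N.Cod_Obj[of h] by simp
  let ?KG = "comp_functor K G"
  have KG: "right_exact D N ?KG"
    unfolding right_exact_def
  proof (intro conjI allI impI)
    show "is_linear_functor D N ?KG"
      unfolding is_linear_functor_def is_functor_def
    proof (intro conjI ballI allI impI)
      fix x y f g assume "x \<in> Obj D" "y \<in> Obj D" "f \<in> Hom D x y" "g \<in> Hom D x y"
      moreover from this have "FMor G f \<in> Hom C (FObj G x) (FObj G y)" "FMor G g \<in> Hom C (FObj G x) (FObj G y)"
        by (auto simp: Hom_def)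
      ultimately show "FMor ?KG (Add D f g) = Add N (FMor ?KG f) (FMor ?KG g)"
        by (simp add: comp_functor_def linear_functor_Add[OF G, of f x y g] linear_functor_Add[OF K'(1), of _ "FObj G x" "FObj G y"])
    qed (simp_all add: comp_functor_def Hom_def linear_functorD(7)[OF G] linear_functorD(7)[OF K'(1)])
    show "is_cokernel N (FMor ?KG f) (FMor ?KG q)" if "is_cokernel D f q" for f q
      using K'(2)[OF G_cokernel[OF that]] by (simp add: comp_functor_def)
  qed
  let ?i = "inv_arr C (\<eta> x)"
  have "h \<cdot>\<^bsub>N\<^esub> FMor K ?i = Zero N (FObj K (FObj G (FObj F x))) z"
  proof (rule fd_alg.joint_epi[OF fd_alg_axioms N KG, of "FObj F x", unfolded comp_functor_def funct.simps])
    show "fd_module A (FObj F x)" using F_simps(1)[OF x] by (simp add: D_simps)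
    show "h \<cdot>\<^bsub>N\<^esub> FMor K ?i \<in> Hom N (FObj K (FObj G (FObj F x))) z" by (simp add: Hom_def)
    fix t assume "t \<in> Hom D P (FObj F x)"
    then have [simp]: "t \<in> Arr D" "Dom D t = P" "Cod D t = FObj F x" by (auto simp: Hom_def)
    have "h \<cdot>\<^bsub>N\<^esub> FMor K (?i \<cdot>\<^bsub>C\<^esub> FMor G t) = Zero N (FObj K (FObj G P)) z"
      by (rule 0) (simp add: Hom_def)
    then show "(h \<cdot>\<^bsub>N\<^esub> FMor K ?i) \<cdot>\<^bsub>N\<^esub> FMor K (FMor G t) = Zero N (FObj K (FObj G P)) z" by simp
  qed
  then have "(h \<cdot>\<^bsub>N\<^esub> FMor K ?i) \<cdot>\<^bsub>N\<^esub> FMor K (\<eta> x) = Zero N (FObj K (FObj G (FObj F x))) z \<cdot>\<^bsub>N\<^esub> FMor K (\<eta> x)" by simp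
  moreover have "FMor K ?i \<cdot>\<^bsub>N\<^esub> FMor K (\<eta> x) = Idn N (FObj K x)"
    using linear_functorD(6)[OF K'(1), of "\<eta> x" ?i] by simp
  moreover have "Zero N (FObj K (FObj G (FObj F x))) z \<cdot>\<^bsub>N\<^esub> FMor K (\<eta> x) = Zero N (FObj K x) z"
    by (rule N.Comp_Zero(2)) (simp_all add: Hom_def)
  ultimately show ?thesis by simp
qed

text \<open>The entries of the matrix of \<open>FMor F f\<close> serve as coordinates; they
  determine \<open>f\<close> because \<open>F\<close> is faithful.\<close>

lemma Hom_finite_dim:
  assumes x: "x \<in> Obj C" and y: "y \<in> Obj C"
  shows "\<exists>m (\<phi> :: 'm \<Rightarrow> nat \<Rightarrow> 'k). (\<forall>e \<in> Hom C x y. \<forall>e' \<in> Hom C x y. \<forall>i. \<phi> (Add C e e') i = \<phi> e i + \<phi> e' i) \<and>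
       (\<forall>a. \<forall>e \<in> Hom C x y. \<forall>i. \<phi> (Scale C a e) i = a * \<phi> e i) \<and>
       (\<forall>e \<in> Hom C x y. (\<forall>i<m. \<phi> e i = 0) \<longrightarrow> e = Zero C x y)"
proof -
  let ?n = "fst (FObj F x)" and ?l = "fst (FObj F y)"
  define X where "X f = fst (snd (FMor F f))" for f
  \<comment> \<open>The entries are numbered row by row. The default \<open>0\<close> beyond the
    last entry keeps \<open>\<phi>\<close> linear at every index.\<close>
  define \<phi> where "\<phi> f i = (if i < ?l * ?n then X f $$ (i div ?n, i mod ?n) else 0)" for f i
  have FX: "FMor F f = (FObj F x, X f, FObj F y)" "X f \<in> carrier_mat ?l ?n" if "f \<in> Hom C x y" for f
  proof -
    have "FMor F f \<in> Hom D (FObj F x) (FObj F y)" using that by (simp add: Hom_def del: D_simps)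
    then show "FMor F f = (FObj F x, X f, FObj F y)" "X f \<in> carrier_mat ?l ?n" by (auto simp: Hom_D X_def)
  qed
  have idx: "i div ?n < ?l" "i mod ?n < ?n" if "i < ?l * ?n" for i
    using that by (auto simp: less_mult_imp_div_less) (metis less_nat_zero_code mod_less_divisor mult_0_right neq0_conv)
  have "\<phi> (Add C e e') i = \<phi> e i + \<phi> e' i" if "e \<in> Hom C x y" "e' \<in> Hom C x y" for e e' i
  proof -
    have "X (Add C e e') = X e + X e'"
      unfolding X_def[of "Add C e e'"] linear_functor_Add[OF F that x y] by (simp add: FX that)
    then show ?thesis using idx[of i] FX(2)[OF that(1)] FX(2)[OF that(2)] by (simp add: \<phi>_def)
  qed
  moreover have "\<phi> (Scale C a e) i = a * \<phi> e i" if e: "e \<in> Hom C x y" for e i a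
  proof -
    have "X (Scale C a e) = a \<cdot>\<^sub>m X e"
    proof -
      have "e \<in> Arr C" using e by (simp add: Hom_def)
      from linear_functorD(7)[OF F this, of a] show ?thesis unfolding X_def[of "Scale C a e"] by (simp add: FX e)
    qed
    then show ?thesis using idx[of i] FX(2)[OF e] by (simp add: \<phi>_def)
  qed
  moreover have "e = Zero C x y" if e: "e \<in> Hom C x y" and 0: "\<And>i. i < ?l * ?n \<Longrightarrow> \<phi> e i = 0" for e
  proof -
    have "X e = 0\<^sub>m ?l ?n"
    proof (rule eq_matI)
      fix i j assume ij: "i < dim_row (0\<^sub>m ?l ?n :: 'k mat)" "j < dim_col (0\<^sub>m ?l ?n :: 'k mat)"
      then have "i * ?n + j < ?l * ?n"
      proof -
        have "i * ?n + j < Suc i * ?n" using ij by simp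
        also have "\<dots> \<le> ?l * ?n" using ij by (intro mult_le_mono1) simp
        finally show ?thesis .
      qed
      from 0[OF this] this ij show "X e $$ (i, j) = 0\<^sub>m ?l ?n $$ (i, j)" by (simp add: \<phi>_def)
    qed (use FX[OF e] in auto)
    then have "FMor F e = FMor F (Zero C x y)" using FX[OF e] by (simp add: F_Zero x y)
    then show ?thesis by (rule F_faithful[OF e C.Zero_in_Hom[OF x y]])
  qed
  ultimately show ?thesis by blast
qed

end

section \<open>Existence of universal families\<close>

context module_category
begin

text \<open>The families of \<open>family1\<close> again, now for functors without module structure
  on an arbitrary category, and extensional so that agreement on the objects of \<open>M\<close> is
  equality and the presheaf laws hold strictly.\<close>

definition families :: "('o, 'm, 'y) cat_scheme \<Rightarrow> ('o, 'm, 'p, 'q, 'w) funct_scheme \<Rightarrow> ('o, 'm, 'p, 'q, 'v) funct_scheme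
    \<Rightarrow> 'c \<Rightarrow> ('o \<Rightarrow> 'q) set" where
  "families M K L a = {\<xi> \<in> extensional (Obj M). (\<forall>x \<in> Obj M. \<xi> x \<in> Hom N (a \<star> FObj K x) (FObj L x)) \<and>
     (\<forall>f \<in> Arr M. FMor L f \<diamondop> \<xi> (Dom M f) = \<xi> (Cod M f) \<diamondop> (a \<triangleright> FMor K f))}"

lemma familiesD:
  assumes "\<xi> \<in> families M K L a" "x \<in> Obj M"
  shows "\<xi> x \<in> Hom N (a \<star> FObj K x) (FObj L x)" "\<xi> x \<in> Arr N" "Dom N (\<xi> x) = a \<star> FObj K x" "Cod N (\<xi> x) = FObj L x"
  using assms by (auto simp: families_def Hom_def)

lemma families_nat:
  "\<xi> \<in> families M K L a \<Longrightarrow> f \<in> Arr M \<Longrightarrow> FMor L f \<diamondop> \<xi> (Dom M f) = \<xi> (Cod M f) \<diamondop> (a \<triangleright> FMor K f)"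
  by (simp add: families_def)

text \<open>Families descend along a cokernel componentwise, because the action in the first
  variable preserves cokernels. Finite dimension comes from evaluation at \<open>P\<close>, which is
  injective by \<open>joint\<close> and lands in a Hom space of the finite linear category
  \<open>N\<close>.\<close>

lemma families_presheaf:
  fixes M :: "('o, 'm, 'y) cat_scheme"
  assumes M: "category M" and K: "is_functor M N K" and L: "is_functor M N L"
    and act_exact: "\<And>t p y. is_cokernel C t p \<Longrightarrow> y \<in> Obj N \<Longrightarrow> is_cokernel N (t \<triangleleft> y) (p \<triangleleft> y)"
    and N: "finite_linear_category N"
    and P: "P \<in> Obj M" and joint: "\<And>a \<xi> x. \<lbrakk>a \<in> Obj C; \<xi> \<in> families M K L a; \<xi> P = Zero N (a \<star> FObj K P) (FObj L P); x \<in> Obj M\<rbrakk>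
        \<Longrightarrow> \<xi> x = Zero N (a \<star> FObj K x) (FObj L x)"
  shows "presheaf C (families M K L) (\<lambda>u \<xi>. restrict (\<lambda>x. \<xi> x \<diamondop> (u \<triangleleft> FObj K x)) (Obj M))
    (\<lambda>\<xi> \<zeta>. restrict (\<lambda>x. Add N (\<xi> x) (\<zeta> x)) (Obj M)) (\<lambda>k \<xi>. restrict (\<lambda>x. Scale N k (\<xi> x)) (Obj M))
    (\<lambda>a. restrict (\<lambda>x. Zero N (a \<star> FObj K x) (FObj L x)) (Obj M))"
proof -
  interpret M: category M by (rule M)
  have [simp]: "FObj K x \<in> Obj N" "FObj L x \<in> Obj N" if "x \<in> Obj M" for x
    using K L that by (auto simp: is_functor_def)
  have [simp]: "FMor K f \<in> Arr N" "Dom N (FMor K f) = FObj K (Dom M f)" "Cod N (FMor K f) = FObj K (Cod M f)"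
    "FMor L f \<in> Arr N" "Dom N (FMor L f) = FObj L (Dom M f)" "Cod N (FMor L f) = FObj L (Cod M f)" if "f \<in> Arr M" for f
    using K L that by (auto simp: is_functor_def Hom_def)
  note [simp] = familiesD(2-4)
  have famI: "restrict \<xi> (Obj M) \<in> families M K L a"
    if "\<And>x. x \<in> Obj M \<Longrightarrow> \<xi> x \<in> Hom N (a \<star> FObj K x) (FObj L x)"
      "\<And>f. f \<in> Arr M \<Longrightarrow> FMor L f \<diamondop> \<xi> (Dom M f) = \<xi> (Cod M f) \<diamondop> (a \<triangleright> FMor K f)" for a \<xi>
    using that by (simp add: families_def)
  have LH: "FMor L f \<in> Hom N (FObj L (Dom M f)) (FObj L (Cod M f))"
    and KH: "a \<in> Obj C \<Longrightarrow> a \<triangleright> FMor K f \<in> Hom N (a \<star> FObj K (Dom M f)) (a \<star> FObj K (Cod M f))" if "f \<in> Arr M" for f a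
    using that by (simp_all add: Hom_def)
  note famH = familiesD(1)
  have HomC: "u \<in> Arr C" "Dom C u = x" "Cod C u = y" "x \<in> Obj C" "y \<in> Obj C" if "u \<in> Hom C x y" for u x y
    using that by (auto simp: Hom_def)
  have rwH: "u \<triangleleft> z \<in> Hom N (x \<star> z) (y \<star> z)" if "u \<in> Hom C x y" "z \<in> Obj N" for u x y z
    using that by (auto simp: Hom_def)
  show ?thesis
  proof (rule presheaf.intro)
    fix u x y e assume u: "u \<in> Hom C x y" and e: "e \<in> families M K L y"
    note [simp] = HomC[OF u] and eH = famH[OF e]
    show "restrict (\<lambda>z. e z \<diamondop> (u \<triangleleft> FObj K z)) (Obj M) \<in> families M K L x"
    proof (rule famI)
      show "e z \<diamondop> (u \<triangleleft> FObj K z) \<in> Hom N (x \<star> FObj K z) (FObj L z)" if "z \<in> Obj M" for z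
        using e that by (simp add: Hom_def)
      fix f assume f: "f \<in> Arr M"
      then show "FMor L f \<diamondop> e (Dom M f) \<diamondop> (u \<triangleleft> FObj K (Dom M f)) = (e (Cod M f) \<diamondop> (u \<triangleleft> FObj K (Cod M f))) \<diamondop> (x \<triangleright> FMor K f)"
        using e interchange[of u "FMor K f" x y] by (simp add: N.prefix[OF families_nat[OF e f]])
    qed
    show "restrict (\<lambda>z. e z \<diamondop> (Scale C a u \<triangleleft> FObj K z)) (Obj M) =
        restrict (\<lambda>z. Scale N a (restrict (\<lambda>z. e z \<diamondop> (u \<triangleleft> FObj K z)) (Obj M) z)) (Obj M)" for a
    proof (rule restrict_ext)
      fix z assume z: "z \<in> Obj M"
      then show "e z \<diamondop> (Scale C a u \<triangleleft> FObj K z) = Scale N a (restrict (\<lambda>z. e z \<diamondop> (u \<triangleleft> FObj K z)) (Obj M) z)"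
        using ActMor_Scale_left[OF u N.Idn_in_Hom[of "FObj K z"], of a] N.Comp_Scale_right[OF rwH[OF u] eH[OF z]]
        by (simp add: rw_def)
    qed
    show "restrict (\<lambda>z. e z \<diamondop> (Add C u v \<triangleleft> FObj K z)) (Obj M) =
        restrict (\<lambda>z. Add N (restrict (\<lambda>z. e z \<diamondop> (u \<triangleleft> FObj K z)) (Obj M) z) (restrict (\<lambda>z. e z \<diamondop> (v \<triangleleft> FObj K z)) (Obj M) z)) (Obj M)"
      if v: "v \<in> Hom C x y" for v
    proof (rule restrict_ext)
      fix z assume z: "z \<in> Obj M"
      then show "e z \<diamondop> (Add C u v \<triangleleft> FObj K z) =
          Add N (restrict (\<lambda>z. e z \<diamondop> (u \<triangleleft> FObj K z)) (Obj M) z) (restrict (\<lambda>z. e z \<diamondop> (v \<triangleleft> FObj K z)) (Obj M) z)"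
        using ActMor_Add_left[OF u v N.Idn_in_Hom[of "FObj K z"]] N.Comp_Add_right[OF rwH[OF u] rwH[OF v] eH[OF z]]
        by (simp add: rw_def)
    qed
    show "restrict (\<lambda>z. restrict (\<lambda>z. Add N (e z) (e' z)) (Obj M) z \<diamondop> (u \<triangleleft> FObj K z)) (Obj M) =
        restrict (\<lambda>z. Add N (restrict (\<lambda>z. e z \<diamondop> (u \<triangleleft> FObj K z)) (Obj M) z) (restrict (\<lambda>z. e' z \<diamondop> (u \<triangleleft> FObj K z)) (Obj M) z)) (Obj M)"
      if e': "e' \<in> families M K L y" for e'
    proof (rule restrict_ext)
      fix z assume z: "z \<in> Obj M"
      then show "restrict (\<lambda>z. Add N (e z) (e' z)) (Obj M) z \<diamondop> (u \<triangleleft> FObj K z) =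
         Add N (restrict (\<lambda>z. e z \<diamondop> (u \<triangleleft> FObj K z)) (Obj M) z) (restrict (\<lambda>z. e' z \<diamondop> (u \<triangleleft> FObj K z)) (Obj M) z)"
        using N.Comp_Add_left[OF rwH[OF u] eH[OF z] famH[OF e' z]] by simp
    qed
  next
    fix u x y v w e assume u: "u \<in> Hom C x y" and v: "v \<in> Hom C y w" and e: "e \<in> families M K L w"
    show "restrict (\<lambda>z. e z \<diamondop> ((v \<cdot>\<^bsub>C\<^esub> u) \<triangleleft> FObj K z)) (Obj M) =
       restrict (\<lambda>z. restrict (\<lambda>z. e z \<diamondop> (v \<triangleleft> FObj K z)) (Obj M) z \<diamondop> (u \<triangleleft> FObj K z)) (Obj M)"
      using HomC[OF u] HomC[OF v] e by (intro restrict_ext) (simp add: rw_Comp)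
  next
    fix a e assume a: "a \<in> Obj C"
    let ?z = "\<lambda>a. restrict (\<lambda>x. Zero N (a \<star> FObj K x) (FObj L x)) (Obj M)"
    show "?z a \<in> families M K L a"
    proof (rule famI)
      fix f assume f: "f \<in> Arr M"
      show "FMor L f \<diamondop> Zero N (a \<star> FObj K (Dom M f)) (FObj L (Dom M f)) =
         Zero N (a \<star> FObj K (Cod M f)) (FObj L (Cod M f)) \<diamondop> (a \<triangleright> FMor K f)"
        using f a by (simp add: N.Comp_Zero(1)[OF _ LH[OF f]] N.Comp_Zero(2)[OF _ KH[OF f a]])
    qed (use a in \<open>simp add: N.Zero_in_Hom\<close>)
    assume e: "e \<in> families M K L a"
    have ext: "restrict \<xi> (Obj M) = e" if "\<And>x. x \<in> Obj M \<Longrightarrow> \<xi> x = e x" for \<xi>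
      using e that by (auto simp: families_def restrict_def extensional_def)
    show "restrict (\<lambda>z. e z \<diamondop> (Idn C a \<triangleleft> FObj K z)) (Obj M) = e"
      by (rule ext) (use a e in simp)
    show "restrict (\<lambda>x. Add N (?z a x) (e x)) (Obj M) = e"
      by (rule ext) (use N.Add_Zero[OF famH[OF e]] in simp)
    show "restrict (\<lambda>x. Add N (e x) (?z a x)) (Obj M) = e"
    proof (rule ext)
      fix x assume x: "x \<in> Obj M"
      then show "Add N (e x) (?z a x) = e x"
        using N.Add_Zero[OF famH[OF e x]] N.Add_commute[OF famH[OF e x] N.Zero_in_Hom] a by simp
    qed
    show "restrict (\<lambda>x. Add N (e x) (e' x)) (Obj M) \<in> families M K L a" if e': "e' \<in> families M K L a" for e'
    proof (rule famI)
      fix f assume f: "f \<in> Arr M"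
      then have D: "Dom M f \<in> Obj M" and C: "Cod M f \<in> Obj M" by simp_all
      show "FMor L f \<diamondop> Add N (e (Dom M f)) (e' (Dom M f)) = Add N (e (Cod M f)) (e' (Cod M f)) \<diamondop> (a \<triangleright> FMor K f)"
        using N.Comp_Add_right[OF famH[OF e D] famH[OF e' D] LH[OF f]] N.Comp_Add_left[OF KH[OF f a] famH[OF e C] famH[OF e' C]]
          families_nat[OF e f] families_nat[OF e' f] by simp
    qed (use N.Add_in_Hom famH[OF e] famH[OF e'] in simp)
  next
    fix a b e assume a: "a \<in> Obj C" and b: "b \<in> Obj C" and e: "e \<in> families M K L b"
    show "restrict (\<lambda>z. e z \<diamondop> (Zero C a b \<triangleleft> FObj K z)) (Obj M) = restrict (\<lambda>x. Zero N (a \<star> FObj K x) (FObj L x)) (Obj M)"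
    proof (rule restrict_ext)
      fix z assume z: "z \<in> Obj M"
      have Z: "Zero C a b \<in> Hom C a b" by (rule C.Zero_in_Hom[OF a b])
      have "Zero C a b \<triangleleft> FObj K z = Scale N 0 (Zero C a b \<triangleleft> FObj K z)"
        using ActMor_Scale_left[OF Z N.Idn_in_Hom[of "FObj K z"], of 0] C.Scale_0[OF Z] z by (simp add: rw_def)
      also have "\<dots> = Zero N (a \<star> FObj K z) (b \<star> FObj K z)"
        by (rule N.Scale_0[OF rwH[OF Z]]) (use z in simp)
      finally show "e z \<diamondop> (Zero C a b \<triangleleft> FObj K z) = Zero N (a \<star> FObj K z) (FObj L z)"
        using N.Comp_Zero(1)[OF _ famH[OF e z]] a z by simp
    qed
  next
    fix t p e assume cok: "is_cokernel C t p" and e: "e \<in> families M K L (Dom C p)"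
      and 0: "restrict (\<lambda>z. e z \<diamondop> (t \<triangleleft> FObj K z)) (Obj M) = restrict (\<lambda>x. Zero N (Dom C t \<star> FObj K x) (FObj L x)) (Obj M)"
    have tp [simp]: "t \<in> Arr C" "p \<in> Arr C" "Dom C p = Cod C t" using cok by (simp_all add: is_cokernel_def)
    let ?a = "Cod C t" and ?b = "Cod C p"
    have e' [simp]: "e x \<in> Arr N" "Dom N (e x) = ?a \<star> FObj K x" "Cod N (e x) = FObj L x" if "x \<in> Obj M" for x
      using e that by simp_all
    note cokx = act_exact[OF cok]
    have "\<exists>k. k \<in> Hom N (?b \<star> FObj K x) (FObj L x) \<and> k \<diamondop> (p \<triangleleft> FObj K x) = e x" if x: "x \<in> Obj M" for x
    proof -
      have "e x \<diamondop> (t \<triangleleft> FObj K x) = Zero N (Dom C t \<star> FObj K x) (FObj L x)"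
        using fun_cong[OF 0, of x] x by simp
      then show ?thesis
        using cokernel_factor[OF cokx[of "FObj K x"], of "e x" "FObj L x"] x by simp
    qed
    then obtain k where k: "\<And>x. x \<in> Obj M \<Longrightarrow> k x \<in> Hom N (?b \<star> FObj K x) (FObj L x)"
      and kp: "\<And>x. x \<in> Obj M \<Longrightarrow> k x \<diamondop> (p \<triangleleft> FObj K x) = e x" by metis
    have k' [simp]: "k x \<in> Arr N" "Dom N (k x) = ?b \<star> FObj K x" "Cod N (k x) = FObj L x" if "x \<in> Obj M" for x
      using k[OF that] by (auto simp: Hom_def)
    \<comment> \<open>The descended components form a natural family, since an arrow out of a
      cokernel is determined by its composite with it.\<close>
    have "restrict k (Obj M) \<in> families M K L ?b"
    proof (rule famI)
      fix f assume f [simp]: "f \<in> Arr M"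
      let ?x = "Dom M f" and ?y = "Cod M f"
      have "(FMor L f \<diamondop> k ?x) \<diamondop> (p \<triangleleft> FObj K ?x) = FMor L f \<diamondop> e ?x" using kp[of ?x] by simp
      also have "\<dots> = e ?y \<diamondop> (?a \<triangleright> FMor K f)" using families_nat[OF e f] by simp
      also have "\<dots> = k ?y \<diamondop> (p \<triangleleft> FObj K ?y) \<diamondop> (?a \<triangleright> FMor K f)" using kp[of ?y] by (simp flip: N.assoc)
      also have "\<dots> = (k ?y \<diamondop> (?b \<triangleright> FMor K f)) \<diamondop> (p \<triangleleft> FObj K ?x)"
        using interchange[of p "FMor K f" ?a ?b] by simp
      finally have eq: "(FMor L f \<diamondop> k ?x) \<diamondop> (p \<triangleleft> FObj K ?x) = (k ?y \<diamondop> (?b \<triangleright> FMor K f)) \<diamondop> (p \<triangleleft> FObj K ?x)" .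
      have x: "FObj K ?x \<in> Obj N" by simp
      show "FMor L f \<diamondop> k ?x = k ?y \<diamondop> (?b \<triangleright> FMor K f)"
        by (rule cokernel_cancel[OF cokx[OF x] N.linear_category_axioms _ _ eq, of "FObj L ?y"]) (simp_all add: Hom_def)
    qed (rule k)
    moreover have "restrict (\<lambda>z. restrict k (Obj M) z \<diamondop> (p \<triangleleft> FObj K z)) (Obj M) = e"
      using e kp by (auto simp: families_def restrict_def extensional_def)
    ultimately show "\<exists>e' \<in> families M K L ?b. restrict (\<lambda>z. e' z \<diamondop> (p \<triangleleft> FObj K z)) (Obj M) = e" by blast
  next
    fix a assume a: "a \<in> Obj C"
    obtain d A F G \<eta> \<epsilon> where "finite_equivalence N d A F G \<eta> \<epsilon>" using finite_linear_categoryE[OF N] by blast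
    then interpret E: finite_equivalence N d A F G \<eta> \<epsilon> .
    let ?H = "Hom N (a \<star> FObj K P) (FObj L P)"
    have "a \<star> FObj K P \<in> Obj N" "FObj L P \<in> Obj N" using P a by simp_all
    from E.Hom_finite_dim[OF this] obtain m and \<phi> :: "'q \<Rightarrow> nat \<Rightarrow> 'k"
      where \<phi>: "(\<forall>e \<in> ?H. \<forall>e' \<in> ?H. \<forall>i. \<phi> (Add N e e') i = \<phi> e i + \<phi> e' i) \<and>
       (\<forall>a. \<forall>e \<in> ?H. \<forall>i. \<phi> (Scale N a e) i = a * \<phi> e i) \<and>
       (\<forall>e \<in> ?H. (\<forall>i<m. \<phi> e i = 0) \<longrightarrow> e = Zero N (a \<star> FObj K P) (FObj L P))"
      by (elim exE)
    show "\<exists>m (\<phi> :: ('o \<Rightarrow> 'q) \<Rightarrow> nat \<Rightarrow> 'k). (\<forall>e \<in> families M K L a. \<forall>e' \<in> families M K L a. \<forall>i.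
           \<phi> (restrict (\<lambda>x. Add N (e x) (e' x)) (Obj M)) i = \<phi> e i + \<phi> e' i) \<and>
       (\<forall>k. \<forall>e \<in> families M K L a. \<forall>i. \<phi> (restrict (\<lambda>x. Scale N k (e x)) (Obj M)) i = k * \<phi> e i) \<and>
       (\<forall>e \<in> families M K L a. (\<forall>i<m. \<phi> e i = 0) \<longrightarrow> e = restrict (\<lambda>x. Zero N (a \<star> FObj K x) (FObj L x)) (Obj M))"
    \<comment> \<open>The coordinates of a family are those of its component at
      \<open>P\<close>.\<close>
    proof (intro exI[of _ m] exI[of _ "\<lambda>e. \<phi> (e P)"] conjI ballI allI impI)
      fix e assume e: "e \<in> families M K L a" and "\<forall>i<m. \<phi> (e P) i = 0"
      then have "e P = Zero N (a \<star> FObj K P) (FObj L P)" using \<phi> famH[OF e P] by blast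
      then have "e x = Zero N (a \<star> FObj K x) (FObj L x)" if "x \<in> Obj M" for x using joint[OF a e _ that] by blast
      then show "e = restrict (\<lambda>x. Zero N (a \<star> FObj K x) (FObj L x)) (Obj M)"
        using e by (auto simp: families_def extensional_def)
    next
      fix e e' i assume "e \<in> families M K L a" "e' \<in> families M K L a"
      then have "e P \<in> ?H" "e' P \<in> ?H" using famH[OF _ P] by blast+
      then show "\<phi> (restrict (\<lambda>x. Add N (e x) (e' x)) (Obj M) P) i = \<phi> (e P) i + \<phi> (e' P) i" using \<phi> P by simp
    next
      fix k e i assume "e \<in> families M K L a"
      then have "e P \<in> ?H" using famH[OF _ P] by blast
      then show "\<phi> (restrict (\<lambda>x. Scale N k (e x)) (Obj M) P) i = k * \<phi> (e P) i" using \<phi> P by simp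
    qed
  qed
qed

lemma universal_families_exist:
  fixes M :: "('o, 'm, 'y) cat_scheme"
  assumes C: "finite_linear_category C" and M: "category M" and K: "is_functor M N K" and L: "is_functor M N L"
    and act_exact: "\<And>t p y. is_cokernel C t p \<Longrightarrow> y \<in> Obj N \<Longrightarrow> is_cokernel N (t \<triangleleft> y) (p \<triangleleft> y)"
    and N: "finite_linear_category N"
    and P: "P \<in> Obj M" and joint: "\<And>a \<xi> x. \<lbrakk>a \<in> Obj C; \<xi> \<in> families M K L a; \<xi> P = Zero N (a \<star> FObj K P) (FObj L P); x \<in> Obj M\<rbrakk>
        \<Longrightarrow> \<xi> x = Zero N (a \<star> FObj K x) (FObj L x)"
  shows "\<exists>g \<epsilon>. g \<in> Obj C \<and> \<epsilon> \<in> families M K L g \<and> (\<forall>a \<in> Obj C. \<forall>\<xi> \<in> families M K L a.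
    \<exists>!u. u \<in> Hom C a g \<and> (\<forall>x \<in> Obj M. \<epsilon> x \<diamondop> (u \<triangleleft> FObj K x) = \<xi> x))"
proof -
  have "\<exists>g \<epsilon>. represents C (families M K L) (\<lambda>u \<xi>. restrict (\<lambda>x. \<xi> x \<diamondop> (u \<triangleleft> FObj K x)) (Obj M)) g \<epsilon>"
    by (rule presheaf_represents[OF C families_presheaf[where M = M and K = K and L = L and P = P, OF M K L _ N P]])
      (erule (1) act_exact, erule (3) joint)
  then obtain g \<epsilon> where g: "represents C (families M K L) (\<lambda>u \<xi>. restrict (\<lambda>x. \<xi> x \<diamondop> (u \<triangleleft> FObj K x)) (Obj M)) g \<epsilon>"
    by blast
  have "restrict (\<lambda>x. \<epsilon> x \<diamondop> (u \<triangleleft> FObj K x)) (Obj M) = \<xi> \<longleftrightarrow> (\<forall>x \<in> Obj M. \<epsilon> x \<diamondop> (u \<triangleleft> FObj K x) = \<xi> x)"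
    if "\<xi> \<in> families M K L a" for a \<xi> u
    using that by (auto simp: families_def restrict_def extensional_def)
  then show ?thesis
    using g unfolding represents_def by (intro exI[of _ g] exI[of _ \<epsilon>]) (simp cong: conj_cong)
qed

text \<open>The internal Hom is the case of a one-point category \<open>M\<close>.\<close>

lemma universal_element_exists:
  assumes C: "finite_linear_category C" and N: "finite_linear_category N"
    and act_exact: "\<And>t p y. is_cokernel C t p \<Longrightarrow> y \<in> Obj N \<Longrightarrow> is_cokernel N (t \<triangleleft> y) (p \<triangleleft> y)"
    and x: "x \<in> Obj N" and y: "y \<in> Obj N"
  shows "\<exists>g e. act.universal x y g e"
proof -
  define M where "M = \<lparr>Obj = {()}, Arr = {()}, Dom = (\<lambda>_. ()), Cod = (\<lambda>_. ()), Idn = (\<lambda>_. ()), Comp = (\<lambda>_ _. ())\<rparr>"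
  define K :: "'p \<Rightarrow> (unit, unit, 'p, 'q) funct" where "K z = \<lparr>FObj = (\<lambda>_. z), FMor = (\<lambda>_. Idn N z)\<rparr>" for z
  have M: "category M" by unfold_locales (simp_all add: M_def Hom_def)
  have K: "is_functor M N (K z)" if "z \<in> Obj N" for z using that by (simp add: is_functor_def K_def M_def Hom_def)
  have "\<exists>g \<epsilon>. g \<in> Obj C \<and> \<epsilon> \<in> families M (K x) (K y) g \<and> (\<forall>a \<in> Obj C. \<forall>\<xi> \<in> families M (K x) (K y) a.
      \<exists>!u. u \<in> Hom C a g \<and> (\<forall>z \<in> Obj M. \<epsilon> z \<diamondop> (u \<triangleleft> FObj (K x) z) = \<xi> z))"
    by (rule universal_families_exist[where M = M and K = "K x" and L = "K y" and P = "()", OF C M K[OF x] K[OF y] _ N])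
      (erule (1) act_exact, simp_all add: M_def)
  then obtain g \<epsilon> where g: "g \<in> Obj C" "\<epsilon> \<in> families M (K x) (K y) g"
    and u: "\<And>a \<xi>. \<lbrakk>a \<in> Obj C; \<xi> \<in> families M (K x) (K y) a\<rbrakk> \<Longrightarrow> \<exists>!u. u \<in> Hom C a g \<and> \<epsilon> () \<diamondop> (u \<triangleleft> x) = \<xi> ()"
    by (auto simp: M_def K_def)
  have fam: "\<xi> \<in> families M (K x) (K y) a \<longleftrightarrow> \<xi> () \<in> Hom N (a \<star> x) y" if "a \<in> Obj C" for a \<xi>
    using that x y by (auto simp: families_def M_def K_def Hom_def extensional_def)
  have "act.universal x y g (\<epsilon> ())"
    unfolding act.universal_def using g u[OF _ fam[THEN iffD2], of _ "\<lambda>_. k" for k] fam by (auto simp: rw_def)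
  then show ?thesis by blast
qed

end

section \<open>The opposite of a finite linear category\<close>

definition op_alg :: "'a ring \<Rightarrow> 'a ring" where
  "op_alg A = A\<lparr>mult := (\<lambda>x y. mult A y x)\<rparr>"

text \<open>The dual module in matrices: transposition makes modules over \<open>A\<close> into
  modules over the opposite algebra. It is a strict involution, so no isomorphism with a double dual
  intervenes.\<close>

definition op_mod :: "'k fdmod \<Rightarrow> 'k::field fdmod" where
  "op_mod V = (fst V, \<lambda>a. transpose_mat (snd V a))"

definition op_hom :: "'k fdmod \<times> 'k mat \<times> 'k fdmod \<Rightarrow> 'k::field fdmod \<times> 'k mat \<times> 'k fdmod" where
  "op_hom t = (op_mod (snd (snd t)), transpose_mat (fst (snd t)), op_mod (fst t))"

lemma op_alg_simps [simp]:
  "carrier (op_alg A) = carrier A" "x \<otimes>\<^bsub>op_alg A\<^esub> y = y \<otimes>\<^bsub>A\<^esub> x" "\<one>\<^bsub>op_alg A\<^esub> = \<one>\<^bsub>A\<^esub>"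
  "\<zero>\<^bsub>op_alg A\<^esub> = \<zero>\<^bsub>A\<^esub>" "add (op_alg A) = add A" "op_alg (op_alg A) = A"
  by (simp_all add: op_alg_def)

lemma op_mod_simps [simp]:
  "fst (op_mod V) = fst V" "snd (op_mod V) a = transpose_mat (snd V a)" "op_mod (op_mod V) = V"
  by (simp_all add: op_mod_def)

lemma op_hom_op_hom [simp]: "op_hom (op_hom t) = t"
  by (simp add: op_hom_def)

lemma (in fd_alg) fd_alg_op: "fd_alg d (op_alg A)"
proof -
  interpret A: ring A by (rule A_ring)
  have "ring (op_alg A)"
  proof (rule ringI)
    show "abelian_group (op_alg A)"
      using A.abelian_group_axioms by (simp add: abelian_group_def abelian_monoid_def abelian_group_axioms_def)
    show "monoid (op_alg A)"
      by (rule monoidI) (use A.ring_simprules in \<open>simp_all del: A_carrier\<close>)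
  qed (use A.ring_simprules in \<open>simp_all del: A_carrier\<close>)
  then show ?thesis
    using alg by (simp add: fd_alg_def fd_algebra_def)
qed

context fd_alg
begin

lemma op_module: "fd_module A V \<Longrightarrow> fd_module (op_alg A) (op_mod V)"
proof -
  assume V: "fd_module A V"
  note m = moduleD[OF V]
  have "transpose_mat (snd V (y \<otimes>\<^bsub>A\<^esub> x)) = transpose_mat (snd V x) * transpose_mat (snd V y)"
    if "x \<in> carrier_vec d" "y \<in> carrier_vec d" for x y
    using transpose_mult[OF m(1)[OF that(2)] m(1)[OF that(1)]] m(4) that by simp
  moreover have "transpose_mat (snd V (x + y)) = transpose_mat (snd V x) + transpose_mat (snd V y)"
    if "x \<in> carrier_vec d" "y \<in> carrier_vec d" for x y
    using transpose_add[OF m(1)[OF that(1)] m(1)[OF that(2)]] m(2) that by simp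
  moreover have "transpose_mat (snd V (a \<cdot>\<^sub>v x)) = a \<cdot>\<^sub>m transpose_mat (snd V x)" if "x \<in> carrier_vec d" for a x
    using m(1)[OF that] m(3)[OF that] by (auto intro!: eq_matI)
  ultimately show ?thesis
    using m by (simp add: fd_module_def A_add)
qed

lemma op_hom_functor:
  shows "t \<in> Arr D \<Longrightarrow> op_hom t \<in> Arr (fd_module_cat (op_alg A))"
    "Dom (fd_module_cat (op_alg A)) (op_hom t) = op_mod (Cod D t)"
    "Cod (fd_module_cat (op_alg A)) (op_hom t) = op_mod (Dom D t)"
    "op_hom (Idn D V) = Idn (fd_module_cat (op_alg A)) (op_mod V)"
    "\<lbrakk>t \<in> Arr D; s \<in> Arr D; Dom D s = Cod D t\<rbrakk> \<Longrightarrow> op_hom (s \<cdot>\<^bsub>D\<^esub> t) = op_hom t \<cdot>\<^bsub>fd_module_cat (op_alg A)\<^esub> op_hom s"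
    "\<lbrakk>t \<in> Arr D; s \<in> Arr D; Dom D s = Dom D t; Cod D s = Cod D t\<rbrakk> \<Longrightarrow> op_hom (Add D t s) = Add (fd_module_cat (op_alg A)) (op_hom t) (op_hom s)"
    "t \<in> Arr D \<Longrightarrow> op_hom (Scale D a t) = Scale (fd_module_cat (op_alg A)) a (op_hom t)"
proof -
  interpret op: fd_alg d "op_alg A" by (rule fd_alg_op)
  obtain V X W where t [simp]: "t = (V, X, W)" by (cases t) auto
  obtain V' Y W' where s [simp]: "s = (V', Y, W')" by (cases s) auto
  show "Dom op.D (op_hom t) = op_mod (Cod D t)" "Cod op.D (op_hom t) = op_mod (Dom D t)"
    "op_hom (Idn D V) = Idn op.D (op_mod V)" for V
    by (simp_all add: op_hom_def)
  show "op_hom t \<in> Arr op.D" if a: "t \<in> Arr D"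
  proof -
    have m: "fd_module A V" "fd_module A W" and X: "X \<in> carrier_mat (fst W) (fst V)"
      and eq: "\<And>x. x \<in> carrier_vec d \<Longrightarrow> X * snd V x = snd W x * X" using a by auto
    have "transpose_mat X * transpose_mat (snd W x) = transpose_mat (snd V x) * transpose_mat X" if x: "x \<in> carrier_vec d" for x
      using eq[OF x] transpose_mult[OF X moduleD(1)[OF m(1) x]] transpose_mult[OF moduleD(1)[OF m(2) x] X] by simp
    then show ?thesis using X m op_module by (simp add: op_hom_def)
  qed
  show "op_hom (s \<cdot>\<^bsub>D\<^esub> t) = op_hom t \<cdot>\<^bsub>op.D\<^esub> op_hom s" if "t \<in> Arr D" "s \<in> Arr D" "Dom D s = Cod D t"
    using that transpose_mult[of Y "fst W'" "fst W" X "fst V"] by (simp add: op_hom_def)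
  show "op_hom (Add D t s) = Add op.D (op_hom t) (op_hom s)" if "t \<in> Arr D" "s \<in> Arr D" "Dom D s = Dom D t" "Cod D s = Cod D t"
    using that transpose_add[of X "fst W" "fst V" Y] by (simp add: op_hom_def)
  show "op_hom (Scale D a t) = Scale op.D a (op_hom t)" if "t \<in> Arr D"
    using that by (simp add: op_hom_def) (auto intro!: eq_matI)
qed

end

text \<open>The reversed equivalence is composed with transposition of modules. The general form of
  \<open>X\<close> covers both \<open>op_tensor\<close> and \<open>op_module\<close>.\<close>

lemma finite_linear_category_op:
  fixes C :: "('k::field, 'o, 'm, 'z) lin_cat_scheme" and X :: "('k, 'o, 'm, 'y) lin_cat_scheme"
  assumes fin: "finite_linear_category C"
    and X: "Obj X = Obj C" "Arr X = Arr C" "Dom X = Cod C" "Cod X = Dom C" "Idn X = Idn C"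
    "\<And>f g. f \<cdot>\<^bsub>X\<^esub> g = g \<cdot>\<^bsub>C\<^esub> f" "\<And>x y. Zero X x y = Zero C y x" "Add X = Add C" "Scale X = Scale C"
  shows "finite_linear_category X"
proof -
  obtain d A F G \<eta> \<epsilon> where "finite_equivalence C d A F G \<eta> \<epsilon>" using finite_linear_categoryE[OF fin] by blast
  then interpret finite_equivalence C d A F G \<eta> \<epsilon> .
  interpret op: fd_alg d "op_alg A" by (rule fd_alg_op)
  note [simp del] = D_simps op.D_simps
  have opO [simp]: "op_mod V \<in> Obj op.D" if "V \<in> Obj D" for V using op_module[of V] that by (simp add: D_simps op.D_simps)
  have Oop [simp]: "op_mod V \<in> Obj D" if "V \<in> Obj op.D" for V using op.op_module[of V] that by (simp add: D_simps op.D_simps)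
  note [simp] = op_hom_functor(1-5) op.op_hom_functor(1-5)[unfolded op_alg_simps]
  have H: "Hom X x y = Hom C y x" for x y using X by (auto simp: Hom_def)
  have iso: "iso_arr X f = iso_arr C f" for f
  proof -
    have "inverse_arrows X f g = inverse_arrows C f g" for g using X H by (auto simp: inverse_arrows_def)
    then show ?thesis by (simp add: iso_arr_def)
  qed
  define F' :: "('o, 'm, 'k fdmod, 'k fdmod \<times> 'k mat \<times> 'k fdmod) funct"
    where "F' = \<lparr>FObj = (\<lambda>x. op_mod (FObj F x)), FMor = (\<lambda>f. op_hom (FMor F f))\<rparr>"
  define G' :: "('k fdmod, 'k fdmod \<times> 'k mat \<times> 'k fdmod, 'o, 'm) funct"
    where "G' = \<lparr>FObj = (\<lambda>V. FObj G (op_mod V)), FMor = (\<lambda>t. FMor G (op_hom t))\<rparr>"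
  have "is_linear_functor X op.D F'"
    unfolding is_linear_functor_def is_functor_def
  proof (intro conjI ballI allI impI)
    fix x y f g assume "x \<in> Obj X" "y \<in> Obj X" "f \<in> Hom X x y" "g \<in> Hom X x y"
    then have *: "f \<in> Hom C y x" "g \<in> Hom C y x" "y \<in> Obj C" "x \<in> Obj C" by (simp_all add: H X)
    moreover from * have "FMor F f \<in> Arr D" "FMor F g \<in> Arr D" "Dom D (FMor F g) = Dom D (FMor F f)" "Cod D (FMor F g) = Cod D (FMor F f)"
      by (auto simp: Hom_def)
    ultimately show "FMor F' (Add X f g) = Add op.D (FMor F' f) (FMor F' g)"
      using linear_functor_Add[OF F *] op_hom_functor(6)[of "FMor F f" "FMor F g"] by (simp add: F'_def X)
  qed (simp_all add: X F'_def Hom_def linear_functorD(7)[OF F] op_hom_functor(7))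
  moreover have "is_linear_functor op.D X G'"
    unfolding is_linear_functor_def is_functor_def
  proof (intro conjI ballI allI impI)
    fix x y f g assume xy: "x \<in> Obj op.D" "y \<in> Obj op.D" and fg: "f \<in> Hom op.D x y" "g \<in> Hom op.D x y"
    then have *: "op_hom f \<in> Hom D (op_mod y) (op_mod x)" "op_hom g \<in> Hom D (op_mod y) (op_mod x)" "op_mod y \<in> Obj D" "op_mod x \<in> Obj D"
      by (auto simp: Hom_def)
    have "op_hom (Add op.D f g) = Add D (op_hom f) (op_hom g)"
      using op.op_hom_functor(6)[of f g] fg by (simp add: Hom_def)
    then show "FMor G' (Add op.D f g) = Add X (FMor G' f) (FMor G' g)"
      using linear_functor_Add[OF G *] by (simp add: G'_def X)
  next
    fix a f assume "f \<in> Arr op.D"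
    then show "FMor G' (Scale op.D a f) = Scale X a (FMor G' f)"
      using op.op_hom_functor(7)[of f a] linear_functorD(7)[OF G, of "op_hom f" a] by (simp add: G'_def X)
  qed (simp_all add: X G'_def Hom_def)
  \<comment> \<open>Reversal turns the natural isomorphisms around, so their inverses take their
    place.\<close>
  moreover have "is_nat_iso X X id_functor (comp_functor G' F') (\<lambda>x. inv_arr C (\<eta> x))"
    unfolding is_nat_iso_def is_nat_transf_def
  proof (intro conjI ballI)
    fix f assume f: "f \<in> Arr X"
    then show "FMor (comp_functor G' F') f \<cdot>\<^bsub>X\<^esub> inv_arr C (\<eta> (Dom X f)) = inv_arr C (\<eta> (Cod X f)) \<cdot>\<^bsub>X\<^esub> FMor id_functor f"
      using C.square_inv[OF \<eta>_nat[of f, symmetric]] by (simp add: X comp_functor_def id_functor_def F'_def G'_def)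
  qed (simp_all add: iso H X comp_functor_def id_functor_def F'_def G'_def Hom_def)
  moreover have "is_nat_iso op.D op.D (comp_functor F' G') id_functor (\<lambda>V. op_hom (inv_arr D (\<epsilon> (op_mod V))))"
    unfolding is_nat_iso_def is_nat_transf_def
  proof (intro conjI ballI)
    fix t assume t: "t \<in> Arr op.D"
    interpret opc: category op.D by (rule op.D_category)
    let ?s = "op_hom t" and ?V = "op_mod (Dom op.D t)" and ?W = "op_mod (Cod op.D t)"
    have s [simp]: "?s \<in> Arr D" "Dom D ?s = ?W" "Cod D ?s = ?V" "?V \<in> Obj D" "?W \<in> Obj D" using t by simp_all
    have "FMor F (FMor G ?s) \<cdot>\<^bsub>D\<^esub> inv_arr D (\<epsilon> ?W) = inv_arr D (\<epsilon> ?V) \<cdot>\<^bsub>D\<^esub> ?s"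
      using D.square_inv[OF \<epsilon>_nat[of ?s, symmetric]] by simp
    then have "op_hom (FMor F (FMor G ?s) \<cdot>\<^bsub>D\<^esub> inv_arr D (\<epsilon> ?W)) = op_hom (inv_arr D (\<epsilon> ?V) \<cdot>\<^bsub>D\<^esub> ?s)" by simp
    then show "FMor id_functor t \<cdot>\<^bsub>op.D\<^esub> op_hom (inv_arr D (\<epsilon> ?V)) = op_hom (inv_arr D (\<epsilon> ?W)) \<cdot>\<^bsub>op.D\<^esub> FMor (comp_functor F' G') t"
      by (simp add: comp_functor_def id_functor_def F'_def G'_def)
  next
    fix V assume V: "V \<in> Obj op.D"
    show "op_hom (inv_arr D (\<epsilon> (op_mod V))) \<in> Hom op.D (FObj (comp_functor F' G') V) (FObj id_functor V)"
      using V by (simp add: comp_functor_def id_functor_def F'_def G'_def Hom_def)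
    let ?e = "\<epsilon> (op_mod V)"
    have "op_hom ?e \<cdot>\<^bsub>op.D\<^esub> op_hom (inv_arr D ?e) = op_hom (inv_arr D ?e \<cdot>\<^bsub>D\<^esub> ?e)"
      "op_hom (inv_arr D ?e) \<cdot>\<^bsub>op.D\<^esub> op_hom ?e = op_hom (?e \<cdot>\<^bsub>D\<^esub> inv_arr D ?e)"
      using V op_hom_functor(5)[of ?e "inv_arr D ?e"] op_hom_functor(5)[of "inv_arr D ?e" ?e] by simp_all
    then have "inverse_arrows op.D (op_hom (inv_arr D ?e)) (op_hom ?e)"
      using V by (simp add: inverse_arrows_def Hom_def)
    then show "iso_arr op.D (op_hom (inv_arr D ?e))" unfolding iso_arr_def by (rule exI)
  qed
  ultimately have "linearly_equivalent X op.D"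
    unfolding linearly_equivalent_def by blast
  moreover have "linear_category X" by (rule C.linear_category_op) (use X in simp_all)
  ultimately show ?thesis
    using op.alg unfolding finite_linear_category_def by blast
qed

section \<open>Finite module categories\<close>

text \<open>Both halves of \<open>exact_act\<close> are called upon: preservation of cokernels for
  families from \<open>a.F\<close> to \<open>G\<close>, and preservation of kernels for families
  from \<open>G\<close> to \<open>a.F\<close>.\<close>

locale finite_modules = center_action C N M
  for C :: "('k::field, 'c, 'd, 'z) tensor_cat_scheme"
    and N :: "('k, 'c, 'd, 'p, 'q, 'x) module_cat_scheme"
    and M :: "('k, 'c, 'd, 'o, 'm, 'y) module_cat_scheme" +
  assumes finite_C: "finite_linear_category C" and finite_N: "finite_linear_category N" and finite_M: "finite_linear_category M"
    and exact_act: "x \<in> Obj N \<Longrightarrow> exact C N \<lparr>FObj = (\<lambda>c. c \<rhd>\<^sub>o\<^bsub>N\<^esub> x), FMor = (\<lambda>f. f \<rhd>\<^sub>m\<^bsub>N\<^esub> Idn N x)\<rparr>"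

lemma finite_module_category_module:
  assumes "finite_module_category C N"
  shows "module_category C N" "rigid_category C"
proof -
  interpret N: finite_module_category C N by fact
  show "module_category C N"
    by unfold_locales
      (fact N.ActObj_in_Obj N.ActMor_in_Hom N.ActMor_Idn N.ActMor_Comp N.ActMor_Add_left N.ActMor_Scale_left
        N.MAssoc_in_Hom N.MAssoc_iso N.MAssoc_natural N.MUnit_in_Hom N.MUnit_iso N.MUnit_natural
        N.module_pentagon N.module_triangle)+
  show "rigid_category C"
    by unfold_locales (fact N.C.right_dual N.C.left_dual)+
qed

lemma finite_modulesI:
  assumes N: "finite_module_category C N" and M: "finite_module_category C M"
  shows "finite_modules C N M"
proof -
  interpret N: finite_module_category C N by (rule N)
  interpret M: finite_module_category C M by (rule M)
  show ?thesis
    by (intro finite_modules.intro finite_modules_axioms.intro center_action.intro center_action_axioms.intro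
        module_functors.intro module_functors_axioms.intro rigid_module_category.intro
        finite_module_category_module[OF N] finite_module_category_module[OF M]
        N.act_right_exact_right N.act_exact_left N.finite_linear_M M.finite_linear_M N.C.finite_linear)
qed

lemma is_cokernel_op:
  "is_cokernel (op_tensor C) f q \<longleftrightarrow> is_kernel C f q" "is_cokernel (op_module N) g r \<longleftrightarrow> is_kernel N g r"
  unfolding is_cokernel_def is_kernel_def by simp_all

context module_functors
begin

lemma functor_op:
  assumes "is_module_functor C M N K"
  shows "is_functor (op_module M) (op_module N) K"
  using assms by (simp add: is_module_functor_def is_linear_functor_def is_functor_def)

end

context finite_modules
begin

lemma cokernel_rw: "is_cokernel C t p \<Longrightarrow> y \<in> Obj N \<Longrightarrow> is_cokernel N (t \<triangleleft> y) (p \<triangleleft> y)"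
  using exact_act[of y] by (simp add: exact_def right_exact_def rw_def)

lemma kernel_rw: "is_kernel C t p \<Longrightarrow> y \<in> Obj N \<Longrightarrow> is_kernel N (t \<triangleleft> y) (p \<triangleleft> y)"
  using exact_act[of y] by (simp add: exact_def left_exact_def rw_def)

lemma finite_op:
  "finite_linear_category (op_tensor C)" "finite_linear_category (op_module N)"
  by (rule finite_linear_category_op[OF finite_C]; simp) (rule finite_linear_category_op[OF finite_N]; simp)

lemma universal_exists_N: "\<lbrakk>x \<in> Obj N; y \<in> Obj N\<rbrakk> \<Longrightarrow> \<exists>g e. act.universal x y g e"
  by (rule universal_element_exists[OF finite_C finite_N cokernel_rw])

lemma internal_Hom_of_exists: "\<exists>H. internal_Hom_of C N H"
  by (rule act.internal_Hom_exists[OF universal_exists_N])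

lemma internal_coHom_of_exists: "\<exists>K. internal_coHom_of C N K"
proof -
  interpret op: module_category "op_tensor C" "op_module N" by (rule module_op)
  have "\<exists>g e. op.act.universal x y g e" if "x \<in> Obj (op_module N)" "y \<in> Obj (op_module N)" for x y
    by (rule op.universal_element_exists[OF finite_op _ that]) (simp add: is_cokernel_op rw_op kernel_rw)
  from op.act.internal_Hom_exists[OF this] obtain K where "internal_Hom_of (op_tensor C) (op_module N) K" by blast
  then show ?thesis using internal_coHom_of_op by blast
qed

text \<open>\<open>P\<close> is the object of \<open>M\<close> that corresponds to the regular
  module. It is chosen before \<open>K\<close>, so it serves the functors \<open>a.F\<close> for all
  \<open>a\<close> as well as \<open>G\<close>.\<close>

lemma joint_generator:
  "\<exists>P \<in> Obj M. \<forall>K x h z. right_exact M N K \<longrightarrow> x \<in> Obj M \<longrightarrow> h \<in> Hom N (FObj K x) z \<longrightarrow>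
     (\<forall>t \<in> Hom M P x. h \<diamondop> FMor K t = Zero N (FObj K P) z) \<longrightarrow> h = Zero N (FObj K x) z"
proof -
  obtain d A F G \<eta> \<epsilon> where "finite_equivalence M d A F G \<eta> \<epsilon>" using finite_linear_categoryE[OF finite_M] by blast
  then interpret E: finite_equivalence M d A F G \<eta> \<epsilon> .
  have "FObj G E.P \<in> Obj M" using E.P_module by simp
  then show ?thesis using E.joint_epi[OF N.linear_category_axioms] by blast
qed

text \<open>A family from \<open>a.F\<close> to \<open>G\<close> that vanishes at \<open>P\<close>
  vanishes: by naturality its components are killed by the images of all arrows out of
  \<open>P\<close>, and \<open>a.F\<close> is right exact.\<close>

lemma universal_pair_exists:
  assumes F: "F \<in> Obj (Rex C M N)" and G: "G \<in> Obj (Rex C M N)"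
  shows "\<exists>g \<epsilon>. universal_pair C N M F G g \<epsilon>"
proof -
  have F': "is_module_functor C M N F" "right_exact M N F" and G': "is_module_functor C M N G" using F G by simp_all
  interpret module_functor_pair C N M F G by (rule pairI) (use F' G' in blast)+
  have FG: "is_functor M N F" "is_functor M N G"
    using F'(1) G' by (simp_all add: is_module_functor_def is_linear_functor_def)
  obtain P where P: "P \<in> Obj M" and joint: "\<And>(K :: ('o, 'm, 'p, 'q) funct) x h z. \<lbrakk>right_exact M N K; x \<in> Obj M; h \<in> Hom N (FObj K x) z;
      \<forall>t \<in> Hom M P x. h \<diamondop> FMor K t = Zero N (FObj K P) z\<rbrakk> \<Longrightarrow> h = Zero N (FObj K x) z"
    using joint_generator by blast
  have "\<xi> x = Zero N (a \<star> FObj F x) (FObj G x)"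
    if a: "a \<in> Obj C" and \<xi>: "\<xi> \<in> families M F G a" and 0: "\<xi> P = Zero N (a \<star> FObj F P) (FObj G P)" and x: "x \<in> Obj M" for a \<xi> x
  proof -
    let ?K = "\<lparr>FObj = (\<lambda>x. a \<star> FObj F x), FMor = (\<lambda>f. a \<triangleright> FMor F f)\<rparr> :: ('o, 'm, 'p, 'q) funct"
    have lin: "is_linear_functor M N ?K"
      by (rule linear_functor_comp[OF right_exactD(1)[OF F'(2)] right_exactD(1)[OF right_exact_act[OF a]]])
        (use M in \<open>simp_all add: lw_def module_category_def\<close>)
    have K: "right_exact M N ?K"
      using lin right_exactD(2)[OF right_exact_act[OF a]] right_exactD(2)[OF F'(2)] by (simp add: right_exact_def lw_def)
    have "\<xi> x \<diamondop> (a \<triangleright> FMor F t) = Zero N (a \<star> FObj F P) (FObj G x)" if t: "t \<in> Hom M P x" for t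
    proof -
      have t': "t \<in> Arr M" "Dom M t = P" "Cod M t = x" using t by (auto simp: Hom_def)
      then have "\<xi> x \<diamondop> (a \<triangleright> FMor F t) = FMor G t \<diamondop> Zero N (a \<star> FObj F P) (FObj G P)"
        using families_nat[OF \<xi> t'(1)] 0 by simp
      also have "\<dots> = Zero N (a \<star> FObj F P) (FObj G x)"
        by (rule N.Comp_Zero(1)) (use a P t' in \<open>simp_all add: Hom_def\<close>)
      finally show ?thesis .
    qed
    then show ?thesis using joint[OF K x, of "\<xi> x" "FObj G x"] familiesD(1)[OF \<xi> x] by simp
  qed
  then have "\<exists>g \<epsilon>. g \<in> Obj C \<and> \<epsilon> \<in> families M F G g \<and> (\<forall>a \<in> Obj C. \<forall>\<xi> \<in> families M F G a.
    \<exists>!u. u \<in> Hom C a g \<and> (\<forall>x \<in> Obj M. \<epsilon> x \<diamondop> (u \<triangleleft> FObj F x) = \<xi> x))"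
    by (intro universal_families_exist[OF finite_C category_M FG cokernel_rw finite_N P]) blast+
  then obtain g \<epsilon> where g: "g \<in> Obj C" "\<epsilon> \<in> families M F G g"
    and u: "\<And>a \<xi>. \<lbrakk>a \<in> Obj C; \<xi> \<in> families M F G a\<rbrakk> \<Longrightarrow> \<exists>!u. u \<in> Hom C a g \<and> (\<forall>x \<in> Obj M. \<epsilon> x \<diamondop> (u \<triangleleft> FObj F x) = \<xi> x)"
    by blast
  have "universal_family g \<epsilon>"
    unfolding universal_family_def
  proof (intro conjI ballI allI impI)
    show "family1 g \<epsilon>" using g(2) by (simp add: families_def family1_def)
    fix a \<xi> assume a: "a \<in> Obj C" and "family1 a \<xi>"
    then have "restrict \<xi> (Obj M) \<in> families M F G a" by (simp add: families_def family1_def)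
    from u[OF a this] show "\<exists>!u. u \<in> Hom C a g \<and> (\<forall>x \<in> Obj M. \<epsilon> x \<diamondop> (u \<triangleleft> FObj F x) = \<xi> x)"
      by (simp cong: ball_cong_simp)
  qed (rule g(1))
  then have "universal_pair C N M F G g \<epsilon>" by (intro universal_pair.intro universal_pair_axioms.intro) unfold_locales
  then show ?thesis by blast
qed

text \<open>For families from \<open>G\<close> to \<open>a.F\<close> it is right exactness of
  \<open>G\<close> that makes evaluation at \<open>P\<close> injective. The generator is still one
  of \<open>M\<close> and not of its opposite, as the components start at the values of
  \<open>G\<close>.\<close>

lemma op_universal_pair_exists:
  assumes F: "F \<in> Obj (Rex C M N)" and G: "G \<in> Obj (Rex C M N)"
  shows "\<exists>h \<epsilon>. universal_pair (op_tensor C) (op_module N) (op_module M) (op_functor N F) (op_functor N G) h \<epsilon>"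
proof -
  have F': "is_module_functor C M N F" and G': "is_module_functor C M N G" "right_exact M N G" using F G by simp_all
  interpret module_functor_pair C N M F G by (rule pairI) (use F' G' in blast)+
  interpret op: module_category "op_tensor C" "op_module N" by (rule module_op)
  obtain P where P: "P \<in> Obj M" and joint: "\<And>(K :: ('c, 'o, 'm, 'p, 'q) mfunct) x h z. \<lbrakk>right_exact M N K; x \<in> Obj M; h \<in> Hom N (FObj K x) z;
      \<forall>t \<in> Hom M P x. h \<diamondop> FMor K t = Zero N (FObj K P) z\<rbrakk> \<Longrightarrow> h = Zero N (FObj K x) z"
    using joint_generator by blast
  let ?fam = "op.families (op_module M) F G"
  have fam: "\<xi> \<in> ?fam a \<longleftrightarrow> \<xi> \<in> extensional (Obj M) \<and> (\<forall>x \<in> Obj M. \<xi> x \<in> Hom N (FObj G x) (a \<star> FObj F x)) \<and>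
     (\<forall>f \<in> Arr M. (a \<triangleright> FMor F f) \<diamondop> \<xi> (Dom M f) = \<xi> (Cod M f) \<diamondop> FMor G f)" for a \<xi>
    by (auto simp: op.families_def lw_op)
  have "\<xi> x = Zero (op_module N) (a \<star> FObj F x) (FObj G x)"
    if a: "a \<in> Obj C" and \<xi>: "\<xi> \<in> ?fam a" and 0: "\<xi> P = Zero (op_module N) (a \<star> FObj F P) (FObj G P)" and x: "x \<in> Obj M" for a \<xi> x
  proof -
    have "\<xi> x \<diamondop> FMor G t = Zero N (FObj G P) (a \<star> FObj F x)" if t: "t \<in> Hom M P x" for t
    proof -
      have t': "t \<in> Arr M" "Dom M t = P" "Cod M t = x" using t by (auto simp: Hom_def)
      then have "\<xi> x \<diamondop> FMor G t = (a \<triangleright> FMor F t) \<diamondop> Zero N (FObj G P) (a \<star> FObj F P)"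
        using \<xi> 0 by (auto simp: fam)
      also have "\<dots> = Zero N (FObj G P) (a \<star> FObj F x)"
        by (rule N.Comp_Zero(1)) (use a P t' in \<open>simp_all add: Hom_def\<close>)
      finally show ?thesis .
    qed
    moreover have "\<xi> x \<in> Hom N (FObj G x) (a \<star> FObj F x)" using \<xi> x fam by blast
    ultimately show ?thesis using joint[OF G'(2) x, of "\<xi> x" "a \<star> FObj F x"] by simp
  qed
  note joint_op = this
  have cat: "category (op_module M)" using module_category.module_op[OF M] by (simp add: module_category_def linear_category_def)
  have "\<exists>g \<epsilon>. g \<in> Obj (op_tensor C) \<and> \<epsilon> \<in> ?fam g \<and> (\<forall>a \<in> Obj (op_tensor C). \<forall>\<xi> \<in> ?fam a.
    \<exists>!u. u \<in> Hom (op_tensor C) a g \<and> (\<forall>x \<in> Obj (op_module M). \<epsilon> x \<cdot>\<^bsub>op_module N\<^esub> op.rw u (FObj F x) = \<xi> x))"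
  proof (rule op.universal_families_exist[OF finite_op(1) cat functor_op[OF F'] functor_op[OF G'(1)] _ finite_op(2), where P = P])
    show "is_cokernel (op_module N) (op.rw t y) (op.rw p y)" if "is_cokernel (op_tensor C) t p" "y \<in> Obj (op_module N)" for t p y
      using that by (simp add: is_cokernel_op rw_op kernel_rw)
    show "P \<in> Obj (op_module M)" using P by simp
    show "\<xi> x = Zero (op_module N) (op.nact a (FObj F x)) (FObj G x)"
      if "a \<in> Obj (op_tensor C)" "\<xi> \<in> ?fam a" "\<xi> P = Zero (op_module N) (op.nact a (FObj F P)) (FObj G P)" "x \<in> Obj (op_module M)" for a \<xi> x
      using joint_op[of a \<xi> x] that by simp
  qed
  then obtain h \<epsilon> where h: "h \<in> Obj C" "\<epsilon> \<in> ?fam h"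
    and u: "\<And>a \<xi>. \<lbrakk>a \<in> Obj C; \<xi> \<in> ?fam a\<rbrakk> \<Longrightarrow> \<exists>!u. u \<in> Hom C h a \<and> (\<forall>x \<in> Obj M. (u \<triangleleft> FObj F x) \<diamondop> \<epsilon> x = \<xi> x)"
    by (auto simp: rw_op)
  have "module_functor_pair.universal_family (op_tensor C) (op_module N) (op_module M) (op_functor N F) (op_functor N G) h \<epsilon>"
    unfolding op_universal_family_iff
  proof (intro conjI ballI allI impI)
    show "module_functor_pair.family1 (op_tensor C) (op_module N) (op_module M) (op_functor N F) (op_functor N G) h \<epsilon>"
      unfolding op_family1_iff using h(2) fam by blast
    fix a \<xi> assume a: "a \<in> Obj C" and "module_functor_pair.family1 (op_tensor C) (op_module N) (op_module M) (op_functor N F) (op_functor N G) a \<xi>"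
    then have "restrict \<xi> (Obj M) \<in> ?fam a" unfolding op_family1_iff fam by simp
    from u[OF a this] show "\<exists>!u. u \<in> Hom C h a \<and> (\<forall>x \<in> Obj M. (u \<triangleleft> FObj F x) \<diamondop> \<epsilon> x = \<xi> x)"
      by (simp cong: ball_cong_simp)
  qed (rule h(1))
  then have "universal_pair (op_tensor C) (op_module N) (op_module M) (op_functor N F) (op_functor N G) h \<epsilon>"
    by (intro universal_pair.intro universal_pair_axioms.intro pair_op)
  then show ?thesis by blast
qed

end

section \<open>Existence of the objects and the canonical isomorphisms\<close>

context finite_modules
begin

lemma internal_Nat_exists: "\<exists>D. internal_Nat C M N D"
proof (rule center.internal_Hom_exists)
  fix F G assume F: "F \<in> Obj (Rex C M N)" and G: "G \<in> Obj (Rex C M N)"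
  obtain g \<epsilon> where U: "universal_pair C N M F G g \<epsilon>" using universal_pair_exists[OF F G] by blast
  show "\<exists>z e. center.universal F G z e" using universal_center(2)[OF F G U refl] by blast
qed

lemma internal_coNat_exists: "\<exists>E. internal_coNat C M N E"
proof -
  interpret op: category_action "op_cat (center C)" "op_cat (Rex C M N)" "center_act_obj C N" "center_act_mor C M N"
    by (rule center.category_action_op)
  have "\<exists>z e. op.universal F G z e" if "F \<in> Obj (op_cat (Rex C M N))" "G \<in> Obj (op_cat (Rex C M N))" for F G
  proof -
    have F: "F \<in> Obj (Rex C M N)" and G: "G \<in> Obj (Rex C M N)" using that by (simp_all only: op_cat_simps)
    obtain h \<epsilon> where "universal_pair (op_tensor C) (op_module N) (op_module M) (op_functor N F) (op_functor N G) h \<epsilon>"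
      using op_universal_pair_exists[OF F G] by blast
    from op_universal_center(2)[OF F G this refl] show ?thesis by blast
  qed
  from op.internal_Hom_exists[OF this] obtain E
    where "is_internal_Hom (op_cat (center C)) (op_cat (Rex C M N)) (center_act_obj C N) (center_act_mor C M N) E" by blast
  then show ?thesis
    using internal_coHom_op[OF center.category_action_axioms, of "op_cat (center C)" "op_cat (Rex C M N)" E]
    by (auto simp only: op_cat_simps)
qed

context
  fixes F G assumes F: "F \<in> Obj (Rex C M N)" and G: "G \<in> Obj (Rex C M N)"
begin

interpretation pair: module_functor_pair C N M F G
  by (rule pairI) (use F G in simp_all)

lemma is_end_exists:
  assumes H: "internal_Hom_of C N H"
  shows "\<exists>g j. is_end M C (hom_bifun_obj H F G) (hom_bifun_mor H F G) g j"
proof -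
  obtain g \<epsilon> where "universal_pair C N M F G g \<epsilon>" using universal_pair_exists[OF F G] by blast
  then have "pair.universal_family g \<epsilon>" by (simp add: universal_pair_def universal_pair_axioms_def)
  then show ?thesis using pair.universal_end[OF H] by blast
qed

lemma is_coend_exists:
  assumes K: "internal_coHom_of C N K"
  shows "\<exists>h i. is_coend M C (hom_bifun_obj K F G) (hom_bifun_mor K F G) h i"
proof -
  let ?F = "op_functor N F" and ?G = "op_functor N G"
  have K': "internal_Hom_of (op_tensor C) (op_module N) K" using K internal_coHom_of_op by blast
  obtain h \<epsilon> where "universal_pair (op_tensor C) (op_module N) (op_module M) ?F ?G h \<epsilon>"
    using op_universal_pair_exists[OF F G] by blast
  then have "module_functor_pair.universal_family (op_tensor C) (op_module N) (op_module M) ?F ?G h \<epsilon>"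
    by (simp add: universal_pair_def universal_pair_axioms_def)
  from module_functor_pair.universal_end[OF pair.pair_op K' this] show ?thesis
    by (auto simp: is_end_op)
qed

text \<open>Both \<open>(g, \<sigma>)\<close> and \<open>HObj D F G\<close> carry universal elements
  for the action of the center, so \<open>universal_unique\<close> applies. The last condition says
  that \<open>\<theta>\<close> carries one to the other, which is what makes the isomorphism
  canonical.\<close>

lemma internal_Nat_iso_end:
  assumes H: "internal_Hom_of C N H" and D: "internal_Nat C M N D"
    and E: "is_end M C (hom_bifun_obj H F G) (hom_bifun_mor H F G) g j"
  defines "\<sigma> \<equiv> end_half_braiding C M N H F G g j"
  shows "(g, \<sigma>) \<in> Obj (center C) \<and>
    (\<exists>!\<theta>. \<theta> \<in> Hom (center C) (HObj D F G) (g, \<sigma>) \<and> iso_arr (center C) \<theta> \<and>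
      (\<forall>x \<in> Obj M. HAdj H (FObj F x) (FObj G x) (fst (HObj D F G)) (j x \<cdot>\<^bsub>C\<^esub> underlying \<theta>)
        = component (HAdj D F G (HObj D F G) (Idn (center C) (HObj D F G))) x))"
proof -
  define \<epsilon> where "\<epsilon> x = HAdj H (FObj F x) (FObj G x) g (j x)" for x
  have U: "universal_pair C N M F G g \<epsilon>"
    using pair.end_universal[OF H E] by (intro universal_pair.intro universal_pair_axioms.intro) (unfold_locales, simp add: \<epsilon>_def[abs_def])
  interpret U: universal_pair C N M F G g \<epsilon> by (rule U)
  have j: "j x \<in> Hom C g (HObj H (FObj F x) (FObj G x))" if "x \<in> Obj M" for x
    using E that by (simp add: is_end_def is_wedge_def hom_bifun_obj_def)
  have \<sigma>: "\<sigma> c = inv_arr C (U.swap c)" if "c \<in> Obj C" for c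
    unfolding \<sigma>_def by (rule U.end_half_braiding_eq[OF H j \<epsilon>_def that])
  note uc = universal_center[OF F G U \<sigma>]
  let ?z = "HObj D F G" and ?\<epsilon> = "(center_act_obj C N (g, \<sigma>) F, restrict \<epsilon> (Obj M), G)"
  let ?k = "HAdj D F G ?z (Idn (center C) ?z)"
  have UD: "center.universal F G ?z ?k" by (rule center.universal_counit[OF D F G])
  obtain b \<tau> where z: "?z = (b, \<tau>)" by (cases ?z)
  obtain \<kappa> where k: "?k = (center_act_obj C N (b, \<tau>) F, \<kappa>, G)" "\<kappa> \<in> extensional (Obj M)"
    using center.universalD(2)[OF UD] z by (metis Rex_cases)
  \<comment> \<open>Compatibility with the universal elements, expressed through the structure
    arrows of the end.\<close>
  have "?\<epsilon> \<cdot>\<^bsub>Rex C M N\<^esub> center_act_mor C M N \<theta> (Idn (Rex C M N) F) = ?k \<longleftrightarrow>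
    (\<forall>x \<in> Obj M. HAdj H (FObj F x) (FObj G x) (fst ?z) (j x \<cdot>\<^bsub>C\<^esub> underlying \<theta>) = component ?k x)"
    if \<theta>: "\<theta> \<in> Hom (center C) ?z (g, \<sigma>)" for \<theta>
  proof -
    obtain u where u: "\<theta> = ((b, \<tau>), u, (g, \<sigma>))" "u \<in> Hom C b g"
      using \<theta> z by (cases \<theta>) (auto simp: Hom_def)
    have "?\<epsilon> \<cdot>\<^bsub>Rex C M N\<^esub> center_act_mor C M N \<theta> (Idn (Rex C M N) F)
        = (center_act_obj C N (b, \<tau>) F, restrict (\<lambda>x. \<epsilon> x \<diamondop> (u \<triangleleft> FObj F x)) (Obj M), G)"
      by (auto simp: u(1) center_act_mor_def rw_def intro!: restrict_ext)
    moreover have "restrict (\<lambda>x. \<epsilon> x \<diamondop> (u \<triangleleft> FObj F x)) (Obj M) = \<kappa> \<longleftrightarrow> (\<forall>x \<in> Obj M. \<epsilon> x \<diamondop> (u \<triangleleft> FObj F x) = \<kappa> x)"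
      using k(2) by (auto simp: restrict_def extensional_def)
    moreover have "HAdj H (FObj F x) (FObj G x) b (j x \<cdot>\<^bsub>C\<^esub> u) = \<epsilon> x \<diamondop> (u \<triangleleft> FObj F x)" if "x \<in> Obj M" for x
      unfolding \<epsilon>_def by (rule pair.HAdj_rw[OF H]) (use that j u(2) in simp_all)
    ultimately show ?thesis
      unfolding k(1) by (simp add: z u(1) underlying_def component_def)
  qed
  then show ?thesis
    using uc(1) center.universal_unique[OF uc(2) UD F] by (simp cong: conj_cong)
qed

text \<open>In the opposite categories \<open>\<theta>\<close> points from
  \<open>(h, \<sigma>)\<close> to \<open>HObj D F G\<close>, so the two universal elements enter
  \<open>universal_unique\<close> in the order opposite to that for the end.\<close>

lemma internal_coNat_iso_coend:
  assumes K: "internal_coHom_of C N K" and D: "internal_coNat C M N D"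
    and E: "is_coend M C (hom_bifun_obj K F G) (hom_bifun_mor K F G) h i"
  defines "\<sigma> \<equiv> coend_half_braiding C M N K F G h i"
  shows "(h, \<sigma>) \<in> Obj (center C) \<and>
    (\<exists>!\<theta>. \<theta> \<in> Hom (center C) (HObj D F G) (h, \<sigma>) \<and> iso_arr (center C) \<theta> \<and>
      (\<forall>x \<in> Obj M. HAdj K (FObj F x) (FObj G x) h (i x)
        = (underlying \<theta> \<rhd>\<^sub>m\<^bsub>N\<^esub> Idn N (FObj F x)) \<diamondop> component (HAdj D F G (HObj D F G) (Idn (center C) (HObj D F G))) x))"
proof -
  let ?F = "op_functor N F" and ?G = "op_functor N G"
  interpret op: category_action "op_cat (center C)" "op_cat (Rex C M N)" "center_act_obj C N" "center_act_mor C M N"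
    by (rule center.category_action_op)
  define \<epsilon> where "\<epsilon> x = HAdj K (FObj F x) (FObj G x) h (i x)" for x
  have K': "internal_Hom_of (op_tensor C) (op_module N) K" using K internal_coHom_of_op by blast
  have E': "is_end (op_module M) (op_tensor C) (hom_bifun_obj K ?F ?G) (hom_bifun_mor K ?F ?G) h i"
    using E by (simp add: is_end_op)
  have U: "universal_pair (op_tensor C) (op_module N) (op_module M) ?F ?G h \<epsilon>"
    using module_functor_pair.end_universal[OF pair.pair_op K' E']
    by (intro universal_pair.intro universal_pair_axioms.intro pair.pair_op) (simp add: \<epsilon>_def[abs_def])
  have \<sigma>: "\<sigma> c = universal_pair.swap (op_tensor C) (op_module N) (op_module M) ?F ?G h \<epsilon> c" if "c \<in> Obj C" for c
    unfolding \<sigma>_def using pair.coend_half_braiding_op[OF K E U[unfolded \<epsilon>_def[abs_def]] that] by (simp add: \<epsilon>_def[abs_def])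
  note uc = op_universal_center[OF F G U \<sigma>]
  have D': "is_internal_Hom (op_cat (center C)) (op_cat (Rex C M N)) (center_act_obj C N) (center_act_mor C M N) D"
    using D internal_coHom_op[OF center.category_action_axioms, of "op_cat (center C)" "op_cat (Rex C M N)" D]
    by (auto simp only: op_cat_simps)
  let ?z = "HObj D F G" and ?\<epsilon> = "(G, restrict \<epsilon> (Obj M), center_act_obj C N (h, \<sigma>) F)"
  let ?k = "HAdj D F G ?z (Idn (center C) ?z)"
  have F': "F \<in> Obj (op_cat (Rex C M N))" and G': "G \<in> Obj (op_cat (Rex C M N))" using F G by (simp_all only: op_cat_simps)
  have UD: "op.universal F G ?z ?k" using op.universal_counit[OF D' F' G'] by (simp only: op_cat_simps)
  obtain b \<tau> where z: "?z = (b, \<tau>)" by (cases ?z)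
  obtain \<kappa> where k: "?k = (G, \<kappa>, center_act_obj C N (b, \<tau>) F)" "is_module_nat_transf C M N G (center_act_obj C N (b, \<tau>) F) \<kappa>"
    using op.universalD(2)[OF UD] z unfolding Hom_op by (metis Rex_cases)
  have "?k \<cdot>\<^bsub>op_cat (Rex C M N)\<^esub> center_act_mor C M N \<theta> (Idn (op_cat (Rex C M N)) F) = ?\<epsilon> \<longleftrightarrow>
    (\<forall>x \<in> Obj M. HAdj K (FObj F x) (FObj G x) h (i x) = (underlying \<theta> \<rhd>\<^sub>m\<^bsub>N\<^esub> Idn N (FObj F x)) \<diamondop> component ?k x)"
    if \<theta>: "\<theta> \<in> Hom (center C) ?z (h, \<sigma>)" for \<theta>
  proof -
    obtain u where u: "\<theta> = ((b, \<tau>), u, (h, \<sigma>))" "u \<in> Hom C b h"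
      using \<theta> z by (cases \<theta>) (auto simp: Hom_def)
    have "center_act_mor C M N \<theta> (Idn (Rex C M N) F) \<cdot>\<^bsub>Rex C M N\<^esub> ?k
        = (G, restrict (\<lambda>x. (u \<triangleleft> FObj F x) \<diamondop> \<kappa> x) (Obj M), center_act_obj C N (h, \<sigma>) F)"
      unfolding k(1) by (auto simp: u(1) center_act_mor_def rw_def intro!: restrict_ext)
    moreover have "restrict (\<lambda>x. (u \<triangleleft> FObj F x) \<diamondop> \<kappa> x) (Obj M) = restrict \<epsilon> (Obj M) \<longleftrightarrow>
        (\<forall>x \<in> Obj M. \<epsilon> x = (u \<triangleleft> FObj F x) \<diamondop> \<kappa> x)"
      by (auto simp: restrict_def fun_eq_iff)
    ultimately show ?thesis
      unfolding k(1) by (simp add: u(1) underlying_def component_def \<epsilon>_def flip: rw_def)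
  qed
  then show ?thesis
    using uc(1) op.universal_unique[OF UD uc(2) F'] by (simp cong: conj_cong)
qed

end

end

theorem theorem18:
  fixes C :: "('k::alg_closed_field, 'c, 'd) tensor_cat"
    and M :: "('k, 'c, 'd, 'o, 'm) module_cat"
    and N :: "('k, 'c, 'd, 'p, 'q) module_cat"
    and F G :: "('c, 'o, 'm, 'p, 'q) mfunct"
  assumes "finite_tensor_category C"
    and "finite_module_category C M"
    and "finite_module_category C N"
    and "F \<in> Obj (Rex C M N)"
    and "G \<in> Obj (Rex C M N)"
  shows
    "((\<exists>H. internal_Hom_of C N H) \<and>
      (\<exists>D. internal_Nat C M N D) \<and>
      (\<forall>H. internal_Hom_of C N H \<longrightarrow>
        (\<exists>g j. is_end M C (hom_bifun_obj H F G) (hom_bifun_mor H F G) g j)) \<and>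
      (\<forall>H D g j.
        internal_Hom_of C N H \<and> internal_Nat C M N D \<and>
        is_end M C (hom_bifun_obj H F G) (hom_bifun_mor H F G) g j \<longrightarrow>
          (g, end_half_braiding C M N H F G g j) \<in> Obj (center C) \<and>
          (\<exists>!\<theta>. \<theta> \<in> Hom (center C) (HObj D F G) (g, end_half_braiding C M N H F G g j) \<and>
             iso_arr (center C) \<theta> \<and>
             (\<forall>x \<in> Obj M.
               HAdj H (FObj F x) (FObj G x) (fst (HObj D F G)) (j x \<cdot>\<^bsub>C\<^esub> underlying \<theta>)
                 = component (HAdj D F G (HObj D F G) (Idn (center C) (HObj D F G))) x))))
     \<and>
     ((\<exists>K. internal_coHom_of C N K) \<and>
      (\<exists>E. internal_coNat C M N E) \<and>
      (\<forall>K. internal_coHom_of C N K \<longrightarrow>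
        (\<exists>h i. is_coend M C (hom_bifun_obj K F G) (hom_bifun_mor K F G) h i)) \<and>
      (\<forall>K E h i.
        internal_coHom_of C N K \<and> internal_coNat C M N E \<and>
        is_coend M C (hom_bifun_obj K F G) (hom_bifun_mor K F G) h i \<longrightarrow>
          (h, coend_half_braiding C M N K F G h i) \<in> Obj (center C) \<and>
          (\<exists>!\<theta>. \<theta> \<in> Hom (center C) (HObj E F G) (h, coend_half_braiding C M N K F G h i) \<and>
             iso_arr (center C) \<theta> \<and>
             (\<forall>x \<in> Obj M.
               HAdj K (FObj F x) (FObj G x) h (i x)
                 = (underlying \<theta> \<rhd>\<^sub>m\<^bsub>N\<^esub> Idn N (FObj F x))
                     \<cdot>\<^bsub>N\<^esub> component (HAdj E F G (HObj E F G) (Idn (center C) (HObj E F G))) x))))"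
proof -
  interpret finite_modules C N M by (rule finite_modulesI) fact+
  note FG = assms(4,5)
  show ?thesis
    by (intro conjI allI impI; (elim conjE)?)
      (fact internal_Hom_of_exists internal_Nat_exists internal_coHom_of_exists internal_coNat_exists
        | rule is_end_exists[OF FG] is_coend_exists[OF FG] internal_Nat_iso_end[OF FG, THEN conjunct1]
          internal_Nat_iso_end[OF FG, THEN conjunct2] internal_coNat_iso_coend[OF FG, THEN conjunct1]
          internal_coNat_iso_coend[OF FG, THEN conjunct2], assumption+)+
qed

end
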